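(* Let $n\ge2$. There exists a constant $K>0$, depending only on $n$, such that for every admissible shearlet $\psi\in L^2(\mathbb R^n)$ with admissibility constant $C_\psi$, all measurable sets $E_1,E_2\subseteq\mathbb R^n$ of finite Lebesgue measure, and every $f\in L^2(\mathbb R^n)$, $$\int_{\mathbb R^n\setminus E_1}\int_{\mathbb R^{n-1}}\int_{\mathbb R\setminus\{0\}}\big|\mathcal{SH}_{\psi}f(a,s,t)\big|^2\,\frac{da\,ds\,dt}{|a|^{n+1}}+C_{\psi}\int_{\mathbb R^n\setminus E_2}|\hat f(\xi)|^2\,d\xi\;\ge\;\frac{C_{\psi}\,\|f\|_2^2}{K\,e^{K|E_1||E_2|}},$$ where $|E_i|$ denotes the Lebesgue measure of $E_i$.
   Context: Fourier transform: $\hat f(\xi)=\mathscr F[f](\xi)=\int_{\mathbb R^n}f(x)e^{-2\pi i\,\xi\cdot x}\,dx$, extended to $L^2(\mathbb R^n)$ by Plancherel. For $a\in\mathbb R\setminus\{0\}$ and $s\in\mathbb R^{n-1}$ let $$A_a=\begin{pmatrix} a & 0\\ 0 & \operatorname{sgn}(a)|a|^{1/n}I_{n-1}\end{pmatrix},\qquad S_s=\begin{pmatrix}1 & s^T\\ 0 & I_{n-1}\end{pmatrix},\qquad M_{sa}=S_sA_a,$$ so $|\det M_{sa}|=|\det A_a|=|a|^{2-1/n}$. For $\psi\in L^2(\mathbb R^n)$ and $t\in\mathbb R^n$ put $\psi_{a,s,t}(x)=|\det M_{sa}|^{-1/2}\psi\big(M_{sa}^{-1}(x-t)\big)$. The continuous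 shearlet transform of $f\in L^2(\mathbb R^n)$ is $\mathcal{SH}_\psi f(a,s,t)=\langle f,\psi_{a,s,t}\rangle=\int_{\mathbb R^n}f(x)\overline{\psi_{a,s,t}(x)}\,dx$. The function $\psi\in L^2(\mathbb R^n)$ is an admissible shearlet if $$C_\psi=\int_{\mathbb R^{n-1}}\int_{\mathbb R\setminus\{0\}}\frac{|\hat\psi(M_{sa}^T\xi)|^2}{|a|^{(n^2-n+1)/n}}\,da\,ds<\infty;$$ this quantity has the same value for every $\xi\in\mathbb R^n$ with $\xi_1\neq0$. In the triple integral, $t$ ranges over $\mathbb R^n\setminus E_1$, $s$ over $\mathbb R^{n-1}$ and $a$ over $\mathbb R\setminus\{0\}$. *)

theory Defs
  imports "HOL-Analysis.Analysis"
begin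

text \<open>
  \<open>\<real>\<^sup>n\<close> with \<open>n \<ge> 2\<close> is \<open>real ^ ('m option)\<close> for a finite (hence nonempty) type \<open>'m\<close>: the index
  \<open>None\<close> is the first coordinate, the indices \<open>Some j\<close> are the remaining \<open>n - 1\<close> ones, and
  \<open>real ^ 'm\<close> is \<open>\<real>\<^bsup>n-1\<^esup>\<close>. So \<open>n = CARD('m option) = CARD('m) + 1\<close>.

  Functions in \<open>L\<^sup>2\<close> are represented by arbitrary Lebesgue measurable representatives.
\<close>

definition square_integrable :: "('a::euclidean_space \<Rightarrow> complex) \<Rightarrow> bool" where
  "square_integrable f \<longleftrightarrow>
     f \<in> borel_measurable lebesgue \<and> integrable lebesgue (\<lambda>x. (norm (f x))\<^sup>2)"

definition L2_norm_sq :: "('a::euclidean_space \<Rightarrow> complex) \<Rightarrow> ennreal" where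
  "L2_norm_sq f = (\<integral>\<^sup>+ x. ennreal ((norm (f x))\<^sup>2) \<partial>lebesgue)"

definition L2_inner :: "('a::euclidean_space \<Rightarrow> complex) \<Rightarrow> ('a \<Rightarrow> complex) \<Rightarrow> complex" where
  "L2_inner f g = (LINT x|lebesgue. f x * cnj (g x))"

definition fourier_L1 :: "('a::euclidean_space \<Rightarrow> complex) \<Rightarrow> 'a \<Rightarrow> complex" where
  "fourier_L1 f \<xi> =
     (LINT x|lebesgue. f x * exp (- (2 * complex_of_real pi * \<i> * complex_of_real (\<xi> \<bullet> x))))"

text \<open>
  The extension to \<open>L\<^sup>2\<close> by density of \<open>L\<^sup>1 \<inter> L\<^sup>2\<close>: \<open>g\<close> represents the transform of \<open>f\<close> iff it is the
  \<open>L\<^sup>2\<close> limit of the transforms of some sequence in \<open>L\<^sup>1 \<inter> L\<^sup>2\<close> tending to \<open>f\<close> in \<open>L\<^sup>2\<close>. By Plancherel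
  such a \<open>g\<close> exists and is unique almost everywhere; \<open>fourier f\<close> chooses a representative.
\<close>

definition has_fourier_L2 ::
    "('a::euclidean_space \<Rightarrow> complex) \<Rightarrow> ('a \<Rightarrow> complex) \<Rightarrow> bool" where
  "has_fourier_L2 f g \<longleftrightarrow> square_integrable g \<and>
     (\<exists>F. (\<forall>k::nat. integrable lebesgue (F k) \<and> square_integrable (F k)) \<and>
          (\<lambda>k. L2_norm_sq (\<lambda>x. F k x - f x)) \<longlonglongrightarrow> 0 \<and>
          (\<lambda>k. L2_norm_sq (\<lambda>\<xi>. fourier_L1 (F k) \<xi> - g \<xi>)) \<longlonglongrightarrow> 0)"

definition fourier :: "('a::euclidean_space \<Rightarrow> complex) \<Rightarrow> 'a \<Rightarrow> complex" where
  "fourier f = (SOME g. has_fourier_L2 f g)"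

definition dilation_matrix :: "real \<Rightarrow> real ^ ('m::finite option) ^ ('m option)" where
  "dilation_matrix a =
     (\<chi> i j. if i \<noteq> j then 0
            else if i = None then a
            else sgn a * \<bar>a\<bar> powr (1 / real CARD('m option)))"

definition shear_matrix :: "real ^ 'm \<Rightarrow> real ^ ('m::finite option) ^ ('m option)" where
  "shear_matrix s =
     (\<chi> i j. case (i, j) of
               (None, None) \<Rightarrow> 1
             | (None, Some l) \<Rightarrow> s $ l
             | (Some k, None) \<Rightarrow> 0
             | (Some k, Some l) \<Rightarrow> if k = l then 1 else 0)"

definition shearlet_matrix ::
    "real ^ 'm \<Rightarrow> real \<Rightarrow> real ^ ('m::finite option) ^ ('m option)" where
  "shearlet_matrix s a = shear_matrix s ** dilation_matrix a"

definition shearlet_atom ::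
    "(real ^ ('m::finite option) \<Rightarrow> complex) \<Rightarrow> real \<Rightarrow> real ^ 'm \<Rightarrow> real ^ ('m option)
      \<Rightarrow> real ^ ('m option) \<Rightarrow> complex" where
  "shearlet_atom \<psi> a s t x =
     complex_of_real (\<bar>det (shearlet_matrix s a)\<bar> powr (- 1 / 2)) *
       \<psi> (matrix_inv (shearlet_matrix s a) *v (x - t))"

definition shearlet_transform ::
    "(real ^ ('m::finite option) \<Rightarrow> complex) \<Rightarrow> (real ^ ('m option) \<Rightarrow> complex)
      \<Rightarrow> real \<Rightarrow> real ^ 'm \<Rightarrow> real ^ ('m option) \<Rightarrow> complex" where
  "shearlet_transform \<psi> f a s t = L2_inner f (shearlet_atom \<psi> a s t)"

definition admissibility_integral ::
    "(real ^ ('m::finite option) \<Rightarrow> complex) \<Rightarrow> real ^ ('m option) \<Rightarrow> ennreal" where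
  "admissibility_integral \<psi> \<xi> =
     (let n = real CARD('m option) in
       \<integral>\<^sup>+ s. (\<integral>\<^sup>+ a \<in> - {0}.
         ennreal ((norm (fourier \<psi> (transpose (shearlet_matrix s a) *v \<xi>)))\<^sup>2
                  / \<bar>a\<bar> powr ((n\<^sup>2 - n + 1) / n)) \<partial>lebesgue) \<partial>(lebesgue :: (real ^ 'm) measure))"

definition admissible_shearlet :: "(real ^ ('m::finite option) \<Rightarrow> complex) \<Rightarrow> bool" where
  "admissible_shearlet \<psi> \<longleftrightarrow>
     square_integrable \<psi> \<and> (\<forall>\<xi>. \<xi> $ None \<noteq> 0 \<longrightarrow> admissibility_integral \<psi> \<xi> < \<infinity>)"

text \<open>
  The value of \<open>admissibility_integral \<psi> \<xi>\<close> is the same for all \<open>\<xi>\<close> with \<open>\<xi> $ None \<noteq> 0\<close>; it also does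
  not depend on the representative chosen by \<open>fourier\<close>, since \<open>(a, s) \<mapsto> M\<^sub>s\<^sub>a\<^sup>T \<xi>\<close> is then a
  diffeomorphism from \<open>a \<noteq> 0\<close> onto the complement of a hyperplane.
\<close>

definition shearlet_const :: "(real ^ ('m::finite option) \<Rightarrow> complex) \<Rightarrow> ennreal" where
  "shearlet_const \<psi> = (THE C. \<forall>\<xi>. \<xi> $ None \<noteq> 0 \<longrightarrow> admissibility_integral \<psi> \<xi> = C)"

end

theory Submission
  imports Defs "HOL-Complex_Analysis.Complex_Analysis"
    "HOL-Computational_Algebra.Fundamental_Theorem_Algebra"
begin

text \<open>
  For fixed \<open>a\<close> and \<open>s\<close> the shearlet transform is, up to a reflection, the Fourier transform in \<open>t\<close> of
  \<open>\<xi> \<mapsto> |det M|\<^sup>1\<^sup>/\<^sup>2 f^(\<xi>) cnj (\<psi>^(M\<^sup>T \<xi>))\<close>. The uncertainty principle of Nazarov, applied to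
  this function with the sets \<open>E\<^sub>1\<close>, \<open>E\<^sub>2\<close>, is integrated over \<open>a\<close> and \<open>s\<close>; since the admissibility
  integral does not depend on \<open>\<xi>\<close>, this integration turns the weight \<open>|\<psi>^(M\<^sup>T \<xi>)|\<^sup>2\<close> into \<open>C\<^sub>\<psi>\<close>.

  For the uncertainty principle, periodize a function supported in a set of finite measure along
  a random lattice. On average the frequency set meets only boundedly many points of the dual
  lattice outside the origin, and the periodization vanishes on a fixed proportion of the torus. There the trigonometric
  polynomial with the frequencies in the set equals minus the remainder, which Parseval makes
  small, and a Turan-type inequality bounds each coefficient of a trigonometric polynomial by its
  values outside an exceptional set of small measure.
\<close>

no_notation fps_nth (infixl "$" 75)

section \<open>The Turan-type inequality\<close>

text \<open>The exponent is a matter of scaling. The random lattice is dilated until its covolume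
  times the measure of the support is at most 1/2; by averaging, the expected number of nonzero
  lattice points in the other set is then at most a constant times the product of the two measures.
  The Turan-type inequality costs a fixed factor per frequency, hence \<open>exp\<close> of that
  product. For this its constant may depend on the number of frequencies only, not on their size.
  Differentiation removes one frequency at a time, and each removal is paid for with a nonnegative
  function \<open>H\<close> of integral at most \<open>ln 32\<close>, whatever the degree. Separate
  bounds for the steps would lose one exceptional set each; logarithms simply add, and Markov's
  inequality is used once. A single lattice has to meet one set in few points and also carry little
  energy of the transform elsewhere. Both requirements are put into one weighted sum, and a first
  moment argument finds a lattice for which it is at most 1.\<close>

definition ee :: "real \<Rightarrow> complex" where "ee x = cis (2 * pi * x)"

lemma ee_add: "ee (x + y) = ee x * ee y"
  by (simp add: ee_def cis_mult ring_distribs)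

lemma ee_0 [simp]: "ee 0 = 1"
  by (simp add: ee_def)

lemma cnj_ee: "cnj (ee x) = ee (- x)"
  by (simp add: ee_def cis_cnj)

lemma norm_ee [simp]: "norm (ee x) = 1"
  by (simp add: ee_def)

lemma ee_nonzero [simp]: "ee x \<noteq> 0"
  by (simp add: ee_def)

lemma ee_diff: "ee (x - y) = ee x * cnj (ee y)"
  using ee_add[of x "-y"] by (simp add: cnj_ee)

lemma ee_eq_1_iff: "ee x = 1 \<longleftrightarrow> x \<in> \<int>"
proof -
  have "ee x = 1 \<longleftrightarrow> cos (2 * pi * x) = 1"
    by (auto simp: ee_def complex_eq_iff cos_one_sin_zero)
  also have "\<dots> \<longleftrightarrow> (\<exists>k::int. 2 * pi * x = of_int k * 2 * pi)"
    by (rule cos_one_2pi_int)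
  also have "\<dots> \<longleftrightarrow> (\<exists>k::int. x = of_int k)" by auto
  finally show ?thesis by (auto simp: Ints_def)
qed

lemma ee_of_int [simp]: "ee (of_int k) = 1"
  by (simp add: ee_eq_1_iff)

lemma ee_power: "ee (real n * x) = ee x ^ n"
  by (simp add: ee_def Complex.DeMoivre mult_ac)

lemma continuous_on_ee [continuous_intros]:
  "continuous_on S f \<Longrightarrow> continuous_on S (\<lambda>x. ee (f x))"
  unfolding ee_def cis_conv_exp by (intro continuous_intros)

lemma borel_measurable_ee [measurable]: "ee \<in> borel_measurable borel"
  using continuous_on_ee[OF continuous_on_id, of UNIV] by (intro borel_measurable_continuous_onI) simp

text \<open>The solutions form at most one coset of the integers. This discards the points of the
  circle at which a logarithmic derivative has a pole.\<close>

lemma AE_ee_neq: "AE x in lborel. ee x \<noteq> c"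
proof -
  have "countable {x. ee x = c}"
  proof (cases "\<exists>x0. ee x0 = c")
    case True
    then obtain x0 where x0: "ee x0 = c" by blast
    have "{x. ee x = c} \<subseteq> (\<lambda>k::int. x0 + of_int k) ` UNIV"
    proof
      fix x assume "x \<in> {x. ee x = c}"
      then have "ee (x - x0) = ee x0 * cnj (ee x0)"
        using x0 by (simp add: ee_diff)
      also have "\<dots> = 1"
        by (simp only: complex_norm_square[symmetric] norm_ee) simp
      finally have "ee (x - x0) = 1" .
      then obtain k :: int where "x - x0 = of_int k"
        by (auto simp: ee_eq_1_iff Ints_def)
      then show "x \<in> (\<lambda>k::int. x0 + of_int k) ` UNIV"
        by (intro image_eqI[of _ _ k]) auto
    qed
    then show ?thesis by (rule countable_subset) auto
  qed auto
  then have "{x. ee x = c} \<in> null_sets lborel"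
    by (rule countable_imp_null_set_lborel)
  then show ?thesis by (rule AE_I') auto
qed

text \<open>Cauchy's integral formula at the centre: in the parametrization by \<open>ee\<close>,
  the form \<open>dz / z\<close> is a constant multiple of \<open>dx\<close>.\<close>

lemma circle_mean_value:
  assumes "G holomorphic_on ball 0 1" "0 \<le> r" "r < 1"
  shows "((\<lambda>x. G (of_real r * ee x)) has_integral G 0) {0..1}"
proof (cases "r = 0")
  case True
  then show ?thesis using has_integral_const_real[of "G 0" 0 1] by simp
next
  case False
  with assms have r: "0 < r" by simp
  have "G holomorphic_on cball 0 r"
    using assms(1) by (rule holomorphic_on_subset) (use assms in auto)
  then have "((\<lambda>u. G u / (u - 0)) has_contour_integral (2 * of_real pi * \<i> * G 0)) (circlepath 0 r)"
    by (rule Cauchy_integral_circlepath_simple) (use r in auto)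
  then have "((\<lambda>x. G (circlepath 0 r x) / (circlepath 0 r x) *
       vector_derivative (circlepath 0 r) (at x within {0..1})) has_integral (2 * of_real pi * \<i> * G 0)) {0..1}"
    unfolding has_contour_integral_def by simp
  then have "((\<lambda>x. (2 * of_real pi * \<i>) * G (of_real r * ee x)) has_integral (2 * of_real pi * \<i> * G 0)) {0..1}"
  proof (rule has_integral_eq[rotated])
    fix x :: real assume x: "x \<in> {0..1}"
    have e: "exp (2 * of_real pi * \<i> * of_real x) = ee x"
      by (simp add: ee_def cis_conv_exp mult_ac)
    have "circlepath 0 r x = of_real r * ee x"
      by (simp add: circlepath e)
    moreover have "vector_derivative (circlepath 0 r) (at x within {0..1}) = 2 * of_real pi * \<i> * of_real r * ee x"
      by (subst vector_derivative_circlepath01) (use x in \<open>auto simp: e\<close>)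
    ultimately show "G (circlepath 0 r x) / circlepath 0 r x * vector_derivative (circlepath 0 r) (at x within {0..1})
      = 2 * of_real pi * \<i> * G (of_real r * ee x)"
      using r by (simp add: field_simps)
  qed
  then have "((\<lambda>x. (2 * of_real pi * \<i>) * G (of_real r * ee x) / (2 * of_real pi * \<i>))
      has_integral (2 * of_real pi * \<i> * G 0) / (2 * of_real pi * \<i>)) {0..1}"
    by (rule has_integral_divide)
  then show ?thesis by simp
qed

text \<open>The function \<open>Ln (1 + F)\<close> is holomorphic, so its mean value over the circle is its value at \<open>0\<close>.\<close>

lemma log_integral_disc:
  assumes hol: "F holomorphic_on ball 0 1" and pos: "\<And>z. z \<in> ball 0 1 \<Longrightarrow> 0 \<le> Re (F z)"
    and F0: "norm (F 0) \<le> 1" and r: "0 \<le> r" "r < 1"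
  shows "(\<integral>\<^sup>+x. indicator {0..1} x * ennreal (ln (1 + norm (F (of_real r * ee x)))) \<partial>lborel) \<le> ennreal (ln 4)"
proof -
  \<comment> \<open>The nonnegative real part yields both \<open>one\<close> and \<open>two\<close>
    below, so ln (1 + |F|) is at most ln 2 plus the harmonic function ln |1 + F|.\<close>
  define g where "g x = ln 2 + ln (norm (1 + F (of_real r * ee x)))" for x
  have in_ball: "of_real r * ee x \<in> ball 0 1" for x
    using r by (simp add: norm_mult)
  have one: "1 \<le> norm (1 + F z)" if "z \<in> ball 0 1" for z
    using pos[OF that] complex_Re_le_cmod[of "1 + F z"] by simp
  have two: "norm (F z) \<le> norm (1 + F z)" if "z \<in> ball 0 1" for z
  proof -
    have "(norm (F z))\<^sup>2 \<le> (norm (1 + F z))\<^sup>2"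
      using pos[OF that] unfolding cmod_power2 by (simp add: power2_eq_square algebra_simps)
    then show ?thesis by (simp add: power2_le_iff_abs_le)
  qed
  have hol2: "(\<lambda>z. Ln (1 + F z)) holomorphic_on ball 0 1"
    using pos by (intro holomorphic_intros hol) (auto simp: complex_nonpos_Reals_iff, force)
  have "((\<lambda>x. Re (Ln (1 + F (of_real r * ee x)))) has_integral Re (Ln (1 + F 0))) {0..1}"
    using circle_mean_value[OF hol2 r] by (rule has_integral_Re)
  moreover have nz: "1 + F z \<noteq> 0" if "z \<in> ball 0 1" for z
    using one[OF that] by auto
  ultimately have "((\<lambda>x. ln (norm (1 + F (of_real r * ee x)))) has_integral ln (norm (1 + F 0))) {0..1}"
    using in_ball by (simp add: Re_Ln)
  then have "((\<lambda>x. ln 2 + ln (norm (1 + F (of_real r * ee x)))) has_integral (ln 2 + ln (norm (1 + F 0)))) {0..1}"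
    using has_integral_const_real[of "ln 2" 0 "1::real"] by (intro has_integral_add) auto
  then have g_int: "(g has_integral (ln 2 + ln (norm (1 + F 0)))) {0..1}"
    by (simp add: g_def[abs_def])
  have "0 \<le> g x" for x
    using one[OF in_ball] by (auto simp: g_def intro!: add_nonneg_nonneg)
  then have "(\<integral>\<^sup>+x. ennreal (indicator {0..1} x * g x) \<partial>lborel) = ennreal (ln 2 + ln (norm (1 + F 0)))"
    by (intro nn_integral_has_integral_lebesgue g_int) auto
  moreover have "(\<integral>\<^sup>+x. indicator {0..1} x * ennreal (ln (1 + norm (F (of_real r * ee x)))) \<partial>lborel)
      \<le> (\<integral>\<^sup>+x. ennreal (indicator {0..1} x * g x) \<partial>lborel)"
  proof (intro nn_integral_mono)
    fix x
    let ?z = "of_real r * ee x"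
    have "ln (1 + norm (F ?z)) \<le> ln (2 * norm (1 + F ?z))"
      using one[OF in_ball[of x]] two[OF in_ball[of x]] by (intro ln_mono) (auto intro: add_pos_nonneg)
    also have "\<dots> = g x"
      using nz[OF in_ball[of x]] by (simp add: g_def ln_mult)
    finally show "indicator {0..1} x * ennreal (ln (1 + norm (F ?z))) \<le> ennreal (indicator {0..1} x * g x)"
      by (auto simp: indicator_def intro: ennreal_leI)
  qed
  moreover have "ln 2 + ln (norm (1 + F 0)) \<le> ln 4"
  proof -
    have "norm (1 + F 0) \<le> 2" using F0 norm_triangle_ineq[of 1 "F 0"] by simp
    then have "ln (norm (1 + F 0)) \<le> ln 2" using nz[of 0] by (intro ln_mono) auto
    moreover have "ln 4 = ln 2 + ln (2::real)" using ln_mult_pos[of 2 "2::real"] by simp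
    ultimately show ?thesis by simp
  qed
  ultimately show ?thesis
    by (metis ennreal_leI order_trans)
qed

text \<open>The Moebius map sends the unit disc into a right half plane. At the pole v = 1 the
  quotient is 0 by convention, so the closed disc is allowed.\<close>

lemma Re_inverse_1_minus_nonneg:
  assumes "norm (v::complex) \<le> 1"
  shows "0 \<le> Re (1 / (1 - v))"
proof -
  have "Re v \<le> 1" using assms complex_Re_le_cmod[of v] by simp
  then show ?thesis by (simp add: Re_divide)
qed

text \<open>Inside the disc every summand has nonnegative real part, and the value at 0 is
  \<open>length V / N\<close>, at most 1, so \<open>log_integral_disc\<close> applies. Poles may lie
  on the unit circle itself; the bound is therefore taken on smaller circles and carried to the
  boundary by Fatou's lemma.\<close>

lemma log_integral_poles:
  fixes V :: "complex list" and N :: real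
  assumes V: "\<And>v. v \<in> set V \<Longrightarrow> norm v \<le> 1" and N: "real (length V) \<le> N" "0 < N"
  shows "(\<integral>\<^sup>+x. indicator {0..1} x * ennreal (ln (1 + norm ((\<Sum>v\<leftarrow>V. 1 / (1 - v * ee x)) / N))) \<partial>lborel) \<le> ennreal (ln 4)"
proof -
  define F where "F z = (\<Sum>v\<leftarrow>V. 1 / (1 - v * z)) / of_real N" for z :: complex
  have nv: "norm (v * z) < 1" if "v \<in> set V" "z \<in> ball 0 1" for v z
    using V[OF that(1)] that(2) by (simp add: norm_mult) (metis mult_left_le_one_le norm_ge_zero order_le_less_trans)
  have nz: "1 - v * z \<noteq> 0" if "v \<in> set V" "z \<in> ball 0 1" for v z
    using nv[OF that] by auto
  have hol: "F holomorphic_on ball 0 1"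
  proof -
    have "(\<lambda>z. (\<Sum>v\<leftarrow>W. 1 / (1 - v * z))) holomorphic_on ball 0 1" if "set W \<subseteq> set V" for W
      using that
    proof (induction W)
      case (Cons v W)
      then show ?case
        using nz[of v] by (auto intro!: holomorphic_intros)
    qed (auto intro!: holomorphic_intros)
    then show ?thesis unfolding F_def using N by (intro holomorphic_intros) auto
  qed
  have pos: "0 \<le> Re (F z)" if z: "z \<in> ball 0 1" for z
  proof -
    have "0 \<le> Re (\<Sum>v\<leftarrow>W. 1 / (1 - v * z))" if "set W \<subseteq> set V" for W
      using that
    proof (induction W)
      case (Cons v W)
      then have "norm (v * z) \<le> 1" using nv[of v z] z by auto
      from Re_inverse_1_minus_nonneg[OF this] Cons show ?case by simp
    qed auto
    then show ?thesis using N by (simp add: F_def)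
  qed
  have F0: "norm (F 0) \<le> 1"
  proof -
    have "(\<Sum>v\<leftarrow>V. 1 / (1 - v * 0)) = of_nat (length V)"
      by (simp add: sum_list_triv)
    then show ?thesis using N by (simp add: F_def norm_divide)
  qed
  define r where "r n = 1 - inverse (real (Suc n))" for n
  have r: "0 \<le> r n" "r n < 1" for n
    by (auto simp: r_def field_simps)
  have r_lim: "r \<longlonglongrightarrow> 1"
    unfolding r_def using tendsto_diff[OF tendsto_const LIMSEQ_inverse_real_of_nat] by simp
  define h where "h n x = indicator {0..1} x * ennreal (ln (1 + norm (F (of_real (r n) * ee x))))" for n x
  have meas: "F \<in> borel_measurable borel"
  proof -
    have "(\<lambda>z. (\<Sum>v\<leftarrow>W. 1 / (1 - v * z))) \<in> borel_measurable borel" for W :: "complex list"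
      by (induction W) auto
    then show ?thesis by (simp add: F_def[abs_def])
  qed
  have [measurable]: "h n \<in> borel_measurable lborel" for n
    unfolding h_def using meas by measurable
  \<comment> \<open>For \<open>v = 0\<close> the excluded value \<open>1 / v\<close> is 0, which
    \<open>ee x\<close> never takes, so this parameter is covered as well.\<close>
  have "AE x in lborel. \<forall>v\<in>set V. ee x \<noteq> 1 / v"
    by (intro AE_finite_allI) (auto intro: AE_ee_neq)
  then have "AE x in lborel. indicator {0..1} x * ennreal (ln (1 + norm (F (ee x)))) = liminf (\<lambda>n. h n x)"
  proof eventually_elim
    case (elim x)
    have "1 - v * ee x \<noteq> 0" if "v \<in> set V" for v
      using elim that by (auto simp: field_simps) (metis ee_nonzero mult_eq_0_iff nonzero_mult_div_cancel_left one_neq_zero)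
    moreover have "(\<lambda>n. of_real (r n) * ee x) \<longlonglongrightarrow> of_real 1 * ee x"
      by (intro tendsto_intros r_lim)
    then have "(\<lambda>n. of_real (r n) * ee x) \<longlonglongrightarrow> ee x" by simp
    ultimately have "((\<lambda>n. (\<Sum>v\<leftarrow>W. 1 / (1 - v * (of_real (r n) * ee x)))) \<longlongrightarrow> (\<Sum>v\<leftarrow>W. 1 / (1 - v * ee x))) sequentially"
      if "set W \<subseteq> set V" for W
      using that
    proof (induction W)
      case (Cons v W)
      then show ?case by (auto intro!: tendsto_intros)
    qed auto
    from this[OF order_refl] have "(\<lambda>n. F (of_real (r n) * ee x)) \<longlonglongrightarrow> F (ee x)"
      unfolding F_def using N by (auto intro!: tendsto_intros)
    then have "(\<lambda>n. ennreal (ln (1 + norm (F (of_real (r n) * ee x))))) \<longlonglongrightarrow> ennreal (ln (1 + norm (F (ee x))))"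
      by (intro tendsto_intros) (auto simp: add_nonneg_eq_0_iff)
    then have "(\<lambda>n. h n x) \<longlonglongrightarrow> indicator {0..1} x * ennreal (ln (1 + norm (F (ee x))))"
      unfolding h_def by (auto simp: indicator_def)
    then show ?case by (simp add: lim_imp_Liminf)
  qed
  then have "(\<integral>\<^sup>+x. indicator {0..1} x * ennreal (ln (1 + norm (F (ee x)))) \<partial>lborel) = (\<integral>\<^sup>+x. liminf (\<lambda>n. h n x) \<partial>lborel)"
    by (rule nn_integral_cong_AE)
  also have "\<dots> \<le> liminf (\<lambda>n. integral\<^sup>N lborel (h n))"
    by (rule nn_integral_liminf) auto
  also have "\<dots> \<le> ennreal (ln 4)"
    using log_integral_disc[OF hol pos F0 r] unfolding h_def
    by (intro Liminf_le) (auto intro!: always_eventually simp: trivial_limit_sequentially)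
  finally show ?thesis by (simp add: F_def)
qed

lemma poly_prod_list_log_deriv:
  assumes "\<And>w. w \<in> set ws \<Longrightarrow> z \<noteq> w"
  shows "z * poly (pderiv (\<Prod>w\<leftarrow>ws. [:-w, 1:])) z
    = poly (\<Prod>w\<leftarrow>ws. [:-w, 1:]) z * (\<Sum>w\<leftarrow>ws. z / (z - (w::complex)))"
  using assms
proof (induction ws)
  case (Cons w ws)
  then have "z \<noteq> w" by auto
  with Cons show ?case
    by (simp add: pderiv_mult pderiv_pCons divide_simps del: mult_pCons_left) (simp add: algebra_simps del: mult_pCons_left)
qed auto

text \<open>Up to constants, \<open>z q' / q\<close> is the mean of \<open>z / (z - w)\<close> over the roots \<open>w\<close>. The roots outside the
  closed unit disc contribute functions of \<open>z\<close>, those inside contribute functions of \<open>cnj z\<close>, and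
  both kinds have the shape treated in \<open>log_integral_poles\<close>.\<close>

lemma log_derivative_bound:
  fixes q :: "complex poly" and N :: real
  assumes q: "q \<noteq> 0" "real (degree q) \<le> N" "0 < N"
  shows "\<exists>H::real \<Rightarrow> real. H \<in> borel_measurable borel \<and> (\<forall>x. 0 \<le> H x) \<and>
    (\<integral>\<^sup>+x. indicator {0..1} x * ennreal (H x) \<partial>lborel) \<le> ennreal (ln 32) \<and>
    (AE x in lborel. norm (ee x * poly (pderiv q) (ee x)) / N + norm (poly q (ee x)) \<le> exp (H x) * norm (poly q (ee x)))"
proof -
  obtain ws where ws: "q = smult (lead_coeff q) (\<Prod>w\<leftarrow>ws. [:-w, 1:])" "length ws = degree q"
  proof -
    obtain ws where m: "mset ws = proots q" using ex_mset by blast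
    have "(\<Prod>w\<leftarrow>ws. [:-w, 1:]) = (\<Prod>w\<in>#mset ws. [:-w, 1:])"
      by (simp add: prod_mset_prod_list[symmetric] del: prod_mset_prod_list)
    then have "q = smult (lead_coeff q) (\<Prod>w\<leftarrow>ws. [:-w, 1:])"
      using complex_poly_decompose_multiset[of q] m by simp
    moreover have "length ws = degree q"
      using arg_cong[OF m, of size] size_proots_complex[of q] by simp
    ultimately show ?thesis by (rule that)
  qed
  \<comment> \<open>On the circle, z / (z - w) is the conjugate of 1 / (1 - cnj w * z), used for |w|
    \<le> 1, and equals 1 - 1 / (1 - z / w), used for |w| > 1. In both cases the parameter has norm
    at most 1.\<close>
  define V1 where "V1 = map cnj (filter (\<lambda>w. norm w \<le> 1) ws)"
  define V2 where "V2 = map (\<lambda>w. 1 / w) (filter (\<lambda>w. \<not> norm w \<le> 1) ws)"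
  define F where "F V x = norm ((\<Sum>v\<leftarrow>V. 1 / (1 - v * ee x)) / of_real N)" for V x
  have len: "length V1 + length V2 = length ws"
    unfolding V1_def V2_def using sum_length_filter_compl[of "\<lambda>w. norm w \<le> 1" ws] by simp
  have V1: "norm v \<le> 1" if "v \<in> set V1" for v
    using that by (auto simp: V1_def)
  have V2: "norm v \<le> 1" if "v \<in> set V2" for v
    using that by (auto simp: V2_def norm_divide divide_simps)
  have meas: "F V \<in> borel_measurable borel" for V
  proof -
    have "(\<lambda>x. (\<Sum>v\<leftarrow>W. 1 / (1 - v * ee x))) \<in> borel_measurable borel" for W :: "complex list"
      by (induction W) auto
    then show ?thesis by (simp add: F_def[abs_def])
  qed
  have F_nn: "0 \<le> F V x" for V x by (simp add: F_def)
  \<comment> \<open>The factor 2 makes room for two terms of size at most 1: the constants 1 of the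
    roots outside the disc, divided by \<open>N\<close>, and the extra summand
    \<open>norm (poly q (ee x))\<close>. The integral is at most ln 2 + ln 4 + ln 4 = ln 32.\<close>
  define H where "H x = ln 2 + (ln (1 + F V1 x) + ln (1 + F V2 x))" for x
  have int1: "(\<integral>\<^sup>+x. indicator {0..1} x * ennreal (ln (1 + F V1 x)) \<partial>lborel) \<le> ennreal (ln 4)"
    unfolding F_def using len ws q by (intro log_integral_poles V1) auto
  have int2: "(\<integral>\<^sup>+x. indicator {0..1} x * ennreal (ln (1 + F V2 x)) \<partial>lborel) \<le> ennreal (ln 4)"
    unfolding F_def using len ws q by (intro log_integral_poles V2) auto
  have "(\<integral>\<^sup>+x. indicator {0..1} x * ennreal (H x) \<partial>lborel)
     = (\<integral>\<^sup>+x. (indicator {0..1} x * ennreal (ln 2) + (indicator {0..1} x * ennreal (ln (1 + F V1 x))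
        + indicator {0..1} x * ennreal (ln (1 + F V2 x)))) \<partial>lborel)"
    using F_nn by (intro nn_integral_cong) (auto simp: H_def indicator_def ennreal_plus[symmetric] simp del: ennreal_plus intro!: arg_cong[where f=ennreal])
  also have "\<dots> = (\<integral>\<^sup>+x. indicator {0..1::real} x * ennreal (ln 2) \<partial>lborel)
       + ((\<integral>\<^sup>+x. indicator {0..1} x * ennreal (ln (1 + F V1 x)) \<partial>lborel)
        + (\<integral>\<^sup>+x. indicator {0..1} x * ennreal (ln (1 + F V2 x)) \<partial>lborel))"
    using meas by (simp add: nn_integral_add)
  also have "(\<integral>\<^sup>+x. indicator {0..1::real} x * ennreal (ln 2) \<partial>lborel) = ennreal (ln 2)"
    by (simp add: nn_integral_multc)
  also have "ennreal (ln 2) + ((\<integral>\<^sup>+x. indicator {0..1} x * ennreal (ln (1 + F V1 x)) \<partial>lborel)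
        + (\<integral>\<^sup>+x. indicator {0..1} x * ennreal (ln (1 + F V2 x)) \<partial>lborel)) \<le> ennreal (ln 2) + (ennreal (ln 4) + ennreal (ln 4))"
    using int1 int2 by (intro add_mono) auto
  also have "\<dots> = ennreal (ln 32)"
  proof -
    have "ln 32 = ln 2 + (ln 4 + ln (4::real))"
      using ln_mult_pos[of 4 "4::real"] ln_mult_pos[of 2 "16::real"] by simp
    then show ?thesis by (simp add: ennreal_plus[symmetric] del: ennreal_plus)
  qed
  finally have int: "(\<integral>\<^sup>+x. indicator {0..1} x * ennreal (H x) \<partial>lborel) \<le> ennreal (ln 32)" .
  have "AE x in lborel. \<forall>w\<in>set ws. ee x \<noteq> w"
    by (intro AE_finite_allI) (auto intro: AE_ee_neq)
  then have ae: "AE x in lborel. norm (ee x * poly (pderiv q) (ee x)) / N + norm (poly q (ee x)) \<le> exp (H x) * norm (poly q (ee x))"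
  proof eventually_elim
    case (elim x)
    define z where "z = ee x"
    have [simp]: "norm z = 1" "z \<noteq> 0" by (auto simp: z_def)
    have zz: "z * cnj z = 1" by (simp add: complex_norm_square[symmetric])
    define S where "S = (\<Sum>w\<leftarrow>ws. z / (z - w))"
    have S: "z * poly (pderiv q) z = poly q z * S"
    proof -
      obtain c where c: "q = smult c (\<Prod>w\<leftarrow>ws. [:-w, 1:])" using ws(1) by blast
      have "z * poly (pderiv (\<Prod>w\<leftarrow>ws. [:-w, 1:])) z = poly (\<Prod>w\<leftarrow>ws. [:-w, 1:]) z * S"
        using elim unfolding S_def z_def by (intro poly_prod_list_log_deriv) auto
      then have "c * (z * poly (pderiv (\<Prod>w\<leftarrow>ws. [:-w, 1:])) z) = c * (poly (\<Prod>w\<leftarrow>ws. [:-w, 1:]) z * S)"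
        by (rule arg_cong)
      then show ?thesis unfolding c pderiv_smult poly_smult by (simp only: mult_ac)
    qed
    have split: "S = cnj (\<Sum>v\<leftarrow>V1. 1 / (1 - v * z)) + (of_nat (length V2) - (\<Sum>v\<leftarrow>V2. 1 / (1 - v * z)))"
      using elim unfolding S_def V1_def V2_def
    proof (induction ws)
      case (Cons w ws)
      have zw: "z \<noteq> w" using Cons.prems by (auto simp: z_def)
      show ?case
      proof (cases "norm w \<le> 1")
        case True
        have "z / (z - w) = z * cnj z / ((z - w) * cnj z)" by simp
        also have "\<dots> = 1 / (1 - w * cnj z)" using zz by (simp add: left_diff_distrib)
        also have "\<dots> = cnj (1 / (1 - cnj w * z))" by simp
        finally show ?thesis using True Cons by simp
      next
        case False
        then have "w \<noteq> 0" by auto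
        then have "z / (z - w) = 1 - 1 / (1 - 1 / w * z)" using zw by (simp add: field_simps)
        then show ?thesis using False Cons by (simp add: algebra_simps)
      qed
    qed auto
    have "norm S \<le> norm (\<Sum>v\<leftarrow>V1. 1 / (1 - v * z)) + (real (length V2) + norm (\<Sum>v\<leftarrow>V2. 1 / (1 - v * z)))"
      unfolding split
      by (metis (no_types, lifting) add_left_mono complex_mod_cnj norm_of_nat norm_triangle_ineq norm_triangle_ineq4 order_trans)
    then have "norm S / N \<le> (norm (\<Sum>v\<leftarrow>V1. 1 / (1 - v * z)) + (real (length V2) + norm (\<Sum>v\<leftarrow>V2. 1 / (1 - v * z)))) / N"
      using q by (intro divide_right_mono) auto
    also have "\<dots> = F V1 x + (real (length V2) / N + F V2 x)"
      using q by (simp add: F_def norm_divide z_def add_divide_distrib)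
    finally have "norm S / N \<le> F V1 x + (real (length V2) / N + F V2 x)" .
    moreover have *: "real (length V2) / N \<le> 1" using len ws q by (simp add: field_simps)
    ultimately have "norm S / N + 1 \<le> 2 * ((1 + F V1 x) * (1 + F V2 x))"
    proof -
      have "0 \<le> F V1 x * F V2 x" using F_nn by simp
      then have "1 + (F V1 x + F V2 x) + 1 \<le> 2 * ((1 + F V1 x) * (1 + F V2 x))"
        using F_nn[of V1 x] F_nn[of V2 x] unfolding distrib_left distrib_right by linarith
      then show ?thesis using * \<open>norm S / N \<le> F V1 x + (real (length V2) / N + F V2 x)\<close> by linarith
    qed
    also have "\<dots> = exp (H x)"
      using F_nn[of V1 x] F_nn[of V2 x] by (simp add: H_def exp_add add_pos_nonneg)
    finally have "(norm S / N + 1) * norm (poly q z) \<le> exp (H x) * norm (poly q z)"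
      by (intro mult_right_mono) auto
    then show ?case
      using S unfolding z_def[symmetric] by (simp add: norm_mult algebra_simps)
  qed
  have "H \<in> borel_measurable borel" using meas by (simp add: H_def[abs_def])
  moreover have "\<forall>x. 0 \<le> H x" using F_nn by (simp add: H_def)
  ultimately show ?thesis using int ae by blast
qed

lemma pderiv_sum_set: "pderiv (\<Sum>k\<in>M. f k) = (\<Sum>k\<in>M. pderiv (f k))"
  by (induction M rule: infinite_finite_induct) (auto simp: pderiv_add)

text \<open>Shifting the end frequency farther from \<open>k0\<close> to \<open>0\<close> and differentiating removes it, and after
  division by the length of the spectrum the coefficient of \<open>k0\<close> loses at most a factor \<open>2\<close>.\<close>

lemma remove_end_frequency:
  fixes c :: "int \<Rightarrow> complex"
  assumes M: "finite M" "k0 \<in> M" "c k0 \<noteq> 0" "M \<noteq> {k0}"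
  shows "\<exists>s N H. s \<in> M \<and> s \<noteq> k0 \<and> 0 < N \<and> N \<le> 2 * \<bar>real_of_int (k0 - s)\<bar> \<and>
    (H::real \<Rightarrow> real) \<in> borel_measurable borel \<and> (\<forall>x. 0 \<le> H x) \<and>
    (\<integral>\<^sup>+x. indicator {0..1} x * ennreal (H x) \<partial>lborel) \<le> ennreal (ln 32) \<and>
    (AE x in lborel. norm (\<Sum>k\<in>M - {s}. c k * of_real (real_of_int (k - s) / N) * ee (of_int k * x))
       \<le> exp (H x) * norm (\<Sum>k\<in>M. c k * ee (of_int k * x)))"
proof -
  define lo where "lo = Min M"
  define hi where "hi = Max M"
  have ne: "M \<noteq> {}" using M by blast
  have lohi: "lo \<in> M" "hi \<in> M" "\<And>k. k \<in> M \<Longrightarrow> lo \<le> k" "\<And>k. k \<in> M \<Longrightarrow> k \<le> hi"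
    unfolding lo_def hi_def using Min_in[OF M(1) ne] Max_in[OF M(1) ne] M(1) by auto
  have "lo < hi"
  proof (rule ccontr)
    assume "\<not> lo < hi"
    then have "k = k0" if "k \<in> M" for k
      using lohi(3,4)[OF that] lohi(3,4)[OF M(2)] by linarith
    then show False using M by blast
  qed
  define N where "N = real_of_int (hi - lo)"
  have N: "0 < N" using \<open>lo < hi\<close> by (simp add: N_def)
  \<comment> \<open>Division by the unimodular factor \<open>ee (lo * x)\<close> makes all
    frequencies nonnegative and leaves absolute values unchanged.\<close>
  define q where "q = (\<Sum>k\<in>M. monom (c k) (nat (k - lo)))"
  have "coeff q (nat (k0 - lo)) = c k0"
  proof -
    have "coeff q (nat (k0 - lo)) = (\<Sum>k\<in>M. if k = k0 then c k else 0)"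
      unfolding q_def coeff_sum using lohi(3) M(2) by (intro sum.cong) (auto simp: eq_nat_nat_iff)
    then show ?thesis using M by simp
  qed
  then have "q \<noteq> 0" using M by auto
  moreover have "degree q \<le> nat (hi - lo)"
    unfolding q_def
  proof (rule degree_sum_le[OF M(1)])
    fix k assume "k \<in> M"
    then show "degree (monom (c k) (nat (k - lo))) \<le> nat (hi - lo)"
      using lohi(4)[of k] degree_monom_le[of "c k" "nat (k - lo)"] by (intro order_trans[OF degree_monom_le]) auto
  qed
  then have "real (degree q) \<le> N" using \<open>lo < hi\<close> by (simp add: N_def)
  ultimately obtain H where H: "H \<in> borel_measurable borel" "\<forall>x. 0 \<le> H x"
    "(\<integral>\<^sup>+x. indicator {0..1} x * ennreal (H x) \<partial>lborel) \<le> ennreal (ln 32)"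
    "AE x in lborel. norm (ee x * poly (pderiv q) (ee x)) / N + norm (poly q (ee x)) \<le> exp (H x) * norm (poly q (ee x))"
    using log_derivative_bound[of q N] N by blast
  have pw: "ee x ^ nat (k - lo) = ee (of_int k * x) / ee (of_int lo * x)" if "k \<in> M" for x k
  proof -
    have "ee x ^ nat (k - lo) = ee (of_int (k - lo) * x)"
      using lohi(3)[OF that] by (simp add: ee_power[symmetric] of_nat_nat)
    moreover have "ee (of_int lo * x) * ee (of_int (k - lo) * x) = ee (of_int k * x)"
      by (simp add: ee_add[symmetric] algebra_simps)
    ultimately show ?thesis by (simp add: field_simps)
  qed
  have q1: "poly q (ee x) = (\<Sum>k\<in>M. c k * ee (of_int k * x)) / ee (of_int lo * x)" for x
    unfolding q_def poly_sum sum_divide_distrib by (intro sum.cong) (auto simp: poly_monom pw)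
  have q2: "ee x * poly (pderiv q) (ee x) = (\<Sum>k\<in>M. of_int (k - lo) * c k * ee (of_int k * x)) / ee (of_int lo * x)" for x
  proof -
    have "ee x * poly (pderiv (monom (c k) (nat (k - lo)))) (ee x)
        = of_int (k - lo) * c k * ee (of_int k * x) / ee (of_int lo * x)" if "k \<in> M" for k
    proof (cases "k = lo")
      case False
      then have "lo < k" using lohi(3)[OF that] by simp
      then obtain j where j: "nat (k - lo) = Suc j" using gr0_implies_Suc[of "nat (k - lo)"] by auto
      have "ee x * poly (pderiv (monom (c k) (Suc j))) (ee x) = of_nat (Suc j) * c k * ee x ^ Suc j"
        by (simp add: pderiv_monom poly_monom mult_ac)
      moreover have "(of_nat (nat (k - lo)) :: complex) = of_int (k - lo)"
        using \<open>lo < k\<close> by (simp add: of_nat_nat)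
      ultimately show ?thesis using pw[OF that, of x] by (simp only: j times_divide_eq_right)
    qed (simp add: pderiv_monom)
    then show ?thesis
      unfolding q_def pderiv_sum_set poly_sum sum_divide_distrib sum_distrib_left by (intro sum.cong) auto
  qed
  define s where "s = (if k0 - lo \<ge> hi - k0 then lo else hi)"
  have s: "s \<in> M" "s \<noteq> k0" using lohi \<open>lo < hi\<close> by (auto simp: s_def)
  have sN: "N \<le> 2 * \<bar>real_of_int (k0 - s)\<bar>"
    using lohi(3,4)[OF M(2)] by (auto simp: s_def N_def)
  have "AE x in lborel. norm (\<Sum>k\<in>M - {s}. c k * of_real (real_of_int (k - s) / N) * ee (of_int k * x))
       \<le> exp (H x) * norm (\<Sum>k\<in>M. c k * ee (of_int k * x))"
    using H(4)
  proof eventually_elim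
    case (elim x)
    have "(\<Sum>k\<in>M - {s}. c k * of_real (real_of_int (k - s) / N) * ee (of_int k * x))
       = (\<Sum>k\<in>M. c k * of_real (real_of_int (k - s) / N) * ee (of_int k * x))"
      using M s by (intro sum.mono_neutral_left) auto
    \<comment> \<open>Counting frequencies from \<open>s\<close> instead of \<open>lo\<close>
      subtracts \<open>(s - lo) / N\<close> times the sum itself, a multiple that is 0 or 1. This is
      why \<open>log_derivative_bound\<close> also controls
      \<open>norm (poly q (ee x))\<close>.\<close>
    also have "\<dots> = (\<Sum>k\<in>M. of_int (k - lo) * c k * ee (of_int k * x)) / of_real N
        - of_real (real_of_int (s - lo) / N) * (\<Sum>k\<in>M. c k * ee (of_int k * x))"
      unfolding sum_divide_distrib sum_distrib_left sum_subtractf[symmetric]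
    proof (intro sum.cong refl)
      fix k
      have *: "complex_of_real (real_of_int (k - s) / N) = of_int (k - lo) / of_real N - of_real (real_of_int (s - lo) / N)"
        by (simp add: diff_divide_distrib)
      have "c k * (u / v - w) * e = u * c k * e / v - w * (c k * e)" for u v w e :: complex
        by (simp add: algebra_simps)
      then show "c k * complex_of_real (real_of_int (k - s) / N) * ee (of_int k * x)
        = of_int (k - lo) * c k * ee (of_int k * x) / of_real N - of_real (real_of_int (s - lo) / N) * (c k * ee (of_int k * x))"
        unfolding * .
    qed
    finally have eq: "(\<Sum>k\<in>M - {s}. c k * of_real (real_of_int (k - s) / N) * ee (of_int k * x)) = \<dots>" .
    have "norm (\<Sum>k\<in>M - {s}. c k * of_real (real_of_int (k - s) / N) * ee (of_int k * x))
      \<le> norm ((\<Sum>k\<in>M. of_int (k - lo) * c k * ee (of_int k * x)) / of_real N)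
       + norm (of_real (real_of_int (s - lo) / N) * (\<Sum>k\<in>M. c k * ee (of_int k * x)))"
      unfolding eq by (rule norm_triangle_ineq4)
    also have "norm ((\<Sum>k\<in>M. of_int (k - lo) * c k * ee (of_int k * x)) / of_real N) = norm (ee x * poly (pderiv q) (ee x)) / N"
      unfolding q2 using N by (simp add: norm_divide)
    also have "norm (of_real (real_of_int (s - lo) / N) * (\<Sum>k\<in>M. c k * ee (of_int k * x)))
      \<le> 1 * norm (\<Sum>k\<in>M. c k * ee (of_int k * x))"
      unfolding norm_mult
    proof (intro mult_right_mono)
      show "norm (complex_of_real (real_of_int (s - lo) / N)) \<le> 1"
        using \<open>lo < hi\<close> by (auto simp: s_def N_def)
    qed auto
    also have "1 * norm (\<Sum>k\<in>M. c k * ee (of_int k * x)) = norm (poly q (ee x))"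
      unfolding q1 by (simp add: norm_divide)
    also have "norm (ee x * poly (pderiv q) (ee x)) / N + norm (poly q (ee x)) \<le> exp (H x) * norm (poly q (ee x))"
      by (rule elim)
    also have "norm (poly q (ee x)) = norm (\<Sum>k\<in>M. c k * ee (of_int k * x))"
      unfolding q1 by (simp add: norm_divide)
    finally show ?case by simp
  qed
  then show ?thesis using s N sN H by blast
qed

text \<open>Induction with \<open>remove_end_frequency\<close> until only \<open>k0\<close> is left.
  Each removal costs a factor 2 in the coefficient of \<open>k0\<close> and one more summand of
  \<open>H\<close>, so the integrals add up to at most \<open>ln 32\<close> per frequency.\<close>

lemma turan_log:
  fixes c :: "int \<Rightarrow> complex"
  assumes "finite M" "k0 \<in> M" "c k0 \<noteq> 0"
  shows "\<exists>H::real \<Rightarrow> real. H \<in> borel_measurable borel \<and> (\<forall>x. 0 \<le> H x) \<and>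
    (\<integral>\<^sup>+x. indicator {0..1} x * ennreal (H x) \<partial>lborel) \<le> of_nat (card M) * ennreal (ln 32) \<and>
    (AE x in lborel. norm (c k0) \<le> 2 ^ card M * (exp (H x) * norm (\<Sum>k\<in>M. c k * ee (of_int k * x))))"
  using assms
proof (induction "card M" arbitrary: M c)
  case 0
  then show ?case by auto
next
  case (Suc m)
  show ?case
  proof (cases "M = {k0}")
    case True
    then show ?thesis
      by (intro exI[of _ "\<lambda>_. 0"]) (auto simp: norm_mult)
  next
    case False
    obtain s N H0 where s: "s \<in> M" "s \<noteq> k0" "0 < N" "N \<le> 2 * \<bar>real_of_int (k0 - s)\<bar>"
      and H0: "(H0::real \<Rightarrow> real) \<in> borel_measurable borel" "\<forall>x. 0 \<le> H0 x"
      "(\<integral>\<^sup>+x. indicator {0..1} x * ennreal (H0 x) \<partial>lborel) \<le> ennreal (ln 32)"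
      "AE x in lborel. norm (\<Sum>k\<in>M - {s}. c k * of_real (real_of_int (k - s) / N) * ee (of_int k * x))
       \<le> exp (H0 x) * norm (\<Sum>k\<in>M. c k * ee (of_int k * x))"
      using remove_end_frequency[of M k0 c, OF Suc.prems False] by blast
    define d where "d k = c k * of_real (real_of_int (k - s) / N)" for k
    have card: "m = card (M - {s})" using Suc s by simp
    have "d k0 \<noteq> 0" using s Suc.prems by (auto simp: d_def)
    with Suc.hyps(1)[OF card, of d] Suc.prems s
    obtain H1 :: "real \<Rightarrow> real" where H1: "H1 \<in> borel_measurable borel" "\<forall>x. 0 \<le> H1 x"
      "(\<integral>\<^sup>+x. indicator {0..1} x * ennreal (H1 x) \<partial>lborel) \<le> of_nat (card (M - {s})) * ennreal (ln 32)"
      "AE x in lborel. norm (d k0) \<le> 2 ^ card (M - {s}) * (exp (H1 x) * norm (\<Sum>k\<in>M - {s}. d k * ee (of_int k * x)))"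
      by auto
    have dk: "norm (c k0) \<le> 2 * norm (d k0)"
    proof -
      have "1 \<le> 2 * (\<bar>real_of_int (k0 - s)\<bar> / N)" using s by (simp add: field_simps)
      then have "norm (c k0) * 1 \<le> norm (c k0) * (2 * (\<bar>real_of_int (k0 - s)\<bar> / N))"
        by (intro mult_left_mono) auto
      moreover have "norm (d k0) = norm (c k0) * (\<bar>real_of_int (k0 - s)\<bar> / N)"
        unfolding d_def norm_mult norm_of_real abs_divide using s(3) by simp
      ultimately show ?thesis by (simp add: mult_ac)
    qed
    have "AE x in lborel. norm (c k0) \<le> 2 ^ card M * (exp (H1 x + H0 x) * norm (\<Sum>k\<in>M. c k * ee (of_int k * x)))"
      using H1(4) H0(4)
    proof eventually_elim
      case (elim x)
      have "norm (c k0) \<le> 2 * norm (d k0)" by (rule dk)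
      also have "\<dots> \<le> 2 * (2 ^ card (M - {s}) * (exp (H1 x) * norm (\<Sum>k\<in>M - {s}. d k * ee (of_int k * x))))"
        using elim(1) by simp
      also have "\<dots> = 2 ^ card M * (exp (H1 x) * norm (\<Sum>k\<in>M - {s}. d k * ee (of_int k * x)))"
        unfolding Suc.hyps(2)[symmetric] card[symmetric] power_Suc by (simp only: mult.assoc)
      also have "\<dots> \<le> 2 ^ card M * (exp (H1 x) * (exp (H0 x) * norm (\<Sum>k\<in>M. c k * ee (of_int k * x))))"
        using elim(2) by (intro mult_left_mono) (auto simp: d_def)
      finally show ?case by (simp add: exp_add mult_ac)
    qed
    moreover have "(\<integral>\<^sup>+x. indicator {0..1} x * ennreal (H1 x + H0 x) \<partial>lborel) \<le> of_nat (card M) * ennreal (ln 32)"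
    proof -
      have "(\<integral>\<^sup>+x. indicator {0..1} x * ennreal (H1 x + H0 x) \<partial>lborel)
        = (\<integral>\<^sup>+x. indicator {0..1} x * ennreal (H1 x) + indicator {0..1} x * ennreal (H0 x) \<partial>lborel)"
        using H1 H0 by (intro nn_integral_cong) (simp add: distrib_left)
      also have "\<dots> = (\<integral>\<^sup>+x. indicator {0..1} x * ennreal (H1 x) \<partial>lborel) + (\<integral>\<^sup>+x. indicator {0..1} x * ennreal (H0 x) \<partial>lborel)"
        using H1(1) H0(1) by (intro nn_integral_add) auto
      also have "\<dots> \<le> of_nat m * ennreal (ln 32) + ennreal (ln 32)"
        using H1(3) H0(3) card by (intro add_mono) auto
      also have "\<dots> = of_nat (card M) * ennreal (ln 32)"
        by (simp add: Suc.hyps(2)[symmetric] distrib_right add.commute)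
      finally show ?thesis .
    qed
    ultimately show ?thesis
      using H1(1,2) H0(1,2) by (intro exI[of _ "\<lambda>x. H1 x + H0 x"]) auto
  qed
qed

definition turan_base :: real where "turan_base = 2 * 32 ^ 4"

text \<open>Markov's inequality for the function \<open>H\<close> of \<open>turan_log\<close>: it
  exceeds \<open>4 * card M * ln 32\<close> on a set of measure at most 1/4 only.\<close>

lemma turan_circle:
  fixes c :: "int \<Rightarrow> complex"
  assumes "finite M" "k0 \<in> M"
  shows "(\<integral>\<^sup>+x. indicator {0..1} x * indicator {x. turan_base ^ card M * norm (\<Sum>k\<in>M. c k * ee (of_int k * x)) < norm (c k0)} x \<partial>lborel) \<le> ennreal (1/4)"
proof (cases "c k0 = 0")
  case True
  have "\<not> turan_base ^ card M * norm (\<Sum>k\<in>M. c k * ee (of_int k * x)) < 0" for x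
    by (simp add: turan_base_def not_less)
  then show ?thesis using True by simp
next
  case False
  define m where "m = card M"
  have m: "1 \<le> m" using assms by (auto simp: m_def Suc_le_eq card_gt_0_iff)
  from turan_log[of M k0 c, OF assms False] obtain H :: "real \<Rightarrow> real" where H: "H \<in> borel_measurable borel" "\<forall>x. 0 \<le> H x"
    "(\<integral>\<^sup>+x. indicator {0..1} x * ennreal (H x) \<partial>lborel) \<le> of_nat m * ennreal (ln 32)"
    "AE x in lborel. norm (c k0) \<le> 2 ^ m * (exp (H x) * norm (\<Sum>k\<in>M. c k * ee (of_int k * x)))"
    unfolding m_def by blast
  define l where "l = 4 * real m * ln 32"
  have l: "0 < l" using m by (simp add: l_def)
  have el: "2 ^ m * exp l = turan_base ^ m"
  proof -
    have "l = ln (32 ^ (4 * m))" by (simp add: l_def ln_realpow)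
    then have "exp l = (32 ^ 4) ^ m" by (simp add: power_mult)
    then show ?thesis by (simp only: turan_base_def power_mult_distrib)
  qed
  have "(\<integral>\<^sup>+x. indicator {0..1} x * indicator {x. turan_base ^ m * norm (\<Sum>k\<in>M. c k * ee (of_int k * x)) < norm (c k0)} x \<partial>lborel)
    \<le> (\<integral>\<^sup>+x. ennreal (1 / l) * (indicator {0..1} x * ennreal (H x)) \<partial>lborel)"
  proof (rule nn_integral_mono_AE)
    show "AE x in lborel. indicator {0..1} x * indicator {x. turan_base ^ m * norm (\<Sum>k\<in>M. c k * ee (of_int k * x)) < norm (c k0)} x
      \<le> ennreal (1 / l) * (indicator {0..1} x * ennreal (H x))"
      using H(4)
    proof eventually_elim
      case (elim x)
      define p where "p = norm (\<Sum>k\<in>M. c k * ee (of_int k * x))"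
      show ?case
      proof (cases "turan_base ^ m * p < norm (c k0)")
        case True
        then have "2 ^ m * (exp l * p) < 2 ^ m * (exp (H x) * p)"
          using elim el unfolding p_def by (simp add: mult.assoc[symmetric])
        then have "exp l < exp (H x)" using p_def by (simp add: mult_less_cancel_right)
        then have "1 \<le> ennreal (1 / l * H x)" using l by (auto simp: field_simps intro!: ennreal_leI[of 1, simplified])
        then show ?thesis using True l H(2) by (auto simp: indicator_def ennreal_mult'[symmetric])
      qed (auto simp: p_def)
    qed
  qed
  also have "\<dots> = ennreal (1 / l) * (\<integral>\<^sup>+x. (indicator {0..1} x * ennreal (H x)) \<partial>lborel)"
    using H(1) by (intro nn_integral_cmult) auto
  also have "\<dots> \<le> ennreal (1 / l) * (of_nat m * ennreal (ln 32))"
    using H(3) by (intro mult_left_mono) auto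
  also have "\<dots> = ennreal (1 / l * (real m * ln 32))"
    using l by (simp add: ennreal_mult[symmetric] ennreal_of_nat_eq_real_of_nat)
  also have "1 / l * (real m * ln 32) = 1 / 4"
    using m by (simp add: l_def)
  finally show ?thesis by (simp add: m_def)
qed

section \<open>Fourier series on the unit cube\<close>

definition ivec :: "int ^ 'n \<Rightarrow> real ^ 'n" where "ivec k = (\<chi> i. of_int (k $ i))"

definition unit_cube :: "(real ^ 'n) set" where "unit_cube = {x. \<forall>i. 0 \<le> x $ i \<and> x $ i < 1}"

lemma ivec_nth [simp]: "ivec k $ i = of_int (k $ i)"
  by (simp add: ivec_def)

lemma ivec_0 [simp]: "ivec 0 = 0"
  by (simp add: ivec_def vec_eq_iff)

lemma ivec_add: "ivec (j + k) = ivec j + ivec k"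
  by (simp add: vec_eq_iff)

lemma ivec_minus: "ivec (- k) = - ivec k"
  by (simp add: vec_eq_iff)

lemma ivec_diff: "ivec (j - k) = ivec j - ivec k"
  by (simp add: vec_eq_iff)

lemma inner_ivec_ivec_Ints: "ivec j \<bullet> ivec k \<in> \<int>"
proof -
  have "ivec j \<bullet> ivec k = of_int (\<Sum>i\<in>UNIV. j $ i * k $ i)" by (simp add: inner_vec_def)
  then show ?thesis by (metis Ints_of_int)
qed

lemma ee_inner_ivec [simp]: "ee (ivec j \<bullet> ivec k) = 1"
  by (simp add: ee_eq_1_iff inner_ivec_ivec_Ints)

lemma unit_cube_borel [measurable]: "(unit_cube :: (real ^ 'n) set) \<in> sets borel"
proof -
  have "(unit_cube :: (real ^ 'n) set) = (\<Inter>i. {x. 0 \<le> x $ i} \<inter> {x. x $ i < 1})"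
    by (auto simp: unit_cube_def)
  also have "\<dots> \<in> sets borel"
    by (intro sets.finite_INT sets.Int borel_closed borel_open closed_Collect_le open_Collect_less continuous_intros) auto
  finally show ?thesis .
qed

lemma emeasure_unit_cube [simp]: "emeasure lborel (unit_cube :: (real ^ 'n) set) = 1"
proof (rule antisym)
  have one: "(1 :: real ^ 'n) \<bullet> b = 1" if "b \<in> Basis" for b
    using that by (auto simp: Basis_vec_def inner_axis)
  have "emeasure lborel (unit_cube :: (real ^ 'n) set) \<le> emeasure lborel (cbox (0::real ^ 'n) 1)"
    by (intro emeasure_mono) (auto simp: unit_cube_def mem_box_cart less_imp_le)
  also have "\<dots> = 1" using one by (subst emeasure_lborel_cbox) auto
  finally show "emeasure lborel (unit_cube :: (real ^ 'n) set) \<le> 1" .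
  have "1 = emeasure lborel (box (0::real ^ 'n) 1)"
    using one by (subst emeasure_lborel_box) auto
  also have "\<dots> \<le> emeasure lborel (unit_cube :: (real ^ 'n) set)"
    by (intro emeasure_mono) (auto simp: unit_cube_def mem_box_cart less_imp_le)
  finally show "1 \<le> emeasure lborel (unit_cube :: (real ^ 'n) set)" .
qed

lemma diff_ivec_in_cube_iff: "x - ivec k \<in> unit_cube \<longleftrightarrow> k = (\<chi> i. \<lfloor>x $ i\<rfloor>)"
  by (auto simp: unit_cube_def vec_eq_iff floor_eq_iff) (smt (verit) floor_eq_iff)+

lemma nn_integral_indicator_cube_translates:
  "(\<integral>\<^sup>+k. indicator unit_cube (x - ivec k) \<partial>count_space UNIV) = (1::ennreal)"
proof -
  have "(\<integral>\<^sup>+k. indicator unit_cube (x - ivec k) \<partial>count_space UNIV)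
     = (\<integral>\<^sup>+k. indicator {\<chi> i. \<lfloor>x $ i\<rfloor>} k \<partial>count_space UNIV)"
    by (intro nn_integral_cong) (simp add: indicator_def diff_ivec_in_cube_iff)
  also have "\<dots> = 1" by simp
  finally show ?thesis .
qed

lemma nn_integral_translate:
  fixes f :: "'a::euclidean_space \<Rightarrow> ennreal"
  assumes [measurable]: "f \<in> borel_measurable borel"
  shows "(\<integral>\<^sup>+x. f (x + a) \<partial>lborel) = (\<integral>\<^sup>+x. f x \<partial>lborel)"
proof -
  have "(\<integral>\<^sup>+x. f x \<partial>lborel) = (\<integral>\<^sup>+x. f x \<partial>distr lborel borel ((+) a))"
    by (simp add: lborel_distr_plus)
  also have "\<dots> = (\<integral>\<^sup>+x. f (x + a) \<partial>lborel)"
    by (subst nn_integral_distr) (auto simp: add.commute)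
  finally show ?thesis by simp
qed

text \<open>Insert the partition of unity formed by the translated cubes, then move every piece back
  to the unit cube. The sum is an integral over \<open>count_space\<close>, so Tonelli needs no
  summability.\<close>

lemma nn_integral_tile:
  fixes f :: "real ^ 'n \<Rightarrow> ennreal"
  assumes [measurable]: "f \<in> borel_measurable borel"
  shows "(\<integral>\<^sup>+x. f x \<partial>lborel) = (\<integral>\<^sup>+t. (\<integral>\<^sup>+k. f (t + ivec k) \<partial>count_space UNIV) * indicator unit_cube t \<partial>lborel)"
proof -
  have "(\<integral>\<^sup>+x. f x \<partial>lborel) = (\<integral>\<^sup>+x. f x * (\<integral>\<^sup>+k. indicator unit_cube (x - ivec k) \<partial>count_space UNIV) \<partial>lborel)"
    by (simp add: nn_integral_indicator_cube_translates)
  also have "\<dots> = (\<integral>\<^sup>+x. (\<integral>\<^sup>+k. f x * indicator unit_cube (x - ivec k) \<partial>count_space UNIV) \<partial>lborel)"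
    by (simp add: nn_integral_cmult)
  also have "\<dots> = (\<integral>\<^sup>+k. (\<integral>\<^sup>+x. f x * indicator unit_cube (x - ivec k) \<partial>lborel) \<partial>count_space UNIV)"
    by (intro nn_integral_count_space_nn_integral) auto
  also have "\<dots> = (\<integral>\<^sup>+k. (\<integral>\<^sup>+x. f (x + ivec k) * indicator unit_cube x \<partial>lborel) \<partial>count_space UNIV)"
  proof (rule nn_integral_cong)
    fix k :: "int ^ 'n"
    show "(\<integral>\<^sup>+x. f x * indicator unit_cube (x - ivec k) \<partial>lborel) = (\<integral>\<^sup>+x. f (x + ivec k) * indicator unit_cube x \<partial>lborel)"
      using nn_integral_translate[of "\<lambda>x. f x * indicator unit_cube (x - ivec k)" "ivec k"] by simp
  qed
  also have "\<dots> = (\<integral>\<^sup>+x. (\<integral>\<^sup>+k. f (x + ivec k) * indicator unit_cube x \<partial>count_space UNIV) \<partial>lborel)"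
    by (intro nn_integral_count_space_nn_integral[symmetric]) auto
  finally show ?thesis by (simp add: nn_integral_multc)
qed

definition zperiodic :: "(real ^ 'n \<Rightarrow> 'b) \<Rightarrow> bool" where
  "zperiodic f \<longleftrightarrow> (\<forall>x k. f (x + ivec k) = f x)"

lemma zperiodicD: "zperiodic f \<Longrightarrow> f (x + ivec k) = f x"
  by (simp add: zperiodic_def)

text \<open>The translated cube is another fundamental domain: cut along the integer lattice, its
  pieces move back to cover \<open>unit_cube\<close> exactly once.\<close>

lemma nn_integral_cube_translate:
  fixes f :: "real ^ 'n \<Rightarrow> ennreal"
  assumes [measurable]: "f \<in> borel_measurable borel" and f: "zperiodic f"
  shows "(\<integral>\<^sup>+t. f (t + v) * indicator unit_cube t \<partial>lborel) = (\<integral>\<^sup>+t. f t * indicator unit_cube t \<partial>lborel)"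
proof -
  have "(\<integral>\<^sup>+t. f (t + v) * indicator unit_cube t \<partial>lborel) = (\<integral>\<^sup>+t. f t * indicator unit_cube (t - v) \<partial>lborel)"
    by (subst nn_integral_translate[of _ v, symmetric]) auto
  also have "\<dots> = (\<integral>\<^sup>+t. (\<integral>\<^sup>+k. f (t + ivec k) * indicator unit_cube (t + ivec k - v) \<partial>count_space UNIV) * indicator unit_cube t \<partial>lborel)"
    by (subst nn_integral_tile) auto
  also have "\<dots> = (\<integral>\<^sup>+t. f t * indicator unit_cube t \<partial>lborel)"
  proof (intro nn_integral_cong)
    fix t :: "real ^ 'n"
    have "(\<integral>\<^sup>+k. f (t + ivec k) * indicator unit_cube (t + ivec k - v) \<partial>count_space UNIV)
      = (\<integral>\<^sup>+k. f t * indicator unit_cube ((t - v) - ivec (- k)) \<partial>count_space UNIV)"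
      using f by (intro nn_integral_cong) (simp add: zperiodicD ivec_minus algebra_simps)
    also have "\<dots> = f t * (\<integral>\<^sup>+k. indicator unit_cube ((t - v) - ivec (- k)) \<partial>count_space UNIV)"
      by (simp add: nn_integral_cmult)
    also have "(\<integral>\<^sup>+k. indicator unit_cube ((t - v) - ivec (- k)) \<partial>count_space UNIV)
      = (\<integral>\<^sup>+k. indicator unit_cube ((t - v) - ivec k) \<partial>count_space UNIV)"
      by (rule nn_integral_bij_count_space) (auto intro!: bij_betwI[where g=uminus])
    also have "\<dots> = 1" by (rule nn_integral_indicator_cube_translates)
    finally show "(\<integral>\<^sup>+k. f (t + ivec k) * indicator unit_cube (t + ivec k - v) \<partial>count_space UNIV) * indicator unit_cube t
      = f t * indicator unit_cube t" by simp
  qed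
  finally show ?thesis .
qed

text \<open>The direction consists of powers of one integer \<open>x\<close> with distinct
  exponents. Two frequencies collide only if \<open>x\<close> is a root of the nonzero polynomial
  whose coefficients are their difference, so all but finitely many \<open>x\<close> work.\<close>

lemma separating_direction:
  fixes M :: "(int ^ 'n) set"
  assumes "finite M"
  shows "\<exists>q :: int ^ 'n. inj_on (\<lambda>k. \<Sum>i\<in>UNIV. k $ i * q $ i) M"
proof -
  obtain idx :: "'n \<Rightarrow> nat" where idx: "inj idx"
    by (meson finite_imp_inj_to_nat_seg finite_class.finite_UNIV)
  define p where "p d = (\<Sum>i\<in>UNIV. monom (d $ i) (idx i))" for d :: "int ^ 'n"
  have p0: "p d \<noteq> 0" if d: "d \<noteq> 0" for d
  proof -
    obtain i where i: "d $ i \<noteq> 0" using d by (auto simp: vec_eq_iff)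
    have "coeff (p d) (idx i) = (\<Sum>j\<in>UNIV. if j = i then d $ j else 0)"
      unfolding p_def coeff_sum using idx by (intro sum.cong) (auto simp: inj_eq)
    then show ?thesis using i by auto
  qed
  define D where "D = (\<lambda>(j, k). j - k) ` (M \<times> M) - {0}"
  have "finite (\<Union>d\<in>D. {x. poly (p d) x = 0})"
    using assms p0 by (intro finite_UN_I poly_roots_finite) (auto simp: D_def)
  then obtain x where x: "x \<notin> (\<Union>d\<in>D. {x. poly (p d) x = 0})"
    using ex_new_if_finite infinite_UNIV_int by blast
  define q :: "int ^ 'n" where "q = (\<chi> i. x ^ idx i)"
  have "j = k" if "j \<in> M" "k \<in> M" "(\<Sum>i\<in>UNIV. j $ i * q $ i) = (\<Sum>i\<in>UNIV. k $ i * q $ i)" for j k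
  proof (rule ccontr)
    assume "j \<noteq> k"
    then have "j - k \<in> D" using that by (auto simp: D_def)
    then have "poly (p (j - k)) x \<noteq> 0" using x by auto
    moreover have "poly (p (j - k)) x = (\<Sum>i\<in>UNIV. j $ i * q $ i) - (\<Sum>i\<in>UNIV. k $ i * q $ i)"
      by (simp add: p_def poly_sum poly_monom q_def sum_subtractf left_diff_distrib)
    ultimately show False using that by simp
  qed
  then show ?thesis by (intro exI[of _ q] inj_onI) blast
qed

lemma borel_measurable_ee_inner [measurable]:
  "(\<lambda>t. ee (a \<bullet> t)) \<in> borel_measurable borel"
  by (intro borel_measurable_continuous_onI continuous_on_ee continuous_intros)

text \<open>Reduces to the circle by averaging over translates along an integer direction that separates the frequencies.\<close>

lemma turan_cube:
  fixes c :: "int ^ 'n \<Rightarrow> complex"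
  assumes M: "finite M" "k0 \<in> M"
  shows "emeasure lborel {t\<in>unit_cube. turan_base ^ card M * norm (\<Sum>k\<in>M. c k * ee (ivec k \<bullet> t)) < norm (c k0)} \<le> ennreal (1/4)"
proof -
  obtain q :: "int ^ 'n" where q: "inj_on (\<lambda>k. \<Sum>i\<in>UNIV. k $ i * q $ i) M"
    using separating_direction[OF M(1)] by blast
  define s where "s k = (\<Sum>i\<in>UNIV. k $ i * q $ i)" for k
  have s: "of_int (s k) = ivec k \<bullet> ivec q" for k
    by (simp add: s_def inner_vec_def)
  have inj: "inj_on s M" using q by (simp add: s_def[abs_def])
  define P where "P t = (\<Sum>k\<in>M. c k * ee (ivec k \<bullet> t))" for t
  define S where "S = {t. turan_base ^ card M * norm (P t) < norm (c k0)}"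
  have P_meas [measurable]: "P \<in> borel_measurable borel"
    unfolding P_def by measurable
  have S_meas [measurable]: "S \<in> sets borel"
    unfolding S_def by measurable
  have Pper: "P (t + ivec j) = P t" for t j
    by (simp add: P_def inner_right_distrib ee_add)
  have per: "zperiodic (indicator S :: _ \<Rightarrow> ennreal)"
    by (simp add: zperiodic_def S_def indicator_def Pper)
  \<comment> \<open>Along the line through \<open>t\<close> the sum is a trigonometric polynomial in
    one variable: its frequencies \<open>s k\<close> are distinct integers, and its coefficients
    keep their absolute values.\<close>
  have line: "(\<integral>\<^sup>+x. indicator {0..1} x * indicator S (t + x *\<^sub>R ivec q) \<partial>lborel) \<le> ennreal (1/4)" for t
  proof -
    define d where "d j = c (the_inv_into M s j) * ee (ivec (the_inv_into M s j) \<bullet> t)" for j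
    have d: "d (s k) = c k * ee (ivec k \<bullet> t)" if "k \<in> M" for k
      using that inj by (simp add: d_def the_inv_into_f_f)
    have "P (t + x *\<^sub>R ivec q) = (\<Sum>j\<in>s ` M. d j * ee (of_int j * x))" for x
      unfolding P_def sum.reindex[OF inj] o_def
      by (intro sum.cong) (auto simp: d inner_right_distrib ee_add s mult_ac)
    moreover have "norm (c k0) = norm (d (s k0))" using M by (simp add: d norm_mult)
    moreover have "card M = card (s ` M)" by (simp add: card_image inj)
    ultimately have *: "indicator S (t + x *\<^sub>R ivec q) =
      indicator {x. turan_base ^ card (s ` M) * norm (\<Sum>j\<in>s ` M. d j * ee (of_int j * x)) < norm (d (s k0))} x" for x
      by (simp add: S_def indicator_def)
    show ?thesis unfolding * by (rule turan_circle) (use M in auto)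
  qed
  have "emeasure lborel {t\<in>unit_cube. turan_base ^ card M * norm (P t) < norm (c k0)} = (\<integral>\<^sup>+t. indicator S t * indicator unit_cube t \<partial>lborel)"
  proof -
    have "{t\<in>unit_cube. turan_base ^ card M * norm (P t) < norm (c k0)} = S \<inter> unit_cube"
      by (auto simp: S_def)
    then show ?thesis by (simp flip: nn_integral_indicator add: indicator_inter_arith)
  qed
  \<comment> \<open>The factor 1 is written as an integral over \<open>{0..1}\<close>. Periodicity
    then allows a translation of the inner integral that depends on \<open>x\<close>, and Tonelli
    leaves the circle estimate at each \<open>t\<close>.\<close>
  also have "\<dots> = (\<integral>\<^sup>+x. indicator {0..1::real} x * (\<integral>\<^sup>+t. indicator S t * indicator unit_cube t \<partial>lborel) \<partial>lborel)"
    by (simp add: nn_integral_multc)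
  also have "\<dots> = (\<integral>\<^sup>+x. indicator {0..1::real} x * (\<integral>\<^sup>+t. indicator S (t + x *\<^sub>R ivec q) * indicator unit_cube t \<partial>lborel) \<partial>lborel)"
    by (subst nn_integral_cube_translate[OF _ per]) auto
  also have "\<dots> = (\<integral>\<^sup>+x. (\<integral>\<^sup>+t. indicator {0..1::real} x * (indicator S (t + x *\<^sub>R ivec q) * indicator unit_cube t) \<partial>lborel) \<partial>lborel)"
    by (simp add: nn_integral_cmult)
  also have "\<dots> = (\<integral>\<^sup>+t. (\<integral>\<^sup>+x. indicator {0..1::real} x * (indicator S (t + x *\<^sub>R ivec q) * indicator unit_cube t) \<partial>lborel) \<partial>lborel)"
    by (intro lborel_pair.Fubini') measurable
  also have "\<dots> = (\<integral>\<^sup>+t. (\<integral>\<^sup>+x. indicator {0..1::real} x * indicator S (t + x *\<^sub>R ivec q) \<partial>lborel) * indicator unit_cube t \<partial>lborel)"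
    by (simp add: nn_integral_multc mult.assoc[symmetric])
  also have "\<dots> \<le> (\<integral>\<^sup>+t. ennreal (1/4) * indicator unit_cube t \<partial>(lborel :: (real ^ 'n) measure))"
    using line by (intro nn_integral_mono mult_right_mono) auto
  also have "\<dots> = ennreal (1/4)" by (simp add: nn_integral_cmult)
  finally show ?thesis by (simp add: P_def)
qed

section \<open>Fourier coefficients and trigonometric polynomials on the cube\<close>

definition cubeM :: "(real ^ 'n) measure" where "cubeM = restrict_space lborel unit_cube"

lemma borel_measurable_cubeM [measurable (raw)]:
  "f \<in> borel_measurable borel \<Longrightarrow> f \<in> borel_measurable cubeM"
  unfolding cubeM_def by (intro measurable_restrict_space1) simp

lemma nn_integral_cubeM: "(\<integral>\<^sup>+t. f t \<partial>cubeM) = (\<integral>\<^sup>+t. f t * indicator unit_cube t \<partial>lborel)"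
  unfolding cubeM_def by (rule nn_integral_restrict_space) simp

lemma emeasure_space_cubeM: "emeasure cubeM (space cubeM) = 1"
  unfolding cubeM_def by (subst emeasure_restrict_space) (auto simp: space_restrict_space)

lemma finite_measure_cubeM: "finite_measure cubeM"
  by (rule finite_measureI) (simp add: emeasure_space_cubeM)

lemma AE_cubeM: "AE t in lborel. t \<in> unit_cube \<longrightarrow> P t \<Longrightarrow> AE t in cubeM. P t"
  unfolding cubeM_def by (subst AE_restrict_space_iff) auto

text \<open>A class closed under sums and products and integrable over the cube, so that all
  integrability conditions there follow from boundedness. General functions are reduced to it by
  truncation.\<close>

definition bounded_borel :: "('a::topological_space \<Rightarrow> 'b::real_normed_vector) \<Rightarrow> bool" where
  "bounded_borel f \<longleftrightarrow> f \<in> borel_measurable borel \<and> (\<exists>B. \<forall>x. norm (f x) \<le> B)"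

lemma bounded_borel_measurable [measurable_dest]: "bounded_borel f \<Longrightarrow> f \<in> borel_measurable borel"
  by (simp add: bounded_borel_def)

lemma bounded_borel_mult:
  fixes f g :: "'a::topological_space \<Rightarrow> complex"
  assumes f: "bounded_borel f" and g: "bounded_borel g"
  shows "bounded_borel (\<lambda>x. f x * g x)"
proof -
  obtain A B where AB: "\<And>x. norm (f x) \<le> A" "\<And>x. norm (g x) \<le> B"
    using f g unfolding bounded_borel_def by blast
  have "norm (f x * g x) \<le> A * B" for x
    unfolding norm_mult by (intro mult_mono AB order_trans[OF norm_ge_zero AB(1)]) auto
  then show ?thesis using f g unfolding bounded_borel_def by auto
qed

lemma bounded_borel_add:
  fixes f g :: "'a::topological_space \<Rightarrow> complex"
  assumes f: "bounded_borel f" and g: "bounded_borel g"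
  shows "bounded_borel (\<lambda>x. f x + g x)"
proof -
  obtain A B where AB: "\<And>x. norm (f x) \<le> A" "\<And>x. norm (g x) \<le> B"
    using f g unfolding bounded_borel_def by blast
  have "norm (f x + g x) \<le> A + B" for x
    by (intro norm_triangle_mono AB)
  then show ?thesis using f g unfolding bounded_borel_def by auto
qed

lemma bounded_borel_const: "bounded_borel (\<lambda>x. c)"
  unfolding bounded_borel_def by auto

lemma bounded_borel_ee: "bounded_borel (\<lambda>t. ee (a \<bullet> t))"
  unfolding bounded_borel_def by auto

lemma bounded_borel_cnj: "bounded_borel f \<Longrightarrow> bounded_borel (\<lambda>x. cnj (f x))"
  unfolding bounded_borel_def by (auto intro: borel_measurable_continuous_onI[THEN measurable_compose[rotated]] continuous_intros)

lemma bounded_borel_sum: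
  "(\<And>k. k \<in> M \<Longrightarrow> bounded_borel (f k)) \<Longrightarrow> bounded_borel (\<lambda>x. \<Sum>k\<in>M. f k x :: complex)"
  by (induction M rule: infinite_finite_induct) (auto intro: bounded_borel_add bounded_borel_const)

lemma bounded_borel_diff:
  fixes f g :: "'a::topological_space \<Rightarrow> complex"
  assumes f: "bounded_borel f" and g: "bounded_borel g"
  shows "bounded_borel (\<lambda>x. f x - g x)"
  using bounded_borel_add[OF f bounded_borel_mult[OF bounded_borel_const[of "-1"] g]] by simp

lemma integrable_cubeM:
  fixes f :: "real ^ 'n \<Rightarrow> 'b::{banach, second_countable_topology}"
  assumes "bounded_borel f" shows "integrable cubeM f"
proof -
  interpret finite_measure "cubeM :: (real ^ 'n) measure" by (rule finite_measure_cubeM)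
  obtain B where "\<And>x. norm (f x) \<le> B" using assms unfolding bounded_borel_def by blast
  then show ?thesis using assms by (intro integrable_const_bound[of _ B]) (auto simp: bounded_borel_def)
qed

lemma bounded_borel_norm_sq: "bounded_borel (f :: _ \<Rightarrow> complex) \<Longrightarrow> bounded_borel (\<lambda>x. (norm (f x))\<^sup>2)"
proof -
  assume f: "bounded_borel f"
  obtain B where "\<And>x. norm (f x) \<le> B" using f unfolding bounded_borel_def by blast
  then have "norm ((norm (f x))\<^sup>2) \<le> B\<^sup>2" for x by (simp add: power_mono)
  then show ?thesis using f unfolding bounded_borel_def by auto
qed

lemma nn_integral_norm_sq_cubeM:
  fixes f :: "real ^ 'n \<Rightarrow> complex"
  assumes "bounded_borel f"
  shows "(\<integral>\<^sup>+t. ennreal ((norm (f t))\<^sup>2) \<partial>cubeM) = ennreal (integral\<^sup>L cubeM (\<lambda>t. (norm (f t))\<^sup>2))"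
  by (intro nn_integral_eq_integral integrable_cubeM bounded_borel_norm_sq assms) auto

lemma integral_cube_translate:
  fixes f :: "real ^ 'n \<Rightarrow> real"
  assumes f: "bounded_borel f" "zperiodic f"
  shows "integral\<^sup>L cubeM (\<lambda>t. f (t + v)) = integral\<^sup>L cubeM f"
proof -
  interpret finite_measure "cubeM :: (real ^ 'n) measure" by (rule finite_measure_cubeM)
  have [measurable]: "f \<in> borel_measurable borel" using f by (simp add: bounded_borel_def)
  obtain B where B: "\<And>x. norm (f x) \<le> B" using f unfolding bounded_borel_def by blast
  have B': "\<bar>f x\<bar> \<le> B" for x using B[of x] by simp
  have nn: "0 \<le> f x + B" for x using B'[of x] by linarith
  have bb: "bounded_borel (\<lambda>t. f (t + v))"
    using B unfolding bounded_borel_def by auto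
  have bb2: "bounded_borel (\<lambda>t. f (t + v) + B)" for v
  proof -
    have "norm (f (t + v) + B) \<le> B + \<bar>B\<bar>" for t
      using B'[of "t + v"] by simp
    then show ?thesis unfolding bounded_borel_def by auto
  qed
  have "(\<integral>\<^sup>+t. ennreal (f (t + v) + B) \<partial>cubeM) = (\<integral>\<^sup>+t. ennreal (f t + B) \<partial>cubeM)"
    unfolding nn_integral_cubeM
    by (rule nn_integral_cube_translate[of "\<lambda>t. ennreal (f t + B)"]) (use f in \<open>auto simp: zperiodic_def\<close>)
  then have "integral\<^sup>L cubeM (\<lambda>t. f (t + v) + B) = integral\<^sup>L cubeM (\<lambda>t. f t + B)"
    using integrable_cubeM[OF bb2[of v]] integrable_cubeM[OF bb2[of 0]] nn
    by (subst (1 2) integral_eq_nn_integral) auto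
  then show ?thesis
    using integrable_cubeM[OF bb] integrable_cubeM[OF f(1)] by simp
qed

text \<open>For k \<noteq> 0, translation by a vector with inner product 1/2 with \<open>k\<close>
  changes the sign of the character but not its integral.\<close>

lemma integral_ee_cubeM:
  fixes k :: "int ^ 'n"
  shows
  "integral\<^sup>L cubeM (\<lambda>t. ee (ivec k \<bullet> t)) = (if k = 0 then 1 else 0)"
proof (cases "k = 0")
  case True
  interpret finite_measure "cubeM :: (real ^ 'n) measure" by (rule finite_measure_cubeM)
  show ?thesis using True by (simp add: measure_def emeasure_space_cubeM)
next
  case False
  then obtain i where i: "k $ i \<noteq> 0" by (auto simp: vec_eq_iff)
  define v :: "real ^ 'n" where "v = axis i (1 / (2 * of_int (k $ i)))"
  have "ivec k \<bullet> v = 1 / 2" using i by (simp add: v_def inner_axis)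
  then have v: "ee (ivec k \<bullet> (t + v)) = - ee (ivec k \<bullet> t)" for t
  proof -
    have "ee (1 / 2) = -1" by (simp add: ee_def)
    then show ?thesis using \<open>ivec k \<bullet> v = 1 / 2\<close> by (simp only: inner_right_distrib ee_add) simp
  qed
  have int: "integrable cubeM (\<lambda>t. ee (ivec k \<bullet> t))"
    by (intro integrable_cubeM bounded_borel_ee)
  have "integral\<^sup>L cubeM (\<lambda>t. g (ee (ivec k \<bullet> t))) = 0"
    if "g = Re \<or> g = Im" for g
  proof -
    have bb: "bounded_borel (\<lambda>t. g (ee (ivec k \<bullet> t)))"
      unfolding bounded_borel_def
    proof
      show "(\<lambda>t. g (ee (ivec k \<bullet> t))) \<in> borel_measurable borel" using that by auto
      have "norm (g (ee (ivec k \<bullet> t))) \<le> 1" for t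
        using that abs_Re_le_cmod[of "ee (ivec k \<bullet> t)"] abs_Im_le_cmod[of "ee (ivec k \<bullet> t)"] by auto
      then show "\<exists>B. \<forall>t. norm (g (ee (ivec k \<bullet> t))) \<le> B" by blast
    qed
    have "zperiodic (\<lambda>t. g (ee (ivec k \<bullet> t)))"
      by (simp add: zperiodic_def inner_right_distrib ee_add)
    from integral_cube_translate[OF bb this, of v]
    show ?thesis using that by (auto simp: v)
  qed
  note zero = this
  have "Re (integral\<^sup>L cubeM (\<lambda>t. ee (ivec k \<bullet> t))) = 0"
    using zero[of Re] integral_bounded_linear[OF bounded_linear_Re int] by simp
  moreover have "Im (integral\<^sup>L cubeM (\<lambda>t. ee (ivec k \<bullet> t))) = 0"
    using zero[of Im] integral_bounded_linear[OF bounded_linear_Im int] by simp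
  ultimately show ?thesis using False by (simp add: complex_eq_iff)
qed

definition trig :: "(int ^ 'n) set \<Rightarrow> (int ^ 'n \<Rightarrow> complex) \<Rightarrow> real ^ 'n \<Rightarrow> complex" where
  "trig M c t = (\<Sum>k\<in>M. c k * ee (ivec k \<bullet> t))"

definition fcoef :: "(real ^ 'n \<Rightarrow> complex) \<Rightarrow> int ^ 'n \<Rightarrow> complex" where
  "fcoef F k = integral\<^sup>L cubeM (\<lambda>t. F t * cnj (ee (ivec k \<bullet> t)))"

lemma bounded_borel_trig: "bounded_borel (trig M c)"
  unfolding trig_def by (intro bounded_borel_sum bounded_borel_mult bounded_borel_const bounded_borel_ee)

lemma fcoef_trig:
  assumes "finite M" shows "fcoef (trig M c) k = (if k \<in> M then c k else 0)"
proof -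
  have "fcoef (trig M c) k = integral\<^sup>L cubeM (\<lambda>t. \<Sum>j\<in>M. c j * ee (ivec (j - k) \<bullet> t))"
    unfolding fcoef_def trig_def sum_distrib_right
    by (simp add: ivec_diff inner_diff_left ee_diff mult_ac)
  also have "\<dots> = (\<Sum>j\<in>M. c j * integral\<^sup>L cubeM (\<lambda>t. ee (ivec (j - k) \<bullet> t)))"
    by (simp add: integrable_cubeM[OF bounded_borel_ee])
  also have "\<dots> = (\<Sum>j\<in>M. if j = k then c j else 0)"
    by (intro sum.cong) (auto simp: integral_ee_cubeM)
  finally show ?thesis using assms by simp
qed

lemma fcoef_diff:
  assumes "bounded_borel F" "bounded_borel G"
  shows "fcoef (\<lambda>t. F t - G t) k = fcoef F k - fcoef G k"
  unfolding fcoef_def left_diff_distrib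
  by (intro Bochner_Integration.integral_diff integrable_cubeM bounded_borel_mult assms bounded_borel_cnj bounded_borel_ee)

lemma integral_mult_cnj_trig:
  assumes F: "bounded_borel F"
  shows "integral\<^sup>L cubeM (\<lambda>t. F t * cnj (trig M c t)) = (\<Sum>k\<in>M. cnj (c k) * fcoef F k)"
proof -
  have "integral\<^sup>L cubeM (\<lambda>t. F t * cnj (trig M c t)) = integral\<^sup>L cubeM (\<lambda>t. \<Sum>k\<in>M. cnj (c k) * (F t * cnj (ee (ivec k \<bullet> t))))"
    unfolding trig_def by (simp add: sum_distrib_left mult_ac)
  also have "\<dots> = (\<Sum>k\<in>M. cnj (c k) * fcoef F k)"
    unfolding fcoef_def
    by (simp add: integrable_cubeM[OF bounded_borel_mult[OF F bounded_borel_cnj[OF bounded_borel_ee]]])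
  finally show ?thesis .
qed

text \<open>A completed square in the coefficients: the Fourier coefficients are the best choice for
  the frequencies \<open>M\<close>, and inserting them yields Bessel's inequality.\<close>

lemma trig_error:
  assumes F: "bounded_borel F" and M: "finite M"
  shows "integral\<^sup>L cubeM (\<lambda>t. (norm (F t - trig M c t))\<^sup>2) = integral\<^sup>L cubeM (\<lambda>t. (norm (F t))\<^sup>2)
     + (\<Sum>k\<in>M. (norm (c k - fcoef F k))\<^sup>2 - (norm (fcoef F k))\<^sup>2)"
proof -
  note bb = F bounded_borel_trig[of M c]
  have i1: "integrable cubeM (\<lambda>t. F t * cnj (F t))"
    and i2: "integrable cubeM (\<lambda>t. F t * cnj (trig M c t))"
    and i4: "integrable cubeM (\<lambda>t. trig M c t * cnj (trig M c t))"
    and i3: "integrable cubeM (\<lambda>t. cnj (F t * cnj (trig M c t)))"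
    by (intro integrable_cubeM bounded_borel_mult bounded_borel_cnj bb)+
  have "of_real (integral\<^sup>L cubeM (\<lambda>t. (norm (F t - trig M c t))\<^sup>2))
      = integral\<^sup>L cubeM (\<lambda>t. (F t * cnj (F t) - F t * cnj (trig M c t)) - cnj (F t * cnj (trig M c t)) + trig M c t * cnj (trig M c t))"
    unfolding integral_complex_of_real[symmetric]
    by (intro Bochner_Integration.integral_cong refl) (simp add: complex_norm_square algebra_simps flip: of_real_power)
  also have "\<dots> = integral\<^sup>L cubeM (\<lambda>t. F t * cnj (F t)) - integral\<^sup>L cubeM (\<lambda>t. F t * cnj (trig M c t))
     - cnj (integral\<^sup>L cubeM (\<lambda>t. F t * cnj (trig M c t))) + integral\<^sup>L cubeM (\<lambda>t. trig M c t * cnj (trig M c t))"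
    by (simp only: Bochner_Integration.integral_add Bochner_Integration.integral_diff
        Bochner_Integration.integrable_add Bochner_Integration.integrable_diff i1 i2 i3 i4 Bochner_Integration.integral_cnj)
  also have "integral\<^sup>L cubeM (\<lambda>t. F t * cnj (F t)) = of_real (integral\<^sup>L cubeM (\<lambda>t. (norm (F t))\<^sup>2))"
    unfolding integral_complex_of_real[symmetric]
    by (intro Bochner_Integration.integral_cong refl) (simp only: complex_norm_square)
  also have "integral\<^sup>L cubeM (\<lambda>t. F t * cnj (trig M c t)) = (\<Sum>k\<in>M. cnj (c k) * fcoef F k)"
    by (rule integral_mult_cnj_trig[OF F])
  also have "integral\<^sup>L cubeM (\<lambda>t. trig M c t * cnj (trig M c t)) = (\<Sum>k\<in>M. cnj (c k) * c k)"
    unfolding integral_mult_cnj_trig[OF bounded_borel_trig] using M by (simp add: fcoef_trig)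
  finally have "of_real (integral\<^sup>L cubeM (\<lambda>t. (norm (F t - trig M c t))\<^sup>2)) =
     of_real (integral\<^sup>L cubeM (\<lambda>t. (norm (F t))\<^sup>2)) +
     (\<Sum>k\<in>M. cnj (c k) * c k - cnj (c k) * fcoef F k - c k * cnj (fcoef F k))"
    by (simp add: sum_subtractf sum.distrib algebra_simps)
  also have "(\<Sum>k\<in>M. cnj (c k) * c k - cnj (c k) * fcoef F k - c k * cnj (fcoef F k))
     = of_real (\<Sum>k\<in>M. (norm (c k - fcoef F k))\<^sup>2 - (norm (fcoef F k))\<^sup>2)"
    unfolding of_real_sum by (intro sum.cong refl) (simp add: complex_norm_square algebra_simps flip: of_real_power)
  finally show ?thesis
    unfolding of_real_add[symmetric] of_real_eq_iff .
qed

definition is_trig :: "(real ^ 'n \<Rightarrow> complex) \<Rightarrow> bool" where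
  "is_trig T \<longleftrightarrow> (\<exists>M c. finite M \<and> T = trig M c)"

lemma is_trig_ee: "is_trig (\<lambda>t. c * ee (ivec k \<bullet> t))"
  unfolding is_trig_def by (intro exI[of _ "{k}"] exI[of _ "\<lambda>_. c"]) (simp add: trig_def fun_eq_iff)

lemma is_trig_const: "is_trig (\<lambda>t. c)"
  using is_trig_ee[of c 0] by simp

lemma is_trig_add:
  assumes "is_trig S" "is_trig T" shows "is_trig (\<lambda>t. S t + T t)"
proof -
  obtain M c M' c' where *: "finite M" "S = trig M c" "finite M'" "T = trig M' c'"
    using assms unfolding is_trig_def by blast
  define d where "d k = (if k \<in> M then c k else 0) + (if k \<in> M' then c' k else 0)" for k
  have "S t + T t = trig (M \<union> M') d t" for t
  proof -
    have "S t = (\<Sum>k\<in>M \<union> M'. (if k \<in> M then c k else 0) * ee (ivec k \<bullet> t))"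
      unfolding * trig_def using *(1,3) by (intro sum.mono_neutral_cong_left) auto
    moreover have "T t = (\<Sum>k\<in>M \<union> M'. (if k \<in> M' then c' k else 0) * ee (ivec k \<bullet> t))"
      unfolding * trig_def using *(1,3) by (intro sum.mono_neutral_cong_left) auto
    ultimately show ?thesis
      by (simp only: trig_def d_def distrib_right sum.distrib)
  qed
  then show ?thesis using * unfolding is_trig_def by (intro exI[of _ "M \<union> M'"] exI[of _ d]) auto
qed

lemma is_trig_sum: "(\<And>k. k \<in> M \<Longrightarrow> is_trig (f k)) \<Longrightarrow> is_trig (\<lambda>t. \<Sum>k\<in>M. f k t)"
  by (induction M rule: infinite_finite_induct) (auto intro: is_trig_add is_trig_const)

lemma is_trig_mult:
  assumes "is_trig S" "is_trig T" shows "is_trig (\<lambda>t. S t * T t)"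
proof -
  obtain M c M' c' where *: "finite M" "S = trig M c" "finite M'" "T = trig M' c'"
    using assms unfolding is_trig_def by blast
  have "(\<lambda>t. S t * T t) = (\<lambda>t. \<Sum>j\<in>M. \<Sum>k\<in>M'. (c j * c' k) * ee (ivec (j + k) \<bullet> t))"
    unfolding * trig_def sum_product by (simp add: ivec_add inner_left_distrib ee_add mult_ac)
  moreover have "is_trig (\<lambda>t. \<Sum>j\<in>M. \<Sum>k\<in>M'. (c j * c' k) * ee (ivec (j + k) \<bullet> t))"
    by (intro is_trig_sum is_trig_ee)
  ultimately show ?thesis by simp
qed

text \<open>Turns the polynomials of Stone-Weierstrass into trigonometric ones. Only linear
  functionals need work: the real and imaginary parts of a coordinate are combinations of two
  characters with opposite unit frequencies.\<close>

lemma is_trig_real_polynomial: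
  assumes "real_polynomial_function (p :: complex ^ 'n \<Rightarrow> real)"
  shows "is_trig (\<lambda>t :: real ^ 'n. of_real (p (\<chi> i. ee (t $ i))))"
  using assms
proof (induction rule: real_polynomial_function.induct)
  case (linear f)
  interpret f: bounded_linear f by fact
  have ax: "ivec (axis i 1) \<bullet> t = t $ i" for i and t :: "real ^ 'n"
  proof -
    have "ivec (axis i 1) = (axis i 1 :: real ^ 'n)" by (simp add: vec_eq_iff axis_def)
    then show ?thesis by (simp add: inner_axis')
  qed
  have ax': "ivec (- axis i 1) \<bullet> t = - (t $ i)" for i and t :: "real ^ 'n"
    by (simp add: ivec_minus ax)
  have "of_real (f (\<chi> i. ee (t $ i))) = (\<Sum>i\<in>UNIV. (of_real (f (axis i 1)) / 2 - \<i> * of_real (f (axis i \<i>)) / 2) * ee (ivec (axis i 1) \<bullet> t)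
       + (of_real (f (axis i 1)) / 2 + \<i> * of_real (f (axis i \<i>)) / 2) * ee (ivec (- axis i 1) \<bullet> t))" for t :: "real ^ 'n"
  proof -
    have "(\<chi> i. ee (t $ i)) = (\<Sum>i\<in>UNIV. Re (ee (t $ i)) *\<^sub>R axis i 1 + Im (ee (t $ i)) *\<^sub>R axis i \<i>)"
      by (simp add: vec_eq_iff axis_def complex_eq_iff if_distrib[of Re] if_distrib[of Im] cong: if_cong)
         (simp add: if_distrib cong: if_cong)
    then have "f (\<chi> i. ee (t $ i)) = (\<Sum>i\<in>UNIV. Re (ee (t $ i)) * f (axis i 1) + Im (ee (t $ i)) * f (axis i \<i>))"
      by (simp add: f.sum f.add f.scaleR)
    then show ?thesis
      unfolding ax ax' by (simp add: of_real_sum) (intro sum.cong refl, simp add: cnj_ee[symmetric] complex_eq_iff field_simps)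
  qed
  then show ?case
    by (simp only:) (intro is_trig_sum is_trig_add is_trig_ee)
next
  case (const c)
  then show ?case by (simp add: is_trig_const)
next
  case (add f g)
  then show ?case by (simp add: is_trig_add)
next
  case (mult f g)
  then show ?case by (simp add: is_trig_mult)
qed

section \<open>Density of trigonometric polynomials and Parseval's identity\<close>

definition ramp :: "real \<Rightarrow> real" where "ramp s = max 0 (min 1 (s - 1))"

lemma ramp_bounds: "0 \<le> ramp s" "ramp s \<le> 1"
  by (auto simp: ramp_def)

lemma continuous_on_ramp: "continuous_on S ramp"
  unfolding ramp_def by (intro continuous_intros)

text \<open>1 - cos vanishes exactly at integers, so \<open>cutoff l\<close> is 0 near the faces of
  the cube, while at each interior point it equals 1 for large \<open>l\<close>. Through the cosine
  it depends on \<open>ee (t $ i)\<close> only and so lives on the torus.\<close>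

definition cutoff :: "real \<Rightarrow> real ^ 'n \<Rightarrow> real" where
  "cutoff l t = (\<Prod>i\<in>UNIV. ramp (l * (1 - cos (2 * pi * t $ i))))"

lemma cutoff_bounds: "0 \<le> cutoff l t" "cutoff l t \<le> 1"
  by (auto simp: cutoff_def ramp_bounds intro!: prod_nonneg prod_le_1)

lemma continuous_on_cutoff: "continuous_on S (cutoff l)"
  unfolding cutoff_def
  by (intro continuous_intros continuous_on_compose2[OF continuous_on_ramp[of UNIV]]) auto

lemma compact_torus: "compact {z :: complex ^ 'n. \<forall>i. norm (z $ i) = 1}"
proof (rule compact_eq_bounded_closed[THEN iffD2], rule conjI)
  show "bounded {z :: complex ^ 'n. \<forall>i. norm (z $ i) = 1}"
  proof (rule boundedI)
    fix z :: "complex ^ 'n" assume "z \<in> {z. \<forall>i. norm (z $ i) = 1}"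
    then show "norm z \<le> sqrt (real CARD('n))" by (simp add: norm_vec_def L2_set_def)
  qed
  have "{z :: complex ^ 'n. \<forall>i. norm (z $ i) = 1} = (\<Inter>i. {z. norm (z $ i) = 1})" by auto
  also have "closed \<dots>" by (intro closed_INT ballI closed_Collect_eq continuous_intros)
  finally show "closed {z :: complex ^ 'n. \<forall>i. norm (z $ i) = 1}" .
qed

text \<open>Stone--Weierstrass on the torus in \<open>\<complex>\<^sup>n\<close>; the cutoff makes the function continuous across the faces
  of the cube.\<close>

lemma trig_uniform_approx:
  fixes h :: "real ^ 'n \<Rightarrow> complex"
  assumes h: "continuous_on UNIV h" and l: "0 < l" and e: "0 < e"
  shows "\<exists>T. is_trig T \<and> (\<forall>t\<in>unit_cube. norm (of_real (cutoff l t) * h t - T t) < e)"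
proof -
  define Z where "Z = {z :: complex ^ 'n. \<forall>i. norm (z $ i) = 1}"
  \<comment> \<open>Inverse of the map from the half-open cube to the torus. On the torus it jumps
    only where some coordinate equals 1, and near such points the ramps make \<open>G\<close>
    vanish.\<close>
  define A where "A z = (\<chi> i. Arg2pi (z $ i) / (2 * pi))" for z :: "complex ^ 'n"
  define G where "G z = of_real (\<Prod>i\<in>UNIV. ramp (l * (1 - Re (z $ i)))) * h (A z)" for z :: "complex ^ 'n"
  have "continuous_on Z G"
  proof (rule continuous_at_imp_continuous_on, rule ballI)
    fix z assume z: "z \<in> Z"
    show "isCont G z"
    proof (cases "\<exists>i. z $ i = 1")
      case True
      then obtain i where i: "z $ i = 1" by blast
      have "open {w :: complex ^ 'n. l * (1 - Re (w $ i)) < 1}"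
        by (intro open_Collect_less continuous_intros)
      moreover have "z \<in> {w. l * (1 - Re (w $ i)) < 1}" using i by simp
      ultimately have "eventually (\<lambda>w. w \<in> {w. l * (1 - Re (w $ i)) < 1}) (nhds z)"
        by (rule eventually_nhds_in_open)
      moreover have G0: "G w = 0" if "w \<in> {w. l * (1 - Re (w $ i)) < 1}" for w
      proof -
        have "ramp (l * (1 - Re (w $ i))) = 0" using that by (simp add: ramp_def)
        then have "(\<Prod>i\<in>UNIV. ramp (l * (1 - Re (w $ i)))) = 0" by (intro prod_zero) auto
        then show ?thesis by (simp add: G_def)
      qed
      ultimately have "eventually (\<lambda>w. G w = 0) (nhds z)" by (auto elim: eventually_mono)
      then have "eventually (\<lambda>w. G w = G z) (nhds z)"
        using G0[OF \<open>z \<in> {w. l * (1 - Re (w $ i)) < 1}\<close>] by simp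
      then have "eventually (\<lambda>w. G w = G z) (at z)"
        unfolding eventually_at_filter by (rule eventually_mono) simp
      then show ?thesis unfolding isCont_def by (rule tendsto_eventually)
    next
      case False
      have "z $ i \<notin> \<real>\<^sub>\<ge>\<^sub>0" for i
      proof
        assume a: "z $ i \<in> \<real>\<^sub>\<ge>\<^sub>0"
        have "norm (z $ i) = 1" using z by (simp add: Z_def)
        with a have "z $ i = 1" by (auto simp: nonneg_Reals_def)
        then show False using False by blast
      qed
      then have arg: "isCont Arg2pi (z $ i)" for i by (intro continuous_at_Arg2pi)
      have "((\<lambda>w. Arg2pi (w $ i) / (2 * pi)) \<longlongrightarrow> Arg2pi (z $ i) / (2 * pi)) (at z)" for i
        by (intro tendsto_intros isCont_tendsto_compose[OF arg]) auto
      then have "(A \<longlongrightarrow> A z) (at z)" unfolding A_def by (intro vec_tendstoI) simp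
      then have 1: "((\<lambda>w. h (A w)) \<longlongrightarrow> h (A z)) (at z)"
        using h by (intro isCont_tendsto_compose[of _ h]) (auto simp: continuous_on_eq_continuous_at)
      have 2: "((\<lambda>w :: complex ^ 'n. ramp (l * (1 - Re (w $ i)))) \<longlongrightarrow> ramp (l * (1 - Re (z $ i)))) (at z)" for i
        using continuous_on_ramp[of UNIV]
        by (intro isCont_tendsto_compose[of _ ramp] tendsto_intros) (auto simp: continuous_on_eq_continuous_at)
      show ?thesis unfolding isCont_def G_def by (intro tendsto_intros 1 2)
    qed
  qed
  moreover have "compact Z" unfolding Z_def by (rule compact_torus)
  ultimately obtain p where p: "polynomial_function p" "\<And>z. z \<in> Z \<Longrightarrow> norm (G z - p z) < e"
    using Stone_Weierstrass_polynomial_function[of Z G e] e by blast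
  define T where "T t = p (\<chi> i. ee (t $ i))" for t :: "real ^ 'n"
  have "real_polynomial_function (\<lambda>z. Re (p z))" "real_polynomial_function (\<lambda>z. Im (p z))"
    using p(1) bounded_linear_Re bounded_linear_Im unfolding polynomial_function_def o_def by blast+
  then have "is_trig (\<lambda>t. of_real (Re (T t)) + \<i> * of_real (Im (T t)))"
    unfolding T_def by (intro is_trig_add is_trig_mult is_trig_const is_trig_real_polynomial)
  then have "is_trig T" by (simp add: complex_eq[symmetric])
  moreover have "norm (of_real (cutoff l t) * h t - T t) < e" if t: "t \<in> unit_cube" for t
  proof -
    have a: "Arg2pi (ee (t $ i)) = 2 * pi * t $ i" for i
      using t by (intro Arg2pi_unique[of 1]) (auto simp: unit_cube_def ee_def cis_conv_exp mult_ac)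
    have "G (\<chi> i. ee (t $ i)) = of_real (cutoff l t) * h t"
      by (simp add: G_def A_def a cutoff_def) (simp add: ee_def)
    moreover have "(\<chi> i. ee (t $ i)) \<in> Z" by (simp add: Z_def)
    ultimately show ?thesis using p(2) unfolding T_def by metis
  qed
  ultimately show ?thesis by blast
qed

lemma sum_eq_nn_integral_count_space:
  fixes f :: "'a \<Rightarrow> ennreal"
  assumes "finite A"
  shows "sum f A = (\<integral>\<^sup>+x. f x * indicator A x \<partial>count_space UNIV)"
  using assms
  by (subst nn_integral_count_space_indicator[symmetric]) (auto simp: nn_integral_count_space_finite)

text \<open>The enumeration \<open>from_nat\<close> exhausts the type by finite sets, so monotone
  convergence reduces the claim to finite sums.\<close>

lemma nn_integral_count_space_le:
  fixes f :: "'a::countable \<Rightarrow> ennreal"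
  assumes "\<And>A. finite A \<Longrightarrow> sum f A \<le> C"
  shows "(\<integral>\<^sup>+x. f x \<partial>count_space UNIV) \<le> C"
proof -
  define A :: "nat \<Rightarrow> 'a set" where "A n = from_nat ` {..n}" for n
  have sup: "(SUP n. f x * indicator (A n) x) = f x" for x
  proof (rule antisym)
    show "(SUP n. f x * indicator (A n) x) \<le> f x"
      by (intro SUP_least) (auto simp: indicator_def)
    have "x \<in> A (to_nat x)" unfolding A_def by (rule image_eqI[of _ _ "to_nat x"]) auto
    then have "f x = f x * indicator (A (to_nat x)) x" by simp
    also have "\<dots> \<le> (SUP n. f x * indicator (A n) x)" by (intro SUP_upper) auto
    finally show "f x \<le> (SUP n. f x * indicator (A n) x)" .
  qed
  have "incseq (\<lambda>n x. f x * indicator (A n) x)"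
  proof (intro incseq_SucI le_funI mult_left_mono)
    fix n x
    have "A n \<subseteq> A (Suc n)" unfolding A_def by (intro image_mono) auto
    then show "indicator (A n) x \<le> (indicator (A (Suc n)) x :: ennreal)"
      by (auto simp: indicator_def)
  qed auto
  then have "(\<integral>\<^sup>+x. (SUP n. f x * indicator (A n) x) \<partial>count_space UNIV) = (SUP n. \<integral>\<^sup>+x. f x * indicator (A n) x \<partial>count_space UNIV)"
    by (intro nn_integral_monotone_convergence_SUP) auto
  also have "\<dots> \<le> C"
    by (intro SUP_least) (simp add: A_def assms flip: sum_eq_nn_integral_count_space)
  finally show ?thesis by (simp add: sup)
qed

text \<open>The radial retraction onto the closed disc of radius \<open>B\<close>: it bounds
  continuous approximants without moving a limit that already lies in the disc.\<close>

definition clip :: "real \<Rightarrow> complex \<Rightarrow> complex" where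
  "clip B z = of_real (B / max B (norm z)) * z"

lemma norm_clip: "0 < B \<Longrightarrow> norm (clip B z) \<le> B"
proof -
  assume B: "0 < B"
  have "norm (clip B z) = B * (norm z / max B (norm z))"
    unfolding clip_def norm_mult norm_of_real abs_divide using B by simp
  also have "\<dots> \<le> B * 1" using B by (intro mult_left_mono) (auto simp: divide_simps max_def)
  finally show ?thesis by simp
qed

lemma clip_id: "0 < B \<Longrightarrow> norm z \<le> B \<Longrightarrow> clip B z = z"
  by (simp add: clip_def max_def)

lemma continuous_on_clip: "0 < B \<Longrightarrow> continuous_on S (clip B)"
  unfolding clip_def by (intro continuous_intros) auto

text \<open>Measurability supplies continuous functions converging almost everywhere. Clipped and
  cut off near the faces they are bounded and still converge almost everywhere on the cube, so
  dominated convergence gives an L2 approximation, which \<open>trig_uniform_approx\<close> replaces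
  by a trigonometric polynomial.\<close>

lemma trig_dense:
  fixes F :: "real ^ 'n \<Rightarrow> complex"
  assumes F: "bounded_borel F" and e: "0 < e"
  shows "\<exists>T. is_trig T \<and> integral\<^sup>L cubeM (\<lambda>t. (norm (F t - T t))\<^sup>2) < e"
proof -
  interpret finite_measure "cubeM :: (real ^ 'n) measure" by (rule finite_measure_cubeM)
  obtain B0 where B0: "\<And>x. norm (F x) \<le> B0" using F unfolding bounded_borel_def by blast
  define B where "B = \<bar>B0\<bar> + 1"
  have B: "0 < B" "norm (F x) \<le> B" for x using B0[of x] by (auto simp: B_def)
  have [measurable]: "F \<in> borel_measurable borel" using F by (rule bounded_borel_measurable)
  have "F measurable_on UNIV"
    by (intro lebesgue_measurable_imp_measurable_on measurable_completion) auto
  then obtain N g where Ng: "negligible N" "\<And>n. continuous_on UNIV (g n)" "\<And>x. x \<notin> N \<Longrightarrow> (\<lambda>n. g n x) \<longlonglongrightarrow> F x"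
    unfolding measurable_on_def by auto
  define h where "h n t = of_real (cutoff (real n + 1) t) * clip B (g n t)" for n :: nat and t :: "real ^ 'n"
  have cg: "continuous_on UNIV (\<lambda>t. clip B (g n t))" for n
    by (intro continuous_on_compose2[OF continuous_on_clip[OF B(1), of UNIV] Ng(2)]) auto
  have h_cont: "continuous_on UNIV (h n)" for n
    unfolding h_def by (intro continuous_intros cg continuous_on_of_real continuous_on_cutoff)
  have h_bound: "norm (h n t) \<le> B" for n t
  proof -
    have "norm (h n t) \<le> 1 * B"
      unfolding h_def norm_mult norm_of_real using B cutoff_bounds[of "real n + 1" t]
      by (intro mult_mono norm_clip) auto
    then show ?thesis by simp
  qed
  have [measurable]: "h n \<in> borel_measurable borel" for n
    by (intro borel_measurable_continuous_onI h_cont)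
  have h_bb: "bounded_borel (h n)" for n
    unfolding bounded_borel_def using h_bound by auto
  have "AE t in lborel. t \<notin> N"
  proof -
    have "AE t in lebesgue. t \<notin> N" using Ng(1) by (simp add: negligible_iff_null_sets AE_not_in)
    then show ?thesis by (simp add: AE_completion_iff)
  qed
  moreover have "AE t in lborel. \<forall>i\<in>UNIV. (t :: real ^ 'n) $ i \<noteq> 0"
  proof (rule AE_finite_allI[OF finite])
    fix i :: 'n
    have "AE t in lebesgue. t \<notin> {t :: real ^ 'n. t $ i = 0}"
      using negligible_standard_hyperplane_cart[of i] unfolding negligible_iff_null_sets by (rule AE_not_in)
    then show "AE t in lborel. (t :: real ^ 'n) $ i \<noteq> 0" by (simp add: AE_completion_iff)
  qed
  ultimately have "AE t in lborel. t \<in> unit_cube \<longrightarrow> (\<lambda>n. h n t) \<longlonglongrightarrow> F t"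
  proof eventually_elim
    case (elim t)
    show ?case
    proof
      assume t: "t \<in> unit_cube"
      have r: "(\<lambda>n. ramp ((real n + 1) * (1 - cos (2 * pi * t $ i)))) \<longlonglongrightarrow> 1" for i
      proof -
        have "0 < t $ i" "t $ i < 1" using t elim(2) by (auto simp: unit_cube_def order.strict_iff_order)
        then have "ee (t $ i) \<noteq> 1" by (auto simp: ee_eq_1_iff Ints_def)
        then have "cos (2 * pi * t $ i) \<noteq> 1" by (auto simp: ee_def complex_eq_iff cos_one_sin_zero)
        then have "0 < 1 - cos (2 * pi * t $ i)" by (simp add: order.strict_iff_order)
        then obtain m :: nat where m: "2 < real m * (1 - cos (2 * pi * t $ i))"
          using reals_Archimedean3 by blast
        have "ramp ((real n + 1) * (1 - cos (2 * pi * t $ i))) = 1" if "m \<le> n" for n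
        proof -
          have "real m * (1 - cos (2 * pi * t $ i)) \<le> (real n + 1) * (1 - cos (2 * pi * t $ i))"
            using that by (intro mult_right_mono) auto
          then have "2 \<le> (real n + 1) * (1 - cos (2 * pi * t $ i))" using m by linarith
          then show ?thesis unfolding ramp_def by simp
        qed
        then show ?thesis by (intro tendsto_eventually eventually_sequentiallyI[of m])
      qed
      have "(\<lambda>n. cutoff (real n + 1) t) \<longlonglongrightarrow> (\<Prod>i\<in>(UNIV :: 'n set). 1)"
        unfolding cutoff_def by (intro tendsto_prod r)
      then have 1: "(\<lambda>n. cutoff (real n + 1) t) \<longlonglongrightarrow> 1" by simp
      have "(\<lambda>n. clip B (g n t)) \<longlonglongrightarrow> clip B (F t)"
        using continuous_on_clip[OF B(1), of UNIV] Ng(3)[OF elim(1)]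
        by (intro isCont_tendsto_compose[of _ "clip B"]) (auto simp: continuous_on_eq_continuous_at)
      then have 2: "(\<lambda>n. clip B (g n t)) \<longlonglongrightarrow> F t" using B by (simp add: clip_id)
      have "(\<lambda>n. h n t) \<longlonglongrightarrow> of_real 1 * F t" unfolding h_def by (intro tendsto_intros 1 2)
      then show "(\<lambda>n. h n t) \<longlonglongrightarrow> F t" by simp
    qed
  qed
  then have lim: "AE t in cubeM. (\<lambda>n. h n t) \<longlonglongrightarrow> F t" by (rule AE_cubeM)
  have "(\<lambda>n. integral\<^sup>L cubeM (\<lambda>t. (norm (F t - h n t))\<^sup>2)) \<longlonglongrightarrow> integral\<^sup>L (cubeM :: (real ^ 'n) measure) (\<lambda>t. 0)"
  proof (rule integral_dominated_convergence[where w = "\<lambda>_. (2 * B)\<^sup>2"])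
    show "AE t in cubeM. (\<lambda>n. (norm (F t - h n t))\<^sup>2) \<longlonglongrightarrow> 0"
      using lim
    proof eventually_elim
      case (elim t)
      have "(\<lambda>n. (norm (F t - h n t))\<^sup>2) \<longlonglongrightarrow> (norm (F t - F t))\<^sup>2" by (intro tendsto_intros elim)
      then show ?case by simp
    qed
    show "AE t in cubeM. norm ((norm (F t - h n t))\<^sup>2) \<le> (2 * B)\<^sup>2" for n
    proof (intro AE_I2)
      fix t
      have "norm (F t - h n t) \<le> B + B" by (intro norm_triangle_le_diff add_mono B h_bound)
      then have "(norm (F t - h n t))\<^sup>2 \<le> (B + B)\<^sup>2" by (intro power_mono) auto
      then show "norm ((norm (F t - h n t))\<^sup>2) \<le> (2 * B)\<^sup>2" by simp
    qed
  qed auto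
  then have "eventually (\<lambda>n. integral\<^sup>L cubeM (\<lambda>t. (norm (F t - h n t))\<^sup>2) < e / 4) sequentially"
    using e by (intro order_tendstoD(2)[where y = 0]) auto
  then obtain n where n: "integral\<^sup>L cubeM (\<lambda>t. (norm (F t - h n t))\<^sup>2) < e / 4"
    using eventually_happens'[OF sequentially_bot] by blast
  \<comment> \<open>Squared errors at most double when two errors are added, so each of the two gets
    \<open>e / 4\<close>.\<close>
  define d where "d = sqrt (e / 4)"
  have d: "0 < d" "d\<^sup>2 = e / 4" using e by (auto simp: d_def)
  obtain T where T: "is_trig T" "\<And>t. t \<in> unit_cube \<Longrightarrow> norm (h n t - T t) < d"
    using trig_uniform_approx[OF cg[of n] _ d(1), of "real n + 1"] unfolding h_def by auto
  have bT: "bounded_borel T" using T(1) bounded_borel_trig unfolding is_trig_def by blast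
  have "integral\<^sup>L cubeM (\<lambda>t. (norm (F t - T t))\<^sup>2) \<le> integral\<^sup>L cubeM (\<lambda>t. 2 * (norm (F t - h n t))\<^sup>2 + 2 * d\<^sup>2)"
  proof (rule integral_mono_AE)
    show "integrable cubeM (\<lambda>t. (norm (F t - T t))\<^sup>2)"
      by (intro integrable_cubeM bounded_borel_norm_sq bounded_borel_diff F bT)
    show "integrable cubeM (\<lambda>t. 2 * (norm (F t - h n t))\<^sup>2 + 2 * d\<^sup>2)"
      by (intro Bochner_Integration.integrable_add integrable_mult_right integrable_const integrable_cubeM bounded_borel_norm_sq bounded_borel_diff F h_bb)
    show "AE t in cubeM. (norm (F t - T t))\<^sup>2 \<le> 2 * (norm (F t - h n t))\<^sup>2 + 2 * d\<^sup>2"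
    proof (rule AE_cubeM, intro AE_I2 impI)
      fix t :: "real ^ 'n" assume t: "t \<in> unit_cube"
      have "norm (F t - T t) \<le> norm (F t - h n t) + d"
        using T(2)[OF t] norm_triangle_ineq[of "F t - h n t" "h n t - T t"] by simp
      then have "(norm (F t - T t))\<^sup>2 \<le> (norm (F t - h n t) + d)\<^sup>2" by (intro power_mono) auto
      also have "\<dots> \<le> 2 * (norm (F t - h n t))\<^sup>2 + 2 * d\<^sup>2"
        using sum_squares_bound[of "norm (F t - h n t)" d] by (simp add: power2_sum)
      finally show "(norm (F t - T t))\<^sup>2 \<le> 2 * (norm (F t - h n t))\<^sup>2 + 2 * d\<^sup>2" .
    qed
  qed
  also have "\<dots> = 2 * integral\<^sup>L cubeM (\<lambda>t. (norm (F t - h n t))\<^sup>2) + 2 * d\<^sup>2"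
  proof -
    have "integrable cubeM (\<lambda>t. (norm (F t - h n t))\<^sup>2)"
      by (intro integrable_cubeM bounded_borel_norm_sq bounded_borel_diff F h_bb)
    then show ?thesis by (simp add: measure_def emeasure_space_cubeM)
  qed
  also have "\<dots> < e" using n d by simp
  finally show ?thesis using T(1) by blast
qed

text \<open>One inequality is Bessel's. For the other, an approximating trigonometric polynomial is
  no better than the Fourier partial sum with the same frequencies, so density makes the error of
  some partial sum small.\<close>

theorem parseval_cube:
  fixes F :: "real ^ 'n \<Rightarrow> complex"
  assumes F: "bounded_borel F"
  shows "(\<integral>\<^sup>+k. ennreal ((norm (fcoef F k))\<^sup>2) \<partial>count_space UNIV) = (\<integral>\<^sup>+t. ennreal ((norm (F t))\<^sup>2) \<partial>cubeM)"
    (is "?L = ?R")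
proof -
  define I where "I = integral\<^sup>L cubeM (\<lambda>t. (norm (F t))\<^sup>2)"
  have R: "?R = ennreal I" unfolding I_def by (rule nn_integral_norm_sq_cubeM[OF F])
  have "?L \<le> ?R"
  proof (rule nn_integral_count_space_le)
    fix M :: "(int ^ 'n) set" assume M: "finite M"
    have "0 \<le> integral\<^sup>L cubeM (\<lambda>t. (norm (F t - trig M (fcoef F) t))\<^sup>2)" by (intro integral_nonneg_AE) auto
    also have "\<dots> = I - (\<Sum>k\<in>M. (norm (fcoef F k))\<^sup>2)"
      unfolding trig_error[OF F M] I_def by (simp add: sum_negf)
    finally show "(\<Sum>k\<in>M. ennreal ((norm (fcoef F k))\<^sup>2)) \<le> ?R"
      unfolding R by (simp add: ennreal_leI)
  qed
  moreover have "?R \<le> ?L"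
  proof (rule ennreal_le_epsilon)
    fix e :: real assume e: "0 < e"
    obtain T where "is_trig T" and T: "integral\<^sup>L cubeM (\<lambda>t. (norm (F t - T t))\<^sup>2) < e"
      using trig_dense[OF F e] by blast
    then obtain M c where M: "finite M" "T = trig M c" unfolding is_trig_def by blast
    have "I - (\<Sum>k\<in>M. (norm (fcoef F k))\<^sup>2) \<le> I + (\<Sum>k\<in>M. (norm (c k - fcoef F k))\<^sup>2 - (norm (fcoef F k))\<^sup>2)"
      by (simp add: sum_subtractf sum_nonneg)
    also have "\<dots> < e" using T unfolding M(2) trig_error[OF F M(1)] I_def .
    finally have "?R \<le> ennreal ((\<Sum>k\<in>M. (norm (fcoef F k))\<^sup>2) + e)"
      unfolding R by (intro ennreal_leI) simp
    also have "\<dots> = (\<Sum>k\<in>M. ennreal ((norm (fcoef F k))\<^sup>2)) + ennreal e"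
      using e by (subst ennreal_plus) (auto simp: sum_nonneg)
    also have "(\<Sum>k\<in>M. ennreal ((norm (fcoef F k))\<^sup>2)) \<le> ?L"
      unfolding sum_eq_nn_integral_count_space[OF M(1)]
      by (intro nn_integral_mono) (auto simp: indicator_def)
    finally show "?R \<le> ?L + ennreal e" by simp
  qed
  ultimately show ?thesis by (rule antisym)
qed

lemma parseval_cube_tail:
  fixes F :: "real ^ 'n \<Rightarrow> complex"
  assumes F: "bounded_borel F" and M: "finite M"
  shows "(\<integral>\<^sup>+t. ennreal ((norm (F t - trig M (fcoef F) t))\<^sup>2) \<partial>cubeM)
    = (\<integral>\<^sup>+k. ennreal ((norm (fcoef F k))\<^sup>2) * indicator (- M) k \<partial>count_space UNIV)"
proof -
  have "(\<integral>\<^sup>+t. ennreal ((norm (F t - trig M (fcoef F) t))\<^sup>2) \<partial>cubeM)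
    = (\<integral>\<^sup>+k. ennreal ((norm (fcoef (\<lambda>t. F t - trig M (fcoef F) t) k))\<^sup>2) \<partial>count_space UNIV)"
    by (intro parseval_cube[symmetric] bounded_borel_diff F bounded_borel_trig)
  also have "\<dots> = (\<integral>\<^sup>+k. ennreal ((norm (fcoef F k))\<^sup>2) * indicator (- M) k \<partial>count_space UNIV)"
    by (intro nn_integral_cong) (simp add: fcoef_diff[OF F bounded_borel_trig] fcoef_trig[OF M] indicator_def)
  finally show ?thesis .
qed

lemma turan_base_ge_1: "1 \<le> turan_base" by (simp add: turan_base_def)

text \<open>\<open>F\<close> vanishes on at least half of the cube and the Turan bound fails on at
  most a quarter. On the remaining set, of measure at least 1/4, the coefficient is bounded by the
  remainder \<open>F - P\<close>, whose energy Parseval evaluates. The constant 4 is the inverse of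
  1/4.\<close>

lemma fcoef_bound_of_small_support:
  fixes F :: "real ^ 'n \<Rightarrow> complex"
  assumes F: "bounded_borel F" and supp: "emeasure lborel {t\<in>unit_cube. F t \<noteq> 0} \<le> ennreal (1/2)"
    and M: "finite M" "k0 \<in> M"
  shows "ennreal ((norm (fcoef F k0))\<^sup>2) \<le> ennreal (4 * turan_base ^ (2 * card M)) *
    (\<integral>\<^sup>+k. ennreal ((norm (fcoef F k))\<^sup>2) * indicator (- M) k \<partial>count_space UNIV)"
proof -
  define P where "P = trig M (fcoef F)"
  define b where "b = turan_base ^ card M"
  define c where "c = norm (fcoef F k0)"
  have b: "0 \<le> b" "1 \<le> b" using turan_base_ge_1 by (auto simp: b_def one_le_power)
  have [measurable]: "F \<in> borel_measurable borel" "P \<in> borel_measurable borel"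
    using F bounded_borel_trig[of M "fcoef F"] by (auto simp: bounded_borel_def P_def)
  define A where "A = {t\<in>unit_cube. c \<le> b * norm (P t) \<and> F t = 0}"
  have meas: "{t. c \<le> b * norm (P t)} \<in> sets borel" "{t. F t = 0} \<in> sets borel" "{t. F t \<noteq> 0} \<in> sets borel"
    "{t. b * norm (P t) < c} \<in> sets borel"
    by measurable
  have A_meas [measurable]: "A \<in> sets borel"
  proof -
    have "A = unit_cube \<inter> ({t. c \<le> b * norm (P t)} \<inter> {t. F t = 0})" by (auto simp: A_def)
    then show ?thesis using meas by auto
  qed
  have bad: "emeasure lborel {t\<in>unit_cube. b * norm (P t) < c} \<le> ennreal (1/4)"
    unfolding P_def b_def c_def trig_def by (rule turan_cube[OF M])
  have m1: "{t\<in>unit_cube. F t \<noteq> 0} \<in> sets borel" "{t\<in>unit_cube. b * norm (P t) < c} \<in> sets borel"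
    by measurable
  have "1 = emeasure lborel (unit_cube :: (real ^ 'n) set)" by simp
  also have "\<dots> \<le> emeasure lborel (A \<union> ({t\<in>unit_cube. b * norm (P t) < c} \<union> {t\<in>unit_cube. F t \<noteq> 0}))"
    using m1 by (intro emeasure_mono) (auto simp: A_def)
  also have "\<dots> \<le> emeasure lborel A + (emeasure lborel {t\<in>unit_cube. b * norm (P t) < c} + emeasure lborel {t\<in>unit_cube. F t \<noteq> 0})"
    using m1 by (intro order_trans[OF emeasure_subadditive] add_mono emeasure_subadditive order_refl) auto
  also have "\<dots> \<le> emeasure lborel A + (ennreal (1/4) + ennreal (1/2))"
    by (intro add_mono bad supp order_refl)
  also have "ennreal (1/4) + ennreal (1/2) = ennreal (3/4)"
    by (subst ennreal_plus[symmetric]) auto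
  finally have "1 \<le> emeasure lborel A + ennreal (3/4)" .
  moreover have "1 = ennreal (1/4) + ennreal (3/4)"
    by (subst ennreal_plus[symmetric]) auto
  ultimately have "ennreal (1/4) + ennreal (3/4) \<le> emeasure lborel A + ennreal (3/4)" by simp
  then have A14: "ennreal (1/4) \<le> emeasure lborel A" by (simp add: ennreal_add_left_cancel_le add.commute)
  define W where "W = (\<integral>\<^sup>+k. ennreal ((norm (fcoef F k))\<^sup>2) * indicator (- M) k \<partial>count_space UNIV)"
  have "ennreal (c\<^sup>2) * emeasure lborel A = (\<integral>\<^sup>+t. ennreal (c\<^sup>2) * indicator A t \<partial>lborel)"
    by (subst nn_integral_cmult_indicator) (use A_meas in auto)
  also have "\<dots> \<le> (\<integral>\<^sup>+t. ennreal (b\<^sup>2) * ennreal ((norm (F t - P t))\<^sup>2) * indicator unit_cube t \<partial>lborel)"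
  proof (rule nn_integral_mono)
    fix t
    show "ennreal (c\<^sup>2) * indicator A t \<le> ennreal (b\<^sup>2) * ennreal ((norm (F t - P t))\<^sup>2) * indicator unit_cube t"
    proof (cases "t \<in> A")
      case True
      then have "c \<le> b * norm (P t)" "F t = 0" "t \<in> unit_cube" by (auto simp: A_def)
      then have "c\<^sup>2 \<le> b\<^sup>2 * (norm (F t - P t))\<^sup>2"
        by (simp add: power_mult_distrib[symmetric] power_mono c_def)
      then show ?thesis using True \<open>t \<in> unit_cube\<close> by (simp add: ennreal_mult[symmetric] ennreal_leI)
    qed auto
  qed
  also have "\<dots> = (\<integral>\<^sup>+t. ennreal (b\<^sup>2) * (ennreal ((norm (F t - P t))\<^sup>2) * indicator unit_cube t) \<partial>lborel)"
    by (simp add: mult.assoc)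
  also have "\<dots> = ennreal (b\<^sup>2) * (\<integral>\<^sup>+t. ennreal ((norm (F t - P t))\<^sup>2) \<partial>cubeM)"
    unfolding nn_integral_cubeM by (intro nn_integral_cmult) auto
  also have "(\<integral>\<^sup>+t. ennreal ((norm (F t - P t))\<^sup>2) \<partial>cubeM)
     = W"
    unfolding P_def W_def by (rule parseval_cube_tail[OF F M(1)])
  finally have main: "ennreal (c\<^sup>2) * emeasure lborel A \<le> ennreal (b\<^sup>2) * W" .
  have "ennreal (c\<^sup>2) = ennreal 4 * (ennreal (c\<^sup>2) * ennreal (1/4))"
  proof -
    have "ennreal (c\<^sup>2) * ennreal (1/4) = ennreal (c\<^sup>2 / 4)" by (simp flip: ennreal_mult)
    then show ?thesis using ennreal_mult[of 4 "c\<^sup>2 / 4"] by simp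
  qed
  also have "\<dots> \<le> ennreal 4 * (ennreal (c\<^sup>2) * emeasure lborel A)"
    by (intro mult_left_mono A14) auto
  also have "\<dots> \<le> ennreal 4 * (ennreal (b\<^sup>2) * W)"
    by (intro mult_left_mono main) auto
  also have "ennreal 4 * (ennreal (b\<^sup>2) * W) = ennreal (4 * turan_base ^ (2 * card M)) * W"
    using b turan_base_ge_1 by (simp add: b_def ennreal_mult power_mult[symmetric] mult_ac)
  finally show ?thesis unfolding c_def W_def .
qed

section \<open>Linear changes of variables and periodization\<close>

lemma borel_measurable_cnj [measurable (raw)]:
  "f \<in> borel_measurable M \<Longrightarrow> (\<lambda>x. cnj (f x)) \<in> borel_measurable M"
  by (rule measurable_compose[of f M borel cnj borel])
     (auto intro!: borel_measurable_continuous_onI continuous_intros)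

text \<open>With all coordinates but \<open>m\<close> fixed, the shear is a translation in
  coordinate \<open>m\<close>; Tonelli over the product measure does the rest.\<close>

lemma nn_integral_shear:
  fixes f :: "real ^ 'n \<Rightarrow> ennreal"
  assumes [measurable]: "f \<in> borel_measurable borel" and mn: "m \<noteq> (n :: 'n)"
  shows "(\<integral>\<^sup>+x. f (\<chi> i. if i = m then x $ m + x $ n else x $ i) \<partial>lborel) = (\<integral>\<^sup>+x. f x \<partial>lborel)"
proof -
  interpret product_sigma_finite "\<lambda>b :: real ^ 'n. lborel :: real measure"
    by unfold_locales
  define em where "em = (axis m 1 :: real ^ 'n)"
  define en where "en = (axis n 1 :: real ^ 'n)"
  have B: "em \<in> Basis" "en \<in> Basis" "em \<noteq> en"
    using mn by (auto simp: em_def en_def axis_eq_axis intro: axis_in_Basis_iff[THEN iffD2])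
  define I where "I = (Basis :: (real ^ 'n) set) - {em}"
  have I: "finite I" "em \<notin> I" "insert em I = Basis" "en \<in> I" using B by (auto simp: I_def)
  define T where "T x = (\<chi> i. if i = m then x $ m + x $ n else x $ i)" for x :: "real ^ 'n"
  have xn: "x \<bullet> en = x $ n" for x by (simp add: en_def inner_axis)
  have T: "T x = x + (x \<bullet> en) *\<^sub>R em" for x
    by (auto simp: T_def vec_eq_iff em_def xn axis_def)
  have [measurable]: "T \<in> borel \<rightarrow>\<^sub>M borel" unfolding T[abs_def] by measurable
  define S where "S g = (\<Sum>b\<in>Basis. g b *\<^sub>R b)" for g :: "real ^ 'n \<Rightarrow> real"
  have S_meas: "S \<in> measurable (PiM (insert em I) (\<lambda>b. lborel)) borel"
    unfolding I S_def by measurable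
  have S_upd: "S (x(em := y)) = (\<Sum>b\<in>I. x b *\<^sub>R b) + y *\<^sub>R em" for x y
  proof -
    have "S (x(em := y)) = (\<Sum>b\<in>insert em I. (x(em := y)) b *\<^sub>R b)" unfolding I S_def ..
    also have "\<dots> = y *\<^sub>R em + (\<Sum>b\<in>I. (x(em := y)) b *\<^sub>R b)"
      using I(1,2) by (subst sum.insert) auto
    also have "(\<Sum>b\<in>I. (x(em := y)) b *\<^sub>R b) = (\<Sum>b\<in>I. x b *\<^sub>R b)" using I by (intro sum.cong) auto
    finally show ?thesis by (simp only: add.commute)
  qed
  have TS: "T (S (x(em := y))) = S (x(em := y + x en))" for x y
  proof -
    have "S g \<bullet> en = g en" for g
      unfolding S_def using B by (simp add: inner_sum_left inner_Basis if_distrib cong: if_cong)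
    then have "S (x(em := y)) \<bullet> en = x en" using B by simp
    then show ?thesis unfolding T S_upd by (simp add: algebra_simps)
  qed
  have main: "(\<integral>\<^sup>+x. g x \<partial>lborel) = (\<integral>\<^sup>+x. (\<integral>\<^sup>+y. g (S (x(em := y))) \<partial>lborel) \<partial>PiM I (\<lambda>b. lborel))"
    if [measurable]: "g \<in> borel_measurable borel" for g :: "real ^ 'n \<Rightarrow> ennreal"
  proof -
    have "(\<integral>\<^sup>+x. g x \<partial>lborel) = (\<integral>\<^sup>+x. g (S x) \<partial>PiM (insert em I) (\<lambda>b. lborel))"
    proof -
      have "(\<lambda>f. \<Sum>b\<in>Basis. f b *\<^sub>R b) = S" by (simp add: S_def fun_eq_iff)
      then have eq: "(lborel :: (real ^ 'n) measure) = distr (PiM (insert em I) (\<lambda>b. lborel)) borel S"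
        using lborel_eq[where 'a = "real ^ 'n"] I(3) by simp
      have "(\<integral>\<^sup>+x. g x \<partial>lborel) = (\<integral>\<^sup>+x. g x \<partial>distr (PiM (insert em I) (\<lambda>b. lborel)) borel S)"
        by (simp only: eq[symmetric])
      also have "\<dots> = (\<integral>\<^sup>+x. g (S x) \<partial>PiM (insert em I) (\<lambda>b. lborel))"
        by (rule nn_integral_distr[OF S_meas]) simp
      finally show ?thesis .
    qed
    also have "\<dots> = (\<integral>\<^sup>+x. (\<integral>\<^sup>+y. g (S (x(em := y))) \<partial>lborel) \<partial>PiM I (\<lambda>b. lborel))"
      using measurable_compose[OF S_meas that] by (intro product_nn_integral_insert I) 
    finally show ?thesis .
  qed
  have "(\<integral>\<^sup>+x. f (T x) \<partial>lborel) = (\<integral>\<^sup>+x. (\<integral>\<^sup>+y. f (S (x(em := y + x en))) \<partial>lborel) \<partial>PiM I (\<lambda>b. lborel))"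
    by (subst main) (auto simp: TS)
  also have "\<dots> = (\<integral>\<^sup>+x. (\<integral>\<^sup>+y. f (S (x(em := y))) \<partial>lborel) \<partial>PiM I (\<lambda>b. lborel))"
  proof (rule nn_integral_cong)
    fix x
    have "(\<lambda>y. f (S (x(em := y)))) \<in> borel_measurable borel" unfolding S_upd by measurable
    then show "(\<integral>\<^sup>+y. f (S (x(em := y + x en))) \<partial>lborel) = (\<integral>\<^sup>+y. f (S (x(em := y))) \<partial>lborel)"
      by (rule nn_integral_translate)
  qed
  also have "\<dots> = (\<integral>\<^sup>+x. f x \<partial>lborel)" by (rule main[symmetric]) simp
  finally show ?thesis by (simp add: T_def)
qed

lemma Basis_vec_range: "Basis = range (\<lambda>i :: 'n::finite. axis i (1::real))"
  by (auto simp: Basis_vec_def)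

lemma inj_axis: "inj (\<lambda>i :: 'n::finite. axis i (1::real))"
  by (auto simp: inj_on_def axis_eq_axis)

lemma prod_Basis_vec:
  fixes g :: "real ^ 'n \<Rightarrow> 'b::comm_monoid_mult"
  shows "(\<Prod>b\<in>Basis. g b) = (\<Prod>i\<in>UNIV. g (axis i 1))"
  unfolding Basis_vec_range prod.reindex[OF inj_axis] by simp

lemma sum_Basis_vec:
  fixes g :: "real ^ 'n \<Rightarrow> 'b::comm_monoid_add"
  shows "(\<Sum>b\<in>Basis. g b) = (\<Sum>i\<in>UNIV. g (axis i 1))"
  unfolding Basis_vec_range sum.reindex[OF inj_axis] by simp

lemma nn_integral_transpose:
  fixes f :: "real ^ 'n \<Rightarrow> ennreal"
  assumes [measurable]: "f \<in> borel_measurable borel"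
  shows "(\<integral>\<^sup>+x. f (\<chi> i. x $ Transposition.transpose m n i) \<partial>lborel) = (\<integral>\<^sup>+x. f x \<partial>lborel)"
proof -
  define T where "T x = (\<chi> i. x $ Transposition.transpose m n i)" for x :: "real ^ 'n"
  have [measurable]: "T \<in> borel \<rightarrow>\<^sub>M borel"
    unfolding T_def by (intro borel_measurable_continuous_onI continuous_intros)
  have bij: "bij (Transposition.transpose m n)" by (rule bij_transpose)
  have "lborel = distr lborel borel T"
  proof (rule lborel_eqI)
    fix l u :: "real ^ 'n" assume le': "\<And>b. b \<in> Basis \<Longrightarrow> l \<bullet> b \<le> u \<bullet> b"
    have le: "l $ i \<le> u $ i" for i
      using le'[of "axis i 1"] by (simp add: inner_axis axis_in_Basis_iff)
    have "T -` box l u = box (T l) (T u)"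
      by (auto simp: T_def mem_box_cart) (metis transpose_involutory)+
    moreover have "emeasure lborel (box (T l) (T u)) = ennreal (\<Prod>b\<in>Basis. (T u - T l) \<bullet> b)"
      using le by (subst emeasure_lborel_box) (auto simp: Basis_vec_def inner_axis T_def inner_diff_left)
    moreover have "(\<Prod>b\<in>Basis. (T u - T l) \<bullet> b) = (\<Prod>b\<in>Basis. (u - l) \<bullet> b)"
      unfolding prod_Basis_vec using prod.reindex_bij_betw[OF bij, of "\<lambda>i. u $ i - l $ i"]
      by (simp add: inner_axis T_def)
    ultimately show "emeasure (distr lborel borel T) (box l u) = (\<Prod>b\<in>Basis. (u - l) \<bullet> b)"
      by (simp add: emeasure_distr)
  qed simp
  then have "(\<integral>\<^sup>+x. f x \<partial>lborel) = (\<integral>\<^sup>+x. f x \<partial>distr lborel borel T)" by simp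
  also have "\<dots> = (\<integral>\<^sup>+x. f (T x) \<partial>lborel)" by (rule nn_integral_distr) auto
  finally show ?thesis by (simp add: T_def)
qed

lemma nn_integral_diagonal:
  fixes f :: "real ^ 'n \<Rightarrow> ennreal"
  assumes [measurable]: "f \<in> borel_measurable borel" and c: "\<And>i. c i \<noteq> 0"
  shows "(\<integral>\<^sup>+x. f x \<partial>lborel) = ennreal \<bar>\<Prod>i\<in>UNIV. c i\<bar> * (\<integral>\<^sup>+x. f (\<chi> i. c i * x $ i) \<partial>lborel)"
proof -
  define c' where "c' b = c (THE i. b = axis i 1)" for b :: "real ^ 'n"
  have c': "c' (axis i 1) = c i" for i by (auto simp: c'_def axis_eq_axis)
  have eq: "0 + (\<Sum>j\<in>Basis. (c' j * (x \<bullet> j)) *\<^sub>R j) = (\<chi> i. c i * x $ i)" for x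
  proof -
    have "(\<Sum>j\<in>Basis. (c' j * (x \<bullet> j)) *\<^sub>R j) = (\<Sum>i\<in>UNIV. (c i * x $ i) *\<^sub>R axis i 1)"
      by (simp add: sum_Basis_vec c' inner_axis)
    also have "\<dots> = (\<chi> i. c i * x $ i)"
      by (simp add: vec_eq_iff axis_def if_distrib cong: if_cong)
    finally show ?thesis by simp
  qed
  have nz: "c' j \<noteq> 0" if "j \<in> Basis" for j using c by (simp add: c'_def)
  have "lborel = density (distr lborel borel (\<lambda>x. \<chi> i. c i * x $ i)) (\<lambda>_. ennreal \<bar>\<Prod>i\<in>UNIV. c i\<bar>)"
    using lborel_affine_euclidean[of c' 0] nz unfolding eq by (simp add: prod_Basis_vec c' abs_prod)
  moreover have [measurable]: "(\<lambda>x. \<chi> i. c i * x $ i) \<in> borel \<rightarrow>\<^sub>M borel"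
    by (intro borel_measurable_continuous_onI continuous_intros)
  ultimately have "(\<integral>\<^sup>+x. f x \<partial>lborel) = (\<integral>\<^sup>+x. f x \<partial>density (distr lborel borel (\<lambda>x. \<chi> i. c i * x $ i)) (\<lambda>_. ennreal \<bar>\<Prod>i\<in>UNIV. c i\<bar>))"
    by simp
  also have "\<dots> = ennreal \<bar>\<Prod>i\<in>UNIV. c i\<bar> * (\<integral>\<^sup>+x. f (\<chi> i. c i * x $ i) \<partial>lborel)"
    by (simp add: nn_integral_density nn_integral_distr nn_integral_cmult)
  finally show ?thesis .
qed

text \<open>Induction over elementary linear maps. The premise on the determinant is part of the
  induction predicate: it passes from a composition to its factors, and it makes the maps with a
  vanishing coordinate vacuous.\<close>

lemma nn_integral_linear_map:
  fixes g :: "real ^ 'n \<Rightarrow> real ^ 'n"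
  assumes "linear g"
  shows "det (matrix g) \<noteq> 0 \<longrightarrow> (\<forall>f \<in> borel_measurable borel. (\<integral>\<^sup>+x. f x \<partial>lborel) = ennreal \<bar>det (matrix g)\<bar> * (\<integral>\<^sup>+x. f (g x) \<partial>lborel))"
proof -
  define P :: "(real ^ 'n \<Rightarrow> real ^ 'n) \<Rightarrow> bool" where "P g \<longleftrightarrow> (det (matrix g) \<noteq> 0 \<longrightarrow>
    (\<forall>f \<in> borel_measurable borel. (\<integral>\<^sup>+x. f x \<partial>lborel) = ennreal \<bar>det (matrix g)\<bar> * (\<integral>\<^sup>+x. f (g x) \<partial>lborel)))" for g
  have "P g"
  proof (rule induct_linear_elementary[of g P, OF assms])
  fix f g assume 1: "linear f" "linear g" "P f" "P g"
  show "P (f \<circ> g)" unfolding P_def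
  proof (intro impI ballI)
    fix h :: "real ^ 'n \<Rightarrow> ennreal"
    assume d: "det (matrix (f \<circ> g)) \<noteq> 0" and [measurable]: "h \<in> borel_measurable borel"
    have dd: "det (matrix (f \<circ> g)) = det (matrix f) * det (matrix g)"
      using 1 by (simp add: matrix_compose det_mul)
    have nz: "det (matrix f) \<noteq> 0" "det (matrix g) \<noteq> 0" using d unfolding dd by auto
    have "bounded_linear f" "bounded_linear g"
      using 1(1,2) by (auto intro: linear_conv_bounded_linear[THEN iffD1])
    then have c: "continuous_on UNIV f" "continuous_on UNIV g"
      by (auto intro: linear_continuous_on)
    have [measurable]: "f \<in> borel \<rightarrow>\<^sub>M borel"
      by (rule borel_measurable_continuous_onI[OF c(1)])
    have [measurable]: "g \<in> borel \<rightarrow>\<^sub>M borel"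
      by (rule borel_measurable_continuous_onI[OF c(2)])
    have "(\<integral>\<^sup>+x. h x \<partial>lborel) = ennreal \<bar>det (matrix f)\<bar> * (\<integral>\<^sup>+x. h (f x) \<partial>lborel)"
      by (rule 1(3)[unfolded P_def, rule_format, OF nz(1)]) measurable
    also have "(\<integral>\<^sup>+x. h (f x) \<partial>lborel) = ennreal \<bar>det (matrix g)\<bar> * (\<integral>\<^sup>+x. h (f (g x)) \<partial>lborel)"
      by (rule 1(4)[unfolded P_def, rule_format, OF nz(2)]) measurable
    finally show "(\<integral>\<^sup>+x. h x \<partial>lborel) = ennreal \<bar>det (matrix (f \<circ> g))\<bar> * (\<integral>\<^sup>+x. h ((f \<circ> g) x) \<partial>lborel)"
      by (simp add: dd abs_mult ennreal_mult mult.assoc)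
  qed
next
  fix f :: "real ^ 'n \<Rightarrow> real ^ 'n" and i assume 2: "linear f" "\<And>x. f x $ i = 0"
  have "row i (matrix f) = 0" using 2 by (simp add: row_def matrix_def vec_eq_iff)
  then show "P f" by (simp add: P_def det_zero_row)
next
  fix c :: "'n \<Rightarrow> real"
  have "matrix (\<lambda>x. \<chi> i. c i * x $ i) = (\<chi> i j. if i = j then c i else 0)"
    by (auto simp: matrix_def vec_eq_iff axis_def)
  then have d: "det (matrix (\<lambda>x. \<chi> i. c i * x $ i)) = (\<Prod>i\<in>UNIV. c i)"
    by (simp add: det_diagonal)
  show "P (\<lambda>x. \<chi> i. c i * x $ i)" unfolding P_def
  proof (intro impI ballI)
    fix f :: "real ^ 'n \<Rightarrow> ennreal"
    assume "det (matrix (\<lambda>x. \<chi> i. c i * x $ i)) \<noteq> 0" and f: "f \<in> borel_measurable borel"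
    then have "c i \<noteq> 0" for i using d by auto
    then show "(\<integral>\<^sup>+x. f x \<partial>lborel) = ennreal \<bar>det (matrix (\<lambda>x. \<chi> i. c i * x $ i))\<bar> * (\<integral>\<^sup>+x. f (\<chi> i. c i * x $ i) \<partial>lborel)"
      unfolding d by (rule nn_integral_diagonal[OF f])
  qed
next
  fix m n :: 'n
  define T where "T x = (\<chi> i. x $ Transposition.transpose m n i)" for x :: "real ^ 'n"
  have lin: "linear T" by (auto simp: linear_iff T_def vec_eq_iff)
  have "T \<circ> T = id" by (auto simp: T_def fun_eq_iff vec_eq_iff)
  then have "matrix T ** matrix T = mat 1"
    using matrix_compose[OF lin lin] by (simp add: matrix_id_mat_1)
  then have "det (matrix T) * det (matrix T) = 1"
    using det_mul[of "matrix T" "matrix T"] by simp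
  then have "\<bar>det (matrix T)\<bar> = 1" using square_eq_1_iff[of "det (matrix T)"] by auto
  then have "P T" using nn_integral_transpose[of _ m n] by (simp add: P_def T_def)
  then show "P (\<lambda>x. \<chi> i. x $ Transposition.transpose m n i)" by (simp add: T_def[abs_def])
next
  fix m n :: 'n assume 5: "m \<noteq> n"
  have "matrix (\<lambda>x. \<chi> i. if i = m then x $ m + x $ n else x $ i) = (\<chi> i. if i = m then row m (mat 1) + 1 *s row n (mat 1) else row i (mat 1 :: real ^ 'n ^ 'n))"
    by (auto simp: matrix_def vec_eq_iff axis_def row_def mat_def)
  then have "det (matrix (\<lambda>x :: real ^ 'n. \<chi> i. if i = m then x $ m + x $ n else x $ i)) = 1"
    using det_row_operation[OF 5, of "mat 1 :: real ^ 'n ^ 'n" 1] by simp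
  then show "P (\<lambda>x. \<chi> i. if i = m then x $ m + x $ n else x $ i)"
    using nn_integral_shear[OF _ 5] by (simp add: P_def)
  qed
  then show ?thesis unfolding P_def .
qed

text \<open>As an identity of measures it serves nonnegative integrals, Bochner integrals and
  integrability alike.\<close>

lemma lborel_linear:
  fixes A :: "real ^ 'n ^ 'n"
  assumes A: "det A \<noteq> 0"
  shows "lborel = density (distr lborel borel ((*v) A)) (\<lambda>_. ennreal \<bar>det A\<bar>)"
proof (rule measure_eqI)
  have [measurable]: "(*v) A \<in> borel \<rightarrow>\<^sub>M borel"
    by (intro borel_measurable_continuous_onI continuous_intros)
  have m: "matrix ((*v) A) = A" by simp
  have *: "\<forall>f\<in>borel_measurable borel. (\<integral>\<^sup>+x. f x \<partial>lborel) = ennreal \<bar>det A\<bar> * (\<integral>\<^sup>+x. f (A *v x) \<partial>lborel)"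
    using nn_integral_linear_map[OF matrix_vector_mul_linear[of A], unfolded m] A by blast
  fix X :: "(real ^ 'n) set" assume "X \<in> sets lborel"
  then have [measurable]: "X \<in> sets borel" by simp
  have "emeasure lborel X = (\<integral>\<^sup>+x. indicator X x \<partial>lborel)" by simp
  also have "\<dots> = ennreal \<bar>det A\<bar> * (\<integral>\<^sup>+x. indicator X (A *v x) \<partial>lborel)"
    by (rule *[rule_format]) measurable
  also have "\<dots> = emeasure (density (distr lborel borel ((*v) A)) (\<lambda>_. ennreal \<bar>det A\<bar>)) X"
  proof -
    have "(\<integral>\<^sup>+x. indicator X (A *v x) \<partial>lborel) = (\<integral>\<^sup>+x. indicator X x \<partial>distr lborel borel ((*v) A))"
      by (rule nn_integral_distr[symmetric]) auto
    then show ?thesis by (simp add: emeasure_density nn_integral_cmult)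
  qed
  finally show "emeasure lborel X = emeasure (density (distr lborel borel ((*v) A)) (\<lambda>_. ennreal \<bar>det A\<bar>)) X" .
qed simp

lemma borel_measurable_matrix_vector [measurable]: "(*v) (A :: real ^ 'n ^ 'm) \<in> borel \<rightarrow>\<^sub>M borel"
  by (intro borel_measurable_continuous_onI continuous_intros)

lemma nn_integral_linear:
  fixes A :: "real ^ 'n ^ 'n"
  assumes A: "det A \<noteq> 0" and [measurable]: "f \<in> borel_measurable borel"
  shows "(\<integral>\<^sup>+x. f x \<partial>lborel) = ennreal \<bar>det A\<bar> * (\<integral>\<^sup>+x. f (A *v x) \<partial>lborel)"
  by (subst lborel_linear[OF A]) (simp add: nn_integral_density nn_integral_distr nn_integral_cmult)

lemma integral_linear:
  fixes A :: "real ^ 'n ^ 'n" and f :: "real ^ 'n \<Rightarrow> complex"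
  assumes A: "det A \<noteq> 0" and [measurable]: "f \<in> borel_measurable borel"
  shows "integral\<^sup>L lborel f = of_real \<bar>det A\<bar> * (LINT x|lborel. f (A *v x))"
  by (subst lborel_linear[OF A]) (simp add: integral_density integral_distr scaleR_conv_of_real)

lemma integrable_linear:
  fixes A :: "real ^ 'n ^ 'n" and f :: "real ^ 'n \<Rightarrow> complex"
  assumes A: "det A \<noteq> 0" and [measurable]: "f \<in> borel_measurable borel" and f: "integrable lborel f"
  shows "integrable lborel (\<lambda>x. f (A *v x))"
proof -
  have "integrable (density (distr lborel borel ((*v) A)) (\<lambda>_. ennreal \<bar>det A\<bar>)) f"
    using f lborel_linear[OF A] by simp
  then have a: "integrable lborel (\<lambda>x. \<bar>det A\<bar> *\<^sub>R f (A *v x))"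
    by (simp add: integrable_density integrable_distr_eq)
  have "integrable lborel (\<lambda>x. inverse \<bar>det A\<bar> *\<^sub>R \<bar>det A\<bar> *\<^sub>R f (A *v x))"
    by (rule integrable_scaleR_right) (rule a)
  moreover have "(\<lambda>x. inverse \<bar>det A\<bar> *\<^sub>R \<bar>det A\<bar> *\<^sub>R f (A *v x)) = (\<lambda>x. f (A *v x))"
    using A by simp
  ultimately show ?thesis by (simp only:)
qed

lemma integral_translate:
  fixes f :: "'a::euclidean_space \<Rightarrow> complex"
  assumes [measurable]: "f \<in> borel_measurable borel"
  shows "(LINT x|lborel. f (x + a)) = (LINT x|lborel. f x)"
proof -
  have "(LINT x|lborel. f x) = (LINT x|distr lborel borel ((+) a). f x)"
    by (simp add: lborel_distr_plus)
  also have "\<dots> = (LINT x|lborel. f (x + a))"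
    by (subst integral_distr) (auto simp: add.commute)
  finally show ?thesis by simp
qed

lemma integrable_translate:
  fixes f :: "'a::euclidean_space \<Rightarrow> complex"
  assumes [measurable]: "f \<in> borel_measurable borel" and f: "integrable lborel f"
  shows "integrable lborel (\<lambda>x. f (x + a))"
proof -
  have "integrable (distr lborel borel ((+) a)) f"
    using f by (simp add: lborel_distr_plus)
  then show ?thesis by (subst (asm) integrable_distr_eq) (auto simp: add.commute)
qed

text \<open>The transform of Borel functions over \<open>lborel\<close>, where Tonelli and automatic
  measurability are available. \<open>fourier_L1_eq_ft\<close> identifies it with
  \<open>fourier_L1\<close> on almost everywhere equal functions.\<close>

definition ft :: "(real ^ 'n \<Rightarrow> complex) \<Rightarrow> real ^ 'n \<Rightarrow> complex" where
  "ft f \<xi> = (LINT x|lborel. f x * cnj (ee (\<xi> \<bullet> x)))"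

section \<open>Periodization along the integer lattice\<close>

lemma finite_vec_set:
  assumes "finite S" shows "finite {k :: 'a ^ 'n. \<forall>i. k $ i \<in> S}"
    and "card {k :: 'a ^ 'n. \<forall>i. k $ i \<in> S} = card S ^ CARD('n)"
proof -
  have eq: "{k :: 'a ^ 'n. \<forall>i. k $ i \<in> S} = vec_lambda ` (PiE UNIV (\<lambda>_. S))"
  proof (intro equalityI subsetI)
    fix k :: "'a ^ 'n" assume "k \<in> {k. \<forall>i. k $ i \<in> S}"
    then show "k \<in> vec_lambda ` (PiE UNIV (\<lambda>_. S))"
      by (intro image_eqI[of _ _ "vec_nth k"]) auto
  qed (auto simp: PiE_def Pi_def)
  have inj: "inj_on vec_lambda (PiE (UNIV :: 'n set) (\<lambda>_. S))"
    by (auto simp: inj_on_def vec_lambda_inject)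
  show "finite {k :: 'a ^ 'n. \<forall>i. k $ i \<in> S}"
    unfolding eq using assms by (intro finite_imageI finite_PiE) auto
  show "card {k :: 'a ^ 'n. \<forall>i. k $ i \<in> S} = card S ^ CARD('n)"
    unfolding eq card_image[OF inj] by (simp add: card_PiE)
qed

text \<open>A bounded support meets finitely many unit cubes, so a finite sum of translates serves
  as periodization on the cube. Cutting the integral of \<open>F\<close> along the cubes identifies
  the coefficients, and folding the support into one cube cannot increase its measure.\<close>

lemma periodization:
  fixes F :: "real ^ 'n \<Rightarrow> complex"
  assumes F: "bounded_borel F" and bdd: "bounded {x. F x \<noteq> 0}"
  shows "\<exists>G. bounded_borel G \<and> (\<forall>k. fcoef G k = ft F (ivec k)) \<and>
    emeasure lborel {t\<in>unit_cube. G t \<noteq> 0} \<le> emeasure lborel {x. F x \<noteq> 0}"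
proof -
  have [measurable]: "F \<in> borel_measurable borel" using F by (rule bounded_borel_measurable)
  obtain R where R: "\<And>x. F x \<noteq> 0 \<Longrightarrow> norm x \<le> R" using bdd unfolding bounded_iff by blast
  \<comment> \<open>Contains the integer corner of every unit cube that meets the support.\<close>
  define J :: "(int ^ 'n) set" where "J = {k. \<forall>i. k $ i \<in> {\<lfloor>- R\<rfloor> .. \<lfloor>R\<rfloor>}}"
  have J: "finite J" unfolding J_def by (rule finite_vec_set) simp
  have J2: "j \<in> J" if "F t \<noteq> 0" "t - ivec j \<in> unit_cube" for t j
  proof -
    have "\<bar>t $ i\<bar> \<le> R" for i using R[OF that(1)] component_le_norm_cart[of t i] by linarith
    then have "\<lfloor>t $ i\<rfloor> \<in> {\<lfloor>- R\<rfloor> .. \<lfloor>R\<rfloor>}" for i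
      by (auto intro!: floor_mono simp: abs_le_iff) (smt (verit) floor_mono)+
    then show ?thesis using that(2) unfolding diff_ivec_in_cube_iff J_def by simp
  qed
  have shift: "bounded_borel (\<lambda>t. F (t + v))" for v
    using F unfolding bounded_borel_def by auto
  define G where "G t = (\<Sum>j\<in>J. F (t + ivec j))" for t
  have G: "bounded_borel G" unfolding G_def by (intro bounded_borel_sum shift)
  have coef: "fcoef G k = ft F (ivec k)" for k
  proof -
    define f :: "int ^ 'n \<Rightarrow> real ^ 'n \<Rightarrow> complex" where "f j t = (if t - ivec j \<in> unit_cube then F t * cnj (ee (ivec k \<bullet> t)) else 0)" for j t
    have fm [measurable]: "f j \<in> borel_measurable borel" for j
    proof -
      have "f j = (\<lambda>t. indicator unit_cube (t - ivec j) * (F t * cnj (ee (ivec k \<bullet> t))))"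
        by (auto simp: f_def indicator_def)
      then show ?thesis by simp
    qed
    have term_eq: "indicator unit_cube t *\<^sub>R (F (t + ivec j) * cnj (ee (ivec k \<bullet> t))) = f j (t + ivec j)" for t j
      by (simp add: f_def indicator_def inner_right_distrib ee_add)
    have bb: "bounded_borel (\<lambda>t. F (t + ivec j) * cnj (ee (ivec k \<bullet> t)))" for j
      by (intro bounded_borel_mult shift bounded_borel_cnj bounded_borel_ee)
    have int0: "integrable lborel (\<lambda>t. f j (t + ivec j))" for j
      using integrable_cubeM[OF bb[of j]] unfolding cubeM_def
      by (subst (asm) integrable_restrict_space) (auto simp: term_eq)
    have int: "integrable lborel (f j)" for j
      using integrable_translate[OF _ int0[of j], of "- ivec j"] by simp
    have "fcoef G k = (\<Sum>j\<in>J. integral\<^sup>L cubeM (\<lambda>t. F (t + ivec j) * cnj (ee (ivec k \<bullet> t))))"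
      unfolding fcoef_def G_def sum_distrib_right
      by (intro Bochner_Integration.integral_sum integrable_cubeM bb)
    also have "\<dots> = (\<Sum>j\<in>J. LINT t|lborel. f j (t + ivec j))"
      unfolding cubeM_def by (subst integral_restrict_space) (auto simp: term_eq)
    also have "\<dots> = (\<Sum>j\<in>J. LINT t|lborel. f j t)"
      by (simp add: integral_translate)
    also have "\<dots> = (LINT t|lborel. (\<Sum>j\<in>J. f j t))"
      by (intro Bochner_Integration.integral_sum[symmetric] int)
    also have "\<dots> = ft F (ivec k)"
      unfolding ft_def
    proof (intro Bochner_Integration.integral_cong refl)
      fix t :: "real ^ 'n"
      define j0 :: "int ^ 'n" where "j0 = (\<chi> i. \<lfloor>t $ i\<rfloor>)"
      have "(\<Sum>j\<in>J. f j t) = (\<Sum>j\<in>J. if j = j0 then F t * cnj (ee (ivec k \<bullet> t)) else 0)"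
        unfolding f_def diff_ivec_in_cube_iff j0_def ..
      also have "\<dots> = F t * cnj (ee (ivec k \<bullet> t))"
        using J J2[of t j0] by (auto simp: diff_ivec_in_cube_iff j0_def)
      finally show "(\<Sum>j\<in>J. f j t) = F t * cnj (ee (ivec k \<bullet> t))" .
    qed
    finally show ?thesis .
  qed
  define S where "S = {x. F x \<noteq> 0}"
  have [measurable]: "S \<in> sets borel" unfolding S_def by measurable
  have [measurable]: "G \<in> borel_measurable borel" using G by (rule bounded_borel_measurable)
  have "emeasure lborel {t\<in>unit_cube. G t \<noteq> 0} = (\<integral>\<^sup>+t. indicator {t\<in>unit_cube. G t \<noteq> 0} t \<partial>lborel)"
    by simp
  also have "\<dots> \<le> (\<integral>\<^sup>+t. (\<integral>\<^sup>+k. indicator S (t + ivec k) \<partial>count_space UNIV) * indicator unit_cube t \<partial>lborel)"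
  proof (rule nn_integral_mono)
    fix t
    show "indicator {t\<in>unit_cube. G t \<noteq> 0} t \<le> (\<integral>\<^sup>+k. indicator S (t + ivec k) \<partial>count_space UNIV) * (indicator unit_cube t :: ennreal)"
    proof (cases "t \<in> unit_cube \<and> G t \<noteq> 0")
      case True
      then obtain j where j: "F (t + ivec j) \<noteq> 0" unfolding G_def by (meson sum.neutral)
      have "(1::ennreal) = (\<Sum>k\<in>{j}. indicator S (t + ivec k))" using j by (simp add: S_def)
      also have "\<dots> \<le> (\<integral>\<^sup>+k. indicator S (t + ivec k) \<partial>count_space UNIV)"
        by (subst sum_eq_nn_integral_count_space) (auto intro!: nn_integral_mono simp: indicator_def)
      finally show ?thesis using True by simp
    qed auto
  qed
  also have "\<dots> = (\<integral>\<^sup>+x. indicator S x \<partial>lborel)"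
    by (rule nn_integral_tile[symmetric]) simp
  also have "\<dots> = emeasure lborel S" by simp
  finally show ?thesis using G coef unfolding S_def by blast
qed

lemma lattice_coefficient_bound:
  fixes F :: "real ^ 'n \<Rightarrow> complex"
  assumes F: "bounded_borel F" "bounded {x. F x \<noteq> 0}" and supp: "emeasure lborel {x. F x \<noteq> 0} \<le> ennreal (1/2)"
    and M: "finite M" "k0 \<in> M"
  shows "ennreal ((norm (ft F (ivec k0)))\<^sup>2) \<le> ennreal (4 * turan_base ^ (2 * card M)) *
    (\<integral>\<^sup>+k. ennreal ((norm (ft F (ivec k)))\<^sup>2) * indicator (- M) k \<partial>count_space UNIV)"
proof -
  obtain G where G: "bounded_borel G" "\<And>k. fcoef G k = ft F (ivec k)"
    "emeasure lborel {t\<in>unit_cube. G t \<noteq> 0} \<le> emeasure lborel {x. F x \<noteq> 0}"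
    using periodization[OF F] by blast
  then show ?thesis
    using fcoef_bound_of_small_support[OF G(1) order_trans[OF G(3) supp] M] by simp
qed

lemma nn_integral_affine:
  fixes f :: "real ^ 'n \<Rightarrow> ennreal"
  assumes [measurable]: "f \<in> borel_measurable borel" and c: "c \<noteq> 0"
  shows "(\<integral>\<^sup>+x. f x \<partial>lborel) = ennreal (\<bar>c\<bar> ^ CARD('n)) * (\<integral>\<^sup>+x. f (t + c *\<^sub>R x) \<partial>lborel)"
  by (subst lborel_affine[OF c, of t])
     (simp add: nn_integral_density nn_integral_distr nn_integral_cmult)

lemma nn_integral_affine':
  fixes f :: "real ^ 'n \<Rightarrow> ennreal"
  assumes f: "f \<in> borel_measurable borel" and c: "c \<noteq> 0"
  shows "(\<integral>\<^sup>+x. f (t + c *\<^sub>R x) \<partial>lborel) = ennreal (inverse (\<bar>c\<bar> ^ CARD('n))) * (\<integral>\<^sup>+x. f x \<partial>lborel)"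
proof -
  have "ennreal (inverse (\<bar>c\<bar> ^ CARD('n))) * ennreal (\<bar>c\<bar> ^ CARD('n)) = 1"
    using c by (simp flip: ennreal_mult)
  then show ?thesis
    unfolding nn_integral_affine[OF f c, of t] by (simp flip: mult.assoc)
qed

section \<open>Random lattices\<close>

text \<open>The parameter space of the random lattices: these are rescaled images of the integer
  lattice under \<open>mat 1 + u\<close>, with \<open>u\<close> distributed over such a box by
  Lebesgue measure.\<close>

definition mat_box :: "real \<Rightarrow> (real ^ 'n ^ 'n) set" where
  "mat_box r = {u. \<forall>i j. \<bar>u $ i $ j\<bar> \<le> r}"

lemma mat_box_borel [measurable]: "(mat_box r :: (real ^ 'n ^ 'n) set) \<in> sets borel"
proof -
  have "(mat_box r :: (real ^ 'n ^ 'n) set) = (\<Inter>i. \<Inter>j. {u. \<bar>u $ i $ j\<bar> \<le> r})"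
    by (auto simp: mat_box_def)
  also have "closed \<dots>"
    by (intro closed_INT ballI closed_Collect_le continuous_intros)
  then have "(\<Inter>i. \<Inter>j. {u :: real ^ 'n ^ 'n. \<bar>u $ i $ j\<bar> \<le> r}) \<in> sets borel" by (rule borel_closed)
  finally show ?thesis .
qed

lemma emeasure_mat_box_finite: "emeasure lborel (mat_box r :: (real ^ 'n ^ 'n) set) < \<infinity>"
proof -
  have "bounded (mat_box r :: (real ^ 'n ^ 'n) set)"
  proof (rule boundedI)
    fix u :: "real ^ 'n ^ 'n" assume u: "u \<in> mat_box r"
    have "norm u \<le> (\<Sum>i\<in>UNIV. norm (u $ i))" unfolding norm_vec_def by (rule L2_set_le_sum) auto
    also have "\<dots> \<le> (\<Sum>i\<in>(UNIV :: 'n set). \<Sum>j\<in>(UNIV :: 'n set). r)"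
      using u by (intro sum_mono order_trans[OF norm_le_l1_cart]) (auto simp: mat_box_def)
    finally show "norm u \<le> (\<Sum>i\<in>(UNIV :: 'n set). \<Sum>j\<in>(UNIV :: 'n set). r)" .
  qed
  then show ?thesis by (rule emeasure_bounded_finite)
qed

lemma emeasure_pos_of_ball:
  fixes S :: "'a::euclidean_space set"
  assumes "S \<in> sets borel" "0 < r" "ball 0 r \<subseteq> S"
  shows "0 < emeasure lborel S"
proof -
  have "\<not> negligible (ball (0::'a) r)" using assms by (intro open_not_negligible) auto
  then have "emeasure lborel (ball (0::'a) r) \<noteq> 0"
    by (auto simp: negligible_iff_null_sets null_sets_def)
  then show ?thesis using emeasure_mono[OF assms(3), of lborel] assms(1) by (auto simp: zero_less_iff_neq_zero)
qed

lemma emeasure_mat_box_pos: "0 < r \<Longrightarrow> 0 < emeasure lborel (mat_box r :: (real ^ 'n ^ 'n) set)"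
proof (rule emeasure_pos_of_ball)
  assume r: "0 < r"
  show "ball 0 r \<subseteq> (mat_box r :: (real ^ 'n ^ 'n) set)"
  proof
    fix u :: "real ^ 'n ^ 'n" assume "u \<in> ball 0 r"
    then have "norm u < r" by simp
    moreover have "\<bar>u $ i $ j\<bar> \<le> norm u" for i j
      using component_le_norm_cart[of "u $ i" j] Finite_Cartesian_Product.norm_nth_le[of u i] by linarith
    ultimately show "u \<in> mat_box r" unfolding mat_box_def by (auto intro: less_imp_le order_le_less_trans)
  qed
qed auto

definition vec_box :: "real \<Rightarrow> (real ^ 'n) set" where
  "vec_box r = {y. \<forall>i. \<bar>y $ i\<bar> \<le> r}"

lemma vec_box_borel [measurable]: "(vec_box r :: (real ^ 'n) set) \<in> sets borel"
proof -
  have "(vec_box r :: (real ^ 'n) set) = (\<Inter>i. {u. \<bar>u $ i\<bar> \<le> r})"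
    by (auto simp: vec_box_def)
  also have "closed \<dots>"
    by (intro closed_INT ballI closed_Collect_le continuous_intros)
  then have "(\<Inter>i. {u :: real ^ 'n. \<bar>u $ i\<bar> \<le> r}) \<in> sets borel" by (rule borel_closed)
  finally show ?thesis .
qed

lemma emeasure_vec_box_pos: "0 < r \<Longrightarrow> 0 < emeasure lborel (vec_box r :: (real ^ 'n) set)"
proof (rule emeasure_pos_of_ball)
  assume r: "0 < r"
  show "ball 0 r \<subseteq> (vec_box r :: (real ^ 'n) set)"
  proof
    fix u :: "real ^ 'n" assume "u \<in> ball 0 r"
    then have "norm u < r" by simp
    moreover have "\<bar>u $ i\<bar> \<le> norm u" for i
      using component_le_norm_cart[of u i] by linarith
    ultimately show "u \<in> vec_box r" unfolding vec_box_def by (auto intro: less_imp_le order_le_less_trans)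
  qed
qed auto

lemma borel_measurable_matrix_vector_left [measurable]:
  "(\<lambda>u :: real ^ 'n ^ 'm. u *v x) \<in> borel \<rightarrow>\<^sub>M borel"
  unfolding matrix_vector_mult_def
  by (intro borel_measurable_continuous_onI continuous_intros)

text \<open>Adding \<open>y\<close> to column \<open>j\<close> of \<open>u\<close> moves \<open>u *v z\<close> by \<open>z $ j\<close> times \<open>y\<close>; average over \<open>y\<close>.\<close>

lemma random_matrix_spread:
  fixes f :: "real ^ 'n \<Rightarrow> ennreal" and z :: "real ^ 'n"
  assumes [measurable]: "f \<in> borel_measurable borel" and z: "z $ j \<noteq> 0"
  shows "emeasure lborel (vec_box r :: (real ^ 'n) set) * (\<integral>\<^sup>+u. f (z + u *v z) * indicator (mat_box r) u \<partial>lborel)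
    \<le> ennreal (inverse (\<bar>z $ j\<bar> ^ CARD('n))) * emeasure lborel (mat_box (2 * r) :: (real ^ 'n ^ 'n) set) * (\<integral>\<^sup>+x. f x \<partial>lborel)"
proof -
  define E where "E y = (\<chi> i l. if l = j then y $ i else 0)" for y :: "real ^ 'n"
  have Ez: "E y *v z = (z $ j) *\<^sub>R y" for y
    by (simp add: E_def matrix_vector_mult_def vec_eq_iff if_distrib[of "\<lambda>a. a * _"] cong: if_cong)
  \<comment> \<open>The translated parameter may leave the box of radius \<open>r\<close>, but the
    entries of \<open>E y\<close> are at most \<open>r\<close>, so radius \<open>2 * r\<close>
    suffices.\<close>
  have line: "(\<integral>\<^sup>+u. f (z + u *v z) * indicator (mat_box r) u \<partial>lborel)
     \<le> (\<integral>\<^sup>+w. f ((z + w *v z) + (z $ j) *\<^sub>R y) * indicator (mat_box (2 * r)) w \<partial>lborel)" if y: "y \<in> vec_box r" for y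
  proof -
    have "(\<integral>\<^sup>+u. f (z + u *v z) * indicator (mat_box r) u \<partial>lborel)
      = (\<integral>\<^sup>+w. f (z + (w + E y) *v z) * indicator (mat_box r) (w + E y) \<partial>lborel)"
      by (rule nn_integral_translate[symmetric]) measurable
    also have "\<dots> \<le> (\<integral>\<^sup>+w. f ((z + w *v z) + (z $ j) *\<^sub>R y) * indicator (mat_box (2 * r)) w \<partial>lborel)"
    proof (intro nn_integral_mono mult_mono)
      fix w :: "real ^ 'n ^ 'n"
      have "w \<in> mat_box (2 * r)" if w: "w + E y \<in> mat_box r"
        unfolding mat_box_def
      proof safe
        fix i l
        have "\<bar>(w + E y) $ i $ l\<bar> \<le> r" using w by (simp add: mat_box_def)
        moreover have "\<bar>E y $ i $ l\<bar> \<le> r" using y unfolding E_def vec_box_def by auto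
        ultimately show "\<bar>w $ i $ l\<bar> \<le> 2 * r" by simp
      qed
      then show "indicator (mat_box r) (w + E y) \<le> (indicator (mat_box (2 * r)) w :: ennreal)"
        by (auto simp: indicator_def)
    qed (auto simp: matrix_vector_mult_add_rdistrib Ez add.assoc)
    finally show ?thesis .
  qed
  have "emeasure lborel (vec_box r :: (real ^ 'n) set) * (\<integral>\<^sup>+u. f (z + u *v z) * indicator (mat_box r) u \<partial>lborel)
    = (\<integral>\<^sup>+y. (\<integral>\<^sup>+u. f (z + u *v z) * indicator (mat_box r) u \<partial>lborel) * indicator (vec_box r :: (real ^ 'n) set) y \<partial>lborel)"
    by (subst nn_integral_cmult_indicator) (auto simp: mult.commute)
  also have "\<dots> \<le> (\<integral>\<^sup>+y. (\<integral>\<^sup>+w. f ((z + w *v z) + (z $ j) *\<^sub>R y) * indicator (mat_box (2 * r)) w \<partial>lborel) \<partial>lborel)"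
    using line by (intro nn_integral_mono) (auto simp: indicator_def)
  also have "\<dots> = (\<integral>\<^sup>+w. (\<integral>\<^sup>+y. f ((z + w *v z) + (z $ j) *\<^sub>R y) * indicator (mat_box (2 * r)) w \<partial>lborel) \<partial>lborel)"
    by (intro lborel_pair.Fubini') measurable
  also have "\<dots> = (\<integral>\<^sup>+w. (ennreal (inverse (\<bar>z $ j\<bar> ^ CARD('n))) * (\<integral>\<^sup>+x. f x \<partial>lborel)) * indicator (mat_box (2 * r) :: (real ^ 'n ^ 'n) set) w \<partial>lborel)"
    using z by (intro nn_integral_cong) (simp add: nn_integral_multc nn_integral_affine')
  also have "\<dots> = ennreal (inverse (\<bar>z $ j\<bar> ^ CARD('n))) * emeasure lborel (mat_box (2 * r) :: (real ^ 'n ^ 'n) set) * (\<integral>\<^sup>+x. f x \<partial>lborel)"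
    by (subst nn_integral_cmult_indicator) (auto simp: mult_ac)
  finally show ?thesis .
qed

text \<open>The supremum norm. A coordinate attaining it is the one to which
  \<open>random_matrix_spread\<close> is applied.\<close>

definition height :: "int ^ 'n \<Rightarrow> int" where "height k = Max (range (\<lambda>i. \<bar>k $ i\<bar>))"

lemma height_ge: "\<bar>k $ i\<bar> \<le> height k"
  unfolding height_def by (intro Max_ge) auto

lemma height_attained: "\<exists>i. \<bar>k $ i\<bar> = height k"
proof -
  have "height k \<in> range (\<lambda>i. \<bar>k $ i\<bar>)" unfolding height_def by (intro Max_in) auto
  then show ?thesis by auto
qed

lemma height_pos: "k \<noteq> 0 \<Longrightarrow> 1 \<le> height k"
proof -
  assume "k \<noteq> 0"
  then obtain i where "k $ i \<noteq> 0" by (auto simp: vec_eq_iff)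
  then show ?thesis using height_ge[of k i] by linarith
qed

text \<open>The condition forces \<open>height k\<close> to be comparable with the supremum norm
  \<open>N\<close> of \<open>x\<close>. About \<open>N ^ n\<close> lattice points qualify, each with
  weight about \<open>N ^ (- n)\<close>, so the sum is bounded independently of
  \<open>x\<close>.\<close>

lemma lattice_count:
  fixes x :: "real ^ 'n"
  shows "(\<integral>\<^sup>+k. ennreal (inverse (real_of_int (height k) ^ CARD('n))) * indicator {k. k \<noteq> 0 \<and> (\<forall>i. \<bar>x $ i - of_int (k $ i)\<bar> \<le> of_int (height k) / 2)} k \<partial>count_space UNIV)
    \<le> ennreal (9 ^ CARD('n))"
proof -
  define K where "K = {k. k \<noteq> 0 \<and> (\<forall>i. \<bar>x $ i - of_int (k $ i)\<bar> \<le> of_int (height k) / 2)}"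
  define N where "N = Max (range (\<lambda>i. \<bar>x $ i\<bar>))"
  have N_ge: "\<bar>x $ i\<bar> \<le> N" for i unfolding N_def by (intro Max_ge) auto
  have "N \<in> range (\<lambda>i. \<bar>x $ i\<bar>)" unfolding N_def by (intro Max_in) auto
  then obtain i0 where i0: "N = \<bar>x $ i0\<bar>" by auto
  have h: "of_int (height k) \<le> 2 * N" "2 * N \<le> 3 * of_int (height k)" if k: "k \<in> K" for k
  proof -
    obtain i where i: "\<bar>k $ i\<bar> = height k" using height_attained by blast
    have "\<bar>x $ i - of_int (k $ i)\<bar> \<le> of_int (height k) / 2" using k by (auto simp: K_def)
    moreover have "of_int (height k) = \<bar>real_of_int (k $ i)\<bar>" using i by linarith
    ultimately show "of_int (height k) \<le> 2 * N" using N_ge[of i] by linarith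
    have "\<bar>x $ i0 - of_int (k $ i0)\<bar> \<le> of_int (height k) / 2" using k by (auto simp: K_def)
    moreover have "\<bar>real_of_int (k $ i0)\<bar> \<le> of_int (height k)" using height_ge[of k i0] by linarith
    ultimately show "2 * N \<le> 3 * of_int (height k)" using i0 by linarith
  qed
  show ?thesis
  proof (cases "K = {}")
    case True
    then show ?thesis unfolding K_def[symmetric] by simp
  next
    case False
    then obtain k0 where k0: "k0 \<in> K" by blast
    then have "1 \<le> height k0" by (auto simp: K_def intro: height_pos)
    then have N: "1 / 2 \<le> N" using h[OF k0] by linarith
    \<comment> \<open>Each coordinate takes at most \<open>4 * N + 1\<close> values, which is at
      most \<open>6 * N\<close> since N \<ge> 1/2. Against weights at most
      \<open>(3 / (2 * N)) ^ n\<close> this gives the constant \<open>9 ^ n\<close>.\<close>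
    define S where "S = {- \<lfloor>2 * N\<rfloor>..\<lfloor>2 * N\<rfloor>}"
    have KS: "K \<subseteq> {k. \<forall>i. k $ i \<in> S}"
    proof safe
      fix k i assume "k \<in> K"
      then have "\<bar>real_of_int (k $ i)\<bar> \<le> 2 * N" using h[of k] height_ge[of k i] by linarith
      then have "\<bar>k $ i\<bar> \<le> \<lfloor>2 * N\<rfloor>" by (simp add: le_floor_iff)
      then show "k $ i \<in> S" by (auto simp: S_def)
    qed
    have S: "finite S" by (simp add: S_def)
    have fin: "finite K" using KS finite_vec_set(1)[OF S] by (rule finite_subset)
    have "card K \<le> card S ^ CARD('n)"
      using card_mono[OF finite_vec_set(1)[OF S] KS] by (simp add: finite_vec_set(2)[OF S])
    then have "real (card K) \<le> real (card S) ^ CARD('n)" by (metis of_nat_le_iff of_nat_power)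
    also have "real (card S) \<le> 6 * N"
    proof -
      have "0 \<le> \<lfloor>2 * N\<rfloor>" using N by simp
      then have "real (card S) = 2 * real_of_int \<lfloor>2 * N\<rfloor> + 1" by (simp add: S_def)
      also have "\<dots> \<le> 2 * (2 * N) + 1" by linarith
      finally show ?thesis using N by linarith
    qed
    then have "real (card S) ^ CARD('n) \<le> (6 * N) ^ CARD('n)" by (intro power_mono) auto
    finally have cK: "real (card K) \<le> (6 * N) ^ CARD('n)" .
    have "(\<integral>\<^sup>+k. ennreal (inverse (real_of_int (height k) ^ CARD('n))) * indicator K k \<partial>count_space UNIV)
      = (\<Sum>k\<in>K. ennreal (inverse (real_of_int (height k) ^ CARD('n))))"
      by (rule sum_eq_nn_integral_count_space[OF fin, symmetric])
    also have "\<dots> \<le> (\<Sum>k\<in>K. ennreal ((3 / (2 * N)) ^ CARD('n)))"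
    proof (intro sum_mono ennreal_leI)
      fix k assume k: "k \<in> K"
      then have "1 \<le> height k" by (auto simp: K_def intro: height_pos)
      then have "inverse (real_of_int (height k)) \<le> 3 / (2 * N)"
        using h(2)[OF k] N by (simp add: field_simps)
      then show "inverse (real_of_int (height k) ^ CARD('n)) \<le> (3 / (2 * N)) ^ CARD('n)"
        unfolding power_inverse[symmetric] using \<open>1 \<le> height k\<close> by (intro power_mono) auto
    qed
    also have "\<dots> = ennreal (real (card K) * (3 / (2 * N)) ^ CARD('n))"
      using N by (simp add: ennreal_mult ennreal_of_nat_eq_real_of_nat)
    also have "\<dots> \<le> ennreal ((6 * N) ^ CARD('n) * (3 / (2 * N)) ^ CARD('n))"
      using N cK by (intro ennreal_leI mult_right_mono) auto
    also have "(6 * N) ^ CARD('n) * (3 / (2 * N)) ^ CARD('n) = 9 ^ CARD('n)"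
      unfolding power_mult_distrib[symmetric] using N by simp
    finally show ?thesis unfolding K_def .
  qed
qed

text \<open>Matrices with entries this small at most halve the supremum norm of a vector. Hence
  \<open>mat 1 + u\<close> is invertible, and it moves a lattice point by at most half its
  height.\<close>

definition perturb :: "'n::finite itself \<Rightarrow> real" where "perturb _ = 1 / (2 * real CARD('n))"

lemma perturb_pos: "0 < perturb TYPE('n::finite)"
  by (simp add: perturb_def)

lemma mat_box_perturb_apply:
  fixes u :: "real ^ 'n ^ 'n" and x :: "real ^ 'n"
  assumes u: "u \<in> mat_box (perturb TYPE('n))" and x: "\<And>j. \<bar>x $ j\<bar> \<le> m"
  shows "\<bar>(u *v x) $ i\<bar> \<le> m / 2"
proof -
  have m: "0 \<le> m" using x[of i] by linarith
  have "\<bar>(u *v x) $ i\<bar> \<le> (\<Sum>j\<in>UNIV. \<bar>u $ i $ j * x $ j\<bar>)"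
    unfolding matrix_vector_mult_def by simp
  also have "\<dots> \<le> (\<Sum>j\<in>(UNIV :: 'n set). perturb TYPE('n) * m)"
    unfolding abs_mult using u m by (intro sum_mono mult_mono x) (auto simp: mat_box_def perturb_def)
  also have "\<dots> = m / 2" by (simp add: perturb_def)
  finally show ?thesis .
qed

text \<open>An upper-bound form of Siegel's mean value theorem. Averaging over \<open>u\<close>
  spreads the image of \<open>k\<close> over a cube of radius \<open>height k / 2\<close>, with
  density about \<open>height k ^ (- n)\<close>; summed over \<open>k\<close>, these densities stay
  bounded by \<open>lattice_count\<close>. The origin is left out because no matrix moves
  it.\<close>

lemma lattice_average:
  "\<exists>C > 0. \<forall>f \<in> borel_measurable borel.
    (\<integral>\<^sup>+u. (\<integral>\<^sup>+k. f (ivec k + u *v ivec k) * indicator (- {0}) k \<partial>count_space UNIV) * indicator (mat_box (perturb TYPE('n))) u \<partial>lborel)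
    \<le> ennreal C * (\<integral>\<^sup>+x. f (x :: real ^ 'n) \<partial>lborel)"
proof -
  define r where "r = perturb TYPE('n)"
  have r: "0 < r" by (simp add: r_def perturb_pos)
  define V where "V = emeasure lborel (mat_box (2 * r) :: (real ^ 'n ^ 'n) set)"
  \<comment> \<open>Capping at 1 makes \<open>b\<close> a finite positive number; only a lower bound
    for the measure of this box enters.\<close>
  define b where "b = min 1 (emeasure lborel (vec_box r :: (real ^ 'n) set))"
  have "b \<noteq> 0" "b \<noteq> top" using emeasure_vec_box_pos[where 'n = 'n, OF r] unfolding b_def by (auto simp: min_def)
  then obtain b' where b': "b = ennreal b'" "0 < b'" by (cases b) (auto simp: less_le)
  have "V < \<infinity>" unfolding V_def by (rule emeasure_mat_box_finite)
  then obtain V' where V': "V = ennreal V'" "0 \<le> V'" by (cases V) auto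
  define C where "C = 1 + V' / b' * 9 ^ CARD('n)"
  have C: "0 < C" using b' V' by (simp add: C_def add_pos_nonneg)
  have main: "(\<integral>\<^sup>+u. (\<integral>\<^sup>+k. f (ivec k + u *v ivec k) * indicator (- {0}) k \<partial>count_space UNIV) * indicator (mat_box r) u \<partial>lborel)
    \<le> ennreal C * (\<integral>\<^sup>+x. f x \<partial>lborel)" if [measurable]: "f \<in> borel_measurable borel" for f :: "real ^ 'n \<Rightarrow> ennreal"
  proof -
    define R where "R k = {x :: real ^ 'n. \<forall>i. \<bar>x $ i - of_int (k $ i)\<bar> \<le> of_int (height k) / 2}" for k :: "int ^ 'n"
    have R_meas [measurable]: "R k \<in> sets borel" for k
    proof -
      have "R k = (\<lambda>x. x - ivec k) -` vec_box (of_int (height k) / 2) \<inter> space borel"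
        by (auto simp: R_def vec_box_def)
      also have "\<dots> \<in> sets borel" by measurable
      finally show ?thesis .
    qed
    \<comment> \<open>Restricting \<open>f\<close> to \<open>R k\<close> changes nothing for
      \<open>u\<close> in the box, but it is what keeps the sum of the weights bounded at each
      \<open>x\<close>.\<close>
    define g where "g k x = f x * indicator (R k) x" for k x
    have [measurable]: "g k \<in> borel_measurable borel" for k unfolding g_def by measurable
    have step: "(\<integral>\<^sup>+u. f (ivec k + u *v ivec k) * indicator (mat_box r) u \<partial>lborel)
        \<le> ennreal (V' / b') * (\<integral>\<^sup>+x. ennreal (inverse (real_of_int (height k) ^ CARD('n))) * g k x \<partial>lborel)" if k: "k \<noteq> 0" for k
    proof -
      obtain j where j: "\<bar>k $ j\<bar> = height k" using height_attained by blast
      have hk: "1 \<le> height k" using height_pos[OF k] .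
      have jz: "ivec k $ j \<noteq> 0" "\<bar>ivec k $ j\<bar> = of_int (height k)" using j hk by auto
      have "(\<integral>\<^sup>+u. f (ivec k + u *v ivec k) * indicator (mat_box r) u \<partial>lborel)
        = (\<integral>\<^sup>+u. g k (ivec k + u *v ivec k) * indicator (mat_box r) u \<partial>lborel)"
      proof (intro nn_integral_cong)
        fix u :: "real ^ 'n ^ 'n"
        have "ivec k + u *v ivec k \<in> R k" if "u \<in> mat_box r"
        proof -
          have "\<bar>(u *v ivec k) $ i\<bar> \<le> of_int (height k) / 2" for i
          proof (rule mat_box_perturb_apply)
            show "u \<in> mat_box (perturb TYPE('n))" using that by (simp add: r_def)
            show "\<bar>ivec k $ j\<bar> \<le> of_int (height k)" for j
              using height_ge[of k j] by simp
          qed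
          then show ?thesis by (simp add: R_def)
        qed
        then show "f (ivec k + u *v ivec k) * indicator (mat_box r) u = g k (ivec k + u *v ivec k) * indicator (mat_box r) u"
          by (auto simp: g_def indicator_def)
      qed
      also have "\<dots> = ennreal (1 / b') * (ennreal b' * \<dots>)"
        using b' by (simp flip: mult.assoc ennreal_mult)
      also have "\<dots> \<le> ennreal (1 / b') * (ennreal (inverse (real_of_int (height k) ^ CARD('n))) * ennreal V' * (\<integral>\<^sup>+x. g k x \<partial>lborel))"
      proof (rule mult_left_mono)
        have "ennreal b' * (\<integral>\<^sup>+u. g k (ivec k + u *v ivec k) * indicator (mat_box r) u \<partial>lborel)
          \<le> emeasure lborel (vec_box r :: (real ^ 'n) set) * (\<integral>\<^sup>+u. g k (ivec k + u *v ivec k) * indicator (mat_box r) u \<partial>lborel)"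
          unfolding b'(1)[symmetric] b_def by (intro mult_right_mono) auto
        also have "\<dots> \<le> ennreal (inverse (\<bar>ivec k $ j\<bar> ^ CARD('n))) * V * (\<integral>\<^sup>+x. g k x \<partial>lborel)"
          unfolding V_def by (rule random_matrix_spread) (use jz in auto)
        finally show "ennreal b' * (\<integral>\<^sup>+u. g k (ivec k + u *v ivec k) * indicator (mat_box r) u \<partial>lborel)
          \<le> ennreal (inverse (real_of_int (height k) ^ CARD('n))) * ennreal V' * (\<integral>\<^sup>+x. g k x \<partial>lborel)"
          unfolding jz(2) V'(1) .
      qed auto
      also have "\<dots> = ennreal (V' / b') * (\<integral>\<^sup>+x. ennreal (inverse (real_of_int (height k) ^ CARD('n))) * g k x \<partial>lborel)"
      proof -
        have "ennreal (V' / b') = ennreal (1 / b') * ennreal V'" using b' V' by (simp flip: ennreal_mult)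
        moreover have "(\<integral>\<^sup>+x. ennreal (inverse (real_of_int (height k) ^ CARD('n))) * g k x \<partial>lborel)
          = ennreal (inverse (real_of_int (height k) ^ CARD('n))) * (\<integral>\<^sup>+x. g k x \<partial>lborel)"
          by (rule nn_integral_cmult) simp
        ultimately show ?thesis by (simp only: mult_ac)
      qed
      finally show ?thesis .
    qed
    have "(\<integral>\<^sup>+u. (\<integral>\<^sup>+k. f (ivec k + u *v ivec k) * indicator (- {0}) k \<partial>count_space UNIV) * indicator (mat_box r) u \<partial>lborel)
      = (\<integral>\<^sup>+u. (\<integral>\<^sup>+k. f (ivec k + u *v ivec k) * indicator (mat_box r) u * indicator (- {0}) k \<partial>count_space UNIV) \<partial>lborel)"
    proof (rule nn_integral_cong)
      fix u :: "real ^ 'n ^ 'n"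
      show "(\<integral>\<^sup>+k. f (ivec k + u *v ivec k) * indicator (- {0}) k \<partial>count_space UNIV) * indicator (mat_box r) u
        = (\<integral>\<^sup>+k. f (ivec k + u *v ivec k) * indicator (mat_box r) u * indicator (- {0}) k \<partial>count_space UNIV)"
        by (subst nn_integral_multc[symmetric]) (simp_all add: mult_ac)
    qed
    also have "\<dots> = (\<integral>\<^sup>+k. (\<integral>\<^sup>+u. f (ivec k + u *v ivec k) * indicator (mat_box r) u * indicator (- {0}) k \<partial>lborel) \<partial>count_space UNIV)"
      by (intro nn_integral_count_space_nn_integral) auto
    also have "\<dots> = (\<integral>\<^sup>+k. (\<integral>\<^sup>+u. f (ivec k + u *v ivec k) * indicator (mat_box r) u \<partial>lborel) * indicator (- {0}) k \<partial>count_space UNIV)"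
      by (simp add: nn_integral_multc)
    also have "\<dots> \<le> (\<integral>\<^sup>+k. (\<integral>\<^sup>+x. ennreal (V' / b') * (ennreal (inverse (real_of_int (height k) ^ CARD('n))) * g k x) * indicator (- {0}) k \<partial>lborel) \<partial>count_space UNIV)"
      using step by (intro nn_integral_mono) (auto simp: indicator_def nn_integral_cmult)
    also have "\<dots> = (\<integral>\<^sup>+x. (\<integral>\<^sup>+k. ennreal (V' / b') * (ennreal (inverse (real_of_int (height k) ^ CARD('n))) * g k x) * indicator (- {0}) k \<partial>count_space UNIV) \<partial>lborel)"
      by (intro nn_integral_count_space_nn_integral[symmetric]) auto
    also have "\<dots> = (\<integral>\<^sup>+x. (\<integral>\<^sup>+k. (ennreal (V' / b') * f x) * (ennreal (inverse (real_of_int (height k) ^ CARD('n))) *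
         indicator {k. k \<noteq> 0 \<and> (\<forall>i. \<bar>x $ i - of_int (k $ i)\<bar> \<le> of_int (height k) / 2)} k) \<partial>count_space UNIV) \<partial>lborel)"
      by (intro nn_integral_cong) (auto simp: g_def R_def indicator_def mult_ac)
    also have "\<dots> \<le> (\<integral>\<^sup>+x. (ennreal (V' / b') * f x) * ennreal (9 ^ CARD('n)) \<partial>lborel)"
      by (intro nn_integral_mono) (subst nn_integral_cmult, simp, intro mult_left_mono lattice_count, simp)
    also have "\<dots> = ennreal (V' / b' * 9 ^ CARD('n)) * (\<integral>\<^sup>+x. f x \<partial>lborel)"
    proof -
      have "ennreal (V' / b' * 9 ^ CARD('n)) = ennreal (V' / b') * ennreal (9 ^ CARD('n))"
        using V' b' by (intro ennreal_mult) auto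
      moreover have "(\<integral>\<^sup>+x. (ennreal (V' / b') * f x) * ennreal (9 ^ CARD('n)) \<partial>lborel)
        = ennreal (V' / b') * (\<integral>\<^sup>+x. f x \<partial>lborel) * ennreal (9 ^ CARD('n))"
        by (subst nn_integral_multc) (auto simp: nn_integral_cmult)
      ultimately show ?thesis by (simp only: mult_ac)
    qed
    also have "\<dots> \<le> ennreal C * (\<integral>\<^sup>+x. f x \<partial>lborel)"
      by (intro mult_right_mono ennreal_leI) (auto simp: C_def)
    finally show ?thesis .
  qed
  show ?thesis using C main unfolding r_def by blast
qed

lemma abs_det_le:
  fixes A :: "real ^ 'n ^ 'n"
  assumes "\<And>i j. \<bar>A $ i $ j\<bar> \<le> b"
  shows "\<bar>det A\<bar> \<le> fact CARD('n) * b ^ CARD('n)"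
proof -
  have "\<bar>det A\<bar> \<le> (\<Sum>p\<in>{p. p permutes (UNIV :: 'n set)}. \<bar>of_int (sign p) * (\<Prod>i\<in>UNIV. A $ i $ p i)\<bar>)"
    unfolding det_def by (rule sum_abs)
  also have "\<dots> \<le> (\<Sum>p\<in>{p. p permutes (UNIV :: 'n set)}. b ^ CARD('n))"
  proof (intro sum_mono)
    fix p :: "'n \<Rightarrow> 'n"
    have "\<bar>real_of_int (sign p)\<bar> = 1" by (simp add: sign_def)
    then have "\<bar>of_int (sign p) * (\<Prod>i\<in>UNIV. A $ i $ p i)\<bar> = (\<Prod>i\<in>UNIV. \<bar>A $ i $ p i\<bar>)"
      by (simp add: abs_mult abs_prod)
    also have "\<dots> \<le> (\<Prod>i\<in>(UNIV :: 'n set). b)" using assms by (intro prod_mono) auto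
    finally show "\<bar>of_int (sign p) * (\<Prod>i\<in>UNIV. A $ i $ p i)\<bar> \<le> b ^ CARD('n)" by simp
  qed
  also have "\<dots> = fact CARD('n) * b ^ CARD('n)" by (simp add: card_permutations)
  finally show ?thesis .
qed

text \<open>A kernel vector would equal \<open>- (u *v x)\<close>, whose entries are at most half
  the largest entry of \<open>x\<close>. The upper bound is Leibniz' formula for entries at most
  2.\<close>

lemma det_perturbed_identity:
  fixes u :: "real ^ 'n ^ 'n"
  assumes u: "u \<in> mat_box (perturb TYPE('n))"
  shows "det (mat 1 + u) \<noteq> 0" and "\<bar>det (mat 1 + u)\<bar> \<le> fact CARD('n) * 2 ^ CARD('n)"
proof -
  have "x = 0" if x: "(mat 1 + u) *v x = 0" for x
  proof (rule ccontr)
    assume "x \<noteq> 0"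
    define m where "m = Max (range (\<lambda>i. \<bar>x $ i\<bar>))"
    have m: "\<bar>x $ i\<bar> \<le> m" for i unfolding m_def by (intro Max_ge) auto
    have "m \<in> range (\<lambda>i. \<bar>x $ i\<bar>)" unfolding m_def by (intro Max_in) auto
    then obtain i where i: "m = \<bar>x $ i\<bar>" by auto
    obtain i' where "x $ i' \<noteq> 0" using \<open>x \<noteq> 0\<close> by (auto simp: vec_eq_iff)
    then have "0 < m" using m[of i'] by linarith
    moreover have "x $ i = - ((u *v x) $ i)"
      using x by (simp add: matrix_vector_mult_add_rdistrib vec_eq_iff eq_neg_iff_add_eq_0)
    moreover have "\<bar>(u *v x) $ i\<bar> \<le> m / 2" by (rule mat_box_perturb_apply[OF u m])
    ultimately show False using i by linarith
  qed
  then show "det (mat 1 + u) \<noteq> 0"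
    using matrix_left_invertible_ker[of "mat 1 + u"] invertible_left_inverse[of "mat 1 + u"] by (auto simp: invertible_det_nz)
  show "\<bar>det (mat 1 + u)\<bar> \<le> fact CARD('n) * 2 ^ CARD('n)"
  proof (rule abs_det_le)
    fix i j
    have "1 \<le> real CARD('n)" using zero_less_card_finite[where 'a = 'n] by linarith
    then have "perturb TYPE('n) \<le> 1"
      unfolding perturb_def by (subst divide_le_eq_1_pos) linarith+
    moreover have "\<bar>u $ i $ j\<bar> \<le> perturb TYPE('n)" using u by (simp add: mat_box_def)
    ultimately show "\<bar>(mat 1 + u) $ i $ j\<bar> \<le> 2" by (auto simp: mat_def)
  qed
qed

section \<open>Pointwise bound of a transform by its energy outside a set\<close>

lemma ft_borel_measurable [measurable]:
  assumes [measurable]: "f \<in> borel_measurable borel"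
  shows "ft f \<in> borel_measurable borel"
proof -
  have "(\<lambda>\<xi>. LINT x|lborel. f x * cnj (ee (\<xi> \<bullet> x))) \<in> borel_measurable borel"
    by measurable
  then show ?thesis by (simp add: ft_def[abs_def])
qed

text \<open>Modulation shifts the frequency and the linear substitution stretches it, so the integer
  frequencies of the new function are the points \<open>y + A *v ivec k\<close> for
  \<open>f\<close>.\<close>

lemma ft_modulated_pullback:
  fixes f :: "real ^ 'n \<Rightarrow> complex" and A :: "real ^ 'n ^ 'n"
  assumes [measurable]: "f \<in> borel_measurable borel" and A: "det A \<noteq> 0"
    and B: "B ** transpose A = mat 1"
  shows "ft (\<lambda>t. f (B *v t) * cnj (ee (y \<bullet> (B *v t)))) \<xi> = of_real \<bar>det A\<bar> * ft f (y + A *v \<xi>)"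
proof -
  have d: "det (transpose A) \<noteq> 0" using A by (simp add: det_transpose)
  have "ft (\<lambda>t. f (B *v t) * cnj (ee (y \<bullet> (B *v t)))) \<xi>
     = of_real \<bar>det (transpose A)\<bar> * (LINT x|lborel. f (B *v (transpose A *v x)) * cnj (ee (y \<bullet> (B *v (transpose A *v x)))) * cnj (ee (\<xi> \<bullet> (transpose A *v x))))"
    unfolding ft_def by (rule integral_linear[OF d]) measurable
  also have "\<dots> = of_real \<bar>det A\<bar> * ft f (y + A *v \<xi>)"
  proof -
    have "B *v (transpose A *v x) = x" for x by (simp only: matrix_vector_mul_assoc B matrix_vector_mul_lid)
    moreover have "\<xi> \<bullet> (transpose A *v x) = (A *v \<xi>) \<bullet> x" for x
      using dot_lmul_matrix[of x A \<xi>] by (simp add: inner_commute transpose_matrix_vector)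
    ultimately show ?thesis
      by (simp add: ft_def det_transpose inner_add_left ee_add mult.assoc)
  qed
  finally show ?thesis .
qed

text \<open>Apply \<open>lattice_coefficient_bound\<close> to the modulated pullback of
  \<open>f\<close>, at frequency 0. The pullback multiplies the measure of the support by \<bar>det
  A\<bar>, which \<open>supp\<close> anticipates, and the same factor \<bar>det A\<bar>^2 appears on
  both sides and cancels.\<close>

lemma affine_lattice_bound:
  fixes f :: "real ^ 'n \<Rightarrow> complex" and A :: "real ^ 'n ^ 'n"
  assumes f: "bounded_borel f" "bounded {x. f x \<noteq> 0}" and A: "det A \<noteq> 0"
    and supp: "ennreal \<bar>det A\<bar> * emeasure lborel {x. f x \<noteq> 0} \<le> ennreal (1/2)"
    and M: "finite M" "0 \<in> M"
  shows "ennreal ((norm (ft f y))\<^sup>2) \<le> ennreal (4 * turan_base ^ (2 * card M)) *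
    (\<integral>\<^sup>+k. ennreal ((norm (ft f (y + A *v ivec k)))\<^sup>2) * indicator (- M) k \<partial>count_space UNIV)"
proof -
  have fm [measurable]: "f \<in> borel_measurable borel" using f(1) by (rule bounded_borel_measurable)
  have d: "det (transpose A) \<noteq> 0" using A by (simp add: det_transpose)
  then obtain B where B: "B ** transpose A = mat 1" "transpose A ** B = mat 1"
    unfolding invertible_det_nz[symmetric] invertible_def by blast
  define F where "F t = f (B *v t) * cnj (ee (y \<bullet> (B *v t)))" for t
  have F1: "bounded_borel F"
  proof -
    obtain b where "\<And>x. norm (f x) \<le> b" using f(1) unfolding bounded_borel_def by blast
    then have "norm (F t) \<le> b" for t by (simp add: F_def norm_mult)
    moreover have "F \<in> borel_measurable borel" unfolding F_def by measurable
    ultimately show ?thesis unfolding bounded_borel_def by blast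
  qed
  have Fnz: "F t \<noteq> 0 \<longleftrightarrow> f (B *v t) \<noteq> 0" for t by (simp add: F_def)
  have F2: "bounded {t. F t \<noteq> 0}"
  proof (rule bounded_subset)
    show "bounded ((*v) (transpose A) ` {x. f x \<noteq> 0})"
      by (intro bounded_linear_image f(2) matrix_vector_mul_bounded_linear)
    show "{t. F t \<noteq> 0} \<subseteq> (*v) (transpose A) ` {x. f x \<noteq> 0}"
    proof
      fix t assume "t \<in> {t. F t \<noteq> 0}"
      then show "t \<in> (*v) (transpose A) ` {x. f x \<noteq> 0}"
        by (intro image_eqI[of _ _ "B *v t"]) (auto simp: Fnz matrix_vector_mul_assoc B)
    qed
  qed
  have F3: "emeasure lborel {t. F t \<noteq> 0} \<le> ennreal (1/2)"
  proof -
    have [measurable]: "{t. F t \<noteq> 0} \<in> sets borel" "{x. f x \<noteq> 0} \<in> sets borel"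
      using bounded_borel_measurable[OF F1] by measurable
    have "emeasure lborel {t. F t \<noteq> 0} = (\<integral>\<^sup>+t. indicator {t. F t \<noteq> 0} t \<partial>lborel)" by simp
    also have "\<dots> = ennreal \<bar>det (transpose A)\<bar> * (\<integral>\<^sup>+x. indicator {t. F t \<noteq> 0} (transpose A *v x) \<partial>lborel)"
      by (rule nn_integral_linear[OF d]) measurable
    also have "(\<integral>\<^sup>+x. indicator {t. F t \<noteq> 0} (transpose A *v x) \<partial>lborel) = (\<integral>\<^sup>+x. indicator {x. f x \<noteq> 0} x \<partial>lborel)"
      by (intro nn_integral_cong) (simp only: indicator_def Fnz mem_Collect_eq matrix_vector_mul_assoc B matrix_vector_mul_lid)
    also have "ennreal \<bar>det (transpose A)\<bar> * \<dots> = ennreal \<bar>det A\<bar> * emeasure lborel {x. f x \<noteq> 0}"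
      by (simp add: det_transpose)
    finally show ?thesis using supp by simp
  qed
  have ftF: "ft F \<xi> = of_real \<bar>det A\<bar> * ft f (y + A *v \<xi>)" for \<xi>
    unfolding F_def by (rule ft_modulated_pullback[OF fm A B(1)])
  define c where "c = \<bar>det A\<bar>\<^sup>2"
  have c: "0 < c" using A by (simp add: c_def)
  have sq: "ennreal ((norm (ft F \<xi>))\<^sup>2) = ennreal c * ennreal ((norm (ft f (y + A *v \<xi>)))\<^sup>2)" for \<xi>
    by (simp add: ftF norm_mult power_mult_distrib c_def ennreal_mult)
  define X where "X = (\<integral>\<^sup>+k. ennreal ((norm (ft f (y + A *v ivec k)))\<^sup>2) * indicator (- M) k \<partial>count_space UNIV)"
  have "ennreal c * ennreal ((norm (ft f y))\<^sup>2) = ennreal ((norm (ft F (ivec 0)))\<^sup>2)"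
    unfolding sq by simp
  also have "\<dots> \<le> ennreal (4 * turan_base ^ (2 * card M)) *
    (\<integral>\<^sup>+k. ennreal ((norm (ft F (ivec k)))\<^sup>2) * indicator (- M) k \<partial>count_space UNIV)"
    by (rule lattice_coefficient_bound[OF F1 F2 F3 M])
  also have "(\<integral>\<^sup>+k. ennreal ((norm (ft F (ivec k)))\<^sup>2) * indicator (- M) k \<partial>count_space UNIV) = ennreal c * X"
    unfolding sq X_def by (simp add: nn_integral_cmult mult.assoc)
  finally have "ennreal c * ennreal ((norm (ft f y))\<^sup>2) \<le> ennreal c * (ennreal (4 * turan_base ^ (2 * card M)) * X)"
    by (simp add: mult_ac)
  then have "ennreal (inverse c) * (ennreal c * ennreal ((norm (ft f y))\<^sup>2)) \<le> ennreal (inverse c) * (ennreal c * (ennreal (4 * turan_base ^ (2 * card M)) * X))"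
    by (rule mult_left_mono) simp
  moreover have one: "ennreal (inverse c) * ennreal c = 1" using c by (simp flip: ennreal_mult)
  ultimately show ?thesis unfolding X_def[symmetric] by (simp only: mult.assoc[symmetric] one mult_1_left)
qed

lemma finite_card_of_weighted_count:
  fixes K :: "'a::countable set"
  assumes a: "0 < a" and K: "(\<integral>\<^sup>+k. ennreal a * indicator K k \<partial>count_space UNIV) \<le> 1"
  shows "finite K \<and> real (card K) \<le> 1 / a"
proof -
  have fin: "real (card F) \<le> 1 / a" if F: "finite F" "F \<subseteq> K" for F
  proof -
    have "ennreal (real (card F) * a) = (\<Sum>k\<in>F. ennreal a)"
      using a by (simp add: ennreal_mult ennreal_of_nat_eq_real_of_nat)
    also have "\<dots> = (\<integral>\<^sup>+k. ennreal a * indicator F k \<partial>count_space UNIV)"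
      by (rule sum_eq_nn_integral_count_space[OF F(1)])
    also have "\<dots> \<le> (\<integral>\<^sup>+k. ennreal a * indicator K k \<partial>count_space UNIV)"
      using F(2) by (intro nn_integral_mono mult_left_mono) (auto simp: indicator_def)
    finally have "ennreal (real (card F) * a) \<le> 1" using K by (rule order_trans)
    then have "real (card F) * a \<le> 1" by (simp add: ennreal_le_1)
    then show ?thesis using a by (simp add: field_simps)
  qed
  have "finite K"
  proof (rule ccontr)
    assume "infinite K"
    obtain N :: nat where N: "1 / a < real N" using reals_Archimedean2 by blast
    obtain F where "finite F" "card F = N" "F \<subseteq> K"
      using infinite_arbitrarily_large[OF \<open>infinite K\<close>] by blast
    then show False using fin[of F] N by simp
  qed
  then show ?thesis using fin[of K] by simp
qed

text \<open>The point \<open>y\<close> serves as the origin of a random affine lattice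
  \<open>y + T *v ivec k\<close> scaled to satisfy \<open>affine_lattice_bound\<close>. By a first
  moment argument one \<open>T\<close> has both few points in \<open>A\<close> and little energy of
  the transform at the points outside \<open>A\<close>. The points in \<open>A\<close>, together
  with \<open>y\<close>, form the set \<open>M\<close>, and its size enters the exponent.\<close>

lemma ft_pointwise_bound:
  "\<exists>C \<ge> 1. \<forall>(f :: real ^ 'n \<Rightarrow> complex) A \<sigma> y. bounded_borel f \<longrightarrow> bounded {x. f x \<noteq> 0} \<longrightarrow> A \<in> sets borel \<longrightarrow>
     emeasure lborel A < \<infinity> \<longrightarrow> 0 < \<sigma> \<longrightarrow> emeasure lborel {x. f x \<noteq> 0} \<le> ennreal \<sigma> \<longrightarrow>
     ennreal ((norm (ft f y))\<^sup>2) \<le> ennreal (C * \<sigma> * exp (C * \<sigma> * measure lborel A)) *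
       (\<integral>\<^sup>+\<xi>. ennreal ((norm (ft f \<xi>))\<^sup>2) * indicator (- A) \<xi> \<partial>lborel)"
proof -
  obtain C2 where C2: "0 < C2" "\<And>f :: real ^ 'n \<Rightarrow> ennreal. f \<in> borel_measurable borel \<Longrightarrow>
    (\<integral>\<^sup>+u. (\<integral>\<^sup>+k. f (ivec k + u *v ivec k) * indicator (- {0}) k \<partial>count_space UNIV) * indicator (mat_box (perturb TYPE('n))) u \<partial>lborel)
    \<le> ennreal C2 * (\<integral>\<^sup>+x. f x \<partial>lborel)"
    using lattice_average by blast
  define U where "U = (mat_box (perturb TYPE('n)) :: (real ^ 'n ^ 'n) set)"
  have U_meas [measurable]: "U \<in> sets borel" unfolding U_def by simp
  have U0: "0 < emeasure lborel U" "emeasure lborel U < \<infinity>"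
    unfolding U_def using emeasure_mat_box_pos[OF perturb_pos] emeasure_mat_box_finite by blast+
  define V where "V = measure lborel U"
  have V1: "emeasure lborel U = ennreal V"
    unfolding V_def by (rule emeasure_eq_ennreal_measure) (use U0 in auto)
  have V2: "0 < V"
  proof (rule ccontr)
    assume "\<not> 0 < V"
    then have "ennreal V = 0" by (simp add: ennreal_neg)
    then show False using U0(1) V1 by simp
  qed
  note V = V1 V2
  define D :: real where "D = fact CARD('n) * 2 ^ CARD('n)"
  have D: "0 < D" by (simp add: D_def)
  define C3 where "C3 = C2 * 2 * D / V"
  have C3: "0 < C3" using C2 D V by (simp add: C3_def)
  define L where "L = ln turan_base"
  have L: "0 \<le> L" using turan_base_ge_1 by (simp add: L_def)
  \<comment> \<open>With \<open>card M\<close> at most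
    \<open>2 + 2 * C3 * \<sigma> * \<alpha>\<close>, the Turan factor is at most
    \<open>exp (4 * L + 4 * L * C3 * \<sigma> * \<alpha>)\<close>. The two products here are the
    resulting prefactor and exponent.\<close>
  define C where "C = 1 + 8 * C3 * exp (4 * L) + 4 * L * C3"
  have C: "1 \<le> C" "8 * C3 * exp (4 * L) \<le> C" "4 * L * C3 \<le> C" using C3 L by (auto simp: C_def)
  have main: "ennreal ((norm (ft f y))\<^sup>2) \<le> ennreal (C * \<sigma> * exp (C * \<sigma> * measure lborel A)) *
       (\<integral>\<^sup>+\<xi>. ennreal ((norm (ft f \<xi>))\<^sup>2) * indicator (- A) \<xi> \<partial>lborel)"
    if f: "bounded_borel f" "bounded {x. f x \<noteq> 0}" and A [measurable]: "A \<in> sets borel"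
      and A2: "emeasure lborel A < \<infinity>" and \<sigma>: "0 < \<sigma>" and supp: "emeasure lborel {x. f x \<noteq> 0} \<le> ennreal \<sigma>"
    for f :: "real ^ 'n \<Rightarrow> complex" and A \<sigma> y
  proof -
    have [measurable]: "f \<in> borel_measurable borel" using f(1) by (rule bounded_borel_measurable)
    define \<alpha> where "\<alpha> = measure lborel A"
    have \<alpha>: "emeasure lborel A = ennreal \<alpha>" "0 \<le> \<alpha>" unfolding \<alpha>_def by (rule emeasure_eq_ennreal_measure, use A2 in auto)
    define W where "W = (\<integral>\<^sup>+\<xi>. ennreal ((norm (ft f \<xi>))\<^sup>2) * indicator (- A) \<xi> \<partial>lborel)"
    show ?thesis
    proof (cases "W = \<infinity>")
      case True
      have "0 < C * \<sigma> * exp (C * \<sigma> * measure lborel A)" using C \<sigma> by simp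
      then show ?thesis using True unfolding W_def[symmetric] using C \<sigma> by (auto simp: ennreal_mult_top)
    next
      case False
      then obtain w where w: "W = ennreal w" "0 \<le> w" by (cases W) auto
      \<comment> \<open>\<eta> keeps the weight \<open>b\<close> finite when the energy
        \<open>w\<close> outside \<open>A\<close> is 0; it tends to 0 at the end.\<close>
      have eta: "(norm (ft f y))\<^sup>2 \<le> 4 * exp (4 * L + 4 * L * C3 * \<sigma> * \<alpha>) * (2 * C3 * \<sigma> * w + \<eta>)" if \<eta>: "0 < \<eta>" for \<eta>
      proof -
        \<comment> \<open>The weights make the expected number of points in \<open>A\<close> and the
          expected energy outside \<open>A\<close> contribute less than 1/2 each. Hence some
          \<open>u\<close> keeps the weighted sum \<open>S u\<close> at most 1, which bounds both
          quantities at once.\<close>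
        define a where "a = 1 / (2 * C3 * \<sigma> * \<alpha> + 1)"
        define b where "b = 1 / (2 * C3 * \<sigma> * w + \<eta>)"
        have pa: "0 < 2 * C3 * \<sigma> * \<alpha> + 1" using C3 \<sigma> \<alpha> by (intro add_nonneg_pos) auto
        have pb: "0 < 2 * C3 * \<sigma> * w + \<eta>" using C3 \<sigma> w \<eta> by (intro add_nonneg_pos) auto
        have a: "0 < a" "C3 * \<sigma> * (a * \<alpha>) < 1 / 2" using pa by (auto simp: a_def field_simps)
        have b: "0 < b" "C3 * \<sigma> * (b * w) < 1 / 2" using pb \<eta> by (auto simp: b_def field_simps)
        \<comment> \<open>\<open>D\<close> bounds the determinant of \<open>mat 1 + u\<close>, so
          this dilation makes the covolume at most \<open>1 / (2 * \<sigma>)\<close>.\<close>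
        define l where "l = root CARD('n) (1 / (2 * D * \<sigma>))"
        have l: "0 < l" "l ^ CARD('n) = 1 / (2 * D * \<sigma>)" using D \<sigma> by (auto simp: l_def)
        define \<psi> where "\<psi> x = ennreal a * indicator A x + ennreal b * (ennreal ((norm (ft f x))\<^sup>2) * indicator (- A) x)" for x
        have [measurable]: "\<psi> \<in> borel_measurable borel" unfolding \<psi>_def by measurable
        define \<phi> where "\<phi> x = \<psi> (y + l *\<^sub>R x)" for x
        have [measurable]: "\<phi> \<in> borel_measurable borel" unfolding \<phi>_def by measurable
        have "(\<integral>\<^sup>+x. \<psi> x \<partial>lborel) = ennreal a * ennreal \<alpha> + ennreal b * ennreal w"
          unfolding \<psi>_def by (subst nn_integral_add) (auto simp: nn_integral_cmult \<alpha> w(1)[symmetric] W_def)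
        also have "\<dots> = ennreal (a * \<alpha> + b * w)" using a b \<alpha> w by (simp add: ennreal_mult)
        finally have "(\<integral>\<^sup>+x. \<phi> x \<partial>lborel) = ennreal (inverse (\<bar>l\<bar> ^ CARD('n))) * ennreal (a * \<alpha> + b * w)"
          unfolding \<phi>_def using l by (subst nn_integral_affine') auto
        also have "\<dots> = ennreal (2 * D * \<sigma> * (a * \<alpha> + b * w))"
        proof -
          have "inverse (\<bar>l\<bar> ^ CARD('n)) = 2 * D * \<sigma>" using l by simp
          moreover have "ennreal (2 * D * \<sigma>) * ennreal (a * \<alpha> + b * w) = ennreal (2 * D * \<sigma> * (a * \<alpha> + b * w))"
            using D \<sigma> a b \<alpha> w by (intro ennreal_mult[symmetric]) auto
          ultimately show ?thesis by (simp only:)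
        qed
        finally have int_phi: "(\<integral>\<^sup>+x. \<phi> x \<partial>lborel) = ennreal (2 * D * \<sigma> * (a * \<alpha> + b * w))" .
        define S where "S u = (\<integral>\<^sup>+k. \<phi> (ivec k + u *v ivec k) * indicator (- {0}) k \<partial>count_space UNIV)" for u
        have "\<exists>u\<in>U. S u \<le> 1"
        proof (rule ccontr)
          assume neg: "\<not> (\<exists>u\<in>U. S u \<le> 1)"
          have "ennreal V = (\<integral>\<^sup>+u. indicator U u \<partial>lborel)" using V by simp
          also have "\<dots> \<le> (\<integral>\<^sup>+u. S u * indicator U u \<partial>lborel)"
            using neg by (intro nn_integral_mono) (auto simp: indicator_def not_le less_imp_le)
          also have "\<dots> \<le> ennreal C2 * (\<integral>\<^sup>+x. \<phi> x \<partial>lborel)"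
            unfolding S_def U_def by (rule C2(2)) simp
          also have "\<dots> = ennreal (C2 * (2 * D * \<sigma> * (a * \<alpha> + b * w)))"
            unfolding int_phi using C2 D \<sigma> a b \<alpha> w by (simp add: ennreal_mult[symmetric])
          also have "C2 * (2 * D * \<sigma> * (a * \<alpha> + b * w)) = V * (C3 * \<sigma> * (a * \<alpha>) + C3 * \<sigma> * (b * w))"
            using V by (simp add: C3_def field_simps)
          finally have "V \<le> V * (C3 * \<sigma> * (a * \<alpha>) + C3 * \<sigma> * (b * w))"
            using C3 \<sigma> a b \<alpha> w V by (subst (asm) ennreal_le_iff) auto
          moreover have "V * (C3 * \<sigma> * (a * \<alpha>) + C3 * \<sigma> * (b * w)) < V * 1"
            using a b V by (intro mult_strict_left_mono) auto
          ultimately show False by simp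
        qed
        then obtain u where u: "u \<in> U" "S u \<le> 1" by blast
        define T where "T = l *\<^sub>R (mat 1 + u)"
        have T_apply: "T *v x = l *\<^sub>R (x + u *v x)" for x
          by (simp add: T_def scaleR_matrix_vector_assoc[symmetric] matrix_vector_mult_add_rdistrib)
        have detT: "det T = l ^ CARD('n) * det (mat 1 + u)"
        proof -
          have "T = (\<chi> i. l *s ((mat 1 + u) $ i))" by (simp add: T_def vec_eq_iff distrib_left)
          then show ?thesis by (simp only: det_rows_mul prod_constant vec_lambda_eta)
        qed
        have dT: "det T \<noteq> 0" "\<bar>det T\<bar> \<le> 1 / (2 * \<sigma>)"
        proof -
          show "det T \<noteq> 0" unfolding detT using l D \<sigma> det_perturbed_identity(1)[of u] u by (simp add: U_def)
          have "\<bar>det T\<bar> = l ^ CARD('n) * \<bar>det (mat 1 + u)\<bar>" unfolding detT abs_mult using l(1) by simp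
          also have "\<dots> \<le> l ^ CARD('n) * D"
            unfolding D_def using l(1) det_perturbed_identity(2)[of u] u by (intro mult_left_mono) (auto simp: U_def)
          also have "\<dots> = 1 / (2 * \<sigma>)" unfolding l(2) using D by simp
          finally show "\<bar>det T\<bar> \<le> 1 / (2 * \<sigma>)" .
        qed
        define K where "K = {k :: int ^ 'n. k \<noteq> 0 \<and> y + T *v ivec k \<in> A}"
        have phiT: "\<phi> (ivec k + u *v ivec k) = \<psi> (y + T *v ivec k)" for k
          by (simp add: \<phi>_def T_apply)
        have "(\<integral>\<^sup>+k. ennreal a * indicator K k \<partial>count_space UNIV) \<le> S u"
          unfolding S_def phiT by (intro nn_integral_mono) (auto simp: K_def \<psi>_def indicator_def)
        then have "(\<integral>\<^sup>+k. ennreal a * indicator K k \<partial>count_space UNIV) \<le> 1" using u(2) by (rule order_trans)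
        then have K: "finite K" "real (card K) \<le> 1 / a"
          using finite_card_of_weighted_count[OF a(1), of K] by auto
        define M where "M = insert 0 K"
        have M: "finite M" "0 \<in> M" using K by (auto simp: M_def)
        have cM: "real (card M) \<le> 2 + 2 * C3 * \<sigma> * \<alpha>"
        proof -
          have "card M \<le> Suc (card K)" unfolding M_def by (rule card_insert_le_m1) (auto simp: card_insert_if K)
          then have "real (card M) \<le> 1 + 1 / a" using K(2) by linarith
          then show ?thesis by (simp add: a_def)
        qed
        define X where "X = (\<integral>\<^sup>+k. ennreal ((norm (ft f (y + T *v ivec k)))\<^sup>2) * indicator (- M) k \<partial>count_space UNIV)"
        have "ennreal b * X \<le> S u"
          unfolding S_def phiT X_def
          by (subst nn_integral_cmult[symmetric]) (auto intro!: nn_integral_mono simp: M_def K_def \<psi>_def indicator_def)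
        then have bX: "ennreal b * X \<le> 1" using u(2) by (rule order_trans)
        have X: "X \<le> ennreal (2 * C3 * \<sigma> * w + \<eta>)"
        proof -
          have "X = ennreal (1 / b) * (ennreal b * X)"
            using b by (simp flip: mult.assoc ennreal_mult)
          also have "\<dots> \<le> ennreal (1 / b) * 1" by (intro mult_left_mono bX) auto
          finally show ?thesis by (simp add: b_def)
        qed
        have "ennreal \<bar>det T\<bar> * emeasure lborel {x. f x \<noteq> 0} \<le> ennreal (1 / (2 * \<sigma>)) * ennreal \<sigma>"
          by (intro mult_mono ennreal_leI dT supp) auto
        also have "\<dots> = ennreal (1 / 2)" using \<sigma> by (simp flip: ennreal_mult)
        finally have sm: "ennreal \<bar>det T\<bar> * emeasure lborel {x. f x \<noteq> 0} \<le> ennreal (1 / 2)" .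
        have "ennreal ((norm (ft f y))\<^sup>2) \<le> ennreal (4 * turan_base ^ (2 * card M)) * X"
          unfolding X_def by (rule affine_lattice_bound[OF f dT(1) sm M])
        also have "\<dots> \<le> ennreal (4 * turan_base ^ (2 * card M)) * ennreal (2 * C3 * \<sigma> * w + \<eta>)"
          by (intro mult_left_mono X) auto
        also have "\<dots> = ennreal (4 * turan_base ^ (2 * card M) * (2 * C3 * \<sigma> * w + \<eta>))"
          using pb turan_base_ge_1 by (simp add: ennreal_mult)
        finally have "(norm (ft f y))\<^sup>2 \<le> 4 * turan_base ^ (2 * card M) * (2 * C3 * \<sigma> * w + \<eta>)"
          using pb turan_base_ge_1 by (subst (asm) ennreal_le_iff) auto
        also have "\<dots> \<le> 4 * exp (4 * L + 4 * L * C3 * \<sigma> * \<alpha>) * (2 * C3 * \<sigma> * w + \<eta>)"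
        proof (intro mult_right_mono mult_left_mono)
          have "turan_base = exp L" using turan_base_ge_1 by (simp add: L_def)
          then have "turan_base ^ (2 * card M) = exp (real (2 * card M) * L)" by (simp only: exp_of_nat_mult)
          also have "\<dots> \<le> exp (4 * L + 4 * L * C3 * \<sigma> * \<alpha>)"
            using mult_left_mono[OF cM L] by (simp add: algebra_simps)
          finally show "turan_base ^ (2 * card M) \<le> exp (4 * L + 4 * L * C3 * \<sigma> * \<alpha>)" .
        qed (use pb in auto)
        finally show ?thesis .
      qed
      have "(norm (ft f y))\<^sup>2 \<le> 4 * exp (4 * L + 4 * L * C3 * \<sigma> * \<alpha>) * (2 * C3 * \<sigma> * w)"
      proof (rule field_le_epsilon)
        fix e :: real assume e: "0 < e"
        define E where "E = 4 * exp (4 * L + 4 * L * C3 * \<sigma> * \<alpha>)"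
        have E: "0 < E" by (simp add: E_def)
        have "(norm (ft f y))\<^sup>2 \<le> E * (2 * C3 * \<sigma> * w + e / E)"
          unfolding E_def by (rule eta) (use e in simp)
        also have "\<dots> = E * (2 * C3 * \<sigma> * w) + e" using E by (simp add: distrib_left)
        finally show "(norm (ft f y))\<^sup>2 \<le> 4 * exp (4 * L + 4 * L * C3 * \<sigma> * \<alpha>) * (2 * C3 * \<sigma> * w) + e"
          unfolding E_def .
      qed
      also have "\<dots> = (8 * C3 * exp (4 * L)) * \<sigma> * exp ((4 * L * C3) * \<sigma> * \<alpha>) * w"
        by (simp add: exp_add)
      also have "\<dots> \<le> C * \<sigma> * exp (C * \<sigma> * \<alpha>) * w"
      proof -
        have "exp ((4 * L * C3) * \<sigma> * \<alpha>) \<le> exp (C * \<sigma> * \<alpha>)"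
          using C \<sigma> \<alpha> by (simp add: mult_right_mono)
        then show ?thesis using C C3 \<sigma> w by (intro mult_mono mult_nonneg_nonneg) auto
      qed
      finally have "ennreal ((norm (ft f y))\<^sup>2) \<le> ennreal (C * \<sigma> * exp (C * \<sigma> * \<alpha>) * w)"
        by (rule ennreal_leI)
      then show ?thesis
        unfolding W_def[symmetric] w(1) \<alpha>_def[symmetric] using C \<sigma> w by (simp add: ennreal_mult)
    qed
  qed
  show ?thesis using C(1) main by blast
qed

section \<open>The Plancherel theorem and Nazarov's uncertainty principle\<close>

definition l2 :: "'a measure \<Rightarrow> ('a \<Rightarrow> complex) \<Rightarrow> ennreal" where
  "l2 M f = (\<integral>\<^sup>+x. ennreal ((norm (f x))\<^sup>2) \<partial>M)"

definition sq_int :: "'a measure \<Rightarrow> ('a \<Rightarrow> complex) \<Rightarrow> bool" where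
  "sq_int M f \<longleftrightarrow> f \<in> borel_measurable M \<and> l2 M f < \<infinity>"

definition l2norm :: "'a measure \<Rightarrow> ('a \<Rightarrow> complex) \<Rightarrow> real" where
  "l2norm M f = sqrt (enn2real (l2 M f))"

lemma sq_int_measurable [measurable_dest]: "sq_int M f \<Longrightarrow> f \<in> borel_measurable M"
  by (simp add: sq_int_def)

lemma l2norm_nonneg [simp]: "0 \<le> l2norm M f"
  by (simp add: l2norm_def)

lemma l2_eq_l2norm: "sq_int M f \<Longrightarrow> l2 M f = ennreal ((l2norm M f)\<^sup>2)"
  by (simp add: sq_int_def l2norm_def)

text \<open>The free parameter \<open>s\<close> balances the cross term;
  \<open>l2norm_triangle\<close> optimizes it after integration.\<close>

lemma norm_add_sq_le:
  fixes a b :: complex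
  assumes s: "0 < s"
  shows "(norm (a + b))\<^sup>2 \<le> (1 + s) * (norm a)\<^sup>2 + (1 + 1 / s) * (norm b)\<^sup>2"
proof -
  have "(norm (a + b))\<^sup>2 \<le> (norm a + norm b)\<^sup>2" by (intro power_mono norm_triangle_ineq) auto
  also have "\<dots> = (norm a)\<^sup>2 + 2 * (norm a * norm b) + (norm b)\<^sup>2" by (simp add: power2_sum)
  also have "2 * (norm a * norm b) \<le> s * (norm a)\<^sup>2 + 1 / s * (norm b)\<^sup>2"
  proof -
    have "0 \<le> (s * norm a - norm b)\<^sup>2 / s" using s by simp
    also have "\<dots> = s * (norm a)\<^sup>2 - 2 * (norm a * norm b) + 1 / s * (norm b)\<^sup>2"
      using s by (simp add: power2_eq_square field_simps)
    finally show ?thesis by simp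
  qed
  finally show ?thesis by (simp add: algebra_simps)
qed

lemma l2_add_le:
  assumes [measurable]: "f \<in> borel_measurable M" "g \<in> borel_measurable M" and s: "0 < s"
  shows "l2 M (\<lambda>x. f x + g x) \<le> ennreal (1 + s) * l2 M f + ennreal (1 + 1 / s) * l2 M g"
proof -
  have "l2 M (\<lambda>x. f x + g x) \<le> (\<integral>\<^sup>+x. ennreal (1 + s) * ennreal ((norm (f x))\<^sup>2) + ennreal (1 + 1 / s) * ennreal ((norm (g x))\<^sup>2) \<partial>M)"
    unfolding l2_def
  proof (rule nn_integral_mono)
    fix x
    have "ennreal ((norm (f x + g x))\<^sup>2) \<le> ennreal ((1 + s) * (norm (f x))\<^sup>2 + (1 + 1 / s) * (norm (g x))\<^sup>2)"
      using norm_add_sq_le[OF s] by (rule ennreal_leI)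
    also have "\<dots> = ennreal ((1 + s) * (norm (f x))\<^sup>2) + ennreal ((1 + 1 / s) * (norm (g x))\<^sup>2)"
      using s by (intro ennreal_plus) auto
    also have "\<dots> = ennreal (1 + s) * ennreal ((norm (f x))\<^sup>2) + ennreal (1 + 1 / s) * ennreal ((norm (g x))\<^sup>2)"
      using s by (intro arg_cong2[where f = "(+)"] ennreal_mult) auto
    finally show "ennreal ((norm (f x + g x))\<^sup>2) \<le> ennreal (1 + s) * ennreal ((norm (f x))\<^sup>2) + ennreal (1 + 1 / s) * ennreal ((norm (g x))\<^sup>2)" .
  qed
  also have "\<dots> = ennreal (1 + s) * l2 M f + ennreal (1 + 1 / s) * l2 M g"
    unfolding l2_def by (subst nn_integral_add) (auto simp: nn_integral_cmult)
  finally show ?thesis .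
qed

lemma l2_cmult: "f \<in> borel_measurable M \<Longrightarrow> l2 M (\<lambda>x. c * f x) = ennreal ((norm c)\<^sup>2) * l2 M f"
  unfolding l2_def by (subst nn_integral_cmult[symmetric]) (auto simp: norm_mult power_mult_distrib ennreal_mult)

lemma l2_diff_commute: "l2 M (\<lambda>x. f x - g x) = l2 M (\<lambda>x. g x - f x)"
  by (simp add: l2_def norm_minus_commute)

lemma sq_int_add:
  assumes "sq_int M f" "sq_int M g" shows "sq_int M (\<lambda>x. f x + g x)"
proof -
  have "l2 M (\<lambda>x. f x + g x) \<le> ennreal (1 + 1) * l2 M f + ennreal (1 + 1 / 1) * l2 M g"
    using assms by (intro l2_add_le) (auto simp: sq_int_def)
  also have "\<dots> < \<infinity>" using assms by (auto simp: sq_int_def ennreal_mult_less_top)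
  finally show ?thesis using assms by (auto simp: sq_int_def)
qed

lemma sq_int_cmult: "sq_int M f \<Longrightarrow> sq_int M (\<lambda>x. c * f x)"
  by (auto simp: sq_int_def l2_cmult ennreal_mult_less_top)

lemma sq_int_diff: "sq_int M f \<Longrightarrow> sq_int M g \<Longrightarrow> sq_int M (\<lambda>x. f x - g x)"
  using sq_int_add[of M f "\<lambda>x. (-1) * g x"] sq_int_cmult[of M g "-1"] by simp

text \<open>In \<open>l2_add_le\<close> the choice s = v / u turns the right-hand side into (u +
  v)^2. If one of the norms is 0 this quotient degenerates, and a very large or very small
  \<open>s\<close> makes the other term as small as desired.\<close>

lemma l2norm_triangle:
  assumes f: "sq_int M f" and g: "sq_int M g"
  shows "l2norm M (\<lambda>x. f x + g x) \<le> l2norm M f + l2norm M g"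
proof -
  define a where "a = (l2norm M (\<lambda>x. f x + g x))\<^sup>2"
  define u where "u = l2norm M f"
  define v where "v = l2norm M g"
  have uv: "0 \<le> u" "0 \<le> v" by (auto simp: u_def v_def)
  have ineq: "a \<le> (1 + s) * u\<^sup>2 + (1 + 1 / s) * v\<^sup>2" if s: "0 < s" for s
  proof -
    have "ennreal a \<le> ennreal (1 + s) * ennreal (u\<^sup>2) + ennreal (1 + 1 / s) * ennreal (v\<^sup>2)"
      using l2_add_le[of f M g s] f g s
      unfolding a_def u_def v_def by (simp add: l2_eq_l2norm[symmetric] sq_int_add sq_int_measurable)
    also have "\<dots> = ennreal ((1 + s) * u\<^sup>2 + (1 + 1 / s) * v\<^sup>2)"
      using s by (subst ennreal_plus) (auto simp: ennreal_mult)
    finally show ?thesis using s by (subst (asm) ennreal_le_iff) auto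
  qed
  have "a \<le> (u + v)\<^sup>2"
  proof (cases "u = 0 \<or> v = 0")
    case True
    show ?thesis
    proof (rule field_le_epsilon)
      fix e :: real assume e: "0 < e"
      define s where "s = (if u = 0 then (v\<^sup>2 + 1) / e else e / (u\<^sup>2 + 1))"
      have pos: "0 < v\<^sup>2 + 1" "0 < u\<^sup>2 + 1" by (auto intro: add_nonneg_pos)
      then have s: "0 < s" using e by (simp add: s_def)
      show "a \<le> (u + v)\<^sup>2 + e"
      proof (cases "u = 0")
        case True
        have "1 / s * v\<^sup>2 \<le> e" using e pos True by (simp add: s_def field_simps)
        then show ?thesis using ineq[OF s] True by (simp add: algebra_simps)
      next
        case False
        then have v: "v = 0" using \<open>u = 0 \<or> v = 0\<close> by simp
        have "s * u\<^sup>2 \<le> e" using e pos False by (simp add: s_def field_simps)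
        then show ?thesis using ineq[OF s] v by (simp add: algebra_simps)
      qed
    qed
  next
    case False
    then have "0 < u" "0 < v" using uv by auto
    then have "(1 + v / u) * u\<^sup>2 + (1 + 1 / (v / u)) * v\<^sup>2 = (u + v)\<^sup>2"
      by (simp add: power2_eq_square field_simps)
    then show ?thesis using ineq[of "v / u"] \<open>0 < u\<close> \<open>0 < v\<close> by simp
  qed
  then have "sqrt a \<le> sqrt ((u + v)\<^sup>2)" by (rule real_sqrt_le_mono)
  then show ?thesis using uv by (simp add: a_def u_def v_def)
qed

lemma l2norm_diff_commute: "l2norm M (\<lambda>x. f x - g x) = l2norm M (\<lambda>x. g x - f x)"
  unfolding l2norm_def l2_diff_commute[of M f g] ..

lemma l2norm_abs_diff_le:
  assumes f: "sq_int M f" and g: "sq_int M g"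
  shows "\<bar>l2norm M f - l2norm M g\<bar> \<le> l2norm M (\<lambda>x. f x - g x)"
proof -
  have "l2norm M f \<le> l2norm M (\<lambda>x. f x - g x) + l2norm M g"
    using l2norm_triangle[OF sq_int_diff[OF f g] g] by simp
  moreover have "l2norm M g \<le> l2norm M (\<lambda>x. g x - f x) + l2norm M f"
    using l2norm_triangle[OF sq_int_diff[OF g f] f] by simp
  ultimately show ?thesis using l2norm_diff_commute[of M f g] by simp
qed

lemma l2norm_tendsto:
  assumes F: "\<And>k. sq_int M (F k)" and f: "sq_int M f" and lim: "(\<lambda>k. l2norm M (\<lambda>x. F k x - f x)) \<longlonglongrightarrow> 0"
  shows "(\<lambda>k. l2norm M (F k)) \<longlonglongrightarrow> l2norm M f"
proof -
  have "(\<lambda>k. l2norm M (F k) - l2norm M f) \<longlonglongrightarrow> 0"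
    by (rule Lim_null_comparison[OF _ lim]) (use l2norm_abs_diff_le[OF F f] in auto)
  then show ?thesis by (simp add: LIM_zero_iff)
qed

lemma l2_tendsto_iff:
  assumes "\<And>k. sq_int M (F k)"
  shows "(\<lambda>k. l2 M (F k)) \<longlonglongrightarrow> 0 \<longleftrightarrow> (\<lambda>k. l2norm M (F k)) \<longlonglongrightarrow> 0"
proof -
  have "(\<lambda>k. l2 M (F k)) \<longlonglongrightarrow> 0 \<longleftrightarrow> (\<lambda>k. ennreal ((l2norm M (F k))\<^sup>2)) \<longlonglongrightarrow> ennreal 0"
    using assms by (simp add: l2_eq_l2norm)
  also have "\<dots> \<longleftrightarrow> (\<lambda>k. (l2norm M (F k))\<^sup>2) \<longlonglongrightarrow> 0"
    by (rule tendsto_ennreal_iff) auto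
  also have "\<dots> \<longleftrightarrow> (\<lambda>k. l2norm M (F k)) \<longlonglongrightarrow> 0"
  proof
    assume "(\<lambda>k. (l2norm M (F k))\<^sup>2) \<longlonglongrightarrow> 0"
    then have "(\<lambda>k. sqrt ((l2norm M (F k))\<^sup>2)) \<longlonglongrightarrow> sqrt 0" by (rule tendsto_real_sqrt)
    then show "(\<lambda>k. l2norm M (F k)) \<longlonglongrightarrow> 0" by simp
  next
    assume "(\<lambda>k. l2norm M (F k)) \<longlonglongrightarrow> 0"
    then have "(\<lambda>k. (l2norm M (F k))\<^sup>2) \<longlonglongrightarrow> 0\<^sup>2" by (rule tendsto_power)
    then show "(\<lambda>k. (l2norm M (F k))\<^sup>2) \<longlonglongrightarrow> 0" by simp
  qed
  finally show ?thesis .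
qed

section \<open>The Plancherel theorem for integrable functions\<close>

lemma integral_affine:
  fixes f :: "real ^ 'n \<Rightarrow> complex"
  assumes [measurable]: "f \<in> borel_measurable borel" and c: "0 < c"
  shows "(LINT x|lborel. f x) = of_real (c ^ CARD('n)) * (LINT x|lborel. f (t + c *\<^sub>R x))"
proof -
  have "c \<noteq> 0" using c by simp
  then show ?thesis
    using c by (subst lborel_affine[of c t]) (simp_all add: integral_density integral_distr scaleR_conv_of_real[where 'a = complex])
qed

text \<open>For every shift \<open>t\<close>, Parseval applied to a modulation of \<open>f\<close>
  evaluates the sum of |ft f|^2 over the shifted integer lattice, with the same value for all
  \<open>t\<close>. Integration over \<open>t\<close> in the cube covers the whole frequency
  space.\<close>

lemma plancherel_cube:
  fixes f :: "real ^ 'n \<Rightarrow> complex"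
  assumes f: "bounded_borel f" and supp: "{x. f x \<noteq> 0} \<subseteq> unit_cube"
  shows "l2 lborel (ft f) = l2 lborel f"
proof -
  have [measurable]: "f \<in> borel_measurable borel" using f by (rule bounded_borel_measurable)
  have inner: "(\<integral>\<^sup>+k. ennreal ((norm (ft f (t + ivec k)))\<^sup>2) \<partial>count_space UNIV) = l2 lborel f" for t
  proof -
    define g where "g x = f x * cnj (ee (t \<bullet> x))" for x
    have g: "bounded_borel g" unfolding g_def by (intro bounded_borel_mult f bounded_borel_cnj bounded_borel_ee)
    have ind: "indicator unit_cube x *\<^sub>R (g x * z) = g x * z" for x z
      using supp by (auto simp: indicator_def g_def)
    have "fcoef g k = ft f (t + ivec k)" for k
    proof -
      have "fcoef g k = (LINT x|lborel. indicator unit_cube x *\<^sub>R (g x * cnj (ee (ivec k \<bullet> x))))"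
        unfolding fcoef_def cubeM_def by (rule integral_restrict_space) simp
      then show ?thesis unfolding ind by (simp add: ft_def g_def inner_add_left ee_add mult.assoc)
    qed
    then have "(\<integral>\<^sup>+k. ennreal ((norm (ft f (t + ivec k)))\<^sup>2) \<partial>count_space UNIV) = (\<integral>\<^sup>+x. ennreal ((norm (g x))\<^sup>2) \<partial>cubeM)"
      using parseval_cube[OF g] by simp
    also have "\<dots> = l2 lborel f"
      unfolding nn_integral_cubeM l2_def
      using supp by (intro nn_integral_cong) (auto simp: g_def norm_mult indicator_def)
    finally show ?thesis .
  qed
  have "l2 lborel (ft f) = (\<integral>\<^sup>+t. (\<integral>\<^sup>+k. ennreal ((norm (ft f (t + ivec k)))\<^sup>2) \<partial>count_space UNIV) * indicator unit_cube t \<partial>lborel)"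
    unfolding l2_def by (rule nn_integral_tile) simp
  also have "\<dots> = l2 lborel f" unfolding inner by (simp add: nn_integral_cmult)
  finally show ?thesis .
qed

text \<open>An affine substitution moves the support into the unit cube, and both sides scale by the
  same factor.\<close>

lemma plancherel_bounded:
  fixes f :: "real ^ 'n \<Rightarrow> complex"
  assumes f: "bounded_borel f" and supp: "bounded {x. f x \<noteq> 0}"
  shows "l2 lborel (ft f) = l2 lborel f"
proof -
  have [measurable]: "f \<in> borel_measurable borel" using f by (rule bounded_borel_measurable)
  obtain R0 where R0: "\<And>x. f x \<noteq> 0 \<Longrightarrow> norm x \<le> R0" using supp unfolding bounded_iff by blast
  define R where "R = \<bar>R0\<bar>"
  have R: "0 \<le> R" "\<And>x. f x \<noteq> 0 \<Longrightarrow> norm x \<le> R" using order_trans[OF R0 abs_ge_self] by (auto simp: R_def)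
  \<comment> \<open>The extra 1 gives \<open>c > 0\<close> and keeps the rescaled support off the
    upper faces of the half-open cube.\<close>
  define c where "c = 2 * R + 1"
  have c: "0 < c" using R by (simp add: c_def)
  define t :: "real ^ 'n" where "t = (\<chi> i. - R)"
  define F where "F x = f (t + c *\<^sub>R x)" for x
  have [measurable]: "F \<in> borel_measurable borel" unfolding F_def by measurable
  have F: "bounded_borel F" using f unfolding bounded_borel_def F_def by auto
  have Fs: "{x. F x \<noteq> 0} \<subseteq> unit_cube"
  proof
    fix x assume "x \<in> {x. F x \<noteq> 0}"
    then have "norm (t + c *\<^sub>R x) \<le> R" using R by (simp add: F_def)
    then have "\<bar>(t + c *\<^sub>R x) $ i\<bar> \<le> R" for i using component_le_norm_cart[of "t + c *\<^sub>R x" i] by linarith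
    then have "\<bar>c * x $ i - R\<bar> \<le> R" for i by (simp add: t_def)
    then have *: "0 \<le> c * x $ i" "c * x $ i < c * 1" for i
      by (auto simp: abs_le_iff c_def intro: le_less_trans) (smt (verit))+
    show "x \<in> unit_cube" unfolding unit_cube_def
    proof (intro CollectI allI conjI)
      fix i
      show "0 \<le> x $ i" using *(1)[of i] c by (simp add: zero_le_mult_iff)
      show "x $ i < 1" using *(2)[of i] c by (simp only: mult_less_cancel_left_pos)
    qed
  qed
  have ftF: "norm (ft F \<xi>) = norm (ft f (0 + inverse c *\<^sub>R \<xi>)) * inverse (c ^ CARD('n))" for \<xi>
  proof -
    define z where "z = inverse c *\<^sub>R \<xi>"
    have "ft f z = of_real (c ^ CARD('n)) * (LINT x|lborel. f (t + c *\<^sub>R x) * cnj (ee (z \<bullet> (t + c *\<^sub>R x))))"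
      unfolding ft_def by (rule integral_affine[OF _ c]) measurable
    also have "(LINT x|lborel. f (t + c *\<^sub>R x) * cnj (ee (z \<bullet> (t + c *\<^sub>R x)))) = cnj (ee (z \<bullet> t)) * ft F \<xi>"
    proof -
      have "f (t + c *\<^sub>R x) * cnj (ee (z \<bullet> (t + c *\<^sub>R x))) = cnj (ee (z \<bullet> t)) * (F x * cnj (ee (\<xi> \<bullet> x)))" for x
      proof -
        have "z \<bullet> (t + c *\<^sub>R x) = z \<bullet> t + \<xi> \<bullet> x"
          using c by (simp add: z_def inner_add_right field_simps)
        then show ?thesis by (simp add: F_def ee_add mult_ac)
      qed
      then show ?thesis unfolding ft_def by simp
    qed
    finally have "norm (ft f z) = c ^ CARD('n) * norm (ft F \<xi>)" using c by (simp add: norm_mult norm_power)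
    then show ?thesis using c by (simp add: z_def field_simps)
  qed
  define d where "d = c ^ CARD('n)"
  have d: "0 < d" using c by (simp add: d_def)
  have "l2 lborel (ft F) = (\<integral>\<^sup>+\<xi>. ennreal ((inverse d)\<^sup>2) * ennreal ((norm (ft f (0 + inverse c *\<^sub>R \<xi>)))\<^sup>2) \<partial>lborel)"
    unfolding l2_def ftF d_def[symmetric] by (simp add: power_mult_distrib ennreal_mult mult.commute)
  also have "\<dots> = ennreal ((inverse d)\<^sup>2) * (\<integral>\<^sup>+\<xi>. ennreal ((norm (ft f (0 + inverse c *\<^sub>R \<xi>)))\<^sup>2) \<partial>lborel)"
    by (rule nn_integral_cmult) measurable
  also have "(\<integral>\<^sup>+\<xi>. ennreal ((norm (ft f (0 + inverse c *\<^sub>R \<xi>)))\<^sup>2) \<partial>lborel) = ennreal (inverse (\<bar>inverse c\<bar> ^ CARD('n))) * l2 lborel (ft f)"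
    unfolding l2_def by (rule nn_integral_affine'[of "\<lambda>\<xi>. ennreal ((norm (ft f \<xi>))\<^sup>2)"]) (use c in auto)
  also have "inverse (\<bar>inverse c\<bar> ^ CARD('n)) = d" using c by (simp add: d_def power_inverse)
  finally have 1: "l2 lborel (ft F) = ennreal ((inverse d)\<^sup>2) * (ennreal d * l2 lborel (ft f))" .
  have "l2 lborel F = ennreal (inverse (\<bar>c\<bar> ^ CARD('n))) * l2 lborel f"
    unfolding l2_def F_def by (rule nn_integral_affine'[of "\<lambda>\<xi>. ennreal ((norm (f \<xi>))\<^sup>2)"]) (use c in auto)
  then have 2: "l2 lborel F = ennreal (inverse d) * l2 lborel f" using c by (simp add: d_def)
  have "ennreal (inverse d) * l2 lborel (ft f) = ennreal (inverse d) * l2 lborel f"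
  proof -
    have "ennreal ((inverse d)\<^sup>2) * ennreal d = ennreal (inverse d)"
      using d by (simp add: power2_eq_square flip: ennreal_mult)
    then show ?thesis using plancherel_cube[OF F Fs] unfolding 1 2 by (simp flip: mult.assoc)
  qed
  then have "ennreal d * (ennreal (inverse d) * l2 lborel (ft f)) = ennreal d * (ennreal (inverse d) * l2 lborel f)" by simp
  moreover have "ennreal d * ennreal (inverse d) = 1" using d by (simp flip: ennreal_mult)
  ultimately show ?thesis by (simp flip: mult.assoc)
qed

section \<open>Truncation to bounded functions with bounded support\<close>

definition trunc :: "nat \<Rightarrow> (real ^ 'n \<Rightarrow> complex) \<Rightarrow> real ^ 'n \<Rightarrow> complex" where
  "trunc N f x = (if norm x \<le> real N \<and> norm (f x) \<le> real N then f x else 0)"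

lemma trunc_measurable [measurable]: "f \<in> borel_measurable borel \<Longrightarrow> trunc N f \<in> borel_measurable borel"
proof -
  assume f [measurable]: "f \<in> borel_measurable borel"
  have eq: "trunc N f = (\<lambda>x. indicator (cball 0 (real N)) x * (indicator (cball 0 (real N)) (f x) * f x))"
    by (auto simp: trunc_def indicator_def)
  have c1: "(indicator (cball 0 (real N)) :: real ^ 'n \<Rightarrow> complex) \<in> borel_measurable borel"
    by (intro borel_measurable_indicator) auto
  have c2: "(indicator (cball 0 (real N)) :: complex \<Rightarrow> complex) \<in> borel_measurable borel"
    by (intro borel_measurable_indicator) auto
  note [measurable] = c1 measurable_compose[OF f c2]
  show ?thesis unfolding eq by measurable
qed

lemma bounded_borel_trunc:
  "f \<in> borel_measurable borel \<Longrightarrow> bounded_borel (trunc N f)"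
  unfolding bounded_borel_def by (auto simp: trunc_def intro!: exI[of _ "real N"])

lemma bounded_support_trunc: "bounded {x. trunc N f x \<noteq> 0}"
  by (rule boundedI[of _ "real N"]) (auto simp: trunc_def split: if_splits)

lemma norm_trunc_le: "norm (trunc N f x) \<le> norm (f x)" "norm (f x - trunc N f x) \<le> norm (f x)"
  by (auto simp: trunc_def)

lemma trunc_eventually: "\<exists>N0. \<forall>N\<ge>N0. trunc N f x = f x"
proof -
  obtain N0 :: nat where "max (norm x) (norm (f x)) \<le> real N0" using real_arch_simple by blast
  then have "trunc N f x = f x" if "N0 \<le> N" for N using that by (auto simp: trunc_def)
  then show ?thesis by blast
qed

lemma trunc_tendsto: "(\<lambda>N. trunc N f x) \<longlonglongrightarrow> f x"
proof -
  obtain N0 where "\<forall>N\<ge>N0. trunc N f x = f x" using trunc_eventually[of f x] by blast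
  then show ?thesis by (intro tendsto_eventually eventually_sequentiallyI[of N0]) auto
qed

text \<open>With \<open>B = UNIV\<close> this is density of the truncations; with general
  \<open>B\<close> the limit is the energy outside \<open>B\<close> that occurs in the uncertainty
  principle.\<close>

lemma l2_trunc_tendsto:
  fixes f :: "real ^ 'n \<Rightarrow> complex"
  assumes f: "sq_int lborel f" and [measurable]: "B \<in> sets borel"
  shows "(\<lambda>N. l2 lborel (\<lambda>x. f x - indicator B x * trunc N f x)) \<longlonglongrightarrow> (\<integral>\<^sup>+x. ennreal ((norm (f x))\<^sup>2) * indicator (- B) x \<partial>lborel)"
  unfolding l2_def
proof (rule nn_integral_dominated_convergence[where w = "\<lambda>x. ennreal ((norm (f x))\<^sup>2)"])
  have [measurable]: "f \<in> borel_measurable borel" using f by (simp add: sq_int_def)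
  show "(\<lambda>x. ennreal ((norm (f x - indicator B x * trunc i f x))\<^sup>2)) \<in> borel_measurable lborel" for i by measurable
  show "(\<lambda>x. ennreal ((norm (f x))\<^sup>2) * indicator (- B) x) \<in> borel_measurable lborel" by measurable
  show "(\<lambda>x. ennreal ((norm (f x))\<^sup>2)) \<in> borel_measurable lborel" by measurable
  show "AE x in lborel. ennreal ((norm (f x - indicator B x * trunc j f x))\<^sup>2) \<le> ennreal ((norm (f x))\<^sup>2)" for j
    by (intro AE_I2 ennreal_leI power_mono) (auto simp: indicator_def norm_trunc_le)
  show "(\<integral>\<^sup>+x. ennreal ((norm (f x))\<^sup>2) \<partial>lborel) < \<infinity>" using f by (simp add: sq_int_def l2_def)
  show "AE x in lborel. (\<lambda>i. ennreal ((norm (f x - indicator B x * trunc i f x))\<^sup>2)) \<longlonglongrightarrow> ennreal ((norm (f x))\<^sup>2) * indicator (- B) x"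
  proof (intro AE_I2)
    fix x
    have "(\<lambda>i. ennreal ((norm (f x - indicator B x * trunc i f x))\<^sup>2)) \<longlonglongrightarrow> ennreal ((norm (f x - indicator B x * f x))\<^sup>2)"
      by (intro tendsto_intros trunc_tendsto)
    then show "(\<lambda>i. ennreal ((norm (f x - indicator B x * trunc i f x))\<^sup>2)) \<longlonglongrightarrow> ennreal ((norm (f x))\<^sup>2) * indicator (- B) x"
      by (cases "x \<in> B") auto
  qed
qed

lemma ft_diff:
  assumes f: "integrable lborel f" and g: "integrable lborel g"
  shows "ft (\<lambda>x. f x - g x) \<xi> = ft f \<xi> - ft g \<xi>"
proof -
  have "integrable lborel (\<lambda>x. h x * cnj (ee (\<xi> \<bullet> x)))" if "integrable lborel h" for h
    by (rule Bochner_Integration.integrable_bound[OF that]) (use that in \<open>auto simp: norm_mult\<close>)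
  then show ?thesis using f g by (simp add: ft_def left_diff_distrib)
qed

text \<open>Fatou's lemma along the truncations, whose transforms converge pointwise by dominated
  convergence. Only an inequality results, but it makes the transform continuous in L2, and
  \<open>plancherel\<close> turns it into an equality by continuity of the norm.\<close>

lemma ft_le_plancherel:
  fixes f :: "real ^ 'n \<Rightarrow> complex"
  assumes f: "integrable lborel f"
  shows "l2 lborel (ft f) \<le> l2 lborel f"
proof -
  have [measurable]: "f \<in> borel_measurable borel" using f by auto
  have lim: "(\<lambda>N. ft (trunc N f) \<xi>) \<longlonglongrightarrow> ft f \<xi>" for \<xi>
    unfolding ft_def
  proof (rule integral_dominated_convergence[where w = "\<lambda>x. norm (f x)"])
    show "integrable lborel (\<lambda>x. norm (f x))" using f by simp
  qed (auto simp: norm_mult norm_trunc_le intro!: tendsto_intros trunc_tendsto)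
  have "l2 lborel (ft f) = (\<integral>\<^sup>+\<xi>. liminf (\<lambda>N. ennreal ((norm (ft (trunc N f) \<xi>))\<^sup>2)) \<partial>lborel)"
    unfolding l2_def
  proof (rule nn_integral_cong)
    fix \<xi>
    have t: "(\<lambda>N. ennreal ((norm (ft (trunc N f) \<xi>))\<^sup>2)) \<longlonglongrightarrow> ennreal ((norm (ft f \<xi>))\<^sup>2)"
      by (intro tendsto_intros lim)
    show "ennreal ((norm (ft f \<xi>))\<^sup>2) = liminf (\<lambda>N. ennreal ((norm (ft (trunc N f) \<xi>))\<^sup>2))"
      using lim_imp_Liminf[OF sequentially_bot t] ..
  qed
  also have "\<dots> \<le> liminf (\<lambda>N. \<integral>\<^sup>+\<xi>. ennreal ((norm (ft (trunc N f) \<xi>))\<^sup>2) \<partial>lborel)"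
    by (rule nn_integral_liminf) measurable
  also have "\<dots> = liminf (\<lambda>N. l2 lborel (trunc N f))"
    unfolding l2_def[symmetric] by (simp add: plancherel_bounded bounded_borel_trunc bounded_support_trunc)
  also have "\<dots> \<le> l2 lborel f"
    unfolding l2_def
    by (intro Liminf_le) (auto intro!: always_eventually nn_integral_mono ennreal_leI power_mono simp: norm_trunc_le)
  finally show ?thesis .
qed

theorem plancherel:
  fixes f :: "real ^ 'n \<Rightarrow> complex"
  assumes f: "integrable lborel f" and f2: "sq_int lborel f"
  shows "sq_int lborel (ft f)" "l2 lborel (ft f) = l2 lborel f"
proof -
  have [measurable]: "f \<in> borel_measurable borel" using f by auto
  have ftm: "ft g \<in> borel_measurable lborel" if "integrable lborel g" for g :: "real ^ 'n \<Rightarrow> complex"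
    using ft_borel_measurable[of g] that by auto
  show ft2: "sq_int lborel (ft f)"
    using ft_le_plancherel[OF f] f2 ftm[OF f] unfolding sq_int_def by auto
  define F where "F N = trunc N f" for N
  have F: "integrable lborel (F N)" for N
    by (rule Bochner_Integration.integrable_bound[OF f]) (auto simp: F_def norm_trunc_le)
  have F2: "sq_int lborel (F N)" for N
  proof -
    have "l2 lborel (F N) \<le> l2 lborel f"
      unfolding l2_def by (intro nn_integral_mono ennreal_leI power_mono) (auto simp: F_def norm_trunc_le)
    then show ?thesis using f2 by (auto simp: sq_int_def F_def)
  qed
  have ftF2: "sq_int lborel (ft (F N))" for N
    using le_less_trans[OF ft_le_plancherel[OF F]] F2[of N] ftm[OF F] by (auto simp: sq_int_def)
  have "(\<lambda>N. l2 lborel (\<lambda>x. f x - F N x)) \<longlonglongrightarrow> 0"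
    using l2_trunc_tendsto[OF f2, of UNIV] by (simp add: F_def)
  then have t0: "(\<lambda>N. l2norm lborel (\<lambda>x. F N x - f x)) \<longlonglongrightarrow> 0"
    by (subst (asm) l2_tendsto_iff) (auto intro!: sq_int_diff f2 F2 simp: l2norm_diff_commute)
  have le: "l2norm lborel (\<lambda>\<xi>. ft (F N) \<xi> - ft f \<xi>) \<le> l2norm lborel (\<lambda>x. F N x - f x)" for N
  proof -
    have "l2 lborel (\<lambda>\<xi>. ft (F N) \<xi> - ft f \<xi>) \<le> l2 lborel (\<lambda>x. F N x - f x)"
    proof -
      have "ft (\<lambda>x. F N x - f x) = (\<lambda>\<xi>. ft (F N) \<xi> - ft f \<xi>)"
        by (rule ext) (rule ft_diff[OF F f])
      then show ?thesis using ft_le_plancherel[of "\<lambda>x. F N x - f x"] F f by simp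
    qed
    moreover have "l2 lborel (\<lambda>x. F N x - f x) < \<infinity>" using sq_int_diff[OF F2 f2] by (simp add: sq_int_def)
    ultimately show ?thesis unfolding l2norm_def by (simp add: enn2real_mono)
  qed
  have t1: "(\<lambda>N. l2norm lborel (\<lambda>\<xi>. ft (F N) \<xi> - ft f \<xi>)) \<longlonglongrightarrow> 0"
    by (rule Lim_null_comparison[OF _ t0]) (use le in auto)
  have u1: "(\<lambda>N. l2norm lborel (ft (F N))) \<longlonglongrightarrow> l2norm lborel (ft f)"
    by (rule l2norm_tendsto[OF ftF2 ft2 t1])
  have u2: "l2norm lborel (ft (F N)) = l2norm lborel (F N)" for N
    unfolding l2norm_def F_def by (simp add: plancherel_bounded bounded_borel_trunc bounded_support_trunc)
  have u3: "(\<lambda>N. l2norm lborel (F N)) \<longlonglongrightarrow> l2norm lborel f"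
    by (rule l2norm_tendsto[OF F2 f2 t0])
  have "l2norm lborel (ft f) = l2norm lborel f" by (rule LIMSEQ_unique[OF u1[unfolded u2] u3])
  then show "l2 lborel (ft f) = l2 lborel f" using ft2 f2 by (simp add: l2_eq_l2norm)
qed

text \<open>For the part \<open>f N\<close> of \<open>g\<close> in \<open>B\<close>, the pointwise
  bound integrated over \<open>A\<close> controls the energy of the transform in \<open>A\<close> by
  that outside, and Plancherel converts this into a bound of \<open>f N\<close> itself. Returning to
  \<open>g\<close> costs the energy of \<open>g - f N\<close>, which tends to the energy of
  \<open>g\<close> outside \<open>B\<close>.\<close>

theorem nazarov_uncertainty:
  "\<exists>K > 0. \<forall>(g :: real ^ 'n \<Rightarrow> complex) A B. integrable lborel g \<longrightarrow> sq_int lborel g \<longrightarrow>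
    A \<in> sets borel \<longrightarrow> emeasure lborel A < \<infinity> \<longrightarrow> B \<in> sets borel \<longrightarrow> emeasure lborel B < \<infinity> \<longrightarrow>
    l2 lborel g \<le> ennreal (K * exp (K * measure lborel A * measure lborel B)) *
      ((\<integral>\<^sup>+\<xi>. ennreal ((norm (ft g \<xi>))\<^sup>2) * indicator (- A) \<xi> \<partial>lborel) + (\<integral>\<^sup>+x. ennreal ((norm (g x))\<^sup>2) * indicator (- B) x \<partial>lborel))"
proof -
  obtain C where C: "1 \<le> C" and bound: "\<And>(f :: real ^ 'n \<Rightarrow> complex) A \<sigma> y. bounded_borel f \<Longrightarrow> bounded {x. f x \<noteq> 0} \<Longrightarrow> A \<in> sets borel \<Longrightarrow>
     emeasure lborel A < \<infinity> \<Longrightarrow> 0 < \<sigma> \<Longrightarrow> emeasure lborel {x. f x \<noteq> 0} \<le> ennreal \<sigma> \<Longrightarrow>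
     ennreal ((norm (ft f y))\<^sup>2) \<le> ennreal (C * \<sigma> * exp (C * \<sigma> * measure lborel A)) *
       (\<integral>\<^sup>+\<xi>. ennreal ((norm (ft f \<xi>))\<^sup>2) * indicator (- A) \<xi> \<partial>lborel)"
    using ft_pointwise_bound by blast
  define K where "K = 12 * exp (2 * C) + 2 * C"
  have K: "0 < K" "12 * exp (2 * C) \<le> K" "2 * C \<le> K" using C by (auto simp: K_def add_pos_pos)
  have main: "l2 lborel g \<le> ennreal (K * exp (K * measure lborel A * measure lborel B)) *
      ((\<integral>\<^sup>+\<xi>. ennreal ((norm (ft g \<xi>))\<^sup>2) * indicator (- A) \<xi> \<partial>lborel) + (\<integral>\<^sup>+x. ennreal ((norm (g x))\<^sup>2) * indicator (- B) x \<partial>lborel))"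
    if g: "integrable lborel g" "sq_int lborel g" and A [measurable]: "A \<in> sets borel" and A2: "emeasure lborel A < \<infinity>"
      and B [measurable]: "B \<in> sets borel" and B2: "emeasure lborel B < \<infinity>"
    for g :: "real ^ 'n \<Rightarrow> complex" and A B
  proof -
    have gm [measurable]: "g \<in> borel_measurable borel" using g by auto
    define \<alpha> where "\<alpha> = measure lborel A"
    define \<beta> where "\<beta> = measure lborel B"
    have \<alpha>: "emeasure lborel A = ennreal \<alpha>" "0 \<le> \<alpha>" unfolding \<alpha>_def by (rule emeasure_eq_ennreal_measure, use A2 in auto)
    have \<beta>: "emeasure lborel B = ennreal \<beta>" "0 \<le> \<beta>" unfolding \<beta>_def by (rule emeasure_eq_ennreal_measure, use B2 in auto)
    \<comment> \<open>\<sigma> must be positive and at least \<beta>, while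
      \<open>\<sigma> * \<alpha>\<close> may exceed \<open>\<alpha> * \<beta>\<close> by a bounded
      amount only. The summand 1 / (1 + \<alpha>) achieves this even for \<beta> = 0.\<close>
    define \<sigma> where "\<sigma> = \<beta> + 1 / (1 + \<alpha>)"
    have \<sigma>: "0 < \<sigma>" "\<beta> \<le> \<sigma>" "\<sigma> * \<alpha> \<le> \<alpha> * \<beta> + 1"
    proof -
      have "0 < 1 / (1 + \<alpha>)" using \<alpha> by simp
      then show "0 < \<sigma>" "\<beta> \<le> \<sigma>" unfolding \<sigma>_def using \<beta>(2) by linarith+
      have "1 / (1 + \<alpha>) * \<alpha> \<le> 1" using \<alpha> by (simp add: field_simps)
      then show "\<sigma> * \<alpha> \<le> \<alpha> * \<beta> + 1" by (simp add: \<sigma>_def algebra_simps)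
    qed
    define X where "X = (\<integral>\<^sup>+\<xi>. ennreal ((norm (ft g \<xi>))\<^sup>2) * indicator (- A) \<xi> \<partial>lborel)"
    define Y where "Y = (\<integral>\<^sup>+x. ennreal ((norm (g x))\<^sup>2) * indicator (- B) x \<partial>lborel)"
    \<comment> \<open>A bound for the ratio between the full energy of \<open>ft (f N)\<close> and
      its energy outside \<open>A\<close>; the factor 2 adds up the parts inside and
      outside.\<close>
    define E where "E = 2 * exp (2 * C) * exp (2 * C * \<alpha> * \<beta>)"
    have E: "1 \<le> exp (2 * C) * exp (2 * C * \<alpha> * \<beta>)" "2 \<le> E"
    proof -
      have "1 * 1 \<le> exp (2 * C) * exp (2 * C * \<alpha> * \<beta>)" using C \<alpha> \<beta> by (intro mult_mono) auto
      then show "1 \<le> exp (2 * C) * exp (2 * C * \<alpha> * \<beta>)" "2 \<le> E" by (auto simp: E_def)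
    qed
    define f where "f N x = indicator B x * trunc N g x" for N x
    define d where "d N = l2 lborel (\<lambda>x. g x - f N x)" for N
    have step: "l2 lborel g \<le> ennreal (4 * E) * X + ennreal (4 * E + 2) * d N" for N
    proof -
      have fm [measurable]: "f N \<in> borel_measurable borel" unfolding f_def by measurable
      have fb: "bounded_borel (f N)"
        unfolding bounded_borel_def using fm
        by (auto simp: f_def trunc_def indicator_def intro!: exI[of _ "real N"])
      have fs: "bounded {x. f N x \<noteq> 0}"
        by (rule bounded_subset[OF bounded_support_trunc[of N g]]) (auto simp: f_def)
      have fle: "norm (f N x) \<le> norm (g x)" for x by (auto simp: f_def indicator_def norm_trunc_le)
      have fi: "integrable lborel (f N)"
        by (rule Bochner_Integration.integrable_bound[OF g(1)]) (auto simp: fle)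
      have f2: "sq_int lborel (f N)"
      proof -
        have "l2 lborel (f N) \<le> l2 lborel g"
          unfolding l2_def by (intro nn_integral_mono ennreal_leI power_mono fle) auto
        then show ?thesis using g(2) by (auto simp: sq_int_def)
      qed
      have supp: "emeasure lborel {x. f N x \<noteq> 0} \<le> ennreal \<sigma>"
      proof -
        have "emeasure lborel {x. f N x \<noteq> 0} \<le> emeasure lborel B"
          by (intro emeasure_mono) (auto simp: f_def indicator_def)
        also have "\<dots> \<le> ennreal \<sigma>" unfolding \<beta> using \<sigma> by (intro ennreal_leI) auto
        finally show ?thesis .
      qed
      define I where "I = (\<integral>\<^sup>+\<xi>. ennreal ((norm (ft (f N) \<xi>))\<^sup>2) * indicator (- A) \<xi> \<partial>lborel)"
      have "(\<integral>\<^sup>+\<xi>. ennreal ((norm (ft (f N) \<xi>))\<^sup>2) * indicator A \<xi> \<partial>lborel)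
        \<le> (\<integral>\<^sup>+\<xi>. (ennreal (C * \<sigma> * exp (C * \<sigma> * \<alpha>)) * I) * indicator A \<xi> \<partial>lborel)"
        unfolding I_def \<alpha>_def by (intro nn_integral_mono mult_right_mono bound fb fs A A2 \<sigma> supp) auto
      also have "\<dots> = ennreal (C * \<sigma> * exp (C * \<sigma> * \<alpha>)) * I * ennreal \<alpha>"
        by (subst nn_integral_cmult_indicator) (auto simp: \<alpha>)
      also have "\<dots> = ennreal (C * \<sigma> * exp (C * \<sigma> * \<alpha>) * \<alpha>) * I"
        using C \<sigma> \<alpha> by (simp add: ennreal_mult mult_ac)
      also have "\<dots> \<le> ennreal (exp (2 * C) * exp (2 * C * \<alpha> * \<beta>)) * I"
      proof (intro mult_right_mono ennreal_leI)
        have p: "C * (\<sigma> * \<alpha>) \<le> C * (\<alpha> * \<beta> + 1)" using C \<sigma> by (intro mult_left_mono) auto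
        have "C * \<sigma> * exp (C * \<sigma> * \<alpha>) * \<alpha> = C * (\<sigma> * \<alpha>) * exp (C * (\<sigma> * \<alpha>))" by (simp add: mult_ac)
        \<comment> \<open>The linear factor is absorbed by x \<le> exp x, at the price of a doubled
          exponent.\<close>
        also have "\<dots> \<le> exp (C * (\<sigma> * \<alpha>)) * exp (C * (\<sigma> * \<alpha>))"
        proof (intro mult_right_mono)
          show "C * (\<sigma> * \<alpha>) \<le> exp (C * (\<sigma> * \<alpha>))"
            using exp_ge_add_one_self[of "C * (\<sigma> * \<alpha>)"] by linarith
        qed auto
        also have "\<dots> = exp (2 * (C * (\<sigma> * \<alpha>)))" by (simp add: exp_add[symmetric])
        also have "\<dots> \<le> exp (2 * (C * (\<alpha> * \<beta> + 1)))" using p by simp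
        also have "\<dots> = exp (2 * C) * exp (2 * C * \<alpha> * \<beta>)" by (simp add: exp_add[symmetric] algebra_simps)
        finally show "C * \<sigma> * exp (C * \<sigma> * \<alpha>) * \<alpha> \<le> exp (2 * C) * exp (2 * C * \<alpha> * \<beta>)" .
      qed auto
      finally have inA: "(\<integral>\<^sup>+\<xi>. ennreal ((norm (ft (f N) \<xi>))\<^sup>2) * indicator A \<xi> \<partial>lborel) \<le> ennreal (exp (2 * C) * exp (2 * C * \<alpha> * \<beta>)) * I" .
      have "l2 lborel (f N) = l2 lborel (ft (f N))" using plancherel(2)[OF fi f2] by simp
      also have "\<dots> = (\<integral>\<^sup>+\<xi>. ennreal ((norm (ft (f N) \<xi>))\<^sup>2) * indicator A \<xi> + ennreal ((norm (ft (f N) \<xi>))\<^sup>2) * indicator (- A) \<xi> \<partial>lborel)"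
        unfolding l2_def by (intro nn_integral_cong) (auto simp: indicator_def)
      also have "\<dots> = (\<integral>\<^sup>+\<xi>. ennreal ((norm (ft (f N) \<xi>))\<^sup>2) * indicator A \<xi> \<partial>lborel) + I"
        unfolding I_def by (intro nn_integral_add) auto
      also have "\<dots> \<le> ennreal (exp (2 * C) * exp (2 * C * \<alpha> * \<beta>)) * I + ennreal (exp (2 * C) * exp (2 * C * \<alpha> * \<beta>)) * I"
      proof (rule add_mono[OF inA])
        have "1 * I \<le> ennreal (exp (2 * C) * exp (2 * C * \<alpha> * \<beta>)) * I"
          using E(1) by (intro mult_right_mono) auto
        then show "I \<le> ennreal (exp (2 * C) * exp (2 * C * \<alpha> * \<beta>)) * I" by simp
      qed
      also have "\<dots> = ennreal E * I"
      proof -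
        have "E = exp (2 * C) * exp (2 * C * \<alpha> * \<beta>) + exp (2 * C) * exp (2 * C * \<alpha> * \<beta>)" by (simp add: E_def)
        then have "ennreal E = ennreal (exp (2 * C) * exp (2 * C * \<alpha> * \<beta>)) + ennreal (exp (2 * C) * exp (2 * C * \<alpha> * \<beta>))"
          by (simp only:) (rule ennreal_plus, auto)
        then show ?thesis by (simp only: distrib_right)
      qed
      finally have fI: "l2 lborel (f N) \<le> ennreal E * I" .
      have hfi: "integrable lborel (\<lambda>x. f N x - g x)" using fi g(1) by simp
      have ftdiff: "ft (\<lambda>x. f N x - g x) = (\<lambda>\<xi>. ft (f N) \<xi> - ft g \<xi>)"
        by (rule ext) (rule ft_diff[OF fi g(1)])
      have "I \<le> (\<integral>\<^sup>+\<xi>. 2 * (ennreal ((norm (ft g \<xi>))\<^sup>2) * indicator (- A) \<xi>) + 2 * ennreal ((norm (ft (f N) \<xi> - ft g \<xi>))\<^sup>2) \<partial>lborel)"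
        unfolding I_def
      proof (intro nn_integral_mono)
        fix \<xi>
        have "(norm (ft g \<xi> + (ft (f N) \<xi> - ft g \<xi>)))\<^sup>2 \<le> (1 + 1) * (norm (ft g \<xi>))\<^sup>2 + (1 + 1 / 1) * (norm (ft (f N) \<xi> - ft g \<xi>))\<^sup>2"
          by (rule norm_add_sq_le) simp
        then have "ennreal ((norm (ft (f N) \<xi>))\<^sup>2) \<le> ennreal (2 * (norm (ft g \<xi>))\<^sup>2 + 2 * (norm (ft (f N) \<xi> - ft g \<xi>))\<^sup>2)"
          by (intro ennreal_leI) simp
        also have "\<dots> = 2 * ennreal ((norm (ft g \<xi>))\<^sup>2) + 2 * ennreal ((norm (ft (f N) \<xi> - ft g \<xi>))\<^sup>2)"
          by (simp add: ennreal_mult)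
        finally show "ennreal ((norm (ft (f N) \<xi>))\<^sup>2) * indicator (- A) \<xi> \<le> 2 * (ennreal ((norm (ft g \<xi>))\<^sup>2) * indicator (- A) \<xi>) + 2 * ennreal ((norm (ft (f N) \<xi> - ft g \<xi>))\<^sup>2)"
          by (auto simp: indicator_def)
      qed
      also have "\<dots> = 2 * X + 2 * l2 lborel (ft (\<lambda>x. f N x - g x))"
        unfolding ftdiff l2_def X_def by (subst nn_integral_add) (auto simp: nn_integral_cmult)
      also have "\<dots> \<le> 2 * X + 2 * d N"
        using ft_le_plancherel[OF hfi] unfolding d_def l2_diff_commute[of lborel g "f N"]
        by (intro add_left_mono mult_left_mono) auto
      finally have I: "I \<le> 2 * X + 2 * d N" .
      have "l2 lborel g = l2 lborel (\<lambda>x. f N x + (g x - f N x))" by simp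
      also have "\<dots> \<le> ennreal (1 + 1) * l2 lborel (f N) + ennreal (1 + 1 / 1) * d N"
        unfolding d_def by (intro l2_add_le) auto
      also have "\<dots> \<le> 2 * (ennreal E * (2 * X + 2 * d N)) + 2 * d N"
        using order_trans[OF fI mult_left_mono[OF I]] by (intro add_mono) (auto intro!: mult_left_mono)
      also have "\<dots> = ennreal (4 * E) * X + ennreal (4 * E + 2) * d N"
      proof -
        have e: "ennreal (4 * E) = 4 * ennreal E" "ennreal (4 * E + 2) = 4 * ennreal E + 2"
          using E by (auto simp: ennreal_mult)
        have "(2::ennreal) * (y * (2 * z)) = 4 * y * z" for y z
        proof -
          have "(2::ennreal) * (y * (2 * z)) = (2 * 2) * y * z" by (simp only: mult_ac)
          then show ?thesis by simp
        qed
        then show ?thesis unfolding e by (simp add: distrib_left distrib_right add.assoc)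
      qed
      finally show ?thesis .
    qed
    have "d \<longlonglongrightarrow> Y" unfolding d_def[abs_def] Y_def f_def by (rule l2_trunc_tendsto[OF g(2) B])
    then have "(\<lambda>N. ennreal (4 * E) * X + ennreal (4 * E + 2) * d N) \<longlonglongrightarrow> ennreal (4 * E) * X + ennreal (4 * E + 2) * Y"
      by (intro tendsto_add tendsto_const ennreal_tendsto_cmult) auto
    then have "l2 lborel g \<le> ennreal (4 * E) * X + ennreal (4 * E + 2) * Y"
      by (rule LIMSEQ_le_const) (use step in auto)
    also have "\<dots> \<le> ennreal (K * exp (K * \<alpha> * \<beta>)) * X + ennreal (K * exp (K * \<alpha> * \<beta>)) * Y"
    proof (intro add_mono mult_right_mono ennreal_leI)
      have "4 * E + 2 \<le> 12 * exp (2 * C) * exp (2 * C * \<alpha> * \<beta>)" using E by (simp add: E_def)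
      also have "\<dots> \<le> K * exp (K * \<alpha> * \<beta>)"
        using K \<alpha> \<beta> by (intro mult_mono) (auto intro!: mult_right_mono)
      finally show "4 * E + 2 \<le> K * exp (K * \<alpha> * \<beta>)" .
      then show "4 * E \<le> K * exp (K * \<alpha> * \<beta>)" by simp
    qed auto
    finally show ?thesis unfolding X_def Y_def \<alpha>_def \<beta>_def by (simp add: distrib_left)
  qed
  show ?thesis using K(1) main by blast
qed

text \<open>The Riesz-Fischer argument: a rapidly convergent subsequence converges almost
  everywhere, and Fatou's lemma upgrades this to norm convergence of the whole sequence.\<close>

lemma l2_complete:
  assumes G: "\<And>k::nat. sq_int M (G k)"
    and cauchy: "\<And>e. 0 < e \<Longrightarrow> \<exists>N. \<forall>m\<ge>N. \<forall>n\<ge>N. l2norm M (\<lambda>x. G m x - G n x) < e"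
  shows "\<exists>g. sq_int M g \<and> (\<lambda>k. l2norm M (\<lambda>x. G k x - g x)) \<longlonglongrightarrow> 0"
proof -
  have [measurable]: "G k \<in> borel_measurable M" for k using G[of k] by (simp add: sq_int_def)
  have "\<forall>k. \<exists>N. \<forall>m\<ge>N. \<forall>n\<ge>N. l2norm M (\<lambda>x. G m x - G n x) < (1 / 2) ^ k"
    using cauchy by simp
  then obtain b where b: "\<And>k m n. b k \<le> m \<Longrightarrow> b k \<le> n \<Longrightarrow> l2norm M (\<lambda>x. G m x - G n x) < (1 / 2) ^ k"
    by metis
  \<comment> \<open>The sum dominates every \<open>b j\<close> with j \<le> k, and the summand
    \<open>k\<close> forces \<open>r\<close> to tend to infinity.\<close>
  define r where "r k = (\<Sum>j\<le>k. b j) + k" for k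
  have rb: "b k \<le> r j" if "k \<le> j" for k j
  proof -
    have "b k \<le> (\<Sum>i\<le>j. b i)" using that by (intro member_le_sum) auto
    then show ?thesis by (simp add: r_def)
  qed
  have rk: "k \<le> r k" for k by (simp add: r_def)
  define D where "D k x = G (r (Suc k)) x - G (r k) x" for k x
  have [measurable]: "D k \<in> borel_measurable M" for k unfolding D_def by measurable
  have Dl2: "l2 M (D k) \<le> ennreal ((1 / 4) ^ k)" for k
  proof -
    have "l2norm M (D k) \<le> (1 / 2) ^ k" unfolding D_def[abs_def]
      by (rule less_imp_le[OF b[OF rb rb]]) auto
    then have "(l2norm M (D k))\<^sup>2 \<le> ((1 / 2) ^ k)\<^sup>2" by (intro power_mono) auto
    also have "((1 / 2) ^ k)\<^sup>2 = (1 / 4 :: real) ^ k" by (simp only: power2_eq_square power_mult_distrib[symmetric]) simp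
    finally show ?thesis
      using sq_int_diff[OF G[of "r (Suc k)"] G[of "r k"]] by (simp add: l2_eq_l2norm D_def[abs_def] ennreal_leI)
  qed
  \<comment> \<open>The integrals of |D k|^2 are at most \<open>(1 / 4) ^ k\<close>, which leaves
    room for the weight \<open>2 ^ k\<close>. The weight turns finiteness of the sum at
    \<open>x\<close> into geometric decay of \<open>D k x\<close>.\<close>
  have "(\<integral>\<^sup>+x. (\<Sum>k. ennreal (2 ^ k) * ennreal ((norm (D k x))\<^sup>2)) \<partial>M) = (\<Sum>k. \<integral>\<^sup>+x. ennreal (2 ^ k) * ennreal ((norm (D k x))\<^sup>2) \<partial>M)"
    by (rule nn_integral_suminf) measurable
  also have "\<dots> = (\<Sum>k. ennreal (2 ^ k) * l2 M (D k))"
    unfolding l2_def by (simp add: nn_integral_cmult)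
  also have "\<dots> \<le> (\<Sum>k. ennreal ((1 / 2) ^ k))"
  proof (intro suminf_le)
    fix k
    have "ennreal (2 ^ k) * l2 M (D k) \<le> ennreal (2 ^ k) * ennreal ((1 / 4) ^ k)" by (intro mult_left_mono Dl2) auto
    also have "\<dots> = ennreal ((1 / 2) ^ k)" by (simp add: ennreal_mult[symmetric] power_mult_distrib[symmetric])
    finally show "ennreal (2 ^ k) * l2 M (D k) \<le> ennreal ((1 / 2) ^ k)" .
  qed auto
  also have "\<dots> = ennreal (\<Sum>k. (1 / 2) ^ k)" by (intro suminf_ennreal2 summable_geometric) auto
  also have "\<dots> < \<infinity>" by simp
  finally have "AE x in M. (\<Sum>k. ennreal (2 ^ k) * ennreal ((norm (D k x))\<^sup>2)) \<noteq> \<infinity>"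
    by (intro nn_integral_PInf_AE) auto
  then have conv: "AE x in M. convergent (\<lambda>k. G (r k) x)"
  proof eventually_elim
    case (elim x)
    define s where "s = (\<Sum>k. ennreal (2 ^ k) * ennreal ((norm (D k x))\<^sup>2))"
    obtain c where c: "s = ennreal c" "0 \<le> c" using elim unfolding s_def[symmetric] by (cases s) auto
    have bd: "norm (D k x) \<le> sqrt c * (1 / sqrt 2) ^ k" for k
    proof -
      have "ennreal (2 ^ k * (norm (D k x))\<^sup>2) = (\<Sum>j\<in>{k}. ennreal (2 ^ j) * ennreal ((norm (D j x))\<^sup>2))" by (simp add: ennreal_mult)
      also have "\<dots> \<le> s" unfolding s_def by (intro sum_le_suminf) auto
      finally have "2 ^ k * (norm (D k x))\<^sup>2 \<le> c" using c by (simp add: ennreal_le_iff)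
      then have "(norm (D k x))\<^sup>2 \<le> c * (1 / 2) ^ k" by (simp add: field_simps power_divide)
      then have "sqrt ((norm (D k x))\<^sup>2) \<le> sqrt (c * (1 / 2) ^ k)" by (rule real_sqrt_le_mono)
      then show ?thesis by (simp add: real_sqrt_mult real_sqrt_power real_sqrt_divide)
    qed
    have "summable (\<lambda>k. sqrt c * (1 / sqrt 2) ^ k)" by (intro summable_mult summable_geometric) auto
    then have "summable (\<lambda>k. D k x)" by (rule summable_comparison_test'[of _ 0]) (rule bd)
    then have "convergent (\<lambda>n. \<Sum>k<n. D k x)" by (simp add: summable_iff_convergent)
    then have "convergent (\<lambda>n. G (r 0) x + (\<Sum>k<n. D k x))" by (intro convergent_add convergent_const)
    moreover have "G (r 0) x + (\<Sum>k<n. D k x) = G (r n) x" for n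
      using sum_lessThan_telescope[of "\<lambda>k. G (r k) x" n] by (simp add: D_def)
    ultimately show ?case by simp
  qed
  define g where "g x = lim (\<lambda>k. G (r k) x)" for x
  have [measurable]: "g \<in> borel_measurable M" unfolding g_def by measurable
  have glim: "AE x in M. (\<lambda>k. G (r k) x) \<longlonglongrightarrow> g x"
    using conv by eventually_elim (simp add: g_def convergent_LIMSEQ_iff)
  have fatou: "l2 M (\<lambda>x. G n x - g x) \<le> ennreal (e\<^sup>2)"
    if N: "\<And>k. N \<le> k \<Longrightarrow> l2norm M (\<lambda>x. G n x - G k x) < e" and e: "0 < e" for n N e
  proof -
    have "l2 M (\<lambda>x. G n x - g x) = (\<integral>\<^sup>+x. liminf (\<lambda>k. ennreal ((norm (G n x - G (r k) x))\<^sup>2)) \<partial>M)"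
      unfolding l2_def
    proof (rule nn_integral_cong_AE)
      show "AE x in M. ennreal ((norm (G n x - g x))\<^sup>2) = liminf (\<lambda>k. ennreal ((norm (G n x - G (r k) x))\<^sup>2))"
        using glim
      proof eventually_elim
        case (elim x)
        have "(\<lambda>k. ennreal ((norm (G n x - G (r k) x))\<^sup>2)) \<longlonglongrightarrow> ennreal ((norm (G n x - g x))\<^sup>2)"
          by (intro tendsto_intros elim)
        from lim_imp_Liminf[OF sequentially_bot this] show ?case ..
      qed
    qed
    also have "\<dots> \<le> liminf (\<lambda>k. l2 M (\<lambda>x. G n x - G (r k) x))"
      unfolding l2_def by (rule nn_integral_liminf) measurable
    also have "\<dots> \<le> ennreal (e\<^sup>2)"
    proof -
      have "l2 M (\<lambda>x. G n x - G (r k) x) \<le> ennreal (e\<^sup>2)" if k: "N \<le> k" for k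
      proof -
        have "l2norm M (\<lambda>x. G n x - G (r k) x) \<le> e" using N[of "r k"] rk[of k] k by simp
        then have "(l2norm M (\<lambda>x. G n x - G (r k) x))\<^sup>2 \<le> e\<^sup>2" by (intro power_mono) auto
        then show ?thesis using sq_int_diff[OF G[of n] G[of "r k"]] by (simp add: l2_eq_l2norm ennreal_leI)
      qed
      then have "eventually (\<lambda>k. l2 M (\<lambda>x. G n x - G (r k) x) \<le> ennreal (e\<^sup>2)) sequentially"
        by (intro eventually_sequentiallyI)
      then show ?thesis by (intro Liminf_le) auto
    qed
    finally show ?thesis .
  qed
  obtain N1 where "\<forall>m\<ge>N1. \<forall>n\<ge>N1. l2norm M (\<lambda>x. G m x - G n x) < 1" using cauchy[of 1] by auto
  then have "l2 M (\<lambda>x. G N1 x - g x) \<le> ennreal (1\<^sup>2)" by (intro fatou[of N1]) auto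
  then have d: "sq_int M (\<lambda>x. G N1 x - g x)" unfolding sq_int_def by (auto intro: le_less_trans)
  have g: "sq_int M g" using sq_int_diff[OF G[of N1] d] by simp
  have "(\<lambda>k. l2norm M (\<lambda>x. G k x - g x)) \<longlonglongrightarrow> 0"
  proof (rule LIMSEQ_I)
    fix e :: real assume e: "0 < e"
    then obtain N where N: "\<forall>m\<ge>N. \<forall>n\<ge>N. l2norm M (\<lambda>x. G m x - G n x) < e / 2" using cauchy[of "e / 2"] by auto
    have "norm (l2norm M (\<lambda>x. G n x - g x) - 0) < e" if n: "N \<le> n" for n
    proof -
      have "l2 M (\<lambda>x. G n x - g x) \<le> ennreal ((e / 2)\<^sup>2)" using N n e by (intro fatou[of N]) auto
      then have "enn2real (l2 M (\<lambda>x. G n x - g x)) \<le> (e / 2)\<^sup>2" by (intro enn2real_leI) auto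
      then have "l2norm M (\<lambda>x. G n x - g x) \<le> sqrt ((e / 2)\<^sup>2)" unfolding l2norm_def by (rule real_sqrt_le_mono)
      then show ?thesis using e by simp
    qed
    then show "\<exists>N. \<forall>n\<ge>N. norm (l2norm M (\<lambda>x. G n x - g x) - 0) < e" by blast
  qed
  then show ?thesis using g by blast
qed

section \<open>Inner products\<close>

lemma sq_int_integrable:
  assumes "sq_int M f" shows "integrable M (\<lambda>x. (norm (f x))\<^sup>2)"
  using assms by (auto simp: sq_int_def l2_def integrable_iff_bounded)

lemma l2norm_sq_eq_integral:
  assumes "sq_int M f" shows "(l2norm M f)\<^sup>2 = (LINT x|M. (norm (f x))\<^sup>2)"
proof -
  have "l2 M f = ennreal (LINT x|M. (norm (f x))\<^sup>2)"
    unfolding l2_def by (intro nn_integral_eq_integral sq_int_integrable assms) auto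
  then show ?thesis by (simp add: l2norm_def)
qed

lemma integrable_mult_cnj:
  assumes f: "sq_int M f" and g: "sq_int M g"
  shows "integrable M (\<lambda>x. f x * cnj (g x))"
proof (rule Bochner_Integration.integrable_bound)
  show "integrable M (\<lambda>x. (norm (f x))\<^sup>2 + (norm (g x))\<^sup>2)"
    by (intro Bochner_Integration.integrable_add sq_int_integrable f g)
  show "(\<lambda>x. f x * cnj (g x)) \<in> borel_measurable M" using f g by (auto simp: sq_int_def)
  show "AE x in M. norm (f x * cnj (g x)) \<le> norm ((norm (f x))\<^sup>2 + (norm (g x))\<^sup>2)"
  proof (intro AE_I2)
    fix x
    have "2 * (norm (f x) * norm (g x)) \<le> (norm (f x))\<^sup>2 + (norm (g x))\<^sup>2"
      using sum_squares_bound[of "norm (f x)" "norm (g x)"] by simp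
    moreover have "0 \<le> norm (f x) * norm (g x)" by simp
    ultimately have "norm (f x) * norm (g x) \<le> (norm (f x))\<^sup>2 + (norm (g x))\<^sup>2" by linarith
    then show "norm (f x * cnj (g x)) \<le> norm ((norm (f x))\<^sup>2 + (norm (g x))\<^sup>2)" by (simp add: norm_mult)
  qed
qed

lemma polarization_pointwise:
  "4 * (a * cnj b) = of_real ((norm (a + b))\<^sup>2) - of_real ((norm (a + (-1) * b))\<^sup>2)
     + \<i> * of_real ((norm (a + \<i> * b))\<^sup>2) - \<i> * of_real ((norm (a + (- \<i>) * b))\<^sup>2)"
  unfolding complex_norm_square by (simp add: algebra_simps)

text \<open>Expresses an inner product through norms of the combinations \<open>f + c * g\<close>. A
  linear isometry therefore preserves it, which is how \<open>has_ft_inner\<close> follows from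
  \<open>has_ft_l2norm\<close>.\<close>

lemma polarization:
  assumes f: "sq_int M f" and g: "sq_int M g"
  shows "4 * (LINT x|M. f x * cnj (g x)) =
     of_real ((l2norm M (\<lambda>x. f x + 1 * g x))\<^sup>2) - of_real ((l2norm M (\<lambda>x. f x + (-1) * g x))\<^sup>2)
     + \<i> * of_real ((l2norm M (\<lambda>x. f x + \<i> * g x))\<^sup>2) - \<i> * of_real ((l2norm M (\<lambda>x. f x + (- \<i>) * g x))\<^sup>2)"
proof -
  have s: "sq_int M (\<lambda>x. f x + c * g x)" for c by (intro sq_int_add sq_int_cmult f g)
  have i: "integrable M (\<lambda>x. complex_of_real ((norm (f x + c * g x))\<^sup>2))" for c
    using sq_int_integrable[OF s] by (rule integrable_of_real)
  have "4 * (LINT x|M. f x * cnj (g x)) = (LINT x|M. 4 * (f x * cnj (g x)))" by simp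
  also have "\<dots> = (LINT x|M. of_real ((norm (f x + 1 * g x))\<^sup>2) - of_real ((norm (f x + (-1) * g x))\<^sup>2)
     + \<i> * of_real ((norm (f x + \<i> * g x))\<^sup>2) - \<i> * of_real ((norm (f x + (- \<i>) * g x))\<^sup>2))"
    by (simp only: polarization_pointwise mult_1_left)
  also have "\<dots> = (LINT x|M. of_real ((norm (f x + 1 * g x))\<^sup>2)) - (LINT x|M. of_real ((norm (f x + (-1) * g x))\<^sup>2))
     + \<i> * (LINT x|M. of_real ((norm (f x + \<i> * g x))\<^sup>2)) - \<i> * (LINT x|M. of_real ((norm (f x + (- \<i>) * g x))\<^sup>2))"
    by (simp only: Bochner_Integration.integral_add Bochner_Integration.integral_diff Bochner_Integration.integrable_add
        Bochner_Integration.integrable_diff integral_mult_right_zero integrable_mult_right i)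
  finally show ?thesis
    unfolding integral_complex_of_real l2norm_sq_eq_integral[OF s] .
qed

text \<open>Counterpart of \<open>has_fourier_L2\<close> for functions over \<open>lborel\<close>,
  with limits of real norms in place of limits of squared norms in \<open>ennreal\<close>.\<close>

definition has_ft :: "(real ^ 'n \<Rightarrow> complex) \<Rightarrow> (real ^ 'n \<Rightarrow> complex) \<Rightarrow> bool" where
  "has_ft f g \<longleftrightarrow> sq_int lborel f \<and> sq_int lborel g \<and>
     (\<exists>F. (\<forall>k::nat. integrable lborel (F k) \<and> sq_int lborel (F k)) \<and>
        (\<lambda>k. l2norm lborel (\<lambda>x. F k x - f x)) \<longlonglongrightarrow> 0 \<and>
        (\<lambda>k. l2norm lborel (\<lambda>\<xi>. ft (F k) \<xi> - g \<xi>)) \<longlonglongrightarrow> 0)"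

lemma has_ft_l2norm:
  assumes "has_ft f g" shows "l2norm lborel g = l2norm lborel f"
proof -
  obtain F where F: "\<And>k::nat. integrable lborel (F k)" "\<And>k. sq_int lborel (F k)"
    and l1: "(\<lambda>k. l2norm lborel (\<lambda>x. F k x - f x)) \<longlonglongrightarrow> 0"
    and l2: "(\<lambda>k. l2norm lborel (\<lambda>\<xi>. ft (F k) \<xi> - g \<xi>)) \<longlonglongrightarrow> 0"
    and f: "sq_int lborel f" and g: "sq_int lborel g"
    using assms unfolding has_ft_def by blast
  have e: "l2norm lborel (ft (F k)) = l2norm lborel (F k)" for k
    unfolding l2norm_def plancherel(2)[OF F] ..
  have "(\<lambda>k. l2norm lborel (F k)) \<longlonglongrightarrow> l2norm lborel g"
    using l2norm_tendsto[OF plancherel(1)[OF F] g l2] unfolding e .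
  then show ?thesis using l2norm_tendsto[OF F(2) f l1] by (rule LIMSEQ_unique)
qed

lemma ft_add_cmult:
  assumes f: "integrable lborel f" and g: "integrable lborel g"
  shows "ft (\<lambda>x. f x + c * g x) \<xi> = ft f \<xi> + c * ft g \<xi>"
proof -
  have "integrable lborel (\<lambda>x. h x * cnj (ee (\<xi> \<bullet> x)))" if "integrable lborel h" for h
    by (rule Bochner_Integration.integrable_bound[OF that]) (use that in \<open>auto simp: norm_mult\<close>)
  then show ?thesis using f g by (simp add: ft_def distrib_right mult.assoc)
qed

lemma l2norm_cmult:
  assumes "sq_int M f" shows "l2norm M (\<lambda>x. c * f x) = norm c * l2norm M f"
  using assms by (simp add: l2norm_def l2_cmult sq_int_measurable enn2real_mult real_sqrt_mult)

lemma has_ft_add_cmult: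
  assumes f: "has_ft f f'" and g: "has_ft g g'"
  shows "has_ft (\<lambda>x. f x + c * g x) (\<lambda>x. f' x + c * g' x)"
proof -
  obtain F where F: "\<And>k::nat. integrable lborel (F k)" "\<And>k. sq_int lborel (F k)"
    and F1: "(\<lambda>k. l2norm lborel (\<lambda>x. F k x - f x)) \<longlonglongrightarrow> 0"
    and F2: "(\<lambda>k. l2norm lborel (\<lambda>\<xi>. ft (F k) \<xi> - f' \<xi>)) \<longlonglongrightarrow> 0"
    and f2: "sq_int lborel f" "sq_int lborel f'"
    using f unfolding has_ft_def by blast
  obtain G where G: "\<And>k::nat. integrable lborel (G k)" "\<And>k. sq_int lborel (G k)"
    and G1: "(\<lambda>k. l2norm lborel (\<lambda>x. G k x - g x)) \<longlonglongrightarrow> 0"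
    and G2: "(\<lambda>k. l2norm lborel (\<lambda>\<xi>. ft (G k) \<xi> - g' \<xi>)) \<longlonglongrightarrow> 0"
    and g2: "sq_int lborel g" "sq_int lborel g'"
    using g unfolding has_ft_def by blast
  have lim: "(\<lambda>k. l2norm lborel (\<lambda>x. (U k x + c * V k x) - (u x + c * v x))) \<longlonglongrightarrow> 0"
    if s: "\<And>k. sq_int lborel (U k)" "\<And>k. sq_int lborel (V k)" "sq_int lborel u" "sq_int lborel v"
      and l: "(\<lambda>k. l2norm lborel (\<lambda>x. U k x - u x)) \<longlonglongrightarrow> 0" "(\<lambda>k. l2norm lborel (\<lambda>x. V k x - v x)) \<longlonglongrightarrow> 0"
    for U V :: "nat \<Rightarrow> real ^ 'n \<Rightarrow> complex" and u v
  proof (rule Lim_null_comparison)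
    have "(\<lambda>k. l2norm lborel (\<lambda>x. U k x - u x) + norm c * l2norm lborel (\<lambda>x. V k x - v x)) \<longlonglongrightarrow> 0 + norm c * 0"
      by (intro tendsto_intros l)
    then show "(\<lambda>k. l2norm lborel (\<lambda>x. U k x - u x) + norm c * l2norm lborel (\<lambda>x. V k x - v x)) \<longlonglongrightarrow> 0" by simp
    have "l2norm lborel (\<lambda>x. (U k x + c * V k x) - (u x + c * v x)) \<le> l2norm lborel (\<lambda>x. U k x - u x) + norm c * l2norm lborel (\<lambda>x. V k x - v x)" for k
    proof -
      have "(\<lambda>x. (U k x + c * V k x) - (u x + c * v x)) = (\<lambda>x. (U k x - u x) + c * (V k x - v x))"
        by (simp add: fun_eq_iff algebra_simps)
      moreover have "l2norm lborel (\<lambda>x. (U k x - u x) + c * (V k x - v x)) \<le> l2norm lborel (\<lambda>x. U k x - u x) + l2norm lborel (\<lambda>x. c * (V k x - v x))"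
        by (intro l2norm_triangle sq_int_cmult sq_int_diff s)
      ultimately show ?thesis by (simp add: l2norm_cmult sq_int_diff s)
    qed
    then show "\<forall>\<^sub>F k in sequentially. norm (l2norm lborel (\<lambda>x. (U k x + c * V k x) - (u x + c * v x))) \<le> l2norm lborel (\<lambda>x. U k x - u x) + norm c * l2norm lborel (\<lambda>x. V k x - v x)"
      by simp
  qed
  show ?thesis
    unfolding has_ft_def
  proof (intro conjI exI[of _ "\<lambda>k x. F k x + c * G k x"] allI)
    show "(\<lambda>k. l2norm lborel (\<lambda>x. (F k x + c * G k x) - (f x + c * g x))) \<longlonglongrightarrow> 0"
      by (rule lim[OF F(2) G(2) f2(1) g2(1) F1 G1])
    show "(\<lambda>k. l2norm lborel (\<lambda>\<xi>. ft (\<lambda>x. F k x + c * G k x) \<xi> - (f' \<xi> + c * g' \<xi>))) \<longlonglongrightarrow> 0"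
      unfolding ft_add_cmult[OF F(1) G(1)]
      by (rule lim[OF plancherel(1)[OF F] plancherel(1)[OF G] f2(2) g2(2) F2 G2])
    show "integrable lborel (\<lambda>x. F k x + c * G k x)" for k
      by (intro Bochner_Integration.integrable_add integrable_mult_right F G)
  qed (intro sq_int_add sq_int_cmult f2 g2 F G)+
qed

lemma has_ft_inner:
  assumes f: "has_ft f f'" and g: "has_ft g g'"
  shows "(LINT x|lborel. f x * cnj (g x)) = (LINT \<xi>|lborel. f' \<xi> * cnj (g' \<xi>))"
proof -
  have s: "sq_int lborel f" "sq_int lborel g" "sq_int lborel f'" "sq_int lborel g'"
    using f g unfolding has_ft_def by auto
  have "4 * (LINT x|lborel. f x * cnj (g x)) = 4 * (LINT \<xi>|lborel. f' \<xi> * cnj (g' \<xi>))"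
    unfolding polarization[OF s(1,2)] polarization[OF s(3,4)] has_ft_l2norm[OF has_ft_add_cmult[OF f g]] ..
  then show ?thesis by simp
qed

lemma l2_pullback:
  fixes B :: "real ^ 'n ^ 'n"
  assumes B: "det B \<noteq> 0" and [measurable]: "h \<in> borel_measurable borel"
  shows "l2 lborel (\<lambda>x. h (B *v (x - t))) = ennreal (inverse \<bar>det B\<bar>) * l2 lborel h"
proof -
  have "l2 lborel h = ennreal \<bar>det B\<bar> * (\<integral>\<^sup>+x. ennreal ((norm (h (B *v x)))\<^sup>2) \<partial>lborel)"
    unfolding l2_def by (rule nn_integral_linear[OF B]) measurable
  moreover have "(\<integral>\<^sup>+x. ennreal ((norm (h (B *v (x + (- t)))))\<^sup>2) \<partial>lborel) = (\<integral>\<^sup>+x. ennreal ((norm (h (B *v x)))\<^sup>2) \<partial>lborel)"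
    by (rule nn_integral_translate) measurable
  moreover have "ennreal (inverse \<bar>det B\<bar>) * ennreal \<bar>det B\<bar> = 1" using B by (simp flip: ennreal_mult)
  ultimately show ?thesis by (simp add: l2_def flip: mult.assoc)
qed

lemma l2norm_pullback:
  fixes B :: "real ^ 'n ^ 'n"
  assumes B: "det B \<noteq> 0" and h: "h \<in> borel_measurable borel"
  shows "l2norm lborel (\<lambda>x. h (B *v (x - t))) = sqrt (inverse \<bar>det B\<bar>) * l2norm lborel h"
  unfolding l2norm_def l2_pullback[OF assms] by (simp add: enn2real_mult real_sqrt_mult)

lemma sq_int_pullback:
  fixes B :: "real ^ 'n ^ 'n"
  assumes B: "det B \<noteq> 0" and h: "sq_int lborel h"
  shows "sq_int lborel (\<lambda>x. h (B *v (x - t)))"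
proof -
  have [measurable]: "h \<in> borel_measurable borel" using h by (simp add: sq_int_def)
  show ?thesis using h unfolding sq_int_def by (subst l2_pullback[OF B]) (auto simp: ennreal_mult_less_top)
qed

lemma l2norm_unimodular:
  assumes "\<And>x. norm (e x) = 1" shows "l2norm M (\<lambda>x. h x * e x) = l2norm M h"
  using assms by (simp add: l2norm_def l2_def norm_mult)

lemma sq_int_mult_ee:
  assumes "sq_int lborel h" shows "sq_int lborel (\<lambda>\<xi>. h \<xi> * cnj (ee (\<xi> \<bullet> t)))"
  using assms by (auto simp: sq_int_def l2_def norm_mult)

lemma ft_pullback:
  fixes F :: "real ^ 'n \<Rightarrow> complex" and T B :: "real ^ 'n ^ 'n"
  assumes T: "det T \<noteq> 0" and BT: "B ** T = mat 1" and [measurable]: "F \<in> borel_measurable borel"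
  shows "ft (\<lambda>x. c * F (B *v (x - t))) \<xi> = c * of_real \<bar>det T\<bar> * ft F (transpose T *v \<xi>) * cnj (ee (\<xi> \<bullet> t))"
proof -
  have "ft (\<lambda>x. c * F (B *v (x - t))) \<xi> = (LINT x|lborel. c * F (B *v ((x + t) - t)) * cnj (ee (\<xi> \<bullet> (x + t))))"
    unfolding ft_def by (rule integral_translate[symmetric]) measurable
  also have "\<dots> = (LINT x|lborel. c * F (B *v x) * cnj (ee (\<xi> \<bullet> (x + t))))" by simp
  also have "\<dots> = of_real \<bar>det T\<bar> * (LINT x|lborel. c * F (B *v (T *v x)) * cnj (ee (\<xi> \<bullet> (T *v x + t))))"
    by (rule integral_linear[OF T]) measurable
  also have "(LINT x|lborel. c * F (B *v (T *v x)) * cnj (ee (\<xi> \<bullet> (T *v x + t)))) =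
     (LINT x|lborel. (c * cnj (ee (\<xi> \<bullet> t))) * (F x * cnj (ee ((transpose T *v \<xi>) \<bullet> x))))"
  proof (intro Bochner_Integration.integral_cong refl)
    fix x
    have "B *v (T *v x) = x" by (simp only: matrix_vector_mul_assoc BT matrix_vector_mul_lid)
    moreover have "\<xi> \<bullet> (T *v x + t) = (transpose T *v \<xi>) \<bullet> x + \<xi> \<bullet> t"
      by (simp add: inner_add_right dot_lmul_matrix transpose_matrix_vector)
    ultimately show "c * F (B *v (T *v x)) * cnj (ee (\<xi> \<bullet> (T *v x + t))) = (c * cnj (ee (\<xi> \<bullet> t))) * (F x * cnj (ee ((transpose T *v \<xi>) \<bullet> x)))"
      by (simp add: ee_add mult_ac)
  qed
  also have "(LINT x|lborel. (c * cnj (ee (\<xi> \<bullet> t))) * (F x * cnj (ee ((transpose T *v \<xi>) \<bullet> x)))) = (c * cnj (ee (\<xi> \<bullet> t))) * ft F (transpose T *v \<xi>)"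
    unfolding ft_def by (rule integral_mult_right_zero)
  finally show ?thesis by (simp only: mult_ac)
qed

text \<open>For integrable functions this is \<open>ft_pullback\<close>. Both substitutions multiply
  L2 distances by fixed factors, computed in \<open>n1\<close> and \<open>n2\<close>, so the formula
  survives the limit. With \<open>T\<close> a shearlet matrix and \<open>B\<close> its inverse it
  gives the transform of a shearlet atom.\<close>

lemma has_ft_pullback:
  fixes f :: "real ^ 'n \<Rightarrow> complex" and T B :: "real ^ 'n ^ 'n"
  assumes f: "has_ft f f'" and T: "det T \<noteq> 0" and BT: "B ** T = mat 1"
  shows "has_ft (\<lambda>x. c * f (B *v (x - t))) (\<lambda>\<xi>. c * of_real \<bar>det T\<bar> * f' (transpose T *v \<xi>) * cnj (ee (\<xi> \<bullet> t)))"
proof -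
  obtain F where F: "\<And>k::nat. integrable lborel (F k)" "\<And>k. sq_int lborel (F k)"
    and F1: "(\<lambda>k. l2norm lborel (\<lambda>x. F k x - f x)) \<longlonglongrightarrow> 0"
    and F2: "(\<lambda>k. l2norm lborel (\<lambda>\<xi>. ft (F k) \<xi> - f' \<xi>)) \<longlonglongrightarrow> 0"
    and f2: "sq_int lborel f" "sq_int lborel f'"
    using f unfolding has_ft_def by blast
  have dB: "det B \<noteq> 0" using det_mul[of B T] BT by auto
  have dT: "det (transpose T) \<noteq> 0" using T by (simp add: det_transpose)
  have [measurable]: "F k \<in> borel_measurable borel" for k using F(2)[of k] by (simp add: sq_int_def)
  have s1: "sq_int lborel (\<lambda>x. c * h (B *v (x - t)))" if "sq_int lborel h" for h
    by (intro sq_int_cmult sq_int_pullback dB that)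
  have s2: "sq_int lborel (\<lambda>\<xi>. c * of_real \<bar>det T\<bar> * h (transpose T *v \<xi>) * cnj (ee (\<xi> \<bullet> t)))" if "sq_int lborel h" for h
    using sq_int_pullback[OF dT that, of 0] by (intro sq_int_mult_ee sq_int_cmult) simp
  have n1: "l2norm lborel (\<lambda>x. c * F k (B *v (x - t)) - c * f (B *v (x - t))) = (norm c * sqrt (inverse \<bar>det B\<bar>)) * l2norm lborel (\<lambda>x. F k x - f x)" for k
  proof -
    define h where "h x = F k x - f x" for x
    have h: "sq_int lborel h" unfolding h_def by (intro sq_int_diff F f2)
    have "(\<lambda>x. c * F k (B *v (x - t)) - c * f (B *v (x - t))) = (\<lambda>x. c * h (B *v (x - t)))"
      by (simp add: h_def right_diff_distrib)
    then have "l2norm lborel (\<lambda>x. c * F k (B *v (x - t)) - c * f (B *v (x - t))) = norm c * l2norm lborel (\<lambda>x. h (B *v (x - t)))"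
      using l2norm_cmult[OF sq_int_pullback[OF dB h]] by simp
    also have "\<dots> = norm c * (sqrt (inverse \<bar>det B\<bar>) * l2norm lborel h)"
      using h by (subst l2norm_pullback[OF dB]) (auto simp: sq_int_def)
    finally show ?thesis by (simp add: h_def[abs_def])
  qed
  have n2: "l2norm lborel (\<lambda>\<xi>. ft (\<lambda>x. c * F k (B *v (x - t))) \<xi> - c * of_real \<bar>det T\<bar> * f' (transpose T *v \<xi>) * cnj (ee (\<xi> \<bullet> t)))
     = (norm c * \<bar>det T\<bar> * sqrt (inverse \<bar>det T\<bar>)) * l2norm lborel (\<lambda>\<xi>. ft (F k) \<xi> - f' \<xi>)" for k
  proof -
    define h where "h x = ft (F k) x - f' x" for x
    have h: "sq_int lborel h" unfolding h_def by (intro sq_int_diff plancherel F f2)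
    have "(\<lambda>\<xi>. ft (\<lambda>x. c * F k (B *v (x - t))) \<xi> - c * of_real \<bar>det T\<bar> * f' (transpose T *v \<xi>) * cnj (ee (\<xi> \<bullet> t)))
      = (\<lambda>\<xi>. ((c * of_real \<bar>det T\<bar>) * h (transpose T *v (\<xi> - 0))) * cnj (ee (\<xi> \<bullet> t)))"
      using ft_pullback[OF T BT, of "F k"] by (simp add: fun_eq_iff h_def algebra_simps)
    then have "l2norm lborel (\<lambda>\<xi>. ft (\<lambda>x. c * F k (B *v (x - t))) \<xi> - c * of_real \<bar>det T\<bar> * f' (transpose T *v \<xi>) * cnj (ee (\<xi> \<bullet> t)))
      = l2norm lborel (\<lambda>\<xi>. (c * of_real \<bar>det T\<bar>) * h (transpose T *v (\<xi> - 0)))"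
      using l2norm_unimodular[of "\<lambda>\<xi>. cnj (ee (\<xi> \<bullet> t))"] by simp
    also have "\<dots> = norm (c * of_real \<bar>det T\<bar>) * l2norm lborel (\<lambda>\<xi>. h (transpose T *v (\<xi> - 0)))"
      by (rule l2norm_cmult[OF sq_int_pullback[OF dT h]])
    also have "l2norm lborel (\<lambda>\<xi>. h (transpose T *v (\<xi> - 0))) = sqrt (inverse \<bar>det (transpose T)\<bar>) * l2norm lborel h"
      using h by (intro l2norm_pullback[OF dT]) (auto simp: sq_int_def)
    finally show ?thesis by (simp add: h_def[abs_def] norm_mult det_transpose)
  qed
  show ?thesis
    unfolding has_ft_def
  proof (intro conjI exI[of _ "\<lambda>k x. c * F k (B *v (x - t))"] allI)
    show "(\<lambda>k. l2norm lborel (\<lambda>x. c * F k (B *v (x - t)) - c * f (B *v (x - t)))) \<longlonglongrightarrow> 0"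
      unfolding n1 using tendsto_mult_right_zero[OF F1] by simp
    show "(\<lambda>k. l2norm lborel (\<lambda>\<xi>. ft (\<lambda>x. c * F k (B *v (x - t))) \<xi> - c * of_real \<bar>det T\<bar> * f' (transpose T *v \<xi>) * cnj (ee (\<xi> \<bullet> t)))) \<longlonglongrightarrow> 0"
      unfolding n2 using tendsto_mult_right_zero[OF F2] by simp
    show "integrable lborel (\<lambda>x. c * F k (B *v (x - t)))" for k
    proof -
      have "integrable lborel (\<lambda>x. F k (B *v (x + (- t))))"
        by (rule integrable_translate[OF _ integrable_linear[OF dB _ F(1)]]) measurable
      then show ?thesis by simp
    qed
  qed (intro s1 s2 f2 F)+
qed

text \<open>By Plancherel the transforms of the truncations form a Cauchy sequence, which converges
  by \<open>l2_complete\<close>.\<close>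

lemma has_ft_exists:
  fixes f :: "real ^ 'n \<Rightarrow> complex"
  assumes f: "sq_int lborel f"
  shows "\<exists>g. has_ft f g"
proof -
  have [measurable]: "f \<in> borel_measurable borel" using f by (simp add: sq_int_def)
  define F where "F N = trunc N f" for N
  have F2: "sq_int lborel (F N)" for N
  proof -
    have "l2 lborel (F N) \<le> l2 lborel f"
      unfolding l2_def by (intro nn_integral_mono ennreal_leI power_mono) (auto simp: F_def norm_trunc_le)
    then show ?thesis using f by (auto simp: sq_int_def F_def)
  qed
  have F1: "integrable lborel (F N)" for N
  proof (rule Bochner_Integration.integrable_bound)
    have "emeasure lborel (cball (0 :: real ^ 'n) (real N)) < \<infinity>" by (rule emeasure_lborel_cball_finite)
    then have "integrable lborel (\<lambda>x. indicator (cball (0 :: real ^ 'n) (real N)) x :: real)"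
      by (simp add: less_top)
    then show "integrable lborel (\<lambda>x. real N * indicator (cball (0 :: real ^ 'n) (real N)) x)" by simp
    show "F N \<in> borel_measurable lborel" unfolding F_def by simp
    show "AE x in lborel. norm (F N x) \<le> norm (real N * indicator (cball (0 :: real ^ 'n) (real N)) x)"
      by (auto simp: F_def trunc_def indicator_def)
  qed
  have "(\<lambda>N. l2 lborel (\<lambda>x. f x - F N x)) \<longlonglongrightarrow> 0"
    using l2_trunc_tendsto[OF f, of UNIV] by (simp add: F_def)
  then have t0: "(\<lambda>N. l2norm lborel (\<lambda>x. F N x - f x)) \<longlonglongrightarrow> 0"
    by (subst (asm) l2_tendsto_iff) (auto intro!: sq_int_diff f F2 simp: l2norm_diff_commute)
  have "\<exists>g. sq_int lborel g \<and> (\<lambda>k. l2norm lborel (\<lambda>\<xi>. ft (F k) \<xi> - g \<xi>)) \<longlonglongrightarrow> 0"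
  proof (rule l2_complete)
    show "sq_int lborel (ft (F k))" for k by (rule plancherel[OF F1 F2])
    fix e :: real assume "0 < e"
    then have "eventually (\<lambda>N. l2norm lborel (\<lambda>x. F N x - f x) < e / 2) sequentially"
      using t0 by (intro order_tendstoD(2)[where y = 0]) auto
    then obtain N where N: "\<And>n. N \<le> n \<Longrightarrow> l2norm lborel (\<lambda>x. F n x - f x) < e / 2"
      unfolding eventually_sequentially by blast
    have "l2norm lborel (\<lambda>\<xi>. ft (F m) \<xi> - ft (F n) \<xi>) < e" if "N \<le> m" "N \<le> n" for m n
    proof -
      have "l2norm lborel (\<lambda>\<xi>. ft (F m) \<xi> - ft (F n) \<xi>) = l2norm lborel (ft (\<lambda>x. F m x - F n x))"
        unfolding ft_diff[OF F1 F1, abs_def] ..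
      also have "\<dots> = l2norm lborel (\<lambda>x. F m x - F n x)"
        unfolding l2norm_def by (subst plancherel(2)) (auto intro!: sq_int_diff F1 F2)
      also have "\<dots> = l2norm lborel (\<lambda>x. (F m x - f x) + (f x - F n x))" by simp
      also have "\<dots> \<le> l2norm lborel (\<lambda>x. F m x - f x) + l2norm lborel (\<lambda>x. f x - F n x)"
        by (intro l2norm_triangle sq_int_diff F2 f)
      also have "\<dots> < e / 2 + e / 2"
        using N[OF that(1)] N[OF that(2)] l2norm_diff_commute[of lborel f "F n"] by simp
      finally show ?thesis by simp
    qed
    then show "\<exists>N. \<forall>m\<ge>N. \<forall>n\<ge>N. l2norm lborel (\<lambda>\<xi>. ft (F m) \<xi> - ft (F n) \<xi>) < e" by blast
  qed
  then show ?thesis unfolding has_ft_def using f F1 F2 t0 by blast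
qed

section \<open>From Lebesgue measurable representatives to Borel versions\<close>

lemma square_integrable_iff: "square_integrable f \<longleftrightarrow> sq_int lebesgue f"
  by (auto simp: square_integrable_def sq_int_def l2_def integrable_iff_bounded)

lemma L2_norm_sq_eq_l2: "L2_norm_sq f = l2 lebesgue f"
  by (simp add: L2_norm_sq_def l2_def)

lemma borel_version:
  fixes f :: "'a::euclidean_space \<Rightarrow> complex"
  assumes f: "f \<in> borel_measurable lebesgue"
  shows "\<exists>g \<in> borel_measurable borel. AE x in lborel. f x = g x"
proof -
  have m: "(\<lambda>x. Re (f x)) \<in> borel_measurable lebesgue" "(\<lambda>x. Im (f x)) \<in> borel_measurable lebesgue"
    using f by auto
  obtain u v where uv: "u \<in> borel_measurable lborel" "AE x in lborel. Re (f x) = u x"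
     "v \<in> borel_measurable lborel" "AE x in lborel. Im (f x) = v x"
    using completion_ex_borel_measurable_real[OF m(1)] completion_ex_borel_measurable_real[OF m(2)] by blast
  have "AE x in lborel. f x = Complex (u x) (v x)"
    using uv(2,4) by eventually_elim (simp add: complex_eq_iff)
  moreover have "(\<lambda>x. Complex (u x) (v x)) \<in> borel_measurable borel"
    using uv(1,3) by (simp add: borel_measurable_complex_iff)
  ultimately show ?thesis by (intro bexI[of _ "\<lambda>x. Complex (u x) (v x)"])
qed

lemma l2_lebesgue_cong: "AE x in lborel. f x = g x \<Longrightarrow> l2 lebesgue f = l2 lborel g"
  unfolding l2_def nn_integral_completion by (intro nn_integral_cong_AE) auto

lemma sq_int_lebesgue:
  assumes "g \<in> borel_measurable borel" "AE x in lborel. f x = g x" "sq_int lebesgue f"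
  shows "sq_int lborel g"
  using assms l2_lebesgue_cong[OF assms(2)] by (simp add: sq_int_def)

lemma sq_int_lborel_imp_lebesgue: "sq_int lborel g \<Longrightarrow> sq_int lebesgue g"
  using l2_lebesgue_cong[of g g] by (auto simp: sq_int_def measurable_completion)

lemma integral_lebesgue_cong:
  fixes f g :: "'a::euclidean_space \<Rightarrow> complex"
  assumes f: "f \<in> borel_measurable lebesgue" and g: "g \<in> borel_measurable borel" and fg: "AE x in lborel. f x = g x"
  shows "integral\<^sup>L lebesgue f = integral\<^sup>L lborel g" "integrable lebesgue f \<longleftrightarrow> integrable lborel g"
proof -
  have gl: "g \<in> borel_measurable lborel" "g \<in> borel_measurable lebesgue" using g by (auto intro: measurable_completion)
  have ae: "AE x in lebesgue. f x = g x" using fg by (rule AE_completion)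
  show "integral\<^sup>L lebesgue f = integral\<^sup>L lborel g"
    using integral_cong_AE[OF f gl(2) ae] integral_completion[OF gl(1)] by simp
  show "integrable lebesgue f \<longleftrightarrow> integrable lborel g"
    using integrable_cong_AE[OF f gl(2) ae] integrable_completion[OF gl(1)] by simp
qed

lemma fourier_L1_eq_ft:
  fixes f g :: "real ^ 'n \<Rightarrow> complex"
  assumes f: "f \<in> borel_measurable lebesgue" and g [measurable]: "g \<in> borel_measurable borel" and fg: "AE x in lborel. f x = g x"
  shows "fourier_L1 f = ft g"
proof
  fix \<xi> :: "real ^ 'n"
  have e: "exp (- (2 * complex_of_real pi * \<i> * complex_of_real (\<xi> \<bullet> x))) = cnj (ee (\<xi> \<bullet> x))" for x
    by (simp add: ee_def cis_conv_exp mult_ac) (simp add: exp_cnj)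
  have em: "(\<lambda>x. cnj (ee (\<xi> \<bullet> x))) \<in> borel_measurable lebesgue"
    by (rule measurable_completion) measurable
  show "fourier_L1 f \<xi> = ft g \<xi>"
    unfolding fourier_L1_def e ft_def
  proof (rule integral_lebesgue_cong)
    show "(\<lambda>x. f x * cnj (ee (\<xi> \<bullet> x))) \<in> borel_measurable lebesgue" using f em by simp
    show "AE x in lborel. f x * cnj (ee (\<xi> \<bullet> x)) = g x * cnj (ee (\<xi> \<bullet> x))" using fg by auto
  qed measurable
qed

text \<open>The relation sees functions only up to null sets, so every approximant can be exchanged
  for a Borel version.\<close>

lemma has_fourier_L2_borel:
  fixes f f' :: "real ^ 'n \<Rightarrow> complex"
  assumes h: "has_fourier_L2 f f'" and f: "sq_int lebesgue f"
    and g: "g \<in> borel_measurable borel" "AE x in lborel. f x = g x"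
    and g': "g' \<in> borel_measurable borel" "AE x in lborel. f' x = g' x"
  shows "has_ft g g'"
proof -
  obtain F where F: "\<And>k::nat. integrable lebesgue (F k)" "\<And>k. sq_int lebesgue (F k)"
    and l1: "(\<lambda>k. l2 lebesgue (\<lambda>x. F k x - f x)) \<longlonglongrightarrow> 0"
    and l2: "(\<lambda>k. l2 lebesgue (\<lambda>\<xi>. fourier_L1 (F k) \<xi> - f' \<xi>)) \<longlonglongrightarrow> 0"
    and f': "sq_int lebesgue f'"
    using h unfolding has_fourier_L2_def square_integrable_iff L2_norm_sq_eq_l2 by blast
  have Fm: "F k \<in> borel_measurable lebesgue" for k using F(2)[of k] by (simp add: sq_int_def)
  have "\<forall>k. \<exists>G. G \<in> borel_measurable borel \<and> (AE x in lborel. F k x = G x)"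
    using borel_version[OF Fm] by blast
  then obtain G where G: "\<And>k. G k \<in> borel_measurable borel" "\<And>k. AE x in lborel. F k x = G k x" by metis
  have gs: "sq_int lborel g" "sq_int lborel g'"
    by (rule sq_int_lebesgue[OF g f], rule sq_int_lebesgue[OF g' f'])
  have G1: "integrable lborel (G k)" for k
    using integral_lebesgue_cong(2)[OF Fm G] F by blast
  have G2: "sq_int lborel (G k)" for k by (rule sq_int_lebesgue[OF G F(2)])
  have "AE x in lborel. F k x - f x = G k x - g x" for k
    using G(2)[of k] g(2) by eventually_elim simp
  from l2_lebesgue_cong[OF this] l1 have 1: "(\<lambda>k. l2 lborel (\<lambda>x. G k x - g x)) \<longlonglongrightarrow> 0" by simp
  have "AE x in lborel. fourier_L1 (F k) x - f' x = ft (G k) x - g' x" for k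
    using g'(2) unfolding fourier_L1_eq_ft[OF Fm G] by eventually_elim simp
  from l2_lebesgue_cong[OF this] l2 have 2: "(\<lambda>k. l2 lborel (\<lambda>\<xi>. ft (G k) \<xi> - g' \<xi>)) \<longlonglongrightarrow> 0" by simp
  have "(\<lambda>k. l2norm lborel (\<lambda>x. G k x - g x)) \<longlonglongrightarrow> 0"
    using 1 by (subst (asm) l2_tendsto_iff) (auto intro!: sq_int_diff G2 gs)
  moreover have "(\<lambda>k. l2norm lborel (\<lambda>\<xi>. ft (G k) \<xi> - g' \<xi>)) \<longlonglongrightarrow> 0"
    using 2 by (subst (asm) l2_tendsto_iff) (auto intro!: sq_int_diff plancherel(1) G1 G2 gs)
  ultimately show ?thesis unfolding has_ft_def using gs G1 G2 by blast
qed

lemma has_fourier_L2_of_has_ft: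
  fixes f :: "real ^ 'n \<Rightarrow> complex"
  assumes h: "has_ft g g'" and fg: "AE x in lborel. f x = g x"
  shows "has_fourier_L2 f g'"
proof -
  obtain G where G: "\<And>k::nat. integrable lborel (G k)" "\<And>k. sq_int lborel (G k)"
    and l1: "(\<lambda>k. l2norm lborel (\<lambda>x. G k x - g x)) \<longlonglongrightarrow> 0"
    and l2: "(\<lambda>k. l2norm lborel (\<lambda>\<xi>. ft (G k) \<xi> - g' \<xi>)) \<longlonglongrightarrow> 0"
    and gs: "sq_int lborel g" "sq_int lborel g'"
    using h unfolding has_ft_def by blast
  have Gm: "G k \<in> borel_measurable borel" "G k \<in> borel_measurable lborel" for k using G(2)[of k] by (auto simp: sq_int_def)
  have Gl: "G k \<in> borel_measurable lebesgue" for k using Gm(2) by (rule measurable_completion)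
  have "AE x in lborel. G k x - f x = G k x - g x" for k
    using fg by eventually_elim simp
  then have e1: "l2 lebesgue (\<lambda>x. G k x - f x) = l2 lborel (\<lambda>x. G k x - g x)" for k by (rule l2_lebesgue_cong)
  have ftG: "fourier_L1 (G k) = ft (G k)" for k by (rule fourier_L1_eq_ft[OF Gl Gm(1)]) simp
  have e2: "l2 lebesgue (\<lambda>\<xi>. fourier_L1 (G k) \<xi> - g' \<xi>) = l2 lborel (\<lambda>\<xi>. ft (G k) \<xi> - g' \<xi>)" for k
    unfolding ftG by (rule l2_lebesgue_cong) simp
  show ?thesis
    unfolding has_fourier_L2_def square_integrable_iff L2_norm_sq_eq_l2
  proof (intro conjI exI[of _ G] allI)
    show "sq_int lebesgue g'" by (rule sq_int_lborel_imp_lebesgue[OF gs(2)])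
    show "integrable lebesgue (G k)" for k using G(1) integrable_completion[OF Gm(2)] by blast
    show "sq_int lebesgue (G k)" for k by (rule sq_int_lborel_imp_lebesgue[OF G(2)])
    show "(\<lambda>k. l2 lebesgue (\<lambda>x. G k x - f x)) \<longlonglongrightarrow> 0"
      unfolding e1 using l1 by (subst l2_tendsto_iff) (auto intro!: sq_int_diff G gs)
    show "(\<lambda>k. l2 lebesgue (\<lambda>\<xi>. fourier_L1 (G k) \<xi> - g' \<xi>)) \<longlonglongrightarrow> 0"
      unfolding e2 using l2 by (subst l2_tendsto_iff) (auto intro!: sq_int_diff plancherel(1) G gs)
  qed
qed

text \<open>The existence of some transform justifies the choice made by \<open>fourier\<close>; the
  chosen representative is then itself replaced by a Borel version.\<close>

lemma fourier_borel_versions: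
  fixes f :: "real ^ 'n \<Rightarrow> complex"
  assumes f: "square_integrable f"
  obtains g g' where "g \<in> borel_measurable borel" "AE x in lborel. f x = g x"
    "g' \<in> borel_measurable borel" "AE \<xi> in lborel. fourier f \<xi> = g' \<xi>" "has_ft g g'"
proof -
  have f2: "sq_int lebesgue f" using f by (simp add: square_integrable_iff)
  then obtain g where g: "g \<in> borel_measurable borel" "AE x in lborel. f x = g x"
    using borel_version[of f] by (auto simp: sq_int_def)
  obtain h where "has_ft g h" using has_ft_exists[OF sq_int_lebesgue[OF g f2]] by blast
  then have "has_fourier_L2 f h" using g(2) by (rule has_fourier_L2_of_has_ft)
  then have hf: "has_fourier_L2 f (fourier f)" unfolding fourier_def by (rule someI[of "has_fourier_L2 f"])
  then have "sq_int lebesgue (fourier f)" by (simp add: has_fourier_L2_def square_integrable_iff)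
  then obtain g' where g': "g' \<in> borel_measurable borel" "AE \<xi> in lborel. fourier f \<xi> = g' \<xi>"
    using borel_version[of "fourier f"] by (auto simp: sq_int_def)
  have "has_ft g g'" by (rule has_fourier_L2_borel[OF hf f2 g g'])
  then show ?thesis using that g g' by blast
qed

section \<open>Shearlet orbits and the admissibility constant\<close>

text \<open>The isomorphism \<open>\<real> \<times> \<real>\<^bsup>n-1\<^esup> \<cong> \<real>\<^sup>n\<close> splitting off the coordinate \<open>None\<close>.\<close>

definition vec_cons :: "real \<Rightarrow> real ^ 'm \<Rightarrow> real ^ ('m::finite option)" where
  "vec_cons u \<eta> = (\<chi> i. case i of None \<Rightarrow> u | Some j \<Rightarrow> \<eta> $ j)"

lemma vec_cons_nth [simp]: "vec_cons u \<eta> $ None = u" "vec_cons u \<eta> $ Some j = \<eta> $ j"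
  by (simp_all add: vec_cons_def)

lemma UNIV_option: "(UNIV :: 'm::finite option set) = insert None (Some ` UNIV)"
  by (auto simp: image_iff)

lemma prod_option: "(\<Prod>i\<in>(UNIV :: 'm::finite option set). f i) = f None * (\<Prod>j\<in>UNIV. f (Some j) :: 'b::comm_monoid_mult)"
  unfolding UNIV_option by (subst prod.insert) (auto simp: prod.reindex)

lemma sum_option: "(\<Sum>i\<in>(UNIV :: 'm::finite option set). f i) = f None + (\<Sum>j\<in>UNIV. f (Some j) :: 'b::comm_monoid_add)"
  unfolding UNIV_option by (subst sum.insert) (auto simp: sum.reindex)

lemma vec_cons_measurable [measurable]:
  "(\<lambda>p. vec_cons (fst p) (snd p)) \<in> borel \<rightarrow>\<^sub>M (borel :: (real ^ ('m::finite option)) measure)"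
proof (intro borel_measurable_continuous_onI)
  have "continuous_on UNIV (\<lambda>p :: real \<times> (real ^ 'm). \<chi> i. case i of None \<Rightarrow> fst p | Some j \<Rightarrow> snd p $ j)"
  proof (rule continuous_on_vec_lambda)
    fix i :: "'m option"
    show "continuous_on UNIV (\<lambda>p :: real \<times> (real ^ 'm). case i of None \<Rightarrow> fst p | Some j \<Rightarrow> snd p $ j)"
      by (cases i) (auto intro!: continuous_intros)
  qed
  then show "continuous_on UNIV (\<lambda>p :: real \<times> (real ^ 'm). vec_cons (fst p) (snd p))"
    unfolding vec_cons_def .
qed

lemma lborel_vec_cons:
  "(lborel :: (real ^ ('m::finite option)) measure) = distr (lborel \<Otimes>\<^sub>M lborel) borel (\<lambda>p. vec_cons (fst p) (snd p))"
proof (rule lborel_eqI)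
  fix l u :: "real ^ ('m option)"
  assume le: "\<And>b. b \<in> Basis \<Longrightarrow> l \<bullet> b \<le> u \<bullet> b"
  have le': "l $ i \<le> u $ i" for i
    using le[of "axis i 1"] by (simp add: inner_axis axis_in_Basis_iff)
  define l' where "l' = (\<chi> j. l $ Some j)"
  define u' where "u' = (\<chi> j. u $ Some j)"
  have m: "(\<lambda>p. vec_cons (fst p) (snd p)) \<in> (lborel \<Otimes>\<^sub>M lborel) \<rightarrow>\<^sub>M (borel :: (real ^ ('m option)) measure)"
    using vec_cons_measurable unfolding lborel_prod by simp
  have pre: "(\<lambda>p. vec_cons (fst p) (snd p)) -` box l u \<inter> space (lborel \<Otimes>\<^sub>M lborel) = box (l $ None) (u $ None) \<times> box l' u'"
    by (auto simp: mem_box_cart l'_def u'_def space_pair_measure split_option_all)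
  have "emeasure (distr (lborel \<Otimes>\<^sub>M lborel) borel (\<lambda>p. vec_cons (fst p) (snd p))) (box l u)
     = emeasure lborel (box (l $ None) (u $ None)) * emeasure lborel (box l' u')"
    using m by (simp add: emeasure_distr pre lborel.emeasure_pair_measure_Times)
  also have "\<dots> = ennreal (u $ None - l $ None) * ennreal (\<Prod>b\<in>Basis. (u' - l') \<bullet> b)"
    using le' by (subst emeasure_lborel_box) (auto simp: Basis_vec_def inner_axis l'_def u'_def inner_diff_left)
  also have "\<dots> = ennreal ((u $ None - l $ None) * (\<Prod>b\<in>Basis. (u' - l') \<bullet> b))"
    using le' by (simp add: ennreal_mult')
  also have "(u $ None - l $ None) * (\<Prod>b\<in>Basis. (u' - l') \<bullet> b) = (\<Prod>b\<in>Basis. (u - l) \<bullet> b)"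
    unfolding prod_Basis_vec by (simp add: prod_option inner_axis l'_def u'_def)
  finally show "emeasure (distr (lborel \<Otimes>\<^sub>M lborel) borel (\<lambda>p. vec_cons (fst p) (snd p))) (box l u) = (\<Prod>b\<in>Basis. (u - l) \<bullet> b)" .
qed simp

lemma nn_integral_vec_cons:
  assumes [measurable]: "f \<in> borel_measurable (borel :: (real ^ ('m::finite option)) measure)"
  shows "(\<integral>\<^sup>+x. f x \<partial>lborel) = (\<integral>\<^sup>+u. (\<integral>\<^sup>+\<eta>. f (vec_cons u \<eta>) \<partial>lborel) \<partial>lborel)"
proof -
  have m: "(\<lambda>p. vec_cons (fst p) (snd p)) \<in> (lborel \<Otimes>\<^sub>M lborel) \<rightarrow>\<^sub>M (borel :: (real ^ ('m option)) measure)"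
    using vec_cons_measurable unfolding lborel_prod by simp
  have "(\<integral>\<^sup>+x. f x \<partial>lborel) = (\<integral>\<^sup>+p. f (vec_cons (fst p) (snd p)) \<partial>(lborel \<Otimes>\<^sub>M lborel))"
    by (subst lborel_vec_cons) (rule nn_integral_distr[OF m], simp)
  also have "\<dots> = (\<integral>\<^sup>+u. (\<integral>\<^sup>+\<eta>. f (vec_cons (fst (u, \<eta>)) (snd (u, \<eta>))) \<partial>lborel) \<partial>lborel)"
    by (rule lborel.nn_integral_fst[symmetric]) (rule measurable_compose[OF m], simp)
  finally show ?thesis by simp
qed

section \<open>Shearlet matrices, their determinants and exponents\<close>

definition vec_tail :: "real ^ ('m::finite option) \<Rightarrow> real ^ 'm" where "vec_tail x = (\<chi> j. x $ Some j)"

text \<open>The diagonal entry of \<open>dilation_matrix\<close> in all coordinates but the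
  first.\<close>

definition shear_scale :: "'m::finite itself \<Rightarrow> real \<Rightarrow> real" where
  "shear_scale _ a = sgn a * \<bar>a\<bar> powr (1 / real CARD('m option))"

text \<open>Closed form of the transposed shearlet matrix applied to \<xi>, as
  \<open>transpose_shearlet_matrix_apply\<close> confirms.\<close>

definition orbit :: "real \<Rightarrow> real ^ 'm \<Rightarrow> real ^ ('m::finite option) \<Rightarrow> real ^ ('m option)" where
  "orbit a s \<xi> = vec_cons (a * \<xi> $ None) (shear_scale TYPE('m) a *\<^sub>R (\<xi> $ None *\<^sub>R s + vec_tail \<xi>))"

lemma shearlet_matrix_nth:
  "shearlet_matrix s a $ i $ j = shear_matrix s $ i $ j * (if j = None then a else shear_scale TYPE('m::finite) a)"
  for s :: "real ^ 'm"
proof -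
  have d: "dilation_matrix a $ k $ j = (if k = j then (if j = None then a else shear_scale TYPE('m) a) else 0)" for k j :: "'m option"
    by (auto simp: dilation_matrix_def shear_scale_def)
  have "shearlet_matrix s a $ i $ j = (\<Sum>k\<in>UNIV. shear_matrix s $ i $ k * dilation_matrix a $ k $ j)"
    by (simp add: shearlet_matrix_def matrix_matrix_mult_def)
  also have "\<dots> = (\<Sum>k\<in>UNIV. if k = j then shear_matrix s $ i $ j * (if j = None then a else shear_scale TYPE('m) a) else 0)"
    unfolding d by (intro sum.cong) auto
  finally show ?thesis by simp
qed

lemma transpose_shearlet_matrix_apply: "transpose (shearlet_matrix s a) *v \<xi> = orbit a s \<xi>"
proof -
  have "(\<xi> v* shearlet_matrix s a) $ i = orbit a s \<xi> $ i" for i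
    by (cases i)
       (simp_all add: vector_matrix_mult_def shearlet_matrix_nth sum_option orbit_def shear_matrix_def vec_tail_def
         if_distrib[of "\<lambda>c. c * _"] if_distrib[of "\<lambda>c. _ * c"] algebra_simps cong: if_cong)
  then show ?thesis by (simp add: vec_eq_iff)
qed

text \<open>The matrix arises from the identity by adding a combination of the other rows to the
  first one.\<close>

lemma det_shear_matrix: "det (shear_matrix s) = 1"
proof -
  define x where "x = (\<Sum>l\<in>UNIV. s $ l *s row (Some l) (mat 1 :: real ^ ('a option) ^ ('a option)))"
  have "x \<in> vec.span {row j (mat 1 :: real ^ ('a option) ^ ('a option)) |j. j \<noteq> None}"
    unfolding x_def by (intro vec.span_sum vec.span_scale vec.span_base) auto
  then have "det (\<chi> k. if k = None then row None (mat 1) + x else row k (mat 1)) = det (mat 1 :: real ^ ('a option) ^ ('a option))"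
    by (rule det_row_span)
  moreover have "(\<chi> k. if k = None then row None (mat 1) + x else row k (mat 1)) = shear_matrix s"
    by (simp add: vec_eq_iff split_option_all x_def row_def mat_def shear_matrix_def if_distrib[of "\<lambda>c. _ * c"] cong: if_cong)
  ultimately show ?thesis by simp
qed

lemma det_shearlet_matrix:
  fixes s :: "real ^ 'm::finite"
  shows "det (shearlet_matrix s a) = a * shear_scale TYPE('m) a ^ CARD('m)"
proof -
  have "det (dilation_matrix a :: real ^ ('m option) ^ ('m option)) = (\<Prod>i\<in>UNIV. (dilation_matrix a :: real ^ ('m option) ^ ('m option)) $ i $ i)"
    by (rule det_diagonal) (simp add: dilation_matrix_def)
  also have "\<dots> = a * shear_scale TYPE('m) a ^ CARD('m)"
    by (simp add: prod_option dilation_matrix_def shear_scale_def)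
  finally show ?thesis by (simp add: shearlet_matrix_def det_mul det_shear_matrix)
qed

lemma abs_shear_scale: "a \<noteq> 0 \<Longrightarrow> \<bar>shear_scale TYPE('m::finite) a\<bar> = \<bar>a\<bar> powr (1 / real CARD('m option))"
  by (simp add: shear_scale_def abs_mult)

lemma abs_det_shearlet_matrix:
  fixes s :: "real ^ 'm::finite"
  assumes "a \<noteq> 0"
  shows "\<bar>det (shearlet_matrix s a)\<bar> = \<bar>a\<bar> powr (1 + real CARD('m) / real CARD('m option))"
proof -
  have "\<bar>det (shearlet_matrix s a)\<bar> = \<bar>a\<bar> * (\<bar>a\<bar> powr (1 / real CARD('m option))) ^ CARD('m)"
    unfolding det_shearlet_matrix using assms by (simp add: abs_mult power_abs abs_shear_scale)
  also have "(\<bar>a\<bar> powr (1 / real CARD('m option))) ^ CARD('m) = \<bar>a\<bar> powr (real CARD('m) / real CARD('m option))"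
    using assms by (simp add: powr_powr flip: powr_realpow)
  also have "\<bar>a\<bar> * \<dots> = \<bar>a\<bar> powr (1 + real CARD('m) / real CARD('m option))"
    using assms by (simp add: powr_add)
  finally show ?thesis .
qed

definition adm_exp :: "'m::finite itself \<Rightarrow> real" where
  "adm_exp _ = ((real CARD('m option))\<^sup>2 - real CARD('m option) + 1) / real CARD('m option)"

lemma real_card_option: "real CARD('m::finite option) = real CARD('m) + 1"
  by simp

text \<open>The exponents satisfy 1 + (n - 1) / n - (n + 1) = - (n^2 - n + 1) / n. So the
  determinant factor in the squared shearlet transform turns the weight of the triple integral into
  that of the admissibility integral.\<close>

lemma shear_exponent_weight:
  fixes s :: "real ^ 'm::finite"
  assumes a: "a \<noteq> 0"
  shows "\<bar>det (shearlet_matrix s a)\<bar> / \<bar>a\<bar> ^ (CARD('m option) + 1) = 1 / \<bar>a\<bar> powr adm_exp TYPE('m)"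
proof -
  define n where "n = real CARD('m option)"
  have n: "0 < n" unfolding n_def real_card_option by linarith
  have m: "real CARD('m) = n - 1" by (simp add: n_def)
  have "\<bar>a\<bar> ^ (CARD('m option) + 1) = \<bar>a\<bar> powr (n + 1)"
    using a powr_realpow[of "\<bar>a\<bar>" "CARD('m option) + 1"] by (simp add: n_def add.commute)
  moreover have "1 + (n - 1) / n - (n + 1) = - adm_exp TYPE('m)"
    unfolding adm_exp_def n_def[symmetric] using n by (simp add: field_simps power2_eq_square)
  ultimately have "\<bar>det (shearlet_matrix s a)\<bar> / \<bar>a\<bar> ^ (CARD('m option) + 1) = \<bar>a\<bar> powr (- adm_exp TYPE('m))"
    unfolding abs_det_shearlet_matrix[OF a] m n_def[symmetric] by (simp add: powr_diff[symmetric] n_def)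
  then show ?thesis by (simp add: powr_minus_divide)
qed

text \<open>The substitution in \<open>s\<close> has a Jacobian of exponent (n - 1) / n in
  \<open>a\<close>, which completes the exponent of the admissibility weight to exactly
  \<open>n\<close>.\<close>

lemma shear_scale_weight:
  assumes a: "a \<noteq> 0"
  shows "1 / \<bar>a\<bar> powr adm_exp TYPE('m::finite) * inverse (\<bar>shear_scale TYPE('m) a\<bar> ^ CARD('m)) = inverse (\<bar>a\<bar> ^ CARD('m option))"
proof -
  define n where "n = real CARD('m option)"
  have n: "0 < n" unfolding n_def real_card_option by linarith
  have m: "real CARD('m) = n - 1" by (simp add: n_def)
  have "\<bar>shear_scale TYPE('m) a\<bar> ^ CARD('m) = \<bar>a\<bar> powr ((n - 1) / n)"
  proof -
    have "(\<bar>a\<bar> powr (1 / n)) ^ CARD('m) = \<bar>a\<bar> powr (real CARD('m) / n)"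
      using a by (simp add: powr_powr flip: powr_realpow)
    then show ?thesis unfolding abs_shear_scale[OF a] n_def[symmetric] m .
  qed
  moreover have "\<bar>a\<bar> ^ CARD('m option) = \<bar>a\<bar> powr n"
    using a powr_realpow[of "\<bar>a\<bar>" "CARD('m option)"] by (simp add: n_def)
  moreover have "adm_exp TYPE('m) + (n - 1) / n = n"
    unfolding adm_exp_def n_def[symmetric] using n by (simp add: field_simps power2_eq_square)
  moreover have "1 / \<bar>a\<bar> powr adm_exp TYPE('m) * inverse (\<bar>a\<bar> powr ((n - 1) / n)) = inverse (\<bar>a\<bar> powr (adm_exp TYPE('m) + (n - 1) / n))"
    by (simp add: powr_add field_simps)
  ultimately show ?thesis by simp
qed

section \<open>Integration along shearlet orbits\<close>

lemma vec_cons_measurable_raw [measurable (raw)]: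
  assumes "f \<in> borel_measurable M" "g \<in> borel_measurable M"
  shows "(\<lambda>x. vec_cons (f x) (g x)) \<in> borel_measurable M"
  using measurable_compose[OF borel_measurable_Pair[OF assms] vec_cons_measurable] by simp

lemma vec_nth_measurable [measurable (raw)]:
  "f \<in> borel_measurable M \<Longrightarrow> (\<lambda>x. (f x :: real ^ 'n) $ i) \<in> borel_measurable M"
  by (rule measurable_compose[of f M borel "\<lambda>x. x $ i"])
     (auto intro!: borel_measurable_continuous_onI continuous_intros)

lemma vec_tail_measurable [measurable (raw)]:
  "f \<in> borel_measurable M \<Longrightarrow> (\<lambda>x. vec_tail (f x)) \<in> borel_measurable M"
  by (rule measurable_compose[of f M borel vec_tail])
     (auto intro!: borel_measurable_continuous_onI continuous_intros simp: vec_tail_def[abs_def])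

lemma orbit_measurable [measurable (raw)]:
  assumes [measurable]: "f \<in> borel_measurable M" "g \<in> borel_measurable M" "h \<in> borel_measurable M"
  shows "(\<lambda>x. orbit (f x) (g x) (h x)) \<in> borel_measurable M"
  unfolding orbit_def shear_scale_def by measurable

definition adm_weight :: "'m::finite itself \<Rightarrow> real \<Rightarrow> ennreal" where
  "adm_weight _ a = ennreal (1 / \<bar>a\<bar> powr adm_exp TYPE('m)) * indicator (- {0}) a"

lemma adm_weight_measurable [measurable (raw)]:
  "f \<in> borel_measurable M \<Longrightarrow> (\<lambda>x. adm_weight TYPE('m::finite) (f x)) \<in> borel_measurable M"
proof (rule measurable_compose[of f M borel "adm_weight TYPE('m)"])
  have "(indicator (- {0}) :: real \<Rightarrow> ennreal) \<in> borel_measurable borel" by (intro borel_measurable_indicator) auto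
  then show "adm_weight TYPE('m) \<in> borel_measurable borel" unfolding adm_weight_def by measurable
qed

text \<open>The integral of \<open>G\<close> against the density |x_1|^(-n) over the complement of
  the hyperplane x_1 = 0, written in the coordinates of \<open>vec_cons\<close>.\<close>

definition orbit_mean :: "(real ^ ('m::finite option) \<Rightarrow> ennreal) \<Rightarrow> ennreal" where
  "orbit_mean G = (\<integral>\<^sup>+u. ennreal (inverse (\<bar>u\<bar> ^ CARD('m option))) * (\<integral>\<^sup>+\<eta>. G (vec_cons u \<eta>) \<partial>lborel) * indicator (- {0}) u \<partial>lborel)"

text \<open>The change of variables \<open>(a, s) \<mapsto> M\<^sub>s\<^sub>a\<^sup>T \<xi>\<close>; the right-hand side no longer involves \<open>\<xi>\<close>.\<close>

lemma orbit_integral: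
  fixes \<xi> :: "real ^ ('m::finite option)"
  assumes [measurable]: "G \<in> borel_measurable borel" and \<xi>: "\<xi> $ None \<noteq> 0"
  shows "(\<integral>\<^sup>+s. (\<integral>\<^sup>+a. adm_weight TYPE('m) a * G (orbit a s \<xi>) \<partial>lborel) \<partial>lborel) = orbit_mean G"
proof -
  define x where "x = \<xi> $ None"
  define H where "H u = (\<integral>\<^sup>+\<eta>. G (vec_cons u \<eta>) \<partial>lborel)" for u
  define N where "N = CARD('m option)"
  have ind [measurable]: "(indicator (- {0}) :: real \<Rightarrow> ennreal) \<in> borel_measurable borel"
    by (intro borel_measurable_indicator) auto
  have [measurable]: "H \<in> borel_measurable borel" unfolding H_def by measurable
  define g where "g u = ennreal (inverse (\<bar>u\<bar> ^ N)) * H u * indicator (- {0}) u" for u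
  have [measurable]: "g \<in> borel_measurable borel" unfolding g_def by measurable
  have "(\<integral>\<^sup>+s. (\<integral>\<^sup>+a. adm_weight TYPE('m) a * G (orbit a s \<xi>) \<partial>lborel) \<partial>lborel)
      = (\<integral>\<^sup>+a. (\<integral>\<^sup>+s. adm_weight TYPE('m) a * G (orbit a s \<xi>) \<partial>lborel) \<partial>lborel)"
    by (intro lborel_pair.Fubini') measurable
  also have "\<dots> = (\<integral>\<^sup>+a. ennreal \<bar>x\<bar> * g (0 + x * a) \<partial>lborel)"
  proof (rule nn_integral_cong)
    fix a :: real
    show "(\<integral>\<^sup>+s. adm_weight TYPE('m) a * G (orbit a s \<xi>) \<partial>lborel) = ennreal \<bar>x\<bar> * g (0 + x * a)"
    proof (cases "a = 0")
      case True
      then show ?thesis by (simp add: adm_weight_def g_def)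
    next
      case False
      define b where "b = shear_scale TYPE('m) a"
      have b: "b \<noteq> 0" using False by (simp add: b_def shear_scale_def sgn_zero_iff)
      have bx: "b * x \<noteq> 0" using b \<xi> by (simp add: x_def)
      have "(\<integral>\<^sup>+s. adm_weight TYPE('m) a * G (orbit a s \<xi>) \<partial>lborel) = adm_weight TYPE('m) a * (\<integral>\<^sup>+s. G (orbit a s \<xi>) \<partial>lborel)"
        by (rule nn_integral_cmult) measurable
      \<comment> \<open>For fixed \<open>a\<close> the tail of the orbit is affine in
        \<open>s\<close> with factor \<open>b * x\<close>; the substitution in \<open>n - 1\<close>
        variables removes the tail of \<xi> and leaves only \<open>x\<close>.\<close>
      also have "(\<integral>\<^sup>+s. G (orbit a s \<xi>) \<partial>lborel) = (\<integral>\<^sup>+s. G (vec_cons (a * x) (b *\<^sub>R vec_tail \<xi> + (b * x) *\<^sub>R s)) \<partial>lborel)"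
        by (simp add: orbit_def x_def b_def algebra_simps)
      also have "\<dots> = ennreal (inverse (\<bar>b * x\<bar> ^ CARD('m))) * H (a * x)"
        unfolding H_def by (rule nn_integral_affine'[OF _ bx, of "\<lambda>\<eta>. G (vec_cons (a * x) \<eta>)"]) measurable
      also have "adm_weight TYPE('m) a * \<dots> = ennreal (1 / \<bar>a\<bar> powr adm_exp TYPE('m) * inverse (\<bar>b * x\<bar> ^ CARD('m))) * H (a * x)"
      proof -
        have "adm_weight TYPE('m) a = ennreal (1 / \<bar>a\<bar> powr adm_exp TYPE('m))" using False by (simp add: adm_weight_def)
        moreover have "ennreal (1 / \<bar>a\<bar> powr adm_exp TYPE('m) * inverse (\<bar>b * x\<bar> ^ CARD('m)))
          = ennreal (1 / \<bar>a\<bar> powr adm_exp TYPE('m)) * ennreal (inverse (\<bar>b * x\<bar> ^ CARD('m)))"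
          by (rule ennreal_mult) auto
        ultimately show ?thesis by (simp only: mult.assoc)
      qed
      also have "1 / \<bar>a\<bar> powr adm_exp TYPE('m) * inverse (\<bar>b * x\<bar> ^ CARD('m)) = \<bar>x\<bar> * inverse (\<bar>x * a\<bar> ^ N)"
      proof -
        have "1 / \<bar>a\<bar> powr adm_exp TYPE('m) * inverse (\<bar>b * x\<bar> ^ CARD('m)) =
          (1 / \<bar>a\<bar> powr adm_exp TYPE('m) * inverse (\<bar>b\<bar> ^ CARD('m))) * inverse (\<bar>x\<bar> ^ CARD('m))"
          by (simp add: abs_mult power_mult_distrib)
        also have "\<dots> = inverse (\<bar>a\<bar> ^ N) * inverse (\<bar>x\<bar> ^ CARD('m))"
          unfolding b_def shear_scale_weight[OF False] N_def ..
        also have "\<dots> = \<bar>x\<bar> * inverse (\<bar>x * a\<bar> ^ N)"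
          using \<xi> False by (simp add: N_def x_def abs_mult power_mult_distrib field_simps)
        finally show ?thesis .
      qed
      also have "ennreal (\<bar>x\<bar> * inverse (\<bar>x * a\<bar> ^ N)) = ennreal \<bar>x\<bar> * ennreal (inverse (\<bar>x * a\<bar> ^ N))"
        by (rule ennreal_mult) auto
      moreover have "g (0 + x * a) = ennreal (inverse (\<bar>x * a\<bar> ^ N)) * H (a * x)"
        using False \<xi> by (simp add: g_def x_def mult.commute)
      ultimately show ?thesis by (simp only: mult.assoc)
    qed
  qed
  also have "\<dots> = ennreal \<bar>x\<bar> * (\<integral>\<^sup>+a. g (0 + x * a) \<partial>lborel)"
    by (rule nn_integral_cmult) measurable
  \<comment> \<open>The substitution u = x * a absorbs the last factor |x|, and with it the
    dependence on \<xi>.\<close>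
  also have "\<dots> = (\<integral>\<^sup>+u. g u \<partial>lborel)"
    using \<xi> by (intro nn_integral_real_affine[symmetric]) (auto simp: x_def)
  finally show ?thesis by (simp add: orbit_mean_def g_def H_def N_def)
qed

lemma orbit_mean_null:
  fixes N :: "(real ^ ('m::finite option)) set"
  assumes N: "N \<in> null_sets lborel"
  shows "orbit_mean (indicator N) = 0"
proof -
  have [measurable]: "N \<in> sets borel" using N by auto
  have m: "(\<lambda>u. \<integral>\<^sup>+\<eta>. indicator N (vec_cons u \<eta>) \<partial>lborel) \<in> borel_measurable (borel :: real measure)" by measurable
  have "(\<integral>\<^sup>+u. (\<integral>\<^sup>+\<eta>. indicator N (vec_cons u \<eta>) \<partial>lborel) \<partial>lborel) = (\<integral>\<^sup>+x. indicator N x \<partial>lborel)"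
    by (rule nn_integral_vec_cons[symmetric]) measurable
  also have "\<dots> = 0" using N by auto
  finally have "AE u in lborel. (\<integral>\<^sup>+\<eta>. indicator N (vec_cons u \<eta>) \<partial>(lborel :: (real ^ 'm) measure)) = 0"
    using m by (subst (asm) nn_integral_0_iff_AE) auto
  then have "orbit_mean (indicator N) = (\<integral>\<^sup>+u. 0 \<partial>(lborel :: real measure))"
    unfolding orbit_mean_def by (intro nn_integral_cong_AE) auto
  then show ?thesis by simp
qed

text \<open>By \<open>orbit_integral\<close>, the weighted measure of the parameters whose orbit
  point lies in a null set is the \<open>orbit_mean\<close> of that set, which is 0, and the weight
  is positive for a \<noteq> 0. This matters because a transform is fixed only up to null sets,
  while admissibility evaluates it along orbits.\<close>

lemma AE_orbit:
  fixes \<xi> :: "real ^ ('m::finite option)"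
  assumes P: "AE x in lborel. P x" and \<xi>: "\<xi> $ None \<noteq> 0"
  shows "AE s in lborel. AE a in lborel. a \<noteq> 0 \<longrightarrow> P (orbit a s \<xi>)"
proof -
  obtain N where N: "{x \<in> space lborel. \<not> P x} \<subseteq> N" "emeasure lborel N = 0" "N \<in> sets lborel"
    using P by (rule AE_E)
  then have Nn: "N \<in> null_sets lborel" and [measurable]: "N \<in> sets borel" by auto
  have m: "(\<lambda>s. \<integral>\<^sup>+a. adm_weight TYPE('m) a * indicator N (orbit a s \<xi>) \<partial>lborel) \<in> borel_measurable borel" by measurable
  have "(\<integral>\<^sup>+s. (\<integral>\<^sup>+a. adm_weight TYPE('m) a * indicator N (orbit a s \<xi>) \<partial>lborel) \<partial>lborel) = 0"
    using orbit_integral[OF _ \<xi>, of "indicator N"] orbit_mean_null[OF Nn] by simp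
  then have "AE s in lborel. (\<integral>\<^sup>+a. adm_weight TYPE('m) a * indicator N (orbit a s \<xi>) \<partial>lborel) = 0"
    using m by (subst (asm) nn_integral_0_iff_AE) auto
  then show ?thesis
  proof eventually_elim
    case (elim s)
    have "(\<lambda>a. adm_weight TYPE('m) a * indicator N (orbit a s \<xi>)) \<in> borel_measurable lborel" by measurable
    then have "AE a in lborel. adm_weight TYPE('m) a * indicator N (orbit a s \<xi>) = 0"
      using elim by (subst (asm) nn_integral_0_iff_AE) auto
    then show ?case
    proof eventually_elim
      case (elim a)
      show ?case
      proof
        assume "a \<noteq> 0"
        then have "adm_weight TYPE('m) a \<noteq> 0" by (simp add: adm_weight_def)
        then have "orbit a s \<xi> \<notin> N" using elim by (auto simp: indicator_def split: if_splits)
        then show "P (orbit a s \<xi>)" using N(1) by auto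
      qed
    qed
  qed
qed

text \<open>\<open>AE_orbit\<close> exchanges the chosen representative for a Borel one under the
  integrals; the change of variables then removes \<xi>. Hence the constant selected by
  \<open>shearlet_const\<close> exists.\<close>

lemma admissibility_integral_eq:
  fixes \<psi> :: "real ^ ('m::finite option) \<Rightarrow> complex"
  assumes g [measurable]: "g \<in> borel_measurable borel" and ae: "AE \<xi> in lborel. fourier \<psi> \<xi> = g \<xi>" and \<xi>: "\<xi> $ None \<noteq> 0"
  shows "admissibility_integral \<psi> \<xi> = orbit_mean (\<lambda>x. ennreal ((norm (g x))\<^sup>2))"
proof -
  have "admissibility_integral \<psi> \<xi> = (\<integral>\<^sup>+s. (\<integral>\<^sup>+a. ennreal ((norm (fourier \<psi> (orbit a s \<xi>)))\<^sup>2 / \<bar>a\<bar> powr adm_exp TYPE('m)) * indicator (- {0}) a \<partial>lborel) \<partial>lborel)"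
    unfolding admissibility_integral_def Let_def nn_integral_completion transpose_shearlet_matrix_apply adm_exp_def by simp
  also have "\<dots> = (\<integral>\<^sup>+s. (\<integral>\<^sup>+a. adm_weight TYPE('m) a * ennreal ((norm (g (orbit a s \<xi>)))\<^sup>2) \<partial>lborel) \<partial>lborel)"
  proof (rule nn_integral_cong_AE)
    show "AE s in lborel. (\<integral>\<^sup>+a. ennreal ((norm (fourier \<psi> (orbit a s \<xi>)))\<^sup>2 / \<bar>a\<bar> powr adm_exp TYPE('m)) * indicator (- {0}) a \<partial>lborel)
      = (\<integral>\<^sup>+a. adm_weight TYPE('m) a * ennreal ((norm (g (orbit a s \<xi>)))\<^sup>2) \<partial>lborel)"
      using AE_orbit[OF ae \<xi>]
    proof eventually_elim
      case (elim s)
      show ?case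
      proof (rule nn_integral_cong_AE)
        show "AE a in lborel. ennreal ((norm (fourier \<psi> (orbit a s \<xi>)))\<^sup>2 / \<bar>a\<bar> powr adm_exp TYPE('m)) * indicator (- {0}) a
          = adm_weight TYPE('m) a * ennreal ((norm (g (orbit a s \<xi>)))\<^sup>2)"
          using elim
        proof eventually_elim
          case (elim a)
          show ?case
          proof (cases "a = 0")
            case False
            have "ennreal ((norm (g (orbit a s \<xi>)))\<^sup>2 / \<bar>a\<bar> powr adm_exp TYPE('m)) = ennreal (1 / \<bar>a\<bar> powr adm_exp TYPE('m)) * ennreal ((norm (g (orbit a s \<xi>)))\<^sup>2)"
              by (simp add: ennreal_mult[symmetric])
            then show ?thesis using elim False by (simp add: adm_weight_def)
          qed (simp add: adm_weight_def)
        qed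
      qed
    qed
  qed
  also have "\<dots> = orbit_mean (\<lambda>x. ennreal ((norm (g x))\<^sup>2))"
    by (rule orbit_integral[OF _ \<xi>]) measurable
  finally show ?thesis .
qed

lemma shearlet_const_eq:
  fixes \<psi> :: "real ^ ('m::finite option) \<Rightarrow> complex"
  assumes g: "g \<in> borel_measurable borel" and ae: "AE \<xi> in lborel. fourier \<psi> \<xi> = g \<xi>"
  shows "shearlet_const \<psi> = orbit_mean (\<lambda>x. ennreal ((norm (g x))\<^sup>2))"
  unfolding shearlet_const_def
proof (rule the_equality)
  show "\<forall>\<xi>. \<xi> $ None \<noteq> 0 \<longrightarrow> admissibility_integral \<psi> \<xi> = orbit_mean (\<lambda>x. ennreal ((norm (g x))\<^sup>2))"
    using admissibility_integral_eq[OF g ae] by blast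
  fix C assume C: "\<forall>\<xi>. \<xi> $ None \<noteq> 0 \<longrightarrow> admissibility_integral \<psi> \<xi> = C"
  have "vec_cons 1 (0 :: real ^ 'm) $ None \<noteq> 0" by simp
  then show "C = orbit_mean (\<lambda>x. ennreal ((norm (g x))\<^sup>2))"
    using C admissibility_integral_eq[OF g ae] by metis
qed

section \<open>The shearlet transform\<close>

lemma lebesgue_measurable_AE:
  fixes f g :: "'a::euclidean_space \<Rightarrow> 'b::topological_space"
  assumes g: "g \<in> borel_measurable borel" and fg: "AE x in lborel. f x = g x"
  shows "f \<in> borel_measurable lebesgue"
proof -
  obtain N where N: "{x \<in> space lborel. f x \<noteq> g x} \<subseteq> N" "emeasure lborel N = 0" "N \<in> sets lborel"
    using fg by (rule AE_E)
  then have Nn: "N \<in> null_sets (completion lborel)" by (intro null_sets_completionI) auto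
  show ?thesis
  proof (rule measurableI)
    fix S :: "'b set" assume S: "S \<in> sets borel"
    have "f -` S \<inter> N \<in> null_sets (completion lborel)"
      by (rule null_sets_completion_subset[OF _ Nn]) auto
    then have 1: "f -` S \<inter> N \<in> sets lebesgue" by (rule null_setsD2)
    have "g -` S \<in> sets borel" using measurable_sets[OF g S] by simp
    then have 2: "g -` S - N \<in> sets lebesgue" using N(3) by (intro sets.Diff sets_completionI_sets) auto
    have eq: "f -` S \<inter> space lebesgue = (g -` S - N) \<union> (f -` S \<inter> N)" using N(1) by auto
    show "f -` S \<inter> space lebesgue \<in> sets lebesgue" unfolding eq by (rule sets.Un[OF 2 1])
  qed simp
qed

lemma AE_pullback:
  fixes B :: "real ^ 'n ^ 'n"
  assumes P: "AE x in lborel. P x" and B: "det B \<noteq> 0"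
  shows "AE x in lborel. P (B *v (x - t))"
proof -
  obtain N where N: "{x \<in> space lborel. \<not> P x} \<subseteq> N" "emeasure lborel N = 0" "N \<in> sets lborel"
    using P by (rule AE_E)
  then have [measurable]: "N \<in> sets borel" by simp
  have "l2 lborel (\<lambda>x. indicator N (B *v (x - t))) = ennreal (inverse \<bar>det B\<bar>) * l2 lborel (indicator N)"
    by (rule l2_pullback[OF B]) measurable
  also have "l2 lborel (indicator N) = (\<integral>\<^sup>+x. indicator N x \<partial>lborel)"
    unfolding l2_def by (intro nn_integral_cong) (auto simp: indicator_def)
  also have "\<dots> = 0" using N(2) by simp
  finally have "(\<integral>\<^sup>+x. ennreal ((norm (indicator N (B *v (x - t)) :: complex))\<^sup>2) \<partial>lborel) = 0"
    by (simp add: l2_def)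
  then have "AE x in lborel. ennreal ((norm (indicator N (B *v (x - t)) :: complex))\<^sup>2) = 0"
    by (subst (asm) nn_integral_0_iff_AE) auto
  then show ?thesis
  proof eventually_elim
    case (elim x)
    then have "B *v (x - t) \<notin> N" by (auto simp: indicator_def split: if_splits)
    then show ?case using N(1) by auto
  qed
qed

lemma lmeasurable_borel_version:
  fixes E :: "'a::euclidean_space set"
  assumes E: "E \<in> lmeasurable"
  obtains E' where "E' \<in> sets borel" "AE x in lborel. x \<in> E \<longleftrightarrow> x \<in> E'" "emeasure lborel E' < \<infinity>"
    "measure lborel E' = measure lebesgue E"
proof -
  have El: "E \<in> sets lebesgue" "emeasure lebesgue E < \<infinity>" using E by (auto simp: fmeasurable_def)
  have "(indicator E :: 'a \<Rightarrow> complex) \<in> borel_measurable lebesgue"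
    using El(1) by (rule borel_measurable_indicator)
  then obtain g where g [measurable]: "g \<in> borel_measurable borel" and ae: "AE x in lborel. indicator E x = (g x :: complex)"
    using borel_version by blast
  define E' where "E' = g -` {1}"
  have [measurable]: "E' \<in> sets borel" using measurable_sets[OF g, of "{1}"] by (simp add: E'_def)
  have ae': "AE x in lborel. x \<in> E \<longleftrightarrow> x \<in> E'"
    using ae by eventually_elim (auto simp: E'_def indicator_def split: if_splits)
  have "emeasure lebesgue E = (\<integral>\<^sup>+x. indicator E x \<partial>lebesgue)" using El(1) by simp
  also have "\<dots> = (\<integral>\<^sup>+x. indicator E' x \<partial>lborel)"
    unfolding nn_integral_completion
  proof (rule nn_integral_cong_AE)
    show "AE x in lborel. indicator E x = (indicator E' x :: ennreal)"
      using ae' by eventually_elim (simp add: indicator_def)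
  qed
  also have "\<dots> = emeasure lborel E'" by simp
  finally have em: "emeasure lebesgue E = emeasure lborel E'" .
  then show ?thesis using that[of E'] ae' El(2) by (simp add: measure_def)
qed

text \<open>For a \<noteq> 0 the absolute determinant of the shearlet matrix, which depends on
  \<open>a\<close> alone.\<close>

definition shear_det :: "'m::finite itself \<Rightarrow> real \<Rightarrow> real" where
  "shear_det _ a = \<bar>a\<bar> powr (1 + real CARD('m) / real CARD('m option))"

definition shearlet_product ::
    "(real ^ ('m::finite option) \<Rightarrow> complex) \<Rightarrow> (real ^ ('m option) \<Rightarrow> complex) \<Rightarrow> real \<Rightarrow> real ^ 'm \<Rightarrow> real ^ ('m option) \<Rightarrow> complex" where
  "shearlet_product fh ph a s \<xi> = of_real (sqrt (shear_det TYPE('m) a)) * (fh \<xi> * cnj (ph (orbit a s \<xi>)))"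

lemma has_ft_sq_int: "has_ft f g \<Longrightarrow> sq_int lborel f" "has_ft f g \<Longrightarrow> sq_int lborel g"
  by (auto simp: has_ft_def)

text \<open>Parseval's relation \<open>has_ft_inner\<close> for \<open>f\<close> and the atom:
  translation of the atom becomes a phase in frequency, and this phase is the Fourier kernel at
  \<open>- t\<close>. A product of two L2 functions is integrable; its square integrability comes
  later, for almost all parameters.\<close>

lemma shearlet_transform_eq_ft:
  fixes \<psi> f :: "real ^ ('m::finite option) \<Rightarrow> complex"
  assumes a: "a \<noteq> 0" and f: "f \<in> borel_measurable lebesgue"
    and f0: "AE x in lborel. f x = f0 x" and p0: "AE x in lborel. \<psi> x = p0 x"
    and ff: "has_ft f0 fh" and pp: "has_ft p0 ph"
  shows "shearlet_transform \<psi> f a s t = ft (shearlet_product fh ph a s) (- t)"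
    and "integrable lborel (shearlet_product fh ph a s)"
proof -
  define T where "T = shearlet_matrix s a"
  define B where "B = matrix_inv T"
  define D where "D = shear_det TYPE('m) a"
  have D: "\<bar>det T\<bar> = D" unfolding T_def D_def shear_det_def by (rule abs_det_shearlet_matrix[OF a])
  have D0: "0 < D" using a by (simp add: D_def shear_det_def)
  have dT: "det T \<noteq> 0" using D D0 by auto
  then have "\<exists>A'. T ** A' = mat 1 \<and> A' ** T = mat 1" by (simp add: invertible_det_nz[symmetric] invertible_def)
  then have BT: "B ** T = mat 1" unfolding B_def matrix_inv_def by (rule someI2_ex) simp
  have dB: "det B \<noteq> 0" using det_mul[of B T] BT by auto
  define c where "c = complex_of_real (D powr (- 1 / 2))"
  have atom: "shearlet_atom \<psi> a s t = (\<lambda>x. c * \<psi> (B *v (x - t)))"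
    by (simp add: fun_eq_iff shearlet_atom_def T_def[symmetric] B_def[symmetric] D c_def)
  have [measurable]: "f0 \<in> borel_measurable borel" "p0 \<in> borel_measurable borel"
    using has_ft_sq_int[OF ff] has_ft_sq_int[OF pp] by (auto simp: sq_int_def)
  have ae: "AE x in lborel. \<psi> (B *v (x - t)) = p0 (B *v (x - t))" by (rule AE_pullback[OF p0 dB])
  then have ae2: "AE x in lborel. f x * cnj (c * \<psi> (B *v (x - t))) = f0 x * cnj (c * p0 (B *v (x - t)))"
    using f0 by eventually_elim simp
  have gm: "(\<lambda>x. f0 x * cnj (c * p0 (B *v (x - t)))) \<in> borel_measurable borel" by measurable
  have cd: "c * of_real D = of_real (sqrt D)"
  proof -
    have "D powr (- 1 / 2) * D = D powr (- 1 / 2 + 1)" using D0 by (subst powr_add) simp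
    also have "\<dots> = sqrt D" using D0 by (simp add: powr_half_sqrt)
    finally show ?thesis by (simp add: c_def flip: of_real_mult)
  qed
  have hp: "has_ft (\<lambda>x. c * p0 (B *v (x - t))) (\<lambda>\<xi>. c * of_real D * ph (orbit a s \<xi>) * cnj (ee (\<xi> \<bullet> t)))" for t
  proof -
    have "transpose T *v \<xi> = orbit a s \<xi>" for \<xi> unfolding T_def by (rule transpose_shearlet_matrix_apply)
    then show ?thesis using has_ft_pullback[OF pp dT BT, of c t] unfolding D by (simp only:)
  qed
  have "shearlet_transform \<psi> f a s t = (LINT x|lborel. f0 x * cnj (c * p0 (B *v (x - t))))"
    unfolding shearlet_transform_def L2_inner_def atom
    by (rule integral_lebesgue_cong(1)[OF lebesgue_measurable_AE[OF gm ae2] gm ae2])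
  also have "\<dots> = (LINT \<xi>|lborel. fh \<xi> * cnj (c * of_real D * ph (orbit a s \<xi>) * cnj (ee (\<xi> \<bullet> t))))"
    by (rule has_ft_inner[OF ff hp])
  also have "\<dots> = ft (shearlet_product fh ph a s) (- t)"
    unfolding ft_def cd shearlet_product_def D_def[symmetric]
    by (intro Bochner_Integration.integral_cong refl) (simp add: cnj_ee inner_commute mult_ac)
  finally show "shearlet_transform \<psi> f a s t = ft (shearlet_product fh ph a s) (- t)" .
  have "integrable lborel (\<lambda>\<xi>. fh \<xi> * cnj (c * of_real D * ph (orbit a s \<xi>) * cnj (ee (\<xi> \<bullet> 0))))"
    by (rule integrable_mult_cnj[OF has_ft_sq_int(2)[OF ff] has_ft_sq_int(2)[OF hp[of 0]]])
  moreover have "(\<lambda>\<xi>. fh \<xi> * cnj (c * of_real D * ph (orbit a s \<xi>) * cnj (ee (\<xi> \<bullet> 0)))) = shearlet_product fh ph a s"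
    unfolding cd by (simp add: fun_eq_iff shearlet_product_def D_def mult_ac)
  ultimately show "integrable lborel (shearlet_product fh ph a s)" by simp
qed

lemma nn_integral_reflect:
  fixes f :: "real ^ 'n \<Rightarrow> ennreal"
  assumes f: "f \<in> borel_measurable borel"
  shows "(\<integral>\<^sup>+x. f (- x) \<partial>lborel) = (\<integral>\<^sup>+x. f x \<partial>lborel)"
  using nn_integral_affine'[OF f, of "-1" 0] by simp

lemma AE_vec_None_nonzero: "AE \<xi> in lborel. (\<xi> :: real ^ ('m::finite option)) $ None \<noteq> 0"
proof -
  have "AE t in lebesgue. t \<notin> {t :: real ^ ('m option). t $ None = 0}"
    using negligible_standard_hyperplane_cart[of None] unfolding negligible_iff_null_sets by (rule AE_not_in)
  then show ?thesis by (simp add: AE_completion_iff)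
qed

lemma shearlet_product_weight:
  "ennreal (1 / \<bar>a\<bar> ^ (CARD('m::finite option) + 1)) * indicator (- {0}) a * ennreal ((norm (shearlet_product fh ph a (s :: real ^ 'm) \<xi>))\<^sup>2)
    = ennreal ((norm (fh \<xi>))\<^sup>2) * (adm_weight TYPE('m) a * ennreal ((norm (ph (orbit a s \<xi>)))\<^sup>2))"
proof (cases "a = 0")
  case True
  then show ?thesis by (simp add: adm_weight_def)
next
  case False
  have d: "shear_det TYPE('m) a / \<bar>a\<bar> ^ (CARD('m option) + 1) = 1 / \<bar>a\<bar> powr adm_exp TYPE('m)"
    using shear_exponent_weight[OF False, of s] unfolding abs_det_shearlet_matrix[OF False] shear_det_def .
  have "(norm (shearlet_product fh ph a s \<xi>))\<^sup>2 = shear_det TYPE('m) a * ((norm (fh \<xi>))\<^sup>2 * (norm (ph (orbit a s \<xi>)))\<^sup>2)"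
    by (simp add: shearlet_product_def norm_mult power_mult_distrib shear_det_def)
  then have "1 / \<bar>a\<bar> ^ (CARD('m option) + 1) * (norm (shearlet_product fh ph a s \<xi>))\<^sup>2
    = (norm (fh \<xi>))\<^sup>2 * (shear_det TYPE('m) a / \<bar>a\<bar> ^ (CARD('m option) + 1) * (norm (ph (orbit a s \<xi>)))\<^sup>2)"
    by (simp only:) (simp add: mult_ac)
  also have "\<dots> = (norm (fh \<xi>))\<^sup>2 * (1 / \<bar>a\<bar> powr adm_exp TYPE('m) * (norm (ph (orbit a s \<xi>)))\<^sup>2)"
    unfolding d ..
  finally have "ennreal (1 / \<bar>a\<bar> ^ (CARD('m option) + 1) * (norm (shearlet_product fh ph a s \<xi>))\<^sup>2)
    = ennreal ((norm (fh \<xi>))\<^sup>2 * (1 / \<bar>a\<bar> powr adm_exp TYPE('m) * (norm (ph (orbit a s \<xi>)))\<^sup>2))" by (rule arg_cong)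
  moreover have "ennreal (1 / \<bar>a\<bar> ^ (CARD('m option) + 1) * (norm (shearlet_product fh ph a s \<xi>))\<^sup>2)
    = ennreal (1 / \<bar>a\<bar> ^ (CARD('m option) + 1)) * ennreal ((norm (shearlet_product fh ph a s \<xi>))\<^sup>2)"
    by (rule ennreal_mult) auto
  moreover have "ennreal ((norm (fh \<xi>))\<^sup>2 * (1 / \<bar>a\<bar> powr adm_exp TYPE('m) * (norm (ph (orbit a s \<xi>)))\<^sup>2))
    = ennreal ((norm (fh \<xi>))\<^sup>2) * (ennreal (1 / \<bar>a\<bar> powr adm_exp TYPE('m)) * ennreal ((norm (ph (orbit a s \<xi>)))\<^sup>2))"
    by (subst ennreal_mult, simp, simp, subst ennreal_mult) auto
  ultimately show ?thesis using False by (simp add: adm_weight_def)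
qed

text \<open>After Tonelli the integral over \<open>a\<close> and \<open>s\<close> is innermost and
  equals the admissibility constant for every \<xi> with nonzero first coordinate, hence almost
  everywhere. It is applied with the complement of the frequency set and, for the total energy, with
  \<open>UNIV\<close>.\<close>

lemma shearlet_frequency_integral:
  fixes fh ph :: "real ^ ('m::finite option) \<Rightarrow> complex"
  assumes [measurable]: "fh \<in> borel_measurable borel" "ph \<in> borel_measurable borel" and E [measurable]: "E \<in> sets borel"
  shows "(\<integral>\<^sup>+s. (\<integral>\<^sup>+a. ennreal (1 / \<bar>a\<bar> ^ (CARD('m option) + 1)) * indicator (- {0}) a *
      (\<integral>\<^sup>+\<xi>. ennreal ((norm (shearlet_product fh ph a s \<xi>))\<^sup>2) * indicator E \<xi> \<partial>lborel) \<partial>lborel) \<partial>lborel)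
    = orbit_mean (\<lambda>x. ennreal ((norm (ph x))\<^sup>2)) * (\<integral>\<^sup>+\<xi>. ennreal ((norm (fh \<xi>))\<^sup>2) * indicator E \<xi> \<partial>lborel)"
proof -
  define w where "w a = ennreal (1 / \<bar>a\<bar> ^ (CARD('m option) + 1)) * indicator (- {0}) a" for a :: real
  define k where "k a s \<xi> = (ennreal ((norm (fh \<xi>))\<^sup>2) * indicator E \<xi>) * (adm_weight TYPE('m) a * ennreal ((norm (ph (orbit a s \<xi>)))\<^sup>2))" for a s \<xi>
  have pm [measurable]: "shearlet_product fh ph a s \<in> borel_measurable borel" for a s
    unfolding shearlet_product_def by measurable
  have inner: "w a * (\<integral>\<^sup>+\<xi>. ennreal ((norm (shearlet_product fh ph a s \<xi>))\<^sup>2) * indicator E \<xi> \<partial>lborel) = (\<integral>\<^sup>+\<xi>. k a s \<xi> \<partial>lborel)" for a s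
  proof -
    have "w a * (\<integral>\<^sup>+\<xi>. ennreal ((norm (shearlet_product fh ph a s \<xi>))\<^sup>2) * indicator E \<xi> \<partial>lborel)
      = (\<integral>\<^sup>+\<xi>. w a * (ennreal ((norm (shearlet_product fh ph a s \<xi>))\<^sup>2) * indicator E \<xi>) \<partial>lborel)"
      by (rule nn_integral_cmult[symmetric]) measurable
    also have "\<dots> = (\<integral>\<^sup>+\<xi>. k a s \<xi> \<partial>lborel)"
    proof (rule nn_integral_cong)
      fix \<xi>
      have "w a * (ennreal ((norm (shearlet_product fh ph a s \<xi>))\<^sup>2) * indicator E \<xi>)
        = (w a * ennreal ((norm (shearlet_product fh ph a s \<xi>))\<^sup>2)) * indicator E \<xi>" by (simp only: mult.assoc)
      also have "\<dots> = k a s \<xi>" unfolding w_def shearlet_product_weight k_def by (simp only: mult_ac)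
      finally show "w a * (ennreal ((norm (shearlet_product fh ph a s \<xi>))\<^sup>2) * indicator E \<xi>) = k a s \<xi>" .
    qed
    finally show ?thesis .
  qed
  have "(\<integral>\<^sup>+s. (\<integral>\<^sup>+a. w a * (\<integral>\<^sup>+\<xi>. ennreal ((norm (shearlet_product fh ph a s \<xi>))\<^sup>2) * indicator E \<xi> \<partial>lborel) \<partial>lborel) \<partial>lborel)
    = (\<integral>\<^sup>+s. (\<integral>\<^sup>+a. (\<integral>\<^sup>+\<xi>. k a s \<xi> \<partial>lborel) \<partial>lborel) \<partial>lborel)"
    unfolding inner ..
  also have "\<dots> = (\<integral>\<^sup>+s. (\<integral>\<^sup>+\<xi>. (\<integral>\<^sup>+a. k a s \<xi> \<partial>lborel) \<partial>lborel) \<partial>lborel)"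
    by (rule nn_integral_cong, rule lborel_pair.Fubini') (unfold k_def, measurable)
  also have "\<dots> = (\<integral>\<^sup>+\<xi>. (\<integral>\<^sup>+s. (\<integral>\<^sup>+a. k a s \<xi> \<partial>lborel) \<partial>lborel) \<partial>lborel)"
    by (rule lborel_pair.Fubini') (unfold k_def, measurable)
  also have "\<dots> = (\<integral>\<^sup>+\<xi>. (ennreal ((norm (fh \<xi>))\<^sup>2) * indicator E \<xi>) * orbit_mean (\<lambda>x. ennreal ((norm (ph x))\<^sup>2)) \<partial>lborel)"
  proof (rule nn_integral_cong_AE)
    show "AE \<xi> in lborel. (\<integral>\<^sup>+s. (\<integral>\<^sup>+a. k a s \<xi> \<partial>lborel) \<partial>lborel) = (ennreal ((norm (fh \<xi>))\<^sup>2) * indicator E \<xi>) * orbit_mean (\<lambda>x. ennreal ((norm (ph x))\<^sup>2))"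
      using AE_vec_None_nonzero
    proof eventually_elim
      case (elim \<xi>)
      have "(\<integral>\<^sup>+a. k a s \<xi> \<partial>lborel) = (ennreal ((norm (fh \<xi>))\<^sup>2) * indicator E \<xi>) * (\<integral>\<^sup>+a. adm_weight TYPE('m) a * ennreal ((norm (ph (orbit a s \<xi>)))\<^sup>2) \<partial>lborel)" for s
        unfolding k_def by (rule nn_integral_cmult) measurable
      then have "(\<integral>\<^sup>+s. (\<integral>\<^sup>+a. k a s \<xi> \<partial>lborel) \<partial>lborel)
        = (\<integral>\<^sup>+s. (ennreal ((norm (fh \<xi>))\<^sup>2) * indicator E \<xi>) * (\<integral>\<^sup>+a. adm_weight TYPE('m) a * ennreal ((norm (ph (orbit a s \<xi>)))\<^sup>2) \<partial>lborel) \<partial>lborel)"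
        by simp
      also have "\<dots> = (ennreal ((norm (fh \<xi>))\<^sup>2) * indicator E \<xi>) * (\<integral>\<^sup>+s. (\<integral>\<^sup>+a. adm_weight TYPE('m) a * ennreal ((norm (ph (orbit a s \<xi>)))\<^sup>2) \<partial>lborel) \<partial>lborel)"
        by (rule nn_integral_cmult) measurable
      also have "(\<integral>\<^sup>+s. (\<integral>\<^sup>+a. adm_weight TYPE('m) a * ennreal ((norm (ph (orbit a s \<xi>)))\<^sup>2) \<partial>lborel) \<partial>lborel) = orbit_mean (\<lambda>x. ennreal ((norm (ph x))\<^sup>2))"
        by (rule orbit_integral[OF _ elim]) measurable
      finally show ?case .
    qed
  qed
  also have "\<dots> = orbit_mean (\<lambda>x. ennreal ((norm (ph x))\<^sup>2)) * (\<integral>\<^sup>+\<xi>. ennreal ((norm (fh \<xi>))\<^sup>2) * indicator E \<xi> \<partial>lborel)"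
    by (subst nn_integral_multc) (auto simp: mult.commute)
  finally show ?thesis by (simp add: w_def)
qed

theorem theorem4p1:
  "\<exists>K::real. K > 0 \<and>
     (\<forall>(\<psi> :: real ^ ('m::finite option) \<Rightarrow> complex) E1 E2 f.
        admissible_shearlet \<psi> \<longrightarrow> E1 \<in> lmeasurable \<longrightarrow> E2 \<in> lmeasurable \<longrightarrow> square_integrable f \<longrightarrow>
        (\<integral>\<^sup>+ t \<in> - E1. (\<integral>\<^sup>+ s. (\<integral>\<^sup>+ a \<in> - {0}.
             ennreal ((norm (shearlet_transform \<psi> f a s t))\<^sup>2 / \<bar>a\<bar> ^ (CARD('m option) + 1))
             \<partial>lebesgue) \<partial>lebesgue) \<partial>lebesgue)
          + shearlet_const \<psi> * (\<integral>\<^sup>+ \<xi> \<in> - E2. ennreal ((norm (fourier f \<xi>))\<^sup>2) \<partial>lebesgue)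
        \<ge> shearlet_const \<psi> * L2_norm_sq f
            / ennreal (K * exp (K * measure lebesgue E1 * measure lebesgue E2)))"
proof -
  obtain K where K: "0 < K" and naz: "\<And>(g :: real ^ ('m option) \<Rightarrow> complex) A B. integrable lborel g \<Longrightarrow> sq_int lborel g \<Longrightarrow>
    A \<in> sets borel \<Longrightarrow> emeasure lborel A < \<infinity> \<Longrightarrow> B \<in> sets borel \<Longrightarrow> emeasure lborel B < \<infinity> \<Longrightarrow>
    l2 lborel g \<le> ennreal (K * exp (K * measure lborel A * measure lborel B)) *
      ((\<integral>\<^sup>+\<xi>. ennreal ((norm (ft g \<xi>))\<^sup>2) * indicator (- A) \<xi> \<partial>lborel) + (\<integral>\<^sup>+x. ennreal ((norm (g x))\<^sup>2) * indicator (- B) x \<partial>lborel))"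
    using nazarov_uncertainty by blast
  have main: "shearlet_const \<psi> * L2_norm_sq f / ennreal (K * exp (K * measure lebesgue E1 * measure lebesgue E2)) \<le>
        (\<integral>\<^sup>+ t \<in> - E1. (\<integral>\<^sup>+ s. (\<integral>\<^sup>+ a \<in> - {0}.
             ennreal ((norm (shearlet_transform \<psi> f a s t))\<^sup>2 / \<bar>a\<bar> ^ (CARD('m option) + 1))
             \<partial>lebesgue) \<partial>lebesgue) \<partial>lebesgue)
          + shearlet_const \<psi> * (\<integral>\<^sup>+ \<xi> \<in> - E2. ennreal ((norm (fourier f \<xi>))\<^sup>2) \<partial>lebesgue)"
    if adm: "admissible_shearlet \<psi>" and E1: "E1 \<in> lmeasurable" and E2: "E2 \<in> lmeasurable" and f: "square_integrable f"
    for \<psi> f :: "real ^ ('m option) \<Rightarrow> complex" and E1 E2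
  proof -
    have \<psi>: "square_integrable \<psi>" using adm by (simp add: admissible_shearlet_def)
    obtain f0 fh where f0: "f0 \<in> borel_measurable borel" "AE x in lborel. f x = f0 x"
      and fh [measurable]: "fh \<in> borel_measurable borel" and fh_ae: "AE \<xi> in lborel. fourier f \<xi> = fh \<xi>" and ff: "has_ft f0 fh"
      using fourier_borel_versions[OF f] by blast
    obtain p0 ph where p0: "p0 \<in> borel_measurable borel" "AE x in lborel. \<psi> x = p0 x"
      and ph [measurable]: "ph \<in> borel_measurable borel" and ph_ae: "AE \<xi> in lborel. fourier \<psi> \<xi> = ph \<xi>" and pp: "has_ft p0 ph"
      using fourier_borel_versions[OF \<psi>] by blast
    obtain A1 where A1 [measurable]: "A1 \<in> sets borel" and A1_ae: "AE x in lborel. x \<in> E1 \<longleftrightarrow> x \<in> A1"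
      and A1_fin: "emeasure lborel A1 < \<infinity>" and A1_m: "measure lborel A1 = measure lebesgue E1"
      using lmeasurable_borel_version[OF E1] by blast
    obtain A2 where A2 [measurable]: "A2 \<in> sets borel" and A2_ae: "AE x in lborel. x \<in> E2 \<longleftrightarrow> x \<in> A2"
      and A2_fin: "emeasure lborel A2 < \<infinity>" and A2_m: "measure lborel A2 = measure lebesgue E2"
      using lmeasurable_borel_version[OF E2] by blast
    define J where "J = orbit_mean (\<lambda>x. ennreal ((norm (ph x))\<^sup>2))"
    have J: "shearlet_const \<psi> = J" unfolding J_def by (rule shearlet_const_eq[OF ph ph_ae])
    have J_fin: "J < \<infinity>"
    proof -
      have nz: "vec_cons 1 (0 :: real ^ 'm) $ None \<noteq> 0" by simp
      have "admissibility_integral \<psi> (vec_cons 1 0) < \<infinity>"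
        using adm nz unfolding admissible_shearlet_def by blast
      then show ?thesis unfolding J_def admissibility_integral_eq[OF ph ph_ae nz] .
    qed
    define h where "h = shearlet_product fh ph"
    \<comment> \<open>Joint measurability, stated for composed arguments, is the form in which the
      side conditions of Tonelli's theorem ask for it.\<close>
    have hm [measurable (raw)]: "(\<lambda>x. h (u x) (v x) (z x)) \<in> borel_measurable M"
      if [measurable]: "u \<in> borel_measurable M" "v \<in> borel_measurable M" "z \<in> borel_measurable M" for M :: "'z measure" and u v z
      unfolding h_def shearlet_product_def shear_det_def by measurable
    have h_borel [measurable]: "h a s \<in> borel_measurable borel" for a s
      unfolding h_def shearlet_product_def by measurable
    have fl: "f \<in> borel_measurable lebesgue" using f by (simp add: square_integrable_def)
    define w where "w a = ennreal (1 / \<bar>a\<bar> ^ (CARD('m option) + 1)) * indicator (- {0}) a" for a :: real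
    have w [measurable]: "w \<in> borel_measurable borel"
    proof -
      have "(indicator (- {0}) :: real \<Rightarrow> ennreal) \<in> borel_measurable borel" by (intro borel_measurable_indicator) auto
      then show ?thesis unfolding w_def by measurable
    qed
    \<comment> \<open>The transform of \<open>h a s\<close> is evaluated at \<open>- t\<close>, so
      the set of excluded translations is reflected.\<close>
    define N where "N = {t. - t \<in> A1}"
    have N [measurable]: "N \<in> sets borel"
    proof -
      have "N = (\<lambda>t. - t) -` A1 \<inter> space borel" by (auto simp: N_def)
      also have "\<dots> \<in> sets borel" by measurable
      finally show ?thesis .
    qed
    have N_em: "emeasure lborel N = emeasure lborel A1"
    proof -
      have "emeasure lborel N = (\<integral>\<^sup>+t. indicator N t \<partial>lborel)" by simp
      also have "\<dots> = (\<integral>\<^sup>+t. indicator A1 (- t) \<partial>lborel)" by (simp add: N_def indicator_def)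
      also have "\<dots> = (\<integral>\<^sup>+t. indicator A1 t \<partial>lborel)" by (rule nn_integral_reflect) simp
      finally show ?thesis by simp
    qed
    define X where "X a s = (\<integral>\<^sup>+\<tau>. ennreal ((norm (ft (h a s) \<tau>))\<^sup>2) * indicator (- N) \<tau> \<partial>lborel)" for a s
    define Y where "Y a s = (\<integral>\<^sup>+\<xi>. ennreal ((norm (h a s \<xi>))\<^sup>2) * indicator (- A2) \<xi> \<partial>lborel)" for a s
    define Z where "Z a s = l2 lborel (h a s)" for a s
    have ftm [measurable (raw)]: "(\<lambda>x. ft (h (u x) (v x)) (z x)) \<in> borel_measurable M"
      if [measurable]: "u \<in> borel_measurable M" "v \<in> borel_measurable M" "z \<in> borel_measurable M" for M :: "'z measure" and u v z
      unfolding ft_def by measurable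
    have Xm [measurable (raw)]: "(\<lambda>x. X (u x) (v x)) \<in> borel_measurable M"
      if [measurable]: "u \<in> borel_measurable M" "v \<in> borel_measurable M" for M :: "'z measure" and u v
      unfolding X_def by measurable
    have Ym [measurable (raw)]: "(\<lambda>x. Y (u x) (v x)) \<in> borel_measurable M"
      if [measurable]: "u \<in> borel_measurable M" "v \<in> borel_measurable M" for M :: "'z measure" and u v
      unfolding Y_def by measurable
    have Zm [measurable (raw)]: "(\<lambda>x. Z (u x) (v x)) \<in> borel_measurable M"
      if [measurable]: "u \<in> borel_measurable M" "v \<in> borel_measurable M" for M :: "'z measure" and u v
      unfolding Z_def l2_def by measurable
    define k where "k t s a = w a * (ennreal ((norm (ft (h a s) (- t)))\<^sup>2) * indicator (- A1) t)" for t s a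
    have time: "(\<integral>\<^sup>+ t \<in> - E1. (\<integral>\<^sup>+ s. (\<integral>\<^sup>+ a \<in> - {0}.
             ennreal ((norm (shearlet_transform \<psi> f a s t))\<^sup>2 / \<bar>a\<bar> ^ (CARD('m option) + 1))
             \<partial>lebesgue) \<partial>lebesgue) \<partial>lebesgue) = (\<integral>\<^sup>+s. (\<integral>\<^sup>+a. w a * X a s \<partial>lborel) \<partial>lborel)"
    proof -
      have pt: "ennreal ((norm (shearlet_transform \<psi> f a s t))\<^sup>2 / \<bar>a\<bar> ^ (CARD('m option) + 1)) * indicator (- {0}) a
        = w a * ennreal ((norm (ft (h a s) (- t)))\<^sup>2)" for a s t
      proof (cases "a = 0")
        case True
        then show ?thesis by (simp add: w_def)
      next
        case False
        have "ennreal ((norm (ft (h a s) (- t)))\<^sup>2 / \<bar>a\<bar> ^ (CARD('m option) + 1)) = ennreal (1 / \<bar>a\<bar> ^ (CARD('m option) + 1)) * ennreal ((norm (ft (h a s) (- t)))\<^sup>2)"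
          by (subst ennreal_mult[symmetric]) auto
        then show ?thesis
          unfolding shearlet_transform_eq_ft(1)[OF False fl f0(2) p0(2) ff pp] h_def[symmetric] using False by (simp add: w_def)
      qed
      have "(\<integral>\<^sup>+ t \<in> - E1. (\<integral>\<^sup>+ s. (\<integral>\<^sup>+ a \<in> - {0}.
             ennreal ((norm (shearlet_transform \<psi> f a s t))\<^sup>2 / \<bar>a\<bar> ^ (CARD('m option) + 1))
             \<partial>lebesgue) \<partial>lebesgue) \<partial>lebesgue)
        = (\<integral>\<^sup>+t. (\<integral>\<^sup>+s. (\<integral>\<^sup>+a. w a * ennreal ((norm (ft (h a s) (- t)))\<^sup>2) \<partial>lborel) \<partial>lborel) * indicator (- A1) t \<partial>lborel)"
        unfolding nn_integral_completion pt
      proof (rule nn_integral_cong_AE)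
        show "AE t in lborel. (\<integral>\<^sup>+s. (\<integral>\<^sup>+a. w a * ennreal ((norm (ft (h a s) (- t)))\<^sup>2) \<partial>lborel) \<partial>lborel) * indicator (- E1) t
          = (\<integral>\<^sup>+s. (\<integral>\<^sup>+a. w a * ennreal ((norm (ft (h a s) (- t)))\<^sup>2) \<partial>lborel) \<partial>lborel) * indicator (- A1) t"
          using A1_ae by eventually_elim (simp add: indicator_def)
      qed
      also have "\<dots> = (\<integral>\<^sup>+t. (\<integral>\<^sup>+s. (\<integral>\<^sup>+a. k t s a \<partial>lborel) \<partial>lborel) \<partial>lborel)"
      proof (rule nn_integral_cong)
        fix t
        have "(\<integral>\<^sup>+a. k t s a \<partial>lborel) = (\<integral>\<^sup>+a. w a * ennreal ((norm (ft (h a s) (- t)))\<^sup>2) \<partial>lborel) * indicator (- A1) t" for s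
          unfolding k_def mult.assoc[symmetric] by (rule nn_integral_multc) measurable
        then show "(\<integral>\<^sup>+s. (\<integral>\<^sup>+a. w a * ennreal ((norm (ft (h a s) (- t)))\<^sup>2) \<partial>lborel) \<partial>lborel) * indicator (- A1) t
          = (\<integral>\<^sup>+s. (\<integral>\<^sup>+a. k t s a \<partial>lborel) \<partial>lborel)"
          by (simp only:) (rule nn_integral_multc[symmetric], measurable)
      qed
      also have "\<dots> = (\<integral>\<^sup>+s. (\<integral>\<^sup>+t. (\<integral>\<^sup>+a. k t s a \<partial>lborel) \<partial>lborel) \<partial>lborel)"
        by (rule lborel_pair.Fubini') (unfold k_def, measurable)
      also have "\<dots> = (\<integral>\<^sup>+s. (\<integral>\<^sup>+a. (\<integral>\<^sup>+t. k t s a \<partial>lborel) \<partial>lborel) \<partial>lborel)"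
        by (rule nn_integral_cong, rule lborel_pair.Fubini') (unfold k_def, measurable)
      also have "\<dots> = (\<integral>\<^sup>+s. (\<integral>\<^sup>+a. w a * X a s \<partial>lborel) \<partial>lborel)"
      proof (intro nn_integral_cong)
        fix s a
        have "(\<integral>\<^sup>+t. k t s a \<partial>lborel) = w a * (\<integral>\<^sup>+t. ennreal ((norm (ft (h a s) (- t)))\<^sup>2) * indicator (- A1) t \<partial>lborel)"
          unfolding k_def by (rule nn_integral_cmult) measurable
        also have "(\<integral>\<^sup>+t. ennreal ((norm (ft (h a s) (- t)))\<^sup>2) * indicator (- A1) t \<partial>lborel)
          = (\<integral>\<^sup>+t. ennreal ((norm (ft (h a s) (- t)))\<^sup>2) * indicator (- N) (- t) \<partial>lborel)"
          by (simp add: N_def indicator_def)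
        also have "\<dots> = X a s"
          unfolding X_def by (rule nn_integral_reflect[of "\<lambda>\<tau>. ennreal ((norm (ft (h a s) \<tau>))\<^sup>2) * indicator (- N) \<tau>"]) measurable
        finally show "(\<integral>\<^sup>+t. k t s a \<partial>lborel) = w a * X a s" .
      qed
      finally show ?thesis .
    qed
    have freq: "(\<integral>\<^sup>+s. (\<integral>\<^sup>+a. w a * Y a s \<partial>lborel) \<partial>lborel) = J * (\<integral>\<^sup>+\<xi>. ennreal ((norm (fh \<xi>))\<^sup>2) * indicator (- A2) \<xi> \<partial>lborel)"
      unfolding w_def Y_def h_def J_def by (rule shearlet_frequency_integral) measurable
    have total: "(\<integral>\<^sup>+s. (\<integral>\<^sup>+a. w a * Z a s \<partial>lborel) \<partial>lborel) = J * l2 lborel fh"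
      using shearlet_frequency_integral[OF fh ph, of UNIV] unfolding w_def Z_def l2_def h_def J_def by simp
    have freq': "(\<integral>\<^sup>+ \<xi> \<in> - E2. ennreal ((norm (fourier f \<xi>))\<^sup>2) \<partial>lebesgue) = (\<integral>\<^sup>+\<xi>. ennreal ((norm (fh \<xi>))\<^sup>2) * indicator (- A2) \<xi> \<partial>lborel)"
      unfolding nn_integral_completion
    proof (rule nn_integral_cong_AE)
      show "AE \<xi> in lborel. ennreal ((norm (fourier f \<xi>))\<^sup>2) * indicator (- E2) \<xi> = ennreal ((norm (fh \<xi>))\<^sup>2) * indicator (- A2) \<xi>"
        using A2_ae fh_ae by eventually_elim (simp add: indicator_def)
    qed
    have l2f: "L2_norm_sq f = l2 lborel fh"
    proof -
      have "l2 lborel fh = l2 lborel f0"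
        using has_ft_l2norm[OF ff] has_ft_sq_int[OF ff] by (simp add: l2_eq_l2norm)
      then show ?thesis using l2_lebesgue_cong[OF f0(2)] by (simp add: L2_norm_sq_eq_l2)
    qed
    define C where "C = ennreal (K * exp (K * measure lebesgue E1 * measure lebesgue E2))"
    have C: "0 < C" "C \<noteq> top" using K by (auto simp: C_def)
    \<comment> \<open>The uncertainty principle requires \<open>h a s\<close> to be square
      integrable. Finiteness of the admissibility constant makes the total energy finite, hence the
      weighted energy is finite for almost every \<open>s\<close> and almost every
      \<open>a\<close>.\<close>
    have fin: "AE s in lborel. AE a in lborel. w a * Z a s \<noteq> \<infinity>"
    proof -
      have "J * l2 lborel fh < \<infinity>"
        using J_fin has_ft_sq_int(2)[OF ff] by (simp add: sq_int_def ennreal_mult_less_top)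
      then have "AE s in lborel. (\<integral>\<^sup>+a. w a * Z a s \<partial>lborel) \<noteq> \<infinity>"
        unfolding total[symmetric] by (intro nn_integral_PInf_AE) auto
      then show ?thesis
      proof eventually_elim
        case (elim s)
        then show ?case by (intro nn_integral_PInf_AE) auto
      qed
    qed
    have "J * l2 lborel fh = (\<integral>\<^sup>+s. (\<integral>\<^sup>+a. w a * Z a s \<partial>lborel) \<partial>lborel)" by (rule total[symmetric])
    also have "\<dots> \<le> (\<integral>\<^sup>+s. (\<integral>\<^sup>+a. C * (w a * X a s + w a * Y a s) \<partial>lborel) \<partial>lborel)"
    proof (rule nn_integral_mono_AE)
      show "AE s in lborel. (\<integral>\<^sup>+a. w a * Z a s \<partial>lborel) \<le> (\<integral>\<^sup>+a. C * (w a * X a s + w a * Y a s) \<partial>lborel)"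
        using fin
      proof eventually_elim
        case (elim s)
        show ?case
        proof (rule nn_integral_mono_AE)
          show "AE a in lborel. w a * Z a s \<le> C * (w a * X a s + w a * Y a s)"
            using elim
          proof eventually_elim
            case (elim a)
            show ?case
            proof (cases "a = 0")
              case True
              then show ?thesis by (simp add: w_def)
            next
              case False
              \<comment> \<open>Only where the weight is nonzero does finiteness of the weighted
                energy yield finiteness of \<open>Z a s\<close>.\<close>
              then have "w a \<noteq> 0" by (simp add: w_def)
              then have "Z a s < \<infinity>" using elim by (auto simp: ennreal_mult_eq_top_iff less_top)
              then have "sq_int lborel (h a s)" by (simp add: sq_int_def Z_def)
              moreover have "integrable lborel (h a s)"
                unfolding h_def by (rule shearlet_transform_eq_ft(2)[OF False fl f0(2) p0(2) ff pp])
              ultimately have "Z a s \<le> ennreal (K * exp (K * measure lborel N * measure lborel A2)) * (X a s + Y a s)"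
                unfolding Z_def X_def Y_def using N_em A1_fin A2_fin by (intro naz) auto
              also have "ennreal (K * exp (K * measure lborel N * measure lborel A2)) = C"
                using N_em A1_m A2_m by (simp add: C_def measure_def)
              finally have "w a * Z a s \<le> w a * (C * (X a s + Y a s))" by (rule mult_left_mono) simp
              also have "\<dots> = C * (w a * X a s + w a * Y a s)" by (simp add: distrib_left mult_ac)
              finally show ?thesis .
            qed
          qed
        qed
      qed
    qed
    also have "\<dots> = (\<integral>\<^sup>+s. C * (\<integral>\<^sup>+a. w a * X a s + w a * Y a s \<partial>lborel) \<partial>lborel)"
      by (rule nn_integral_cong, rule nn_integral_cmult) measurable
    also have "\<dots> = C * (\<integral>\<^sup>+s. (\<integral>\<^sup>+a. w a * X a s + w a * Y a s \<partial>lborel) \<partial>lborel)"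
      by (rule nn_integral_cmult) measurable
    also have "(\<integral>\<^sup>+s. (\<integral>\<^sup>+a. w a * X a s + w a * Y a s \<partial>lborel) \<partial>lborel)
       = (\<integral>\<^sup>+s. (\<integral>\<^sup>+a. w a * X a s \<partial>lborel) + (\<integral>\<^sup>+a. w a * Y a s \<partial>lborel) \<partial>lborel)"
      by (rule nn_integral_cong, rule nn_integral_add) measurable
    also have "\<dots> = (\<integral>\<^sup>+s. (\<integral>\<^sup>+a. w a * X a s \<partial>lborel) \<partial>lborel) + (\<integral>\<^sup>+s. (\<integral>\<^sup>+a. w a * Y a s \<partial>lborel) \<partial>lborel)"
      by (rule nn_integral_add) measurable
    finally have "J * l2 lborel fh \<le> C * ((\<integral>\<^sup>+s. (\<integral>\<^sup>+a. w a * X a s \<partial>lborel) \<partial>lborel) + (\<integral>\<^sup>+s. (\<integral>\<^sup>+a. w a * Y a s \<partial>lborel) \<partial>lborel))" .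
    then have "J * l2 lborel fh / C \<le> (\<integral>\<^sup>+s. (\<integral>\<^sup>+a. w a * X a s \<partial>lborel) \<partial>lborel) + (\<integral>\<^sup>+s. (\<integral>\<^sup>+a. w a * Y a s \<partial>lborel) \<partial>lborel)"
      using C by (intro divide_le_posI_ennreal) auto
    then show ?thesis unfolding time freq freq' J l2f C_def .
  qed
  show ?thesis using K main by blast
qed

end
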